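(* Let $P_j\in\Psi DO^{m_j}(\mathbb{R}^n)$, $j=1,2$, be properly supported with total (left) symbols $p_j(x,\xi)$. Then $P_1P_2\in\Psi DO^{m_1+m_2}(\mathbb{R}^n)$, and it has total (left) symbol $$a(x,\xi)\sim\sum_\alpha\frac{i^{|\alpha|}}{\alpha!}\,D_\xi^\alpha p_1(x,\xi)\,D_x^\alpha p_2(x,\xi).$$
   Context: Notation: $D_{x_j}=-i\,\partial_{x_j}$, $D^\alpha=(-i)^{|\alpha|}\partial^\alpha$, $\langle\theta\rangle=(1+|\theta|^2)^{1/2}$. For $m\in\mathbb{R}$, $S^m(\mathbb{R}^N;\mathbb{R}^k)$ is the set of $a\in C^\infty(\mathbb{R}^N\times\mathbb{R}^k)$ such that for all multi-indices $\alpha,\beta$ and compact $K$ there is $C$ with $|D_x^\alpha D_\theta^\beta a(x,\theta)|\le C\langle\theta\rangle^{m-|\beta|}$ for $x\in K$ and all $\theta$. $\Psi DO^m(\mathbb{R}^n)$ is the set of operators whose Schwartz kernel is an oscillatory integral $(2\pi)^{-n}\int e^{i\langle x-y,\xi\rangle}a(x,y,\xi)\,d\xi$ with $a\in S^m(\mathbb{R}^n_x\times\mathbb{R}^n_y;\mathbb{R}^n_\xi)$. An operator is properly supported if both coordinate projections from the support of its kernel to $\mathbb{R}^n$ are proper. Modulo a smooth kernel, $P\in\Psi DO^m$ can be written with $a=p(x,\xi)\in S^m(\mathbb{R}^n;\mathbb{R}^n)$; $p$ is the total left symbol, unique modulo $S^{-\infty}=\bigcap_m S^m$. The relation $a\sim\sum_\alpha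 a_\alpha$ with $a_\alpha\in S^{m-|\alpha|}$ means $a-\sum_{|\alpha|<N}a_\alpha\in S^{m-N}$ for all $N$. *)

theory Defs
  imports "HOL-Analysis.Analysis"
begin

section \<open>Multi-indices and derivatives\<close>

text \<open>
  The coordinates of a Euclidean space are taken with respect to \<^const>\<open>Basis\<close>
  (for \<open>real ^ 'n\<close> the standard unit vectors), so a multi-index is a function on basis
  vectors; being zero off \<^const>\<open>Basis\<close> makes its representation unique.
\<close>

definition multi_indices :: "('a::euclidean_space \<Rightarrow> nat) set" where
  "multi_indices = {\<alpha>. \<forall>b. b \<notin> Basis \<longrightarrow> \<alpha> b = 0}"

definition mi_order :: "('a::euclidean_space \<Rightarrow> nat) \<Rightarrow> nat" where
  "mi_order \<alpha> = (\<Sum>b\<in>Basis. \<alpha> b)"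

definition mi_fact :: "('a::euclidean_space \<Rightarrow> nat) \<Rightarrow> nat" where
  "mi_fact \<alpha> = (\<Prod>b\<in>Basis. fact (\<alpha> b))"

definition D_dir :: "'a::euclidean_space \<Rightarrow> ('a \<Rightarrow> complex) \<Rightarrow> 'a \<Rightarrow> complex" where
  "D_dir b f x = - \<i> * vector_derivative (\<lambda>t. f (x + t *\<^sub>R b)) (at 0)"

text \<open>
  \<open>C\<^sup>\<infinity>\<close>: every iterated partial derivative, in any order, is (Frechet) differentiable, hence
  in particular continuous. The factors \<open>- \<i>\<close> are harmless here.
\<close>

definition smooth :: "('a::euclidean_space \<Rightarrow> complex) \<Rightarrow> bool" where
  "smooth f \<longleftrightarrow> (\<forall>bs. set bs \<subseteq> Basis \<longrightarrow> foldr D_dir bs f differentiable_on UNIV)"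

text \<open>
  \<open>D\<^sup>\<alpha>\<close> applies the partial derivatives in some fixed order of the coordinates; for smooth
  functions the order is immaterial.
\<close>

definition basis_list :: "'a::euclidean_space list" where
  "basis_list = (SOME bs. distinct bs \<and> set bs = Basis)"

definition D_mi :: "('a::euclidean_space \<Rightarrow> nat) \<Rightarrow> ('a \<Rightarrow> complex) \<Rightarrow> 'a \<Rightarrow> complex" where
  "D_mi \<alpha> f = foldr (\<lambda>b. D_dir b ^^ \<alpha> b) basis_list f"

abbreviation D_fst ::
  "('a::euclidean_space \<Rightarrow> nat) \<Rightarrow> ('a \<times> 'b \<Rightarrow> complex) \<Rightarrow> 'a \<times> 'b \<Rightarrow> complex" where
  "D_fst \<alpha> a \<equiv> \<lambda>(x, \<theta>). D_mi \<alpha> (\<lambda>x'. a (x', \<theta>)) x"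

abbreviation D_snd ::
  "('b::euclidean_space \<Rightarrow> nat) \<Rightarrow> ('a \<times> 'b \<Rightarrow> complex) \<Rightarrow> 'a \<times> 'b \<Rightarrow> complex" where
  "D_snd \<beta> a \<equiv> \<lambda>(x, \<theta>). D_mi \<beta> (\<lambda>\<theta>'. a (x, \<theta>')) \<theta>"


section \<open>Symbols\<close>

definition japanese :: "'a::real_normed_vector \<Rightarrow> real" where
  "japanese \<theta> = sqrt (1 + (norm \<theta>)\<^sup>2)"

definition symbols :: "real \<Rightarrow> ('a::euclidean_space \<times> 'b::euclidean_space \<Rightarrow> complex) set" where
  "symbols m = {a. smooth a \<and>
     (\<forall>\<alpha>\<in>multi_indices. \<forall>\<beta>\<in>multi_indices. \<forall>K. compact K \<longrightarrow>
       (\<exists>C. \<forall>x\<in>K. \<forall>\<theta>.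
          norm (D_fst \<alpha> (D_snd \<beta> a) (x, \<theta>)) \<le> C * japanese \<theta> powr (m - real (mi_order \<beta>))))}"

definition asymptotic_sum ::
  "real \<Rightarrow> ('a::euclidean_space \<times> 'b::euclidean_space \<Rightarrow> complex)
     \<Rightarrow> (('b \<Rightarrow> nat) \<Rightarrow> 'a \<times> 'b \<Rightarrow> complex) \<Rightarrow> bool" where
  "asymptotic_sum m a A \<longleftrightarrow>
     (\<forall>\<alpha>\<in>multi_indices. A \<alpha> \<in> symbols (m - real (mi_order \<alpha>))) \<and>
     (\<forall>N::nat. (\<lambda>z. a z - (\<Sum>\<alpha> | \<alpha> \<in> multi_indices \<and> mi_order \<alpha> < N. A \<alpha> z))
                 \<in> symbols (m - real N))"


section \<open>Distributions\<close>

definition supp :: "('a::euclidean_space \<Rightarrow> complex) \<Rightarrow> 'a set" where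
  "supp f = closure {x. f x \<noteq> 0}"

definition test_functions :: "('a::euclidean_space \<Rightarrow> complex) set" where
  "test_functions = {\<phi>. smooth \<phi> \<and> compact (supp \<phi>)}"

text \<open>
  Functionals are total functions in HOL, but only their values on test functions are meaningful.
\<close>

type_synonym 'a functional = "('a \<Rightarrow> complex) \<Rightarrow> complex"

definition distribution :: "'a::euclidean_space functional \<Rightarrow> bool" where
  "distribution u \<longleftrightarrow>
     (\<forall>\<phi>\<in>test_functions. \<forall>\<psi>\<in>test_functions. u (\<lambda>x. \<phi> x + \<psi> x) = u \<phi> + u \<psi>) \<and>
     (\<forall>c. \<forall>\<phi>\<in>test_functions. u (\<lambda>x. c * \<phi> x) = c * u \<phi>) \<and>
     (\<forall>K. compact K \<longrightarrow> (\<exists>C N. \<forall>\<phi>\<in>test_functions. supp \<phi> \<subseteq> K \<longrightarrow>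
        norm (u \<phi>) \<le> C * (\<Sum>\<alpha> | \<alpha> \<in> multi_indices \<and> mi_order \<alpha> \<le> N. SUP x. norm (D_mi \<alpha> \<phi> x))))"

definition dist_of_fun :: "('a::euclidean_space \<Rightarrow> complex) \<Rightarrow> 'a functional" where
  "dist_of_fun f \<phi> = (LINT x|lborel. f x * \<phi> x)"

definition dist_support :: "'a::euclidean_space functional \<Rightarrow> 'a set" where
  "dist_support u = - \<Union> {U. open U \<and> (\<forall>\<phi>\<in>test_functions. supp \<phi> \<subseteq> U \<longrightarrow> u \<phi> = 0)}"

text \<open>
  \<open>u\<close> is the oscillatory integral \<open>\<integral> exp (\<i> \<Phi>(x, \<theta>)) a(x, \<theta>) d\<theta>\<close>, i.e. the distribution obtained
  by inserting a cutoff \<open>\<kappa>(\<epsilon> \<theta>)\<close> and letting \<open>\<epsilon>\<close> tend to \<open>0\<close>, the limit being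
  independent of the cutoff.
\<close>

definition is_oscillatory_integral ::
  "('a::euclidean_space \<times> 'b::euclidean_space \<Rightarrow> real) \<Rightarrow> ('a \<times> 'b \<Rightarrow> complex)
     \<Rightarrow> 'a functional \<Rightarrow> bool" where
  "is_oscillatory_integral \<Phi> a u \<longleftrightarrow>
     (\<forall>\<kappa>\<in>test_functions. (\<forall>\<^sub>F \<theta> in nhds 0. \<kappa> \<theta> = 1) \<longrightarrow>
       (\<forall>\<phi>\<in>test_functions.
         ((\<lambda>\<epsilon>::real. LINT z|lborel. exp (\<i> * \<Phi> z) * \<kappa> (\<epsilon> *\<^sub>R snd z) * a z * \<phi> (fst z))
            \<longlongrightarrow> u \<phi>) (at_right 0)))"


section \<open>Operators and their Schwartz kernels\<close>

text \<open>Operators from test functions to distributions.\<close>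

type_synonym 'a operator = "('a \<Rightarrow> complex) \<Rightarrow> 'a functional"

text \<open>
  That \<open>P\<close> is linear and continuous into the distributions follows from the kernel
  being a distribution.
\<close>

definition is_schwartz_kernel ::
  "'a::euclidean_space operator \<Rightarrow> ('a \<times> 'a) functional \<Rightarrow> bool" where
  "is_schwartz_kernel P K \<longleftrightarrow> distribution K \<and>
     (\<forall>\<phi>\<in>test_functions. \<forall>\<psi>\<in>test_functions. P \<phi> \<psi> = K (\<lambda>(x, y). \<psi> x * \<phi> y))"

definition properly_supported :: "'a::euclidean_space operator \<Rightarrow> bool" where
  "properly_supported P \<longleftrightarrow> (\<exists>K. is_schwartz_kernel P K \<and>
     proper_map (top_of_set (dist_support K)) euclidean fst \<and>
     proper_map (top_of_set (dist_support K)) euclidean snd)"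

text \<open>
  Composition of operators. \<open>P1\<close> can be applied to \<open>P2 \<phi>\<close> when this distribution is (given by) a
  test function, which is then unique.
\<close>

definition op_composable :: "'a::euclidean_space operator \<Rightarrow> 'a operator \<Rightarrow> bool" where
  "op_composable P1 P2 \<longleftrightarrow>
     (\<forall>\<phi>\<in>test_functions. \<exists>f\<in>test_functions. \<forall>\<psi>\<in>test_functions. P2 \<phi> \<psi> = dist_of_fun f \<psi>)"

definition op_comp :: "'a::euclidean_space operator \<Rightarrow> 'a operator \<Rightarrow> 'a operator" where
  "op_comp P1 P2 \<phi> =
     P1 (THE f. f \<in> test_functions \<and> (\<forall>\<psi>\<in>test_functions. P2 \<phi> \<psi> = dist_of_fun f \<psi>))"


section \<open>Pseudodifferential operators\<close>

text \<open>\<open>K\<close> is \<open>(2 \<pi>)\<^sup>-\<^sup>n \<integral> exp (\<i> \<langle>x - y, \<xi>\<rangle>) a(x, y, \<xi>) d\<xi>\<close>.\<close>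

definition has_amplitude ::
  "('a \<times> 'a) functional \<Rightarrow> (('a::euclidean_space \<times> 'a) \<times> 'a \<Rightarrow> complex) \<Rightarrow> bool" where
  "has_amplitude K a \<longleftrightarrow>
     (\<exists>I. is_oscillatory_integral (\<lambda>((x, y), \<xi>). (x - y) \<bullet> \<xi>) a I \<and>
          (\<forall>\<phi>\<in>test_functions. K \<phi> = I \<phi> / (2 * pi) ^ DIM('a)))"

definition PsiDO :: "real \<Rightarrow> 'a::euclidean_space operator set" where
  "PsiDO m = {P. \<exists>K. is_schwartz_kernel P K \<and> (\<exists>a\<in>symbols m. has_amplitude K a)}"

text \<open>Left symbols reproduce the kernel only up to a smooth kernel \<open>r\<close>.\<close>

definition total_left_symbol ::
  "real \<Rightarrow> 'a::euclidean_space operator \<Rightarrow> ('a \<times> 'a \<Rightarrow> complex) \<Rightarrow> bool" where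
  "total_left_symbol m P p \<longleftrightarrow> p \<in> symbols m \<and>
     (\<exists>K L r. is_schwartz_kernel P K \<and> has_amplitude L (\<lambda>((x, y), \<xi>). p (x, \<xi>)) \<and> smooth r \<and>
        (\<forall>\<phi>\<in>test_functions. K \<phi> = L \<phi> + dist_of_fun r \<phi>))"

end

theory Submission
  imports Defs "HOL-Probability.Probability"
begin

text \<open>
  By its left symbol, \<open>P\<^sub>j\<close> acts on test functions as \<open>A\<^sub>j = p\<^sub>j(x, D) + R\<^sub>j\<close> with a smooth kernel \<open>R\<^sub>j\<close>,
  and proper support makes the values of \<open>A\<^sub>j \<phi>\<close> on a ball depend on \<open>\<phi>\<close> on a larger ball only.
  Applying such an operator to \<open>e\<^sup>i\<^sup>\<langle>\<^sup>y\<^sup>,\<^sup>\<xi>\<^sup>\<rangle> u(y, \<xi>)\<close> with a symbol \<open>u\<close> compactly supported in \<open>y\<close> gives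
  \<open>e\<^sup>i\<^sup>\<langle>\<^sup>x\<^sup>,\<^sup>\<xi>\<^sup>\<rangle>\<close> times a symbol: \<open>R\<^sub>j\<close> contributes a symbol of order \<open>-\<infinity>\<close> (integration by parts), and
  \<open>p\<^sub>j(x, D)\<close> contributes \<open>(2 \<pi>)\<^sup>-\<^sup>n \<integral> p\<^sub>j(x, \<xi> + \<zeta>) e\<^sup>i\<^sup>\<langle>\<^sup>x\<^sup>,\<^sup>\<zeta>\<^sup>\<rangle> v(\<zeta>, \<xi>) d\<zeta>\<close>,
  where \<open>v\<close> is the Fourier transform of \<open>u\<close> in \<open>y\<close>. The integral is expanded by Taylor's formula
  for \<open>p\<^sub>j\<close> in \<open>\<zeta>\<close>. No stationary phase is needed, since \<open>v\<close> decays rapidly in \<open>\<zeta>\<close>.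

  Applying first \<open>A\<^sub>2\<close> and then \<open>A\<^sub>1\<close> to \<open>e\<^sup>i\<^sup>\<langle>\<^sup>y\<^sup>,\<^sup>\<xi>\<^sup>\<rangle> \<theta>(y)\<close> with a cutoff \<open>\<theta>\<close> yields a symbol \<open>c\<close> which, on a given
  ball, no longer changes once \<open>\<theta> = 1\<close> on a sufficiently large ball. The limiting symbol is the left symbol of
  \<open>A\<^sub>1 A\<^sub>2\<close>, with no smooth remainder, as one sees by inserting the Fourier inversion formula for \<open>\<theta> \<phi> = \<phi>\<close>.
\<close>

section \<open>Partial derivatives and smooth functions\<close>

text \<open>The obstacle is that all derivatives of a symbol have to be estimated, whereas the
  integrals that define it are easy to bound only without derivatives. The operations on pairs
  \<open>(p, u)\<close> and \<open>(r, u)\<close> are therefore set up so that they obey a product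
  rule. The Fourier transform of \<open>u\<close> is taken in the offset from the base point x,
  which absorbs the factor exp(i<x,\<zeta>>), and the smooth kernel is written as a function of x
  and the offset. A derivative then falls on one of the two arguments and returns the same operation
  with a new argument, so one undifferentiated estimate, iterated, gives every symbol estimate. The
  truncated expansion obeys the same rule, hence so does the remainder. A second obstacle is that
  operators are given only through functionals on test functions. Their outputs turn out to be
  smooth functions, so values at points are recovered by testing with bumps, and this converts the
  support of the kernel into vanishing statements at points.\<close>

lemma D_dir_eqI:
  assumes "(f has_derivative f') (at x)"
  shows "D_dir b f x = - \<i> * f' b"
proof -
  have "((\<lambda>t::real. x + t *\<^sub>R b) has_vector_derivative b) (at 0)"
    by (auto intro!: derivative_eq_intros)
  then have "((f \<circ> (\<lambda>t::real. x + t *\<^sub>R b)) has_derivative f' \<circ> (\<lambda>t. t *\<^sub>R b)) (at 0)"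
    using assms by (intro diff_chain_at) (auto simp: has_vector_derivative_def)
  moreover have "f' (t *\<^sub>R b) = t *\<^sub>R f' b" for t
    using has_derivative_linear[OF assms] by (simp add: linear_scale)
  ultimately have "((\<lambda>t::real. f (x + t *\<^sub>R b)) has_vector_derivative f' b) (at 0)"
    by (simp add: has_vector_derivative_def o_def)
  then show ?thesis
    by (simp add: D_dir_def vector_derivative_at)
qed

lemma has_derivative_D_dir:
  fixes f :: "'a::euclidean_space \<Rightarrow> complex"
  assumes "f differentiable at x"
  shows "(f has_derivative (\<lambda>h. \<Sum>b\<in>Basis. (h \<bullet> b) *\<^sub>R (\<i> * D_dir b f x))) (at x)"
proof -
  obtain f' where f': "(f has_derivative f') (at x)"
    using assms by (auto simp: differentiable_def)
  have "f' h = (\<Sum>b\<in>Basis. (h \<bullet> b) *\<^sub>R (\<i> * D_dir b f x))" for h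
  proof -
    have "f' h = f' (\<Sum>b\<in>Basis. (h \<bullet> b) *\<^sub>R b)"
      by (simp add: euclidean_representation)
    also have "\<dots> = (\<Sum>b\<in>Basis. (h \<bullet> b) *\<^sub>R f' b)"
      using has_derivative_linear[OF f'] by (simp add: linear_sum linear_scale)
    also have "\<dots> = (\<Sum>b\<in>Basis. (h \<bullet> b) *\<^sub>R (\<i> * D_dir b f x))"
      by (simp add: D_dir_eqI[OF f'])
    finally show ?thesis .
  qed
  then have "f' = (\<lambda>h. \<Sum>b\<in>Basis. (h \<bullet> b) *\<^sub>R (\<i> * D_dir b f x))" by auto
  with f' show ?thesis by simp
qed

lemma differentiable_on_UNIV: "f differentiable_on UNIV \<longleftrightarrow> (\<forall>x. f differentiable at x)"
  by (simp add: differentiable_on_def)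

lemma D_dir_const [simp]: "D_dir b (\<lambda>x. c) = (\<lambda>x. 0)"
  by (simp add: D_dir_def fun_eq_iff)

lemma D_dir_zero_dir [simp]: "D_dir 0 f = (\<lambda>x. 0)"
  by (simp add: D_dir_def fun_eq_iff)

lemma D_dir_add:
  assumes "f differentiable_on UNIV" "g differentiable_on UNIV"
  shows "D_dir b (\<lambda>x. f x + g x) = (\<lambda>x. D_dir b f x + D_dir b g x)"
proof
  fix x
  obtain f' g' where d: "(f has_derivative f') (at x)" "(g has_derivative g') (at x)"
    using assms by (auto simp: differentiable_on_UNIV differentiable_def) metis
  then have "((\<lambda>x. f x + g x) has_derivative (\<lambda>h. f' h + g' h)) (at x)"
    by (rule has_derivative_add)
  then show "D_dir b (\<lambda>x. f x + g x) x = D_dir b f x + D_dir b g x"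
    using D_dir_eqI[OF d(1)] D_dir_eqI[OF d(2)] by (subst D_dir_eqI) (auto simp: algebra_simps)
qed

lemma D_dir_mult:
  assumes "f differentiable_on UNIV" "g differentiable_on UNIV"
  shows "D_dir b (\<lambda>x. f x * g x) = (\<lambda>x. D_dir b f x * g x + f x * D_dir b g x)"
proof
  fix x
  obtain f' g' where d: "(f has_derivative f') (at x)" "(g has_derivative g') (at x)"
    using assms by (auto simp: differentiable_on_UNIV differentiable_def) metis
  then have "((\<lambda>x. f x * g x) has_derivative (\<lambda>h. f x * g' h + f' h * g x)) (at x)"
    by (rule has_derivative_mult)
  then show "D_dir b (\<lambda>x. f x * g x) x = D_dir b f x * g x + f x * D_dir b g x"
    using D_dir_eqI[OF d(1)] D_dir_eqI[OF d(2)] by (subst D_dir_eqI) (auto simp: algebra_simps)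
qed

lemma D_dir_cmult:
  assumes "f differentiable_on UNIV"
  shows "D_dir b (\<lambda>x. c * f x) = (\<lambda>x. c * D_dir b f x)"
  using D_dir_mult[of "\<lambda>x. c" f b] assms by simp

lemma D_dir_cong_ev:
  assumes "\<forall>\<^sub>F y in nhds x. f y = g y"
  shows "D_dir b f x = D_dir b g x"
proof -
  have "((\<lambda>t::real. x + t *\<^sub>R b) \<longlongrightarrow> x + 0 *\<^sub>R b) (nhds 0)"
    by (intro tendsto_intros filterlim_ident)
  then have "\<forall>\<^sub>F t in nhds (0::real). f (x + t *\<^sub>R b) = g (x + t *\<^sub>R b)"
    using assms by (auto simp: filterlim_iff)
  then have "vector_derivative (\<lambda>t. f (x + t *\<^sub>R b)) (at 0) = vector_derivative (\<lambda>t. g (x + t *\<^sub>R b)) (at 0)"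
    by (intro vector_derivative_cong_eq) auto
  then show ?thesis by (simp add: D_dir_def)
qed

lemma D_dir_translate: "D_dir b (\<lambda>x. f (x + c)) x = D_dir b f (x + c)"
  by (simp add: D_dir_def add_ac)

lemma D_dir_Pair_fst: "D_dir b (\<lambda>x. f (x, y)) x = D_dir (b, 0) f (x, y)"
  by (simp add: D_dir_def)

lemma D_dir_Pair_snd: "D_dir b (\<lambda>y. f (x, y)) y = D_dir (0, b) f (x, y)"
  by (simp add: D_dir_def)

text \<open>Bounds \<open>Q\<close> on \<open>k\<close> derivatives, each derivative along \<open>b\<close> lowering the order by \<open>w b\<close>;
  smooth functions and symbols are both instances.\<close>

primrec graded_diff ::
  "(real \<Rightarrow> ('a::euclidean_space \<Rightarrow> complex) \<Rightarrow> bool) \<Rightarrow> ('a \<Rightarrow> real) \<Rightarrow> nat \<Rightarrow> real \<Rightarrow> ('a \<Rightarrow> complex) \<Rightarrow> bool" where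
  "graded_diff Q w 0 m f \<longleftrightarrow> Q m f"
| "graded_diff Q w (Suc k) m f \<longleftrightarrow> Q m f \<and> f differentiable_on UNIV \<and>
     (\<forall>b\<in>Basis. graded_diff Q w k (m - w b) (D_dir b f))"

text \<open>The order enters the recursion only through differences, so a uniform change of it
  passes through. This gives the inclusion of symbol classes of increasing order.\<close>

lemma graded_diff_shift:
  assumes "\<And>m f. Q m f \<Longrightarrow> Q' (m + c) f" "graded_diff Q w k m f"
  shows "graded_diff Q' w k (m + c) f"
  using assms(2)
proof (induction k arbitrary: m f)
  case (Suc k)
  then have "graded_diff Q' w k (m - w b + c) (D_dir b f)" if "b \<in> Basis" for b
    using that by simp
  then show ?case using Suc.prems assms(1)[of m f] by (auto simp: algebra_simps)
qed (auto intro: assms(1))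

lemma graded_diff_Suc_D: "graded_diff Q w (Suc k) m f \<Longrightarrow> graded_diff Q w k m f"
  by (induction k arbitrary: m f) auto

lemma graded_diff_add:
  assumes Q: "\<And>m f g. Q m f \<Longrightarrow> Q m g \<Longrightarrow> Q m (\<lambda>x. f x + g x)"
  shows "graded_diff Q w k m f \<Longrightarrow> graded_diff Q w k m g \<Longrightarrow> graded_diff Q w k m (\<lambda>x. f x + g x)"
proof (induction k arbitrary: m f g)
  case (Suc k)
  then show ?case
    by (auto simp: D_dir_add differentiable_on_def intro!: Q derivative_intros differentiable_add)
qed (auto intro: Q)

text \<open>By the Leibniz rule a derivative of the product is a sum of two products, each with the
  order of one factor lowered by \<open>w b\<close>. The induction ranges over both factors and both
  orders, so only undifferentiated bounds for sums and products enter.\<close>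

lemma graded_diff_mult:
  assumes Qa: "\<And>m f g. Q m f \<Longrightarrow> Q m g \<Longrightarrow> Q m (\<lambda>x. f x + g x)"
    and Qm: "\<And>m m' f g. Q m f \<Longrightarrow> Q m' g \<Longrightarrow> Q (m + m') (\<lambda>x. f x * g x)"
  shows "graded_diff Q w k m f \<Longrightarrow> graded_diff Q w k m' g \<Longrightarrow> graded_diff Q w k (m + m') (\<lambda>x. f x * g x)"
proof (induction k arbitrary: m m' f g)
  case (Suc k)
  have "graded_diff Q w k (m + m' - w b) (\<lambda>x. D_dir b f x * g x + f x * D_dir b g x)" if "b \<in> Basis" for b
  proof (rule graded_diff_add)
    show "Q m (\<lambda>x. f x + g x)" if "Q m f" "Q m g" for m f g using Qa that .
    have "graded_diff Q w k (m - w b + m') (\<lambda>x. D_dir b f x * g x)"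
      using Suc.prems that graded_diff_Suc_D[of Q w k m' g] by (intro Suc.IH) auto
    then show "graded_diff Q w k (m + m' - w b) (\<lambda>x. D_dir b f x * g x)"
      by (simp add: algebra_simps)
    have "graded_diff Q w k (m + (m' - w b)) (\<lambda>x. f x * D_dir b g x)"
      using Suc.prems that graded_diff_Suc_D[of Q w k m f] by (intro Suc.IH) auto
    then show "graded_diff Q w k (m + m' - w b) (\<lambda>x. f x * D_dir b g x)"
      by (simp add: algebra_simps)
  qed
  then show ?case
    using Suc.prems by (auto simp: D_dir_mult differentiable_on_def intro!: Qm derivative_intros)
qed (auto intro: Qm)

text \<open>The recursion peels off the innermost derivative, that is, the last element of the list;
  hence the induction on lists from the right. The list form is that of \<open>smooth\<close>, the
  recursive form is the one suited to inductions.\<close>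

lemma graded_diff_iff:
  "(\<forall>k. graded_diff Q w k m f) \<longleftrightarrow>
     (\<forall>bs. set bs \<subseteq> Basis \<longrightarrow> foldr D_dir bs f differentiable_on UNIV \<and>
        Q (m - sum_list (map w bs)) (foldr D_dir bs f))" (is "?L \<longleftrightarrow> ?R")
proof
  assume L: ?L
  have "graded_diff Q w (Suc (length bs)) m f \<Longrightarrow> foldr D_dir bs f differentiable_on UNIV \<and>
        Q (m - sum_list (map w bs)) (foldr D_dir bs f)" if "set bs \<subseteq> Basis" for bs
    using that
  proof (induction bs arbitrary: m f rule: rev_induct)
    case (snoc b bs)
    then have "graded_diff Q w (Suc (length bs)) (m - w b) (D_dir b f)"
      by simp
    from snoc.IH[OF this] snoc.prems show ?case by (simp add: algebra_simps)
  qed simp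
  with L show ?R by blast
next
  assume R: ?R
  then have "graded_diff Q w k m f" for k
  proof (induction k arbitrary: m f)
    case 0
    from 0[rule_format, of "[]"] show ?case by simp
  next
    case (Suc k)
    have "graded_diff Q w k (m - w b) (D_dir b f)" if b: "b \<in> Basis" for b
    proof (rule Suc.IH, intro allI impI)
      fix bs :: "'a list" assume "set bs \<subseteq> Basis"
      then show "foldr D_dir bs (D_dir b f) differentiable_on UNIV \<and>
           Q (m - w b - sum_list (map w bs)) (foldr D_dir bs (D_dir b f))"
        using Suc.prems[rule_format, of "bs @ [b]"] b by (simp add: algebra_simps)
    qed
    then show ?case
      using Suc.prems[rule_format, of "[]"] by simp
  qed
  then show ?L by blast
qed

lemma smooth_iff: "smooth f \<longleftrightarrow> (\<forall>k. graded_diff (\<lambda>_ _. True) (\<lambda>_. 0) k 0 f)"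
  unfolding smooth_def graded_diff_iff by simp

lemma smooth_differentiable_on: "smooth f \<Longrightarrow> f differentiable_on UNIV"
  by (auto simp: smooth_def dest: spec[of _ "[]"])

lemma smooth_differentiable: "smooth f \<Longrightarrow> f differentiable at x"
  using smooth_differentiable_on by (auto simp: differentiable_on_UNIV)

lemma smooth_continuous_on: "smooth f \<Longrightarrow> continuous_on S f"
  using smooth_differentiable_on differentiable_imp_continuous_on continuous_on_subset by blast

lemma smooth_measurable: "smooth f \<Longrightarrow> f \<in> borel_measurable borel"
  by (intro borel_measurable_continuous_onI smooth_continuous_on)

lemma smooth_D_dir: "smooth f \<Longrightarrow> b \<in> Basis \<Longrightarrow> smooth (D_dir b f)"
  unfolding smooth_def
proof (intro allI impI)
  fix bs :: "'a list" assume "\<forall>bs. set bs \<subseteq> Basis \<longrightarrow> foldr D_dir bs f differentiable_on UNIV"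
    "b \<in> Basis" "set bs \<subseteq> Basis"
  then show "foldr D_dir bs (D_dir b f) differentiable_on UNIV"
    by (elim allE[of _ "bs @ [b]"]) auto
qed

lemma smooth_foldr_D_dir: "smooth f \<Longrightarrow> set bs \<subseteq> Basis \<Longrightarrow> smooth (foldr D_dir bs f)"
  by (induction bs) (auto intro: smooth_D_dir)

lemma smooth_add: "smooth f \<Longrightarrow> smooth g \<Longrightarrow> smooth (\<lambda>x. f x + g x)"
  unfolding smooth_iff by (auto intro!: graded_diff_add)

lemma smooth_mult: "smooth f \<Longrightarrow> smooth g \<Longrightarrow> smooth (\<lambda>x. f x * g x)"
  unfolding smooth_iff
  using graded_diff_mult[of "\<lambda>_ _. True" "\<lambda>_. 0" _ 0 f 0 g] by auto

lemma smooth_const [simp]: "smooth (\<lambda>x. c)"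
proof -
  have "\<exists>c'. foldr D_dir bs (\<lambda>x::'a. c) = (\<lambda>x. c')" for bs
    by (induction bs) auto
  then show ?thesis unfolding smooth_def by (metis differentiable_on_const)
qed

lemma graded_diff_const [simp]: "graded_diff (\<lambda>_ _. True) (\<lambda>_. 0) k 0 (\<lambda>x. c)"
  using smooth_const[of c] unfolding smooth_iff by blast

lemma smooth_cmult: "smooth f \<Longrightarrow> smooth (\<lambda>x. c * f x)"
  by (intro smooth_mult) auto

lemma smooth_uminus: "smooth f \<Longrightarrow> smooth (\<lambda>x. - f x)"
  using smooth_cmult[of f "-1"] by simp

lemma smooth_diff: "smooth f \<Longrightarrow> smooth g \<Longrightarrow> smooth (\<lambda>x. f x - g x)"
  using smooth_add[of f "\<lambda>x. - g x"] smooth_uminus[of g] by simp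

lemma smooth_sum: "(\<And>i. i \<in> I \<Longrightarrow> smooth (f i)) \<Longrightarrow> smooth (\<lambda>x. \<Sum>i\<in>I. f i x)"
  by (induction I rule: infinite_finite_induct) (auto intro: smooth_add)

lemma smooth_of_real_linear:
  assumes "bounded_linear l"
  shows "smooth (\<lambda>x. complex_of_real (l x))"
proof -
  have d: "((\<lambda>x. complex_of_real (l x)) has_derivative (\<lambda>h. complex_of_real (l h))) (at x)" for x
    using assms by (intro bounded_linear_imp_has_derivative)
      (intro bounded_linear_compose[OF bounded_linear_of_real])
  have "D_dir b (\<lambda>x. complex_of_real (l x)) = (\<lambda>x. - \<i> * l b)" for b
    by (simp add: fun_eq_iff D_dir_eqI[OF d])
  then have "graded_diff (\<lambda>_ _. True) (\<lambda>_. 0) k 0 (\<lambda>x. complex_of_real (l x))" for k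
    using d smooth_const[unfolded smooth_iff]
    by (cases k) (auto simp: differentiable_on_UNIV differentiable_def simp del: mult_minus_left)
  then show ?thesis by (simp add: smooth_iff)
qed

text \<open>The chain rule is expressed through the components of \<open>g\<close>, cast to complex
  values, because \<open>D_dir\<close> and \<open>smooth\<close> are available for complex-valued
  functions only. The factor \<open>\<i>\<close> cancels one of the two factors - \<i> that the
  chain rule would otherwise introduce.\<close>

lemma D_dir_compose:
  fixes F :: "'b::euclidean_space \<Rightarrow> complex" and g :: "'a::euclidean_space \<Rightarrow> 'b"
  assumes F: "F differentiable_on UNIV"
    and g: "\<And>b. b \<in> Basis \<Longrightarrow> (\<lambda>x. complex_of_real (g x \<bullet> b)) differentiable_on UNIV"
  shows "(\<lambda>x. F (g x)) differentiable_on UNIV"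
    and "D_dir c (\<lambda>x. F (g x)) =
      (\<lambda>x. \<Sum>b\<in>Basis. (\<i> * D_dir b F (g x)) * D_dir c (\<lambda>x. complex_of_real (g x \<bullet> b)) x)"
proof -
  have "(\<lambda>x. Re (complex_of_real (g x \<bullet> b))) differentiable at x" if bB: "b \<in> Basis" for b x
  proof -
    obtain G where "((\<lambda>x. complex_of_real (g x \<bullet> b)) has_derivative G) (at x)"
      using g[OF bB] unfolding differentiable_on_UNIV differentiable_def by blast
    from has_derivative_Re[OF this] show ?thesis by (auto simp: differentiable_def)
  qed
  then have "g differentiable at x" for x
    by (subst differentiable_componentwise_within) simp
  then have gd: "\<exists>g'. (g has_derivative g') (at x)" for x
    by (simp add: differentiable_def)
  have main: "(\<lambda>x. F (g x)) differentiable at x \<and> D_dir c (\<lambda>x. F (g x)) x =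
      (\<Sum>b\<in>Basis. (\<i> * D_dir b F (g x)) * D_dir c (\<lambda>x. complex_of_real (g x \<bullet> b)) x)" for x
  proof -
    obtain g' where g': "(g has_derivative g') (at x)" using gd by blast
    have Fd: "(F has_derivative (\<lambda>h. \<Sum>b\<in>Basis. (h \<bullet> b) *\<^sub>R (\<i> * D_dir b F (g x)))) (at (g x))"
      using F by (intro has_derivative_D_dir) (simp add: differentiable_on_UNIV)
    have 1: "((\<lambda>x. F (g x)) has_derivative (\<lambda>h. \<Sum>b\<in>Basis. (g' h \<bullet> b) *\<^sub>R (\<i> * D_dir b F (g x)))) (at x)"
      using diff_chain_at[OF g' Fd] by (simp add: o_def)
    have "((\<lambda>x. complex_of_real (g x \<bullet> b)) has_derivative (\<lambda>h. complex_of_real (g' h \<bullet> b))) (at x)" for b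
      using g' by (intro derivative_intros)
    then have 2: "D_dir c (\<lambda>x. complex_of_real (g x \<bullet> b)) x = - \<i> * (g' c \<bullet> b)" for b
      by (rule D_dir_eqI)
    show ?thesis
      unfolding D_dir_eqI[OF 1] 2
      using 1 by (auto simp: differentiable_def scaleR_conv_of_real sum_distrib_left algebra_simps intro!: sum.cong)
  qed
  then show "(\<lambda>x. F (g x)) differentiable_on UNIV" "D_dir c (\<lambda>x. F (g x)) =
      (\<lambda>x. \<Sum>b\<in>Basis. (\<i> * D_dir b F (g x)) * D_dir c (\<lambda>x. complex_of_real (g x \<bullet> b)) x)"
    by (auto simp: differentiable_on_UNIV)
qed

text \<open>The chain rule turns one derivative into a sum of products of some
  \<open>D_dir b F\<close> composed with \<open>g\<close> and a derivative of a component of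
  \<open>g\<close>. Since \<open>F\<close> is arbitrary in the induction, the hypothesis applies to
  \<open>D_dir b F\<close>.\<close>

lemma smooth_compose:
  fixes F :: "'b::euclidean_space \<Rightarrow> complex" and g :: "'a::euclidean_space \<Rightarrow> 'b"
  assumes "smooth F" and g: "\<And>b. b \<in> Basis \<Longrightarrow> smooth (\<lambda>x. complex_of_real (g x \<bullet> b))"
  shows "smooth (\<lambda>x. F (g x))"
proof -
  let ?d = "graded_diff (\<lambda>_ _. True) (\<lambda>_. 0)"
  have add: "?d k 0 (\<lambda>x::'a. \<Sum>i\<in>I. f i x)" if "\<And>i. i \<in> I \<Longrightarrow> ?d k 0 (f i)" for k I and f :: "'b \<Rightarrow> 'a \<Rightarrow> complex"
    using that
    by (induction I rule: infinite_finite_induct) (auto intro!: graded_diff_add simp: smooth_iff)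
  have "smooth F \<Longrightarrow> ?d k 0 (\<lambda>x. F (g x))" for k
  proof (induction k arbitrary: F)
    case (Suc k)
    have "?d k (0 + 0) (\<lambda>x. (\<i> * D_dir b F (g x)) * D_dir c (\<lambda>x. complex_of_real (g x \<bullet> b)) x)"
      if "b \<in> Basis" "c \<in> Basis" for b c
    proof (rule graded_diff_mult)
      have "?d k (0 + 0) (\<lambda>x. \<i> * D_dir b F (g x))"
        using Suc.IH[OF smooth_D_dir[OF Suc.prems that(1)]]
        by (intro graded_diff_mult) auto
      then show "?d k 0 (\<lambda>x. \<i> * D_dir b F (g x))" by simp
      show "?d k 0 (D_dir c (\<lambda>x. complex_of_real (g x \<bullet> b)))"
        using smooth_D_dir[OF g] that by (auto simp: smooth_iff)
    qed auto
    then have "?d k 0 (\<lambda>x. \<Sum>b\<in>Basis. (\<i> * D_dir b F (g x)) * D_dir c (\<lambda>x. complex_of_real (g x \<bullet> b)) x)"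
      if "c \<in> Basis" for c using that by (intro add) simp
    then show ?case
      using D_dir_compose[of F g] Suc.prems g by (auto simp: smooth_differentiable_on)
  qed simp
  with assms(1) show ?thesis by (simp add: smooth_iff)
qed

lemma smooth_affine:
  fixes F :: "'b::euclidean_space \<Rightarrow> complex"
  assumes "smooth F" "bounded_linear l"
  shows "smooth (\<lambda>x. F (l x + c))"
  using assms(1)
proof (rule smooth_compose)
  fix b :: 'b
  have "smooth (\<lambda>x. complex_of_real (l x \<bullet> b) + complex_of_real (c \<bullet> b))"
    using assms(2) by (intro smooth_add smooth_of_real_linear smooth_const)
      (auto intro: bounded_linear_compose[OF bounded_linear_inner_left])
  then show "smooth (\<lambda>x. complex_of_real ((l x + c) \<bullet> b))"
    by (simp add: inner_add_left)
qed

lemma smooth_linear: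
  fixes F :: "'b::euclidean_space \<Rightarrow> complex"
  assumes "smooth F" "bounded_linear l"
  shows "smooth (\<lambda>x. F (l x))"
  using smooth_affine[OF assms, of 0] by simp

lemma D_dir_linear:
  fixes F :: "'b::euclidean_space \<Rightarrow> complex"
  assumes "bounded_linear l"
  shows "D_dir b (\<lambda>x. F (l x)) x = D_dir (l b) F (l x)"
  using assms by (simp add: D_dir_def linear_simps)

lemma D_dir_exp_ii: "D_dir b (\<lambda>x. exp (\<i> * complex_of_real (x \<bullet> \<xi>))) = (\<lambda>x. (b \<bullet> \<xi>) * exp (\<i> * (x \<bullet> \<xi>)))"
  and exp_ii_differentiable: "(\<lambda>x::'a::euclidean_space. exp (\<i> * complex_of_real (x \<bullet> \<xi>))) differentiable_on UNIV"
proof -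
  have d: "((\<lambda>x::'a. exp (\<i> * complex_of_real (x \<bullet> \<xi>))) has_derivative (\<lambda>h. \<i> * (h \<bullet> \<xi>) * exp (\<i> * (x \<bullet> \<xi>)))) (at x)" for x
  proof -
    have "((\<lambda>x::'a. \<i> * complex_of_real (x \<bullet> \<xi>)) has_derivative (\<lambda>h. \<i> * (h \<bullet> \<xi>))) (at x)"
      by (auto intro!: derivative_eq_intros)
    moreover have "(exp has_derivative (*) (exp (\<i> * complex_of_real (x \<bullet> \<xi>)))) (at (\<i> * complex_of_real (x \<bullet> \<xi>)))"
      using DERIV_exp by (rule has_field_derivative_imp_has_derivative)
    ultimately show ?thesis
      using diff_chain_at by (fastforce simp: o_def mult_ac)
  qed
  show "D_dir b (\<lambda>x. exp (\<i> * complex_of_real (x \<bullet> \<xi>))) = (\<lambda>x. (b \<bullet> \<xi>) * exp (\<i> * (x \<bullet> \<xi>)))"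
    by (simp add: fun_eq_iff D_dir_eqI[OF d] mult.assoc[symmetric])
  show "(\<lambda>x::'a. exp (\<i> * complex_of_real (x \<bullet> \<xi>))) differentiable_on UNIV"
    using d by (auto simp: differentiable_on_UNIV differentiable_def)
qed

lemma smooth_exp_ii: "smooth (\<lambda>x. exp (\<i> * complex_of_real (x \<bullet> \<xi>)))"
proof -
  let ?d = "graded_diff (\<lambda>_ _. True) (\<lambda>_. 0)"
  have "?d k 0 (\<lambda>x. exp (\<i> * complex_of_real (x \<bullet> \<xi>)))" for k
  proof (induction k)
    case (Suc k)
    have "?d k (0 + 0) (\<lambda>x. (b \<bullet> \<xi>) * exp (\<i> * complex_of_real (x \<bullet> \<xi>)))" for b
      using Suc by (intro graded_diff_mult) auto
    then show ?case by (simp add: D_dir_exp_ii exp_ii_differentiable)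
  qed simp
  then show ?thesis by (simp add: smooth_iff)
qed

section \<open>Symbol classes\<close>

lemma has_vector_derivative_along:
  assumes "smooth f"
  shows "((\<lambda>t. f (x + t *\<^sub>R b)) has_vector_derivative \<i> * D_dir b f (x + t *\<^sub>R b)) (at t within S)"
proof -
  obtain f' where f': "(f has_derivative f') (at (x + t *\<^sub>R b))"
    using smooth_differentiable[OF assms] by (auto simp: differentiable_def)
  have "((\<lambda>t::real. x + t *\<^sub>R b) has_derivative (\<lambda>t. t *\<^sub>R b)) (at t)"
    by (auto intro!: derivative_eq_intros)
  from diff_chain_at[OF this f']
  have "((\<lambda>t. f (x + t *\<^sub>R b)) has_vector_derivative f' b) (at t)"
    using has_derivative_linear[OF f'] by (simp add: has_vector_derivative_def o_def linear_scale)
  then show ?thesis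
    by (auto simp: D_dir_eqI[OF f'] mult.assoc[symmetric] intro: has_vector_derivative_at_within)
qed

text \<open>Smoothness supplies all iterated derivatives but says nothing about their order. The
  symmetry follows by writing an increment along \<open>c\<close> as an integral, differentiating it
  along \<open>b\<close> under the integral sign, and then differentiating the result in the upper
  limit.\<close>

lemma D_dir_commute:
  assumes f: "smooth f" and b: "b \<in> Basis" and c: "c \<in> Basis"
  shows "D_dir b (D_dir c f) = D_dir c (D_dir b f)"
proof
  fix x
  have sm: "smooth (D_dir c f)" "smooth (D_dir b f)" "smooth (D_dir b (D_dir c f))"
    using f b c by (auto intro: smooth_D_dir)
  \<comment> \<open>The increment of \<open>f\<close> along \<open>c\<close> is the integral of its
    derivative along \<open>c\<close>; both sides are differentiated along \<open>b\<close>. The two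
    factors \<i> from passing between D and the plain derivative produce the minus sign.\<close>
  have eq: "\<i> * (D_dir b f (x + t *\<^sub>R c) - D_dir b f x) = integral {0..t} (\<lambda>s. - D_dir b (D_dir c f) (x + s *\<^sub>R c))"
    if t: "t \<in> {0..1}" for t :: real
  proof -
    have 1: "integral {0..t} (\<lambda>s. \<i> * D_dir c f ((x + r *\<^sub>R b) + s *\<^sub>R c))
        = f ((x + t *\<^sub>R c) + r *\<^sub>R b) - f (x + r *\<^sub>R b)" for r
      using fundamental_theorem_of_calculus[of 0 t "\<lambda>s. f ((x + r *\<^sub>R b) + s *\<^sub>R c)"] t
        has_vector_derivative_along[OF f, of "x + r *\<^sub>R b" c]
      by (intro integral_unique) (auto simp: algebra_simps)
    have "((\<lambda>r. integral (cbox 0 t) (\<lambda>s. \<i> * D_dir c f ((x + r *\<^sub>R b) + s *\<^sub>R c))) has_vector_derivative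
        integral (cbox 0 t) (\<lambda>s. - D_dir b (D_dir c f) ((x + 0 *\<^sub>R b) + s *\<^sub>R c))) (at 0 within UNIV)"
    proof (rule leibniz_rule_vector_derivative)
      show "((\<lambda>r. \<i> * D_dir c f ((x + r *\<^sub>R b) + s *\<^sub>R c)) has_vector_derivative
         - D_dir b (D_dir c f) ((x + r *\<^sub>R b) + s *\<^sub>R c)) (at r within UNIV)" for r s
      proof -
        have "((\<lambda>r. D_dir c f ((x + s *\<^sub>R c) + r *\<^sub>R b)) has_vector_derivative
           \<i> * D_dir b (D_dir c f) ((x + s *\<^sub>R c) + r *\<^sub>R b)) (at r within UNIV)"
          by (rule has_vector_derivative_along[OF sm(1)])
        from has_vector_derivative_mult_right[OF this, of \<i>]
        show ?thesis by (simp add: algebra_simps mult.assoc[symmetric])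
      qed
      show "(\<lambda>s. \<i> * D_dir c f ((x + r *\<^sub>R b) + s *\<^sub>R c)) integrable_on cbox 0 t" for r
        by (intro integrable_continuous continuous_intros
            continuous_on_compose2[OF smooth_continuous_on[OF sm(1), of UNIV]]) auto
      show "continuous_on (UNIV \<times> cbox 0 t) (\<lambda>(r, s). - D_dir b (D_dir c f) ((x + r *\<^sub>R b) + s *\<^sub>R c))"
        unfolding split_beta
        by (intro continuous_intros
            continuous_on_compose2[OF smooth_continuous_on[OF sm(3), of UNIV]]) auto
    qed auto
    moreover have "((\<lambda>r. f ((x + t *\<^sub>R c) + r *\<^sub>R b) - f (x + r *\<^sub>R b)) has_vector_derivative
        \<i> * D_dir b f ((x + t *\<^sub>R c) + 0 *\<^sub>R b) - \<i> * D_dir b f (x + 0 *\<^sub>R b)) (at 0)"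
      by (intro has_vector_derivative_diff has_vector_derivative_along f)
    ultimately show ?thesis
      unfolding 1 cbox_interval
      by (auto dest: vector_derivative_unique_at simp: algebra_simps)
  qed
  \<comment> \<open>The identity is known for t in [0,1] only, so both sides are differentiated
    one-sidedly at 0, where the derivative within the interval is still unique.\<close>
  have I: "((\<lambda>t. integral {0..t} (\<lambda>s. - D_dir b (D_dir c f) (x + s *\<^sub>R c))) has_vector_derivative
      - D_dir b (D_dir c f) (x + 0 *\<^sub>R c)) (at 0 within {0..1})"
    by (intro integral_has_vector_derivative continuous_intros
          continuous_on_compose2[OF smooth_continuous_on[OF sm(3), of UNIV]]) auto
  have 2: "((\<lambda>t. \<i> * (D_dir b f (x + t *\<^sub>R c) - D_dir b f x)) has_vector_derivative
      - D_dir b (D_dir c f) x) (at 0 within {0..1})"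
    using has_vector_derivative_transform[OF _ eq I] by simp
  have "((\<lambda>t. D_dir b f (x + t *\<^sub>R c) - D_dir b f x) has_vector_derivative
      \<i> * D_dir c (D_dir b f) (x + 0 *\<^sub>R c) - 0) (at 0 within {0..1})"
    by (intro has_vector_derivative_diff has_vector_derivative_along sm has_vector_derivative_const)
  from has_vector_derivative_mult_right[OF this, of \<i>]
  have 3: "((\<lambda>t. \<i> * (D_dir b f (x + t *\<^sub>R c) - D_dir b f x)) has_vector_derivative
      - D_dir c (D_dir b f) x) (at 0 within {0..1})"
    by (simp add: mult.assoc[symmetric])
  show "D_dir b (D_dir c f) x = D_dir c (D_dir b f) x"
    using vector_derivative_unique_within_closed_interval[OF _ _ 2[folded cbox_interval] 3[folded cbox_interval]] by simp
qed

lemma D_dir_foldr_commute: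
  "smooth f \<Longrightarrow> b \<in> Basis \<Longrightarrow> set bs \<subseteq> Basis \<Longrightarrow>
    D_dir b (foldr D_dir bs f) = foldr D_dir bs (D_dir b f)"
  by (induction bs) (auto simp: D_dir_commute[of _ b] smooth_foldr_D_dir)

lemma foldr_D_dir_mset:
  assumes "smooth f" "set bs \<subseteq> Basis" "mset bs = mset cs"
  shows "foldr D_dir bs f = foldr D_dir cs f"
  using assms(2,3)
proof (induction bs arbitrary: cs)
  case (Cons b bs)
  have "b \<in> set cs" using Cons.prems(2) by (metis list.set_intros(1) mset_eq_setD)
  then obtain xs ys where cs: "cs = xs @ b # ys" by (meson split_list)
  with Cons.prems have "mset bs = mset (xs @ ys)" by simp
  moreover have sub: "set cs \<subseteq> Basis" using Cons.prems mset_eq_setD by blast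
  ultimately have "foldr D_dir bs f = foldr D_dir (xs @ ys) f"
    using Cons.prems(1) by (intro Cons.IH) auto
  moreover have "D_dir b (foldr D_dir xs (foldr D_dir ys f)) = foldr D_dir xs (D_dir b (foldr D_dir ys f))"
    using sub cs assms(1) by (intro D_dir_foldr_commute smooth_foldr_D_dir) auto
  ultimately show ?case by (simp add: cs)
qed simp

section \<open>Multi-indices as lists of directions\<close>

lemma basis_list: "distinct (basis_list :: 'a::euclidean_space list)" "set (basis_list :: 'a list) = Basis"
proof -
  obtain bs :: "'a list" where "distinct bs \<and> set bs = Basis"
    using finite_distinct_list[OF finite_Basis] by blast
  then have "distinct (basis_list :: 'a list) \<and> set (basis_list :: 'a list) = Basis"
    unfolding basis_list_def by (rule someI)
  then show "distinct (basis_list :: 'a list)" "set (basis_list :: 'a list) = Basis" by simp_all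
qed

text \<open>As a list of directions a multi-index makes \<open>D_mi\<close> an iterated
  \<open>D_dir\<close>, the form in which smoothness is stated. Identities between multi-indices
  become identities between multisets of directions.\<close>

definition mi_list :: "('a::euclidean_space \<Rightarrow> nat) \<Rightarrow> 'a list" where
  "mi_list \<alpha> = concat (map (\<lambda>b. replicate (\<alpha> b) b) basis_list)"

lemma D_mi_foldr: "D_mi \<alpha> f = foldr D_dir (mi_list \<alpha>) f"
proof -
  have *: "foldr D_dir (replicate n b) g = (D_dir b ^^ n) g" for n and b :: 'a and g
    by (induction n) auto
  have "foldr (\<lambda>b. D_dir b ^^ \<alpha> b) bs f = foldr D_dir (concat (map (\<lambda>b. replicate (\<alpha> b) b) bs)) f" for bs
    by (induction bs) (auto simp: *)
  then show ?thesis by (simp add: D_mi_def mi_list_def)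
qed

lemma set_mi_list: "set (mi_list \<alpha>) \<subseteq> Basis"
  by (auto simp: mi_list_def basis_list)

lemma count_mi_list: "count (mset (mi_list \<alpha>)) b = (if b \<in> Basis then \<alpha> b else 0)"
proof -
  have "count (mset (concat (map (\<lambda>b. replicate (\<alpha> b) b) bs))) b = (if b \<in> set bs then \<alpha> b else 0)"
    if "distinct bs" for bs using that
    by (induction bs) auto
  from this[OF basis_list(1)] show ?thesis by (simp add: mi_list_def basis_list)
qed

lemma length_mi_list: "length (mi_list \<alpha>) = mi_order \<alpha>"
  by (simp add: mi_list_def length_concat o_def sum_list_distinct_conv_sum_set basis_list mi_order_def)

lemma foldr_D_dir_fst:
  "foldr D_dir bs (\<lambda>x. a (x, \<theta>)) = (\<lambda>x. foldr D_dir (map (\<lambda>b. (b, 0)) bs) a (x, \<theta>))"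
  by (induction bs) (auto simp: D_dir_Pair_fst)

lemma foldr_D_dir_snd:
  "foldr D_dir bs (\<lambda>\<theta>. a (x, \<theta>)) = (\<lambda>\<theta>. foldr D_dir (map (\<lambda>b. (0, b)) bs) a (x, \<theta>))"
  by (induction bs) (auto simp: D_dir_Pair_snd)

lemma D_fst_eq: "D_fst \<alpha> a = foldr D_dir (map (\<lambda>b. (b, 0)) (mi_list \<alpha>)) a"
  by (auto simp: D_mi_foldr foldr_D_dir_fst)

lemma D_snd_eq: "D_snd \<beta> a = foldr D_dir (map (\<lambda>b. (0, b)) (mi_list \<beta>)) a"
  by (auto simp: D_mi_foldr foldr_D_dir_snd)

lemma fst_list_subset_Basis: "set bs \<subseteq> Basis \<Longrightarrow> set (map (\<lambda>b. (b, 0)) bs) \<subseteq> Basis"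
  and snd_list_subset_Basis: "set cs \<subseteq> Basis \<Longrightarrow> set (map (\<lambda>b. (0, b)) cs) \<subseteq> Basis"
  by (auto simp: Basis_prod_def)

section \<open>The symbol estimate and closure properties of the symbol classes\<close>

definition symbol_bound :: "real \<Rightarrow> ('a::metric_space \<times> 'b::real_normed_vector \<Rightarrow> complex) \<Rightarrow> bool" where
  "symbol_bound m a \<longleftrightarrow> (\<forall>K. compact K \<longrightarrow> (\<exists>C. \<forall>x\<in>K. \<forall>\<theta>. norm (a (x, \<theta>)) \<le> C * japanese \<theta> powr m))"

text \<open>The order lost by a derivative along \<open>b\<close>: none in the base variable, one in
  the frequency variable. For a basis vector of the product exactly one component is nonzero, so
  looking at \<open>snd b\<close> decides which case applies. With \<open>symbol_bound\<close> as
  the undifferentiated estimate this makes symbols an instance of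
  \<open>graded_diff\<close>.\<close>

definition snd_weight :: "'a::zero \<times> 'b::zero \<Rightarrow> real" where
  "snd_weight b = (if snd b = 0 then 0 else 1)"

lemma japanese_ge_1: "1 \<le> japanese \<theta>"
  by (simp add: japanese_def)

lemma japanese_pos [simp]: "0 < japanese \<theta>"
  using japanese_ge_1[of \<theta>] by linarith

lemma japanese_neq_0 [simp]: "japanese \<theta> \<noteq> 0"
  using japanese_pos[of \<theta>] by linarith

lemma symbol_boundE:
  assumes "symbol_bound m a" "compact K"
  obtains C where "C \<ge> 0" "\<And>x \<theta>. x \<in> K \<Longrightarrow> norm (a (x, \<theta>)) \<le> C * japanese \<theta> powr m"
proof -
  obtain C where C: "\<And>x \<theta>. x \<in> K \<Longrightarrow> norm (a (x, \<theta>)) \<le> C * japanese \<theta> powr m"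
    using assms by (force simp: symbol_bound_def)
  have "norm (a (x, \<theta>)) \<le> \<bar>C\<bar> * japanese \<theta> powr m" if "x \<in> K" for x \<theta>
    using C[OF that, of \<theta>] by (smt (verit) mult_right_mono powr_ge_zero)
  then show ?thesis using that[of "\<bar>C\<bar>"] by auto
qed

lemma symbol_boundI:
  assumes "\<And>K. compact K \<Longrightarrow> \<exists>C. \<forall>x\<in>K. \<forall>\<theta>. norm (a (x, \<theta>)) \<le> C * japanese \<theta> powr m"
  shows "symbol_bound m a"
  using assms by (auto simp: symbol_bound_def)

lemma symbol_bound_add:
  assumes "symbol_bound m a" "symbol_bound m b"
  shows "symbol_bound m (\<lambda>z. a z + b z)"
proof (rule symbol_boundI)
  fix K :: "'a set" assume K: "compact K"
  obtain C where C: "\<And>x \<theta>. x \<in> K \<Longrightarrow> norm (a (x, \<theta>)) \<le> C * japanese \<theta> powr m"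
    using symbol_boundE[OF assms(1) K] by metis
  obtain D where D: "\<And>x \<theta>. x \<in> K \<Longrightarrow> norm (b (x, \<theta>)) \<le> D * japanese \<theta> powr m"
    using symbol_boundE[OF assms(2) K] by metis
  show "\<exists>C. \<forall>x\<in>K. \<forall>\<theta>. norm (a (x, \<theta>) + b (x, \<theta>)) \<le> C * japanese \<theta> powr m"
    by (intro exI[of _ "C + D"] ballI allI order.trans[OF norm_triangle_ineq])
      (simp add: C D add_mono algebra_simps)
qed

lemma symbol_bound_mult:
  assumes "symbol_bound m a" "symbol_bound m' b"
  shows "symbol_bound (m + m') (\<lambda>z. a z * b z)"
proof (rule symbol_boundI)
  fix K :: "'a set" assume K: "compact K"
  obtain C where C: "C \<ge> 0" "\<And>x \<theta>. x \<in> K \<Longrightarrow> norm (a (x, \<theta>)) \<le> C * japanese \<theta> powr m"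
    using symbol_boundE[OF assms(1) K] by metis
  obtain D where D: "\<And>x \<theta>. x \<in> K \<Longrightarrow> norm (b (x, \<theta>)) \<le> D * japanese \<theta> powr m'"
    using symbol_boundE[OF assms(2) K] by metis
  have "norm (a (x, \<theta>) * b (x, \<theta>)) \<le> C * D * japanese \<theta> powr (m + m')" if "x \<in> K" for x \<theta>
  proof -
    have "norm (a (x, \<theta>) * b (x, \<theta>)) \<le> (C * japanese \<theta> powr m) * (D * japanese \<theta> powr m')"
      unfolding norm_mult using C D that by (intro mult_mono) auto
    then show ?thesis by (simp add: powr_add mult_ac)
  qed
  then show "\<exists>C. \<forall>x\<in>K. \<forall>\<theta>. norm (a (x, \<theta>) * b (x, \<theta>)) \<le> C * japanese \<theta> powr (m + m')"
    by blast
qed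

lemma symbol_bound_mono:
  assumes "symbol_bound m a" "m \<le> m'"
  shows "symbol_bound m' a"
proof (rule symbol_boundI)
  fix K :: "'a set" assume K: "compact K"
  obtain C where C: "C \<ge> 0" "\<And>x \<theta>. x \<in> K \<Longrightarrow> norm (a (x, \<theta>)) \<le> C * japanese \<theta> powr m"
    using symbol_boundE[OF assms(1) K] by metis
  have "C * japanese \<theta> powr m \<le> C * japanese \<theta> powr m'" for \<theta> :: 'b
    using C(1) assms(2) japanese_ge_1[of \<theta>] by (intro mult_left_mono powr_mono) auto
  then show "\<exists>C. \<forall>x\<in>K. \<forall>\<theta>. norm (a (x, \<theta>)) \<le> C * japanese \<theta> powr m'"
    using C(2) by (meson order.trans)
qed

lemma sum_list_snd_weight:
  fixes bs :: "'a::euclidean_space list" and cs :: "'b::euclidean_space list"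
  assumes "set bs \<subseteq> Basis" "set cs \<subseteq> Basis"
  shows "sum_list (map snd_weight (map (\<lambda>b. (b, 0)) bs @ map (\<lambda>b. (0, b)) cs)) = real (length cs)"
proof -
  have "sum_list (map snd_weight (map (\<lambda>b. (b, 0::'b)) bs)) = 0"
    by (induction bs) (auto simp: snd_weight_def)
  moreover have "sum_list (map snd_weight (map (\<lambda>b. (0::'a, b)) cs)) = real (length cs)"
    using assms(2) by (induction cs) (auto simp: snd_weight_def)
  ultimately show ?thesis unfolding map_append sum_list_append by simp
qed

lemma count_image_mset_inj:
  assumes "inj f" shows "count (image_mset f M) (f x) = count M x"
  using assms by (induction M) (auto simp: inj_eq)

text \<open>An arbitrary word of derivatives can be sorted into the form
  \<open>D_fst \<alpha> (D_snd \<beta> a)\<close> since derivatives commute. The multi-indices are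
  the multiplicities of the directions in the word, and its total weight is the order of
  \<beta>.\<close>

lemma symbols_iff:
  "a \<in> symbols m \<longleftrightarrow> (\<forall>k. graded_diff symbol_bound snd_weight k m a)"
proof
  assume a: "a \<in> symbols m"
  then have sm: "smooth a" by (simp add: symbols_def)
  have "foldr D_dir bs a differentiable_on UNIV \<and>
      symbol_bound (m - sum_list (map snd_weight bs)) (foldr D_dir bs a)" if bs: "set bs \<subseteq> Basis" for bs
  proof
    show "foldr D_dir bs a differentiable_on UNIV"
      using bs sm by (intro smooth_differentiable_on smooth_foldr_D_dir)
    define \<alpha> where "\<alpha> b = (if b \<in> Basis then count (mset bs) (b, 0) else 0)" for b
    define \<beta> where "\<beta> b = (if b \<in> Basis then count (mset bs) (0, b) else 0)" for b
    let ?l = "map (\<lambda>b. (b, 0)) (mi_list \<alpha>) @ map (\<lambda>b. (0, b)) (mi_list \<beta>)"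
    have inj: "inj (\<lambda>b::'a. (b, 0::'b))" "inj (\<lambda>b::'b. (0::'a, b))" by (auto simp: inj_def)
    have eq: "mset bs = mset ?l"
    proof (rule multiset_eqI)
      fix c :: "'a \<times> 'b"
      show "count (mset bs) c = count (mset ?l) c"
      proof (cases "c \<in> Basis")
        case False
        then have "c \<notin> set bs" "c \<notin> set ?l"
          using bs set_mi_list[of \<alpha>] set_mi_list[of \<beta>] by (auto simp: Basis_prod_def)
        then show ?thesis by (metis count_mset_0_iff)
      next
        case True
        then consider b where "c = (b, 0)" "b \<in> Basis" | b where "c = (0, b)" "b \<in> Basis"
          by (auto simp: Basis_prod_def)
        then show ?thesis
        proof cases
          case 1
          then have "c \<notin> set (map (\<lambda>b. (0, b)) (mi_list \<beta>))" by auto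
          then have "count (mset (map (\<lambda>b. (0, b)) (mi_list \<beta>))) c = 0" by (metis count_mset_0_iff)
          moreover have "count (mset (map (\<lambda>b. (b, 0::'b)) (mi_list \<alpha>))) c = \<alpha> b"
            using count_image_mset_inj[OF inj(1), of "mset (mi_list \<alpha>)" b] 1
            by (simp add: count_mi_list)
          ultimately show ?thesis using 1 by (simp add: \<alpha>_def)
        next
          case 2
          then have "c \<notin> set (map (\<lambda>b. (b, 0)) (mi_list \<alpha>))" by auto
          then have "count (mset (map (\<lambda>b. (b, 0)) (mi_list \<alpha>))) c = 0" by (metis count_mset_0_iff)
          moreover have "count (mset (map (\<lambda>b. (0::'a, b)) (mi_list \<beta>))) c = \<beta> b"
            using count_image_mset_inj[OF inj(2), of "mset (mi_list \<beta>)" b] 2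
            by (simp add: count_mi_list)
          ultimately show ?thesis using 2 by (simp add: \<beta>_def)
        qed
      qed
    qed
    have 1: "foldr D_dir bs a = D_fst \<alpha> (D_snd \<beta> a)"
      unfolding D_fst_eq D_snd_eq using foldr_D_dir_mset[OF sm bs eq] by simp
    have "mset (map snd_weight bs) = mset (map snd_weight ?l)"
      using eq by (metis mset_map)
    then have "sum_list (map snd_weight bs) = sum_list (map snd_weight ?l)"
      by (metis sum_mset_sum_list)
    also have "\<dots> = real (mi_order \<beta>)"
      using sum_list_snd_weight[OF set_mi_list[of \<alpha>] set_mi_list[of \<beta>]] by (simp add: length_mi_list)
    finally have 2: "sum_list (map snd_weight bs) = real (mi_order \<beta>)" .
    have "\<alpha> \<in> multi_indices" "\<beta> \<in> multi_indices"
      by (auto simp: multi_indices_def \<alpha>_def \<beta>_def)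
    then show "symbol_bound (m - sum_list (map snd_weight bs)) (foldr D_dir bs a)"
      using a[unfolded symbols_def mem_Collect_eq, THEN conjunct2, rule_format, of \<alpha> \<beta>]
      unfolding 1 2 symbol_bound_def by simp
  qed
  then show "\<forall>k. graded_diff symbol_bound snd_weight k m a"
    unfolding graded_diff_iff by blast
next
  assume a: "\<forall>k. graded_diff symbol_bound snd_weight k m a"
  have "smooth a"
    using a unfolding graded_diff_iff smooth_def by blast
  moreover have "symbol_bound (m - real (mi_order \<beta>)) (D_fst \<alpha> (D_snd \<beta> a))" for \<alpha> \<beta>
  proof -
    let ?l = "map (\<lambda>b. (b, 0)) (mi_list \<alpha>) @ map (\<lambda>b. (0, b)) (mi_list \<beta>)"
    have "symbol_bound (m - sum_list (map snd_weight ?l)) (foldr D_dir ?l a)"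
      using a fst_list_subset_Basis[OF set_mi_list[of \<alpha>]] snd_list_subset_Basis[OF set_mi_list[of \<beta>]]
      unfolding graded_diff_iff by (metis Un_least set_append)
    then show ?thesis
      unfolding sum_list_snd_weight[OF set_mi_list set_mi_list] D_fst_eq D_snd_eq
      by (simp add: length_mi_list)
  qed
  ultimately show "a \<in> symbols m"
    unfolding symbols_def symbol_bound_def mem_Collect_eq by (intro conjI ballI) simp_all
qed

lemma symbols_smooth: "a \<in> symbols m \<Longrightarrow> smooth a"
  by (simp add: symbols_def)

lemma symbols_bound: "a \<in> symbols m \<Longrightarrow> symbol_bound m a"
  unfolding symbols_iff using graded_diff.simps(1) by blast

lemma symbols_D_dir: "a \<in> symbols m \<Longrightarrow> b \<in> Basis \<Longrightarrow> D_dir b a \<in> symbols (m - snd_weight b)"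
  unfolding symbols_iff using graded_diff.simps(2) by blast

lemma symbols_foldr_D_dir:
  "a \<in> symbols m \<Longrightarrow> set bs \<subseteq> Basis \<Longrightarrow> foldr D_dir bs a \<in> symbols (m - sum_list (map snd_weight bs))"
proof (induction bs)
  case (Cons b bs)
  have "D_dir b (foldr D_dir bs a) \<in> symbols (m - sum_list (map snd_weight bs) - snd_weight b)"
    using Cons by (intro symbols_D_dir) simp_all
  moreover have "m - sum_list (map snd_weight bs) - snd_weight b = m - sum_list (map snd_weight (b # bs))"
    by simp
  ultimately show ?case by simp
qed simp

lemma symbols_add:
  assumes "a \<in> symbols m" "b \<in> symbols m" shows "(\<lambda>z. a z + b z) \<in> symbols m"
  unfolding symbols_iff
proof
  fix k
  show "graded_diff symbol_bound snd_weight k m (\<lambda>z. a z + b z)"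
  proof (rule graded_diff_add[of symbol_bound snd_weight k m a b])
    fix n and f g :: "'a \<times> 'b \<Rightarrow> complex" assume "symbol_bound n f" "symbol_bound n g"
    then show "symbol_bound n (\<lambda>z. f z + g z)" by (rule symbol_bound_add)
  qed (use assms in \<open>simp_all add: symbols_iff\<close>)
qed

lemma symbols_mult:
  assumes "a \<in> symbols m" "b \<in> symbols m'" shows "(\<lambda>z. a z * b z) \<in> symbols (m + m')"
  unfolding symbols_iff
proof
  fix k
  show "graded_diff symbol_bound snd_weight k (m + m') (\<lambda>z. a z * b z)"
  proof (rule graded_diff_mult[of symbol_bound snd_weight k m a m' b])
    fix n n' and f g :: "'a \<times> 'b \<Rightarrow> complex"
    show "symbol_bound n f \<Longrightarrow> symbol_bound n g \<Longrightarrow> symbol_bound n (\<lambda>z. f z + g z)"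
      by (rule symbol_bound_add)
    show "symbol_bound n f \<Longrightarrow> symbol_bound n' g \<Longrightarrow> symbol_bound (n + n') (\<lambda>z. f z * g z)"
      by (rule symbol_bound_mult)
  qed (use assms in \<open>simp_all add: symbols_iff\<close>)
qed

lemma symbols_mono:
  assumes "a \<in> symbols m" "m \<le> m'" shows "a \<in> symbols m'"
proof -
  have "graded_diff symbol_bound snd_weight k (m + (m' - m)) a" for k
  proof (rule graded_diff_shift[of symbol_bound symbol_bound "m' - m" snd_weight k m a])
    show "symbol_bound (n + (m' - m)) f" if "symbol_bound n f" for n and f :: "'a \<times> 'b \<Rightarrow> complex"
      by (rule symbol_bound_mono[OF that]) (use assms(2) in simp)
    show "graded_diff symbol_bound snd_weight k m a"
      using assms(1) unfolding symbols_iff by blast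
  qed
  then show ?thesis by (simp add: symbols_iff)
qed

lemma symbols_zero [simp]: "(\<lambda>z. 0) \<in> symbols m"
proof -
  have "foldr D_dir bs (\<lambda>z::'a \<times> 'b. 0) = (\<lambda>z. 0)" for bs by (induction bs) auto
  then show ?thesis
    unfolding symbols_iff graded_diff_iff by (auto simp: symbol_bound_def intro!: exI[of _ 0])
qed

lemma graded_diff_symbol_zero [simp]: "graded_diff symbol_bound snd_weight k m (\<lambda>z. 0)"
  using symbols_zero unfolding symbols_iff by blast

lemma symbols_const [simp]: "(\<lambda>z. c) \<in> symbols 0"
proof -
  have "graded_diff symbol_bound snd_weight k 0 (\<lambda>z::'a \<times> 'b. c)" for k
  proof (cases k)
    case 0 then show ?thesis by (auto simp: symbol_bound_def)
  next
    case (Suc j)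
    have "(\<lambda>z::'a\<times>'b. 0) \<in> symbols m" for m by simp
    then show ?thesis
      unfolding Suc symbols_iff by (auto simp: symbol_bound_def)
  qed
  then show ?thesis by (simp add: symbols_iff)
qed

lemma symbols_cmult: "a \<in> symbols m \<Longrightarrow> (\<lambda>z. c * a z) \<in> symbols m"
  using symbols_mult[OF symbols_const, of a m c] by simp

lemma symbols_sum: "(\<And>i. i \<in> I \<Longrightarrow> a i \<in> symbols m) \<Longrightarrow> (\<lambda>z. \<Sum>i\<in>I. a i z) \<in> symbols m"
  by (induction I rule: infinite_finite_induct) (auto intro: symbols_add)

lemma symbols_D_fst:
  fixes a :: "'a::euclidean_space \<times> 'b::euclidean_space \<Rightarrow> complex"
  assumes "a \<in> symbols m" shows "D_fst \<alpha> a \<in> symbols m"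
  unfolding D_fst_eq
  using symbols_foldr_D_dir[OF assms fst_list_subset_Basis[OF set_mi_list[of \<alpha>]]]
    sum_list_snd_weight[OF set_mi_list[of \<alpha>], of "[] :: 'b list"] by simp

lemma symbols_D_snd:
  fixes a :: "'a::euclidean_space \<times> 'b::euclidean_space \<Rightarrow> complex"
  assumes "a \<in> symbols m" shows "D_snd \<beta> a \<in> symbols (m - real (mi_order \<beta>))"
  unfolding D_snd_eq
  using symbols_foldr_D_dir[OF assms snd_list_subset_Basis[OF set_mi_list[of \<beta>]]]
    sum_list_snd_weight[of "[] :: 'a list", OF _ set_mi_list[of \<beta>]] by (simp add: length_mi_list)

lemma Basis_prod_cases:
  assumes "c \<in> Basis"
  obtains b where "c = (b, 0)" "b \<in> Basis" | b where "c = (0, b)" "b \<in> Basis"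
  using assms by (auto simp: Basis_prod_def)

text \<open>A derivative of the pullback along a basis vector is the pullback of a derivative along
  its image, which is again a basis vector or zero; the order therefore drops exactly as before. The
  instances are the projection of (x, y) to x and the sum map (x, z) to x + z.\<close>

lemma symbols_lift:
  fixes L :: "'c::euclidean_space \<Rightarrow> 'a::euclidean_space"
  assumes L: "bounded_linear L" "\<And>b. b \<in> Basis \<Longrightarrow> L b = 0 \<or> L b \<in> Basis"
    and a: "(a :: 'a \<times> 'b::euclidean_space \<Rightarrow> complex) \<in> symbols m"
  shows "(\<lambda>(z, \<theta>). a (L z, \<theta>)) \<in> symbols m"
proof -
  have bl: "bounded_linear (\<lambda>z::'c \<times> 'b. (L (fst z), snd z))"
    by (intro bounded_linear_Pair bounded_linear_compose[OF L(1)] bounded_linear_fst bounded_linear_snd)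
  have sb: "symbol_bound m (\<lambda>(z, \<theta>). a (L z, \<theta>))" if "symbol_bound m a" for m and a :: "'a \<times> 'b \<Rightarrow> complex"
  proof (rule symbol_boundI)
    fix K :: "'c set" assume "compact K"
    then have "compact (L ` K)"
      using L(1) by (intro compact_continuous_image linear_continuous_on)
    with that show "\<exists>C. \<forall>x\<in>K. \<forall>\<theta>. cmod (case (x, \<theta>) of (z, \<theta>) \<Rightarrow> a (L z, \<theta>)) \<le> C * japanese \<theta> powr m"
      unfolding symbol_bound_def by fastforce
  qed
  have "a \<in> symbols m \<Longrightarrow> graded_diff symbol_bound snd_weight k m (\<lambda>(z, \<theta>). a (L z, \<theta>))" for k
  proof (induction k arbitrary: m a)
    case 0
    then show ?case using sb[OF symbols_bound] by simp
  next
    case (Suc k)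
    have "graded_diff symbol_bound snd_weight k (m - snd_weight b) (D_dir b (\<lambda>(z, \<theta>). a (L z, \<theta>)))" if "b \<in> Basis" for b
    proof -
      have D: "D_dir b (\<lambda>(z, \<theta>). a (L z, \<theta>)) = (\<lambda>(z, \<theta>). D_dir (L (fst b), snd b) a (L z, \<theta>))"
        using D_dir_linear[OF bl, of b a] by (simp add: case_prod_unfold fun_eq_iff)
      show ?thesis
      proof (cases "(L (fst b), snd b) = 0")
        case True
        then show ?thesis unfolding D True D_dir_zero_dir by (simp add: case_prod_unfold)
      next
        case False
        then have "(L (fst b), snd b) \<in> Basis"
          using \<open>b \<in> Basis\<close> L(2) linear_0[OF bounded_linear.linear[OF L(1)]]
          by (elim Basis_prod_cases) (auto simp: Basis_prod_def zero_prod_def)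
        from symbols_D_dir[OF Suc.prems this]
        have "D_dir (L (fst b), snd b) a \<in> symbols (m - snd_weight b)" by (simp add: snd_weight_def)
        from Suc.IH[OF this] show ?thesis unfolding D .
      qed
    qed
    moreover have "(\<lambda>(z, \<theta>). a (L z, \<theta>)) differentiable_on UNIV"
      using smooth_linear[OF symbols_smooth[OF Suc.prems] bl]
      by (simp add: case_prod_unfold smooth_differentiable_on)
    ultimately show ?case using sb[OF symbols_bound[OF Suc.prems]] by simp
  qed
  with a show ?thesis by (simp add: symbols_iff)
qed

text \<open>Symbol estimates are uniform only over compact sets in x, so continuity of the
  derivatives of \<open>r\<close> suffices; derivatives in the frequency vanish.\<close>

lemma symbols_const_snd:
  fixes r :: "'a::euclidean_space \<Rightarrow> complex"
  assumes "smooth r" shows "(\<lambda>(x, \<theta>::'b::euclidean_space). r x) \<in> symbols 0"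
proof -
  have sb: "symbol_bound 0 (\<lambda>(x, \<theta>::'b). r x)" if r: "smooth r" for r :: "'a \<Rightarrow> complex"
  proof (rule symbol_boundI)
    fix K :: "'a set" assume "compact K"
    then have "compact (r ` K)" using r by (intro compact_continuous_image smooth_continuous_on)
    then obtain C where "\<And>x. x \<in> K \<Longrightarrow> norm (r x) \<le> C"
      using compact_imp_bounded bounded_iff by (metis image_eqI)
    then show "\<exists>C. \<forall>x\<in>K. \<forall>\<theta>::'b. cmod (case (x, \<theta>) of (x, \<theta>) \<Rightarrow> r x) \<le> C * japanese \<theta> powr 0"
      by (intro exI[of _ C]) auto
  qed
  have "smooth r \<Longrightarrow> graded_diff symbol_bound snd_weight k 0 (\<lambda>(x, \<theta>::'b). r x)" for k
  proof (induction k arbitrary: r)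
    case (Suc k)
    have "graded_diff symbol_bound snd_weight k (0 - snd_weight b) (D_dir b (\<lambda>(x, \<theta>::'b). r x))" if "b \<in> Basis" for b :: "'a \<times> 'b"
    proof -
      have D: "D_dir b (\<lambda>(x, \<theta>::'b). r x) = (\<lambda>(x, \<theta>). D_dir (fst b) r x)"
        using D_dir_linear[OF bounded_linear_fst, of b r] by (simp add: case_prod_unfold fun_eq_iff)
      show ?thesis
      proof (cases "snd b = 0")
        case True
        then have "fst b \<in> Basis" using \<open>b \<in> Basis\<close> by (auto elim: Basis_prod_cases)
        then show ?thesis using True Suc.IH[OF smooth_D_dir[OF Suc.prems]] by (simp add: D snd_weight_def[of b])
      next
        case False
        then have "fst b = 0" using \<open>b \<in> Basis\<close> by (auto elim: Basis_prod_cases)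
        then show ?thesis unfolding D by (simp add: case_prod_unfold)
      qed
    qed
    moreover have "(\<lambda>(x, \<theta>::'b). r x) differentiable_on UNIV"
    proof -
      have "smooth (\<lambda>p::'a \<times> 'b. r (fst p))" using Suc.prems bounded_linear_fst by (rule smooth_linear)
      then show ?thesis by (simp add: case_prod_unfold smooth_differentiable_on)
    qed
    ultimately show ?case using sb[OF Suc.prems] by simp
  qed (auto intro: sb)
  with assms show ?thesis by (simp add: symbols_iff)
qed

lemma foldr_D_dir_cong_open:
  assumes "open U" "\<And>x. x \<in> U \<Longrightarrow> f x = g x" "x \<in> U"
  shows "foldr D_dir bs f x = foldr D_dir bs g x"
  using assms(3)
proof (induction bs arbitrary: x)
  case (Cons b bs)
  have "\<forall>\<^sub>F y in nhds x. foldr D_dir bs f y = foldr D_dir bs g y"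
    using assms(1) Cons eventually_nhds by blast
  then show ?case by (simp add: D_dir_cong_ev)
qed (use assms in auto)

text \<open>Both differentiability and the estimates over a compact set involve a function only near
  that set. A function that is pieced together from different symbols over growing balls is thereby
  a symbol.\<close>

lemma symbols_local:
  assumes "\<And>k::nat. \<exists>b\<in>symbols m. \<forall>x\<in>ball 0 (real k). \<forall>\<theta>. a (x, \<theta>) = b (x, \<theta>)"
  shows "a \<in> symbols m"
  unfolding symbols_iff graded_diff_iff
proof (intro allI impI conjI)
  fix bs :: "('a \<times> 'b) list" assume bs: "set bs \<subseteq> Basis"
  have op: "open (ball 0 (real k) \<times> UNIV)" for k by (intro open_Times) auto
  have eq: "\<exists>b\<in>symbols m. \<forall>z\<in>ball 0 (real k) \<times> UNIV. foldr D_dir bs a z = foldr D_dir bs b z" for k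
  proof -
    obtain b where b: "b \<in> symbols m" "\<And>x \<theta>. x \<in> ball 0 (real k) \<Longrightarrow> a (x, \<theta>) = b (x, \<theta>)"
      using assms by blast
    have "foldr D_dir bs a z = foldr D_dir bs b z" if "z \<in> ball 0 (real k) \<times> UNIV" for z
      using b(2) by (intro foldr_D_dir_cong_open[OF op _ that]) auto
    with b(1) show ?thesis by blast
  qed
  show "foldr D_dir bs a differentiable_on UNIV"
    unfolding differentiable_on_UNIV
  proof
    fix z :: "'a \<times> 'b"
    obtain k where k: "norm (fst z) < real k" using reals_Archimedean2 by blast
    obtain b where b: "b \<in> symbols m" "\<And>z. z \<in> ball 0 (real k) \<times> UNIV \<Longrightarrow> foldr D_dir bs a z = foldr D_dir bs b z"
      using eq by blast
    have "foldr D_dir bs b differentiable at z"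
      using b(1) bs by (intro smooth_differentiable smooth_foldr_D_dir symbols_smooth)
    then obtain F where F: "(foldr D_dir bs b has_derivative F) (at z)"
      by (auto simp: differentiable_def)
    have "z \<in> ball 0 (real k) \<times> UNIV" using k by (simp add: mem_Times_iff)
    with F have "(foldr D_dir bs a has_derivative F) (at z)"
      by (rule has_derivative_transform_within_open[OF _ op]) (simp add: b(2))
    then show "foldr D_dir bs a differentiable at z"
      by (auto simp: differentiable_def)
  qed
  show "symbol_bound (m - sum_list (map snd_weight bs)) (foldr D_dir bs a)"
  proof (rule symbol_boundI)
    fix K :: "'a set" assume K: "compact K"
    obtain k where k: "K \<subseteq> ball 0 (real k)"
      using compact_imp_bounded[OF K] unfolding bounded_iff
      by (metis (no_types, lifting) mem_ball_0 order.strict_trans1 reals_Archimedean2 subsetI)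
    obtain b where b: "b \<in> symbols m" "\<And>z. z \<in> ball 0 (real k) \<times> UNIV \<Longrightarrow> foldr D_dir bs a z = foldr D_dir bs b z"
      using eq by blast
    obtain C where "\<And>x \<theta>. x \<in> K \<Longrightarrow> norm (foldr D_dir bs b (x, \<theta>)) \<le> C * japanese \<theta> powr (m - sum_list (map snd_weight bs))"
      using symbol_boundE[OF symbols_bound[OF symbols_foldr_D_dir[OF b(1) bs]] K] by metis
    then show "\<exists>C. \<forall>x\<in>K. \<forall>\<theta>. norm (foldr D_dir bs a (x, \<theta>)) \<le> C * japanese \<theta> powr (m - sum_list (map snd_weight bs))"
      using b(2) k by (intro exI[of _ C]) (auto simp: mem_Times_iff subset_iff)
  qed
qed

section \<open>Fourier transform of test functions\<close>

lemma cis_measurable [measurable]: "cis \<in> borel_measurable borel"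
  by (intro borel_measurable_continuous_onI continuous_intros)

lemma D_dir_cis: "D_dir b (\<lambda>x. cis (x \<bullet> \<xi>)) = (\<lambda>x. (b \<bullet> \<xi>) * cis (x \<bullet> \<xi>))"
  unfolding cis_conv_exp by (rule D_dir_exp_ii)

lemma smooth_cis: "smooth (\<lambda>x. cis (x \<bullet> \<xi>))"
  unfolding cis_conv_exp by (rule smooth_exp_ii)

lemma cis_sum: "finite I \<Longrightarrow> cis (\<Sum>i\<in>I. f i) = (\<Prod>i\<in>I. cis (f i))"
  by (induction I rule: finite_induct) (auto simp: cis_mult[symmetric])

lemma test_functionsI:
  fixes f :: "'a::euclidean_space \<Rightarrow> complex"
  assumes "smooth f" "compact B" "\<And>x. x \<notin> B \<Longrightarrow> f x = 0"
  shows "f \<in> test_functions" "supp f \<subseteq> B"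
proof -
  show "supp f \<subseteq> B"
    unfolding supp_def using assms(3) compact_imp_closed[OF assms(2)] by (intro closure_minimal) auto
  moreover have "closed (supp f)" by (simp add: supp_def)
  ultimately show "f \<in> test_functions"
    using assms(1,2) compact_Int_closed[of B "supp f"] by (simp add: test_functions_def inf.absorb2)
qed

lemma test_functionsE:
  fixes f :: "'a::euclidean_space \<Rightarrow> complex"
  assumes "f \<in> test_functions"
  obtains R where "R > 0" "smooth f" "\<And>x. x \<notin> cball 0 R \<Longrightarrow> f x = 0"
proof -
  have "bounded (supp f)" using assms by (simp add: test_functions_def compact_imp_bounded)
  then obtain R where R: "R > 0" "\<And>x. x \<in> supp f \<Longrightarrow> norm x \<le> R" by (auto simp: bounded_pos)
  have "f x = 0" if "x \<notin> cball 0 R" for x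
    using that R(2)[of x] closure_subset[of "{x. f x \<noteq> 0}"] by (auto simp: supp_def)
  then show ?thesis using R that assms by (simp add: test_functions_def)
qed

lemma test_functions_smooth: "f \<in> test_functions \<Longrightarrow> smooth f"
  by (simp add: test_functions_def)

lemma D_dir_vanish:
  assumes "closed B" "\<And>x. x \<notin> B \<Longrightarrow> f x = 0" "x \<notin> B"
  shows "D_dir b f x = 0"
proof -
  have "\<forall>\<^sub>F y in nhds x. f y = (\<lambda>y. 0) y"
    unfolding eventually_nhds using assms by (intro exI[of _ "- B"]) auto
  then show ?thesis using D_dir_cong_ev[of f "\<lambda>y. 0" x b] by simp
qed

lemma integrable_compact_support:
  fixes f :: "'a::euclidean_space \<Rightarrow> complex"
  assumes "continuous_on UNIV f" "compact B" "\<And>x. x \<notin> B \<Longrightarrow> f x = 0"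
  shows "integrable lborel f"
proof -
  have "integrable lborel (\<lambda>x. indicat_real B x *\<^sub>R f x)"
    using assms continuous_on_subset[OF assms(1)] by (intro borel_integrable_compact) auto
  moreover have "(\<lambda>x. indicat_real B x *\<^sub>R f x) = f"
    using assms(3) by (auto simp: indicator_def)
  ultimately show ?thesis by simp
qed

lemma test_functions_integrable:
  fixes f :: "'a::euclidean_space \<Rightarrow> complex"
  assumes "f \<in> test_functions"
  shows "integrable lborel f"
proof -
  obtain R where R: "R > 0" "smooth f" "\<And>x. x \<notin> cball 0 R \<Longrightarrow> f x = 0"
    using test_functionsE[OF assms] by metis
  show ?thesis
    by (rule integrable_compact_support[OF smooth_continuous_on[OF R(2)] compact_cball R(3)])
qed

lemma test_functions_D_dir:
  fixes f :: "'a::euclidean_space \<Rightarrow> complex"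
  assumes "f \<in> test_functions" "b \<in> Basis"
  shows "D_dir b f \<in> test_functions"
proof -
  obtain R where R: "R > 0" "smooth f" "\<And>x. x \<notin> cball 0 R \<Longrightarrow> f x = 0"
    using test_functionsE[OF assms(1)] by metis
  have "\<And>x. x \<notin> cball 0 R \<Longrightarrow> D_dir b f x = 0"
    by (rule D_dir_vanish[OF closed_cball R(3)])
  then show ?thesis
    using R assms(2) by (intro test_functionsI[of _ "cball 0 R"] smooth_D_dir) auto
qed

lemma test_functions_funpow_D_dir:
  "f \<in> test_functions \<Longrightarrow> b \<in> Basis \<Longrightarrow> (D_dir b ^^ k) f \<in> test_functions"
  by (induction k) (auto intro: test_functions_D_dir)

lemma test_functions_mult:
  fixes f g :: "'a::euclidean_space \<Rightarrow> complex"
  assumes "f \<in> test_functions" "smooth g"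
  shows "(\<lambda>x. g x * f x) \<in> test_functions"
proof -
  obtain R where R: "R > 0" "smooth f" "\<And>x. x \<notin> cball 0 R \<Longrightarrow> f x = 0"
    using test_functionsE[OF assms(1)] by metis
  then show ?thesis
    using assms(2) by (intro test_functionsI[of _ "cball 0 R"] smooth_mult) auto
qed

lemma test_functions_bounded:
  fixes f :: "'a::euclidean_space \<Rightarrow> complex"
  assumes "f \<in> test_functions"
  obtains M where "M \<ge> 0" "\<And>x. norm (f x) \<le> M"
proof -
  obtain R where R: "R > 0" "smooth f" "\<And>x. x \<notin> cball 0 R \<Longrightarrow> f x = 0"
    using test_functionsE[OF assms] by metis
  have "compact (f ` cball 0 R)"
    using R(2) by (intro compact_continuous_image smooth_continuous_on) auto
  then obtain M where "\<And>x. x \<in> cball 0 R \<Longrightarrow> norm (f x) \<le> M"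
    using compact_imp_bounded bounded_iff by (metis image_eqI)
  then have "norm (f x) \<le> \<bar>M\<bar>" for x
    using R(3)[of x] by (cases "x \<in> cball 0 R") fastforce+
  then show ?thesis using that[of "\<bar>M\<bar>"] by auto
qed

section \<open>Changes of variables, differentiation under the integral, integrability\<close>

lemma integral_translate:
  fixes f :: "'a::euclidean_space \<Rightarrow> 'b::{banach, second_countable_topology}"
  assumes "f \<in> borel_measurable borel"
  shows "(LINT x|lborel. f (c + x)) = (LINT x|lborel. f x)"
proof -
  have "(LINT x|lborel. f x) = (LINT x|distr lborel borel ((+) c). f x)"
    by (simp add: lborel_distr_plus)
  also have "\<dots> = (LINT x|lborel. f (c + x))"
    using assms by (subst integral_distr) auto
  finally show ?thesis by simp
qed

lemma integrable_translate:
  fixes f :: "'a::euclidean_space \<Rightarrow> 'b::{banach, second_countable_topology}"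
  assumes "integrable lborel f"
  shows "integrable lborel (\<lambda>x. f (c + x))"
proof -
  have "integrable (distr lborel borel ((+) c)) f" using assms by (simp add: lborel_distr_plus)
  then show ?thesis using assms by (subst (asm) integrable_distr_eq) auto
qed

lemma integral_scale:
  fixes f :: "'a::euclidean_space \<Rightarrow> complex"
  assumes "f \<in> borel_measurable borel" "c > 0"
  shows "(LINT x|lborel. f x) = c ^ DIM('a) * (LINT x|lborel. f (c *\<^sub>R x))"
proof -
  have "(LINT x|lborel. f x) = (LINT x|density (distr lborel borel (\<lambda>x::'a. 0 + c *\<^sub>R x)) (\<lambda>_. ennreal (\<bar>c\<bar> ^ DIM('a))). f x)"
    using lborel_affine[of c "0::'a"] assms(2) by simp
  also have "\<dots> = (LINT x|distr lborel borel (\<lambda>x::'a. 0 + c *\<^sub>R x). (c ^ DIM('a)) *\<^sub>R f x)"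
    using assms by (subst integral_density) auto
  also have "\<dots> = (LINT x|lborel. (c ^ DIM('a)) *\<^sub>R f (c *\<^sub>R x))"
    using assms by (subst integral_distr) auto
  finally show ?thesis by (simp add: scaleR_conv_of_real)
qed

text \<open>Mean value inequality; the dimension appears because the derivative is bounded by
  summing the bounds of the partial derivatives over the coordinates.\<close>

lemma DUI_bound:
  fixes f :: "'a::euclidean_space \<Rightarrow> complex"
  assumes "f differentiable_on UNIV"
    and bd: "\<And>b x. b \<in> Basis \<Longrightarrow> x \<in> ball x0 e \<Longrightarrow> norm (D_dir b f x) \<le> g"
    and h: "norm h < e"
  shows "norm (f (x0 + h) - f x0) \<le> (real DIM('a) * g) * norm h"
proof -
  have "norm (f (x0 + h) - f x0) \<le> (real DIM('a) * g) * norm ((x0 + h) - x0)"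
  proof (rule differentiable_bound[where S = "ball x0 e"])
    fix x assume x: "x \<in> ball x0 e"
    show "(f has_derivative (\<lambda>h. \<Sum>b\<in>Basis. (h \<bullet> b) *\<^sub>R (\<i> * D_dir b f x))) (at x within ball x0 e)"
      by (rule has_derivative_at_withinI[OF has_derivative_D_dir]) (use assms(1) in \<open>simp add: differentiable_on_UNIV\<close>)
    have "norm (\<Sum>b\<in>Basis. (h \<bullet> b) *\<^sub>R (\<i> * D_dir b f x)) \<le> (real DIM('a) * g) * norm h" for h
    proof -
      have "norm (\<Sum>b\<in>Basis. (h \<bullet> b) *\<^sub>R (\<i> * D_dir b f x)) \<le> (\<Sum>b\<in>(Basis::'a set). norm h * g)"
      proof (rule sum_norm_le)
        fix b :: 'a assume "b \<in> Basis"
        then show "norm ((h \<bullet> b) *\<^sub>R (\<i> * D_dir b f x)) \<le> norm h * g"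
          using bd[OF _ x] by (auto simp: norm_mult intro!: mult_mono Basis_le_norm)
      qed
      then show ?thesis by (simp add: mult_ac)
    qed
    then show "onorm (\<lambda>h. \<Sum>b\<in>Basis. (h \<bullet> b) *\<^sub>R (\<i> * D_dir b f x)) \<le> real DIM('a) * g"
      by (rule onorm_le)
  qed (use h in \<open>auto simp: dist_norm intro: le_less_trans[OF norm_ge_zero]\<close>)
  then show ?thesis by simp
qed

text \<open>Total differentiability is proved at once. The first-order remainder divided by the norm
  of the increment tends to 0 pointwise and is dominated by twice the dimension times
  \<open>g\<close>: one half bounds the increment of the integrand by the mean value inequality, the
  other its linear part. Dominated convergence along arbitrary null sequences concludes.\<close>

lemma D_dir_integral:
  fixes f :: "'a::euclidean_space \<Rightarrow> 'b \<Rightarrow> complex"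
  assumes e: "e > 0" and int: "\<And>x. integrable M (f x)"
    and diff: "\<And>t. (\<lambda>x. f x t) differentiable_on UNIV"
    and bd: "\<And>b x t. b \<in> Basis \<Longrightarrow> x \<in> ball x0 e \<Longrightarrow> norm (D_dir b (\<lambda>x. f x t) x) \<le> g t"
    and g: "integrable M g"
  shows "(\<lambda>x. LINT t|M. f x t) differentiable (at x0)"
    and "b \<in> Basis \<Longrightarrow> D_dir b (\<lambda>x. LINT t|M. f x t) x0 = (LINT t|M. D_dir b (\<lambda>x. f x t) x0)"
proof -
  define d where "d b t = \<i> * D_dir b (\<lambda>x. f x t) x0" for b t
  define L where "L h t = (\<Sum>b\<in>Basis. (h \<bullet> b) *\<^sub>R d b t)" for h t
  have fd: "((\<lambda>x. f x t) has_derivative (\<lambda>h. L h t)) (at x0)" for t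
    unfolding L_def d_def using diff by (intro has_derivative_D_dir) (simp add: differentiable_on_UNIV)
  have q0: "(\<lambda>n. norm (f (x0 + S n) t - f x0 t - L (S n) t) / norm (S n)) \<longlonglongrightarrow> 0"
    if "\<And>n. S n \<noteq> 0" "S \<longlonglongrightarrow> 0" for S t
    using fd[of t] that unfolding has_derivative_at LIMSEQ_SEQ_conv[symmetric] by blast
  have Lb: "L b t = d b t" if "b \<in> Basis" for b t
    using that by (simp add: L_def inner_Basis if_distrib[of "\<lambda>x. x *\<^sub>R _"] cong: if_cong)
  have Lscale: "L (c *\<^sub>R h) t = c *\<^sub>R L h t" for c h t
    by (simp add: L_def scaleR_sum_right)
  have dbd: "norm (d b t) \<le> g t" if "b \<in> Basis" for b t
    using bd[OF that, of x0 t] e by (simp add: d_def norm_mult)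
  \<comment> \<open>Measurability of the partial derivatives in the integration variable comes from
    writing them as limits of difference quotients with step 1/(n + 1).\<close>
  have meas: "d b \<in> borel_measurable M" if b: "b \<in> Basis" for b
  proof (rule borel_measurable_LIMSEQ_metric)
    let ?h = "\<lambda>n. (1 / real (Suc n)) *\<^sub>R b"
    show "(\<lambda>t. real (Suc n) *\<^sub>R (f (x0 + ?h n) t - f x0 t)) \<in> borel_measurable M" for n
      using int by measurable
    fix t assume "t \<in> space M"
    have "(\<lambda>n. 1 / real (Suc n)) \<longlonglongrightarrow> 0"
      using LIMSEQ_inverse_real_of_nat by (simp add: inverse_eq_divide)
    then have "?h \<longlonglongrightarrow> 0 *\<^sub>R b"
      by (intro tendsto_intros)
    then have "(\<lambda>n. norm (f (x0 + ?h n) t - f x0 t - L (?h n) t) / norm (?h n)) \<longlonglongrightarrow> 0"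
      using b by (intro q0) (auto simp: nonzero_Basis)
    moreover have "norm (f (x0 + ?h n) t - f x0 t - L (?h n) t) / norm (?h n)
        = norm (real (Suc n) *\<^sub>R (f (x0 + ?h n) t - f x0 t) - d b t)" for n
    proof -
      have "real (Suc n) *\<^sub>R (f (x0 + ?h n) t - f x0 t) - d b t = real (Suc n) *\<^sub>R (f (x0 + ?h n) t - f x0 t - L (?h n) t)"
        using b by (simp add: Lscale Lb scaleR_diff_right)
      then have "norm (real (Suc n) *\<^sub>R (f (x0 + ?h n) t - f x0 t) - d b t) = real (Suc n) * norm (f (x0 + ?h n) t - f x0 t - L (?h n) t)"
        by simp
      then show ?thesis using b by (simp add: mult.commute)
    qed
    ultimately have "(\<lambda>n. norm (real (Suc n) *\<^sub>R (f (x0 + ?h n) t - f x0 t) - d b t)) \<longlonglongrightarrow> 0" by simp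
    then show "(\<lambda>n. real (Suc n) *\<^sub>R (f (x0 + ?h n) t - f x0 t)) \<longlonglongrightarrow> d b t"
      by (simp only: tendsto_norm_zero_iff LIM_zero_iff)
  qed
  have dint: "integrable M (d b)" if "b \<in> Basis" for b
    using meas[OF that] dbd[OF that] by (intro Bochner_Integration.integrable_bound[OF g])
      (auto intro!: AE_I2 order.trans[OF _ abs_ge_self])
  have Lint: "integrable M (L h)" for h
    unfolding L_def by (intro Bochner_Integration.integrable_sum integrable_scaleR_right dint)
  have Lbd: "norm (L h t) \<le> DIM('a) * g t * norm h" for h t
  proof -
    have "norm (L h t) \<le> (\<Sum>b\<in>(Basis::'a set). norm h * g t)"
      unfolding L_def
    proof (rule sum_norm_le)
      fix b :: 'a assume "b \<in> Basis"
      then show "norm ((h \<bullet> b) *\<^sub>R d b t) \<le> norm h * g t"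
        using dbd by (auto intro!: mult_mono Basis_le_norm)
    qed
    then show ?thesis by (simp add: mult_ac)
  qed
  have main: "((\<lambda>x. LINT t|M. f x t) has_derivative (\<lambda>h. LINT t|M. L h t)) (at x0)"
    unfolding has_derivative_at LIMSEQ_SEQ_conv[symmetric]
  proof (intro conjI allI impI)
    have "(LINT t|M. L h t) = (\<Sum>b\<in>Basis. (h \<bullet> b) *\<^sub>R (LINT t|M. d b t))" for h
      unfolding L_def using dint by (simp add: Bochner_Integration.integral_sum)
    then show "bounded_linear (\<lambda>h. LINT t|M. L h t)"
      by (auto intro!: bounded_linear_sum bounded_linear_compose[OF bounded_linear_scaleR_left] bounded_linear_inner_left)
    fix S :: "nat \<Rightarrow> 'a" assume S: "(\<forall>n. S n \<noteq> 0) \<and> S \<longlonglongrightarrow> 0"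
    then have "(\<lambda>n. norm (S n)) \<longlonglongrightarrow> 0" by (simp add: tendsto_norm_zero)
    then have "\<forall>\<^sub>F n in sequentially. norm (S n) < e"
      using e by (rule order_tendstoD(2))
    then obtain N where N: "\<And>n. n \<ge> N \<Longrightarrow> norm (S n) < e"
      by (auto simp: eventually_sequentially)
    \<comment> \<open>Domination is required at every index, so the sequence is shifted past
      \<open>N\<close>, after which the increments stay inside the ball of radius
      \<open>e\<close>.\<close>
    define q where "q n t = inverse (norm (S (n + N))) *\<^sub>R (f (x0 + S (n + N)) t - f x0 t - L (S (n + N)) t)" for n t
    have "(\<lambda>n. LINT t|M. q n t) \<longlonglongrightarrow> (LINT t|M. 0)"
    proof (rule integral_dominated_convergence[where w = "\<lambda>t. 2 * DIM('a) * g t"])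
      show "AE t in M. (\<lambda>n. q n t) \<longlonglongrightarrow> 0"
      proof (rule AE_I2)
        fix t
        have "(\<lambda>n. norm (f (x0 + S n) t - f x0 t - L (S n) t) / norm (S n)) \<longlonglongrightarrow> 0"
          by (rule q0) (use S in auto)
        from LIMSEQ_ignore_initial_segment[OF this, of N]
        have "(\<lambda>n. norm (q n t)) \<longlonglongrightarrow> 0"
          by (simp add: q_def divide_inverse mult.commute)
        then show "(\<lambda>n. q n t) \<longlonglongrightarrow> 0" by (simp only: tendsto_norm_zero_iff)
      qed
      show "AE t in M. norm (q n t) \<le> 2 * DIM('a) * g t" for n
      proof (rule AE_I2)
        fix t
        let ?h = "S (n + N)"
        have "norm (f (x0 + ?h) t - f x0 t) \<le> DIM('a) * g t * norm ?h"
          by (rule DUI_bound[where e = e and f = "\<lambda>x. f x t", OF diff]) (use bd N in auto)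
        then have "norm (f (x0 + ?h) t - f x0 t - L ?h t) \<le> 2 * DIM('a) * g t * norm ?h"
          using Lbd[of ?h t] norm_triangle_ineq4[of "f (x0 + ?h) t - f x0 t" "L ?h t"] by linarith
        moreover have "norm ?h > 0" using S by simp
        ultimately show "norm (q n t) \<le> 2 * DIM('a) * g t"
          by (simp add: q_def divide_inverse[symmetric] pos_divide_le_eq mult.commute[of "inverse _"])
      qed
      show "q n \<in> borel_measurable M" for n
        unfolding q_def using int Lint by (intro borel_measurable_integrable Bochner_Integration.integrable_diff integrable_scaleR_right)
    qed (use g in auto)
    then have "(\<lambda>n. norm (LINT t|M. q n t)) \<longlonglongrightarrow> 0" by (simp add: tendsto_norm_zero)
    moreover have "norm (LINT t|M. q n t) = norm ((LINT t|M. f (x0 + S (n + N)) t) - (LINT t|M. f x0 t) - (LINT t|M. L (S (n + N)) t)) / norm (S (n + N))" for n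
      unfolding q_def using int Lint by (simp add: Bochner_Integration.integral_diff divide_inverse mult.commute)
    ultimately have "(\<lambda>n. norm ((LINT t|M. f (x0 + S (n + N)) t) - (LINT t|M. f x0 t) - (LINT t|M. L (S (n + N)) t)) / norm (S (n + N))) \<longlonglongrightarrow> 0"
      by simp
    then show "(\<lambda>n. norm ((LINT t|M. f (x0 + S n) t) - (LINT t|M. f x0 t) - (LINT t|M. L (S n) t)) / norm (S n)) \<longlonglongrightarrow> 0"
      by (rule LIMSEQ_offset)
  qed
  then show "(\<lambda>x. LINT t|M. f x t) differentiable (at x0)"
    by (auto simp: differentiable_def)
  show "D_dir b (\<lambda>x. LINT t|M. f x t) x0 = (LINT t|M. D_dir b (\<lambda>x. f x t) x0)" if "b \<in> Basis"
  proof -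
    have "L b = (\<lambda>t. \<i> * D_dir b (\<lambda>x. f x t) x0)" using Lb[OF that] by (auto simp: d_def)
    then show ?thesis unfolding D_dir_eqI[OF main] by (simp add: mult.assoc[symmetric])
  qed
qed

text \<open>Lebesgue measure is the image of the product of one-dimensional Lebesgue measures under
  the coordinate map, so the integral of a product of functions of single coordinates
  factors.\<close>

lemma prod_Basis_integral:
  fixes f :: "'a::euclidean_space \<Rightarrow> real \<Rightarrow> 'b::{real_normed_field,banach,second_countable_topology}"
  assumes int: "\<And>b. b \<in> Basis \<Longrightarrow> integrable lborel (f b)"
  shows "integrable lborel (\<lambda>x::'a. \<Prod>b\<in>Basis. f b (x \<bullet> b))"
    and "(LINT x|lborel. (\<Prod>b\<in>Basis. f b (x \<bullet> b))) = (\<Prod>b\<in>Basis. (LINT t|lborel. f b t))"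
proof -
  interpret product_sigma_finite "\<lambda>_::'a. lborel :: real measure" by standard
  have fm: "f b \<in> borel_measurable borel" if "b \<in> Basis" for b
    using borel_measurable_integrable[OF int[OF that]] by simp
  have m1: "(\<lambda>g. \<Sum>b\<in>Basis. g b *\<^sub>R b) \<in> measurable (\<Pi>\<^sub>M b\<in>(Basis::'a set). lborel) borel"
    by measurable
  have m2: "(\<lambda>x::'a. \<Prod>b\<in>Basis. f b (x \<bullet> b)) \<in> borel_measurable borel"
    by (intro borel_measurable_prod measurable_compose[OF _ fm]) auto
  have eq: "(\<Prod>b\<in>Basis. f b ((\<Sum>b'\<in>Basis. g b' *\<^sub>R b') \<bullet> b)) = (\<Prod>b\<in>Basis. f b (g b))" for g :: "'a \<Rightarrow> real"
    by (intro prod.cong refl) (simp add: inner_sum_left inner_Basis if_distrib cong: if_cong)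
  have "integrable (\<Pi>\<^sub>M b\<in>(Basis::'a set). lborel) (\<lambda>g. \<Prod>b\<in>Basis. f b (g b))"
    using int by (intro product_integrable_prod) auto
  then show "integrable lborel (\<lambda>x::'a. \<Prod>b\<in>Basis. f b (x \<bullet> b))"
    using m1 m2 by (subst lborel_eq) (simp add: integrable_distr_eq eq)
  show "(LINT x|lborel. (\<Prod>b\<in>Basis. f b (x \<bullet> b))) = (\<Prod>b\<in>Basis. (LINT t|lborel. f b t))"
    using m1 m2 int by (subst lborel_eq) (simp add: integral_distr eq product_integral_prod)
qed

lemma japanese_continuous_on [continuous_intros]:
  "continuous_on S f \<Longrightarrow> continuous_on S (\<lambda>x. japanese (f x))"
  unfolding japanese_def by (intro continuous_intros)

lemma japanese_measurable [measurable]: "japanese \<in> borel_measurable borel"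
  by (intro borel_measurable_continuous_onI continuous_intros)

text \<open>The square of \<open>japanese \<zeta>\<close> dominates every factor 1 + (\<zeta>
  \<bullet> b)^2, so the weight of order -2 DIM is dominated by a product of one-dimensional
  functions 1/(1 + t^2). This convenient exponent is the one that all later dominations by an
  integrable weight aim at.\<close>

lemma integrable_japanese:
  fixes s :: real
  assumes "s \<ge> 2 * real DIM('a::euclidean_space)"
  shows "integrable lborel (\<lambda>\<zeta>::'a::euclidean_space. japanese \<zeta> powr (- s))"
proof (rule Bochner_Integration.integrable_bound)
  have "integrable lborel (\<lambda>x::real. inverse (1 + x\<^sup>2))"
    using integrable_inverse_1_plus_square by (simp add: set_integrable_def einterval_def)
  then show "integrable lborel (\<lambda>\<zeta>::'a. \<Prod>b\<in>Basis. inverse (1 + (\<zeta> \<bullet> b)\<^sup>2))"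
    using prod_Basis_integral(1)[where f = "\<lambda>_ x. inverse (1 + x\<^sup>2)" and 'a = 'a] by blast
  show "(\<lambda>\<zeta>::'a. japanese \<zeta> powr (- s)) \<in> borel_measurable lborel" by simp
  show "AE \<zeta>::'a in lborel. norm (japanese \<zeta> powr (- s)) \<le> norm (\<Prod>b\<in>Basis. inverse (1 + (\<zeta> \<bullet> b)\<^sup>2))"
  proof (rule AE_I2)
    fix \<zeta> :: 'a
    have "(\<Prod>b\<in>(Basis::'a set). 1 + (\<zeta> \<bullet> b)\<^sup>2) \<le> (\<Prod>b\<in>(Basis::'a set). (japanese \<zeta>)\<^sup>2)"
    proof (rule prod_mono)
      fix b :: 'a assume "b \<in> Basis"
      from Basis_le_norm[OF this, of \<zeta>] have "(\<zeta> \<bullet> b)\<^sup>2 \<le> (norm \<zeta>)\<^sup>2"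
        by (metis abs_le_square_iff abs_norm_cancel)
      then show "0 \<le> 1 + (\<zeta> \<bullet> b)\<^sup>2 \<and> 1 + (\<zeta> \<bullet> b)\<^sup>2 \<le> (japanese \<zeta>)\<^sup>2"
        by (simp add: japanese_def)
    qed
    also have "\<dots> = japanese \<zeta> powr (2 * real DIM('a))"
    proof -
      have "japanese \<zeta> powr (2 * real DIM('a)) = japanese \<zeta> powr real (2 * DIM('a))" by simp
      also have "\<dots> = japanese \<zeta> ^ (2 * DIM('a))" by (rule powr_realpow) simp
      finally show ?thesis by (simp add: power_mult)
    qed
    also have "\<dots> \<le> japanese \<zeta> powr s"
      using assms japanese_ge_1[of \<zeta>] by (intro powr_mono) auto
    finally have "inverse (japanese \<zeta> powr s) \<le> inverse (\<Prod>b\<in>(Basis::'a set). 1 + (\<zeta> \<bullet> b)\<^sup>2)"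
      by (intro le_imp_inverse_le prod_pos) (auto intro: add_pos_nonneg)
    moreover have "0 \<le> (\<Prod>b\<in>(Basis::'a set). inverse (1 + (\<zeta> \<bullet> b)\<^sup>2))"
      by (intro prod_nonneg) auto
    ultimately show "norm (japanese \<zeta> powr (- s)) \<le> norm (\<Prod>b\<in>(Basis::'a set). inverse (1 + (\<zeta> \<bullet> b)\<^sup>2))"
      using prod_inversef[of "\<lambda>b. 1 + (\<zeta> \<bullet> b)\<^sup>2" "Basis :: 'a set"] by (simp add: powr_minus o_def)
  qed
qed


section \<open>Decay of the Fourier transform\<close>

definition fourier :: "('a::euclidean_space \<Rightarrow> complex) \<Rightarrow> 'a \<Rightarrow> complex" where
  "fourier f \<zeta> = (LINT y|lborel. cis (- (y \<bullet> \<zeta>)) * f y)"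

lemma norm_fourier_le: "norm (fourier f \<zeta>) \<le> (LINT y|lborel. norm (f y))"
  unfolding fourier_def
  using integral_norm_bound[of lborel "\<lambda>y. cis (- (y \<bullet> \<zeta>)) * f y"] by (simp add: norm_mult)

lemma integrable_cis_mult:
  fixes f :: "'a::euclidean_space \<Rightarrow> complex"
  assumes "integrable lborel f" "g \<in> borel_measurable borel"
  shows "integrable lborel (\<lambda>y. cis (g y) * f y)"
  using assms borel_measurable_integrable[OF assms(1)]
  by (intro Bochner_Integration.integrable_bound[OF assms(1)] borel_measurable_times)
    (auto simp: norm_mult)

text \<open>Integration by parts is replaced by translation: the integral of exp(-i<z,\<zeta>>) f(x
  + z) over z equals exp(i<x,\<zeta>>) times the transform of f, and both expressions are
  differentiated at x = 0.\<close>

lemma fourier_D_dir: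
  fixes f :: "'a::euclidean_space \<Rightarrow> complex"
  assumes f: "f \<in> test_functions" and b: "b \<in> Basis"
  shows "fourier (D_dir b f) \<zeta> = (\<zeta> \<bullet> b) * fourier f \<zeta>"
proof -
  obtain R where R: "R > 0" "smooth f" "\<And>x. x \<notin> cball 0 R \<Longrightarrow> f x = 0"
    using test_functionsE[OF f] by metis
  define F where "F x z = cis (- (z \<bullet> \<zeta>)) * f (x + z)" for x z :: 'a
  have tr: "smooth (\<lambda>x. f (x + z))" for z
    using smooth_affine[OF R(2) bounded_linear_ident] .
  have DF: "D_dir c (\<lambda>x. F x z) = (\<lambda>x. cis (- (z \<bullet> \<zeta>)) * D_dir c f (x + z))" for c z
  proof -
    have "D_dir c (\<lambda>x. f (x + z)) = (\<lambda>x. D_dir c f (x + z))"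
      by (simp add: fun_eq_iff D_dir_translate)
    then show ?thesis
      unfolding F_def using D_dir_cmult[OF smooth_differentiable_on[OF tr[of z]]] by simp
  qed
  have "\<exists>M. \<forall>c\<in>(Basis::'a set). \<forall>x. norm (D_dir c f x) \<le> M"
  proof -
    have "\<exists>M. \<forall>x. norm (D_dir c f x) \<le> M" if "c \<in> Basis" for c
      using test_functions_bounded[OF test_functions_D_dir[OF f that]] by metis
    then obtain M where M: "\<And>c x. c \<in> Basis \<Longrightarrow> norm (D_dir c f x) \<le> M c" by metis
    have "norm (D_dir c f x) \<le> (\<Sum>c\<in>Basis. \<bar>M c\<bar>)" if "c \<in> Basis" for c x
      using M[OF that, of x] member_le_sum[of c Basis "\<lambda>c. \<bar>M c\<bar>"] that by force
    then show ?thesis by blast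
  qed
  then obtain M where M: "\<And>c x. c \<in> Basis \<Longrightarrow> norm (D_dir c f x) \<le> M" by blast
  have int: "integrable lborel (F x)" for x
    unfolding F_def by (intro integrable_cis_mult integrable_translate test_functions_integrable f) simp
  have V: "(LINT z|lborel. F x z) = cis (x \<bullet> \<zeta>) * fourier f \<zeta>" for x
  proof -
    have "(LINT z|lborel. F x z) = (LINT z|lborel. (\<lambda>y. cis (- ((y - x) \<bullet> \<zeta>)) * f y) (x + z))"
      by (simp add: F_def)
    also have "\<dots> = (LINT y|lborel. cis (- ((y - x) \<bullet> \<zeta>)) * f y)"
      using smooth_measurable[OF R(2)] by (intro integral_translate) simp
    also have "\<dots> = (LINT y|lborel. cis (x \<bullet> \<zeta>) * (cis (- (y \<bullet> \<zeta>)) * f y))"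
      by (intro Bochner_Integration.integral_cong refl) (simp add: cis_mult inner_diff_left mult.assoc[symmetric])
    finally show ?thesis by (simp add: fourier_def)
  qed
  have "D_dir b (\<lambda>x. LINT z|lborel. F x z) 0 = (LINT z|lborel. D_dir b (\<lambda>x. F x z) 0)"
  \<comment> \<open>For x in the unit ball, f(x + z) vanishes once z leaves the ball of radius R +
    1, so a constant on that ball dominates.\<close>
  proof (rule D_dir_integral(2)[of 1 lborel F 0 "\<lambda>z. indicat_real (cball 0 (R + 1)) z *\<^sub>R M", OF _ int])
    show "(\<lambda>x. F x z) differentiable_on UNIV" for z
      unfolding F_def using smooth_differentiable_on[OF smooth_cmult[OF tr]] by simp
    show "norm (D_dir c (\<lambda>x. F x z) x) \<le> indicat_real (cball 0 (R + 1)) z *\<^sub>R M"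
      if "c \<in> Basis" "x \<in> ball 0 1" for c x z
    proof (cases "z \<in> cball 0 (R + 1)")
      case True then show ?thesis using M[OF that(1)] by (simp add: DF norm_mult)
    next
      case False
      then have "x + z \<notin> cball 0 R"
        using that(2) norm_triangle_ineq4[of "x + z" x] by auto
      then show ?thesis
        using D_dir_vanish[of "cball 0 R" f "x + z" c, OF closed_cball R(3)] False by (simp add: DF)
    qed
    show "integrable lborel (\<lambda>z::'a. indicat_real (cball 0 (R + 1)) z *\<^sub>R M)"
      by (intro borel_integrable_compact) auto
  qed (use b in auto)
  moreover have "D_dir b (\<lambda>x. LINT z|lborel. F x z) 0 = (\<zeta> \<bullet> b) * fourier f \<zeta>"
  proof -
    have "D_dir b (\<lambda>x. fourier f \<zeta> * cis (x \<bullet> \<zeta>)) = (\<lambda>x. fourier f \<zeta> * D_dir b (\<lambda>x. cis (x \<bullet> \<zeta>)) x)"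
      by (intro D_dir_cmult smooth_differentiable_on smooth_cis)
    then show ?thesis by (simp add: V D_dir_cis mult.commute inner_commute)
  qed
  ultimately show ?thesis by (simp add: DF fourier_def)
qed

lemma fourier_funpow_D_dir:
  fixes f :: "'a::euclidean_space \<Rightarrow> complex"
  assumes "f \<in> test_functions" "b \<in> Basis"
  shows "fourier ((D_dir b ^^ k) f) \<zeta> = (\<zeta> \<bullet> b) ^ k * fourier f \<zeta>"
  by (induction k) (auto simp: fourier_D_dir test_functions_funpow_D_dir assms)

text \<open>Bounding the power by pure coordinate powers means that decay of order k costs only the
  unmixed derivatives \<open>D_dir b ^^ k\<close>.\<close>

lemma japanese_power_le:
  fixes \<zeta> :: "'a::euclidean_space"
  shows "japanese \<zeta> ^ k \<le> (1 + real DIM('a)) ^ k * (1 + (\<Sum>b\<in>Basis. \<bar>\<zeta> \<bullet> b\<bar> ^ k))"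
proof -
  \<comment> \<open>Including 1 in the maximum lets \<open>M\<close> absorb the constant in 1 + the
    sum of coordinates, while M^k is still at most 1 plus one of the coordinate powers.\<close>
  define M where "M = Max (insert 1 ((\<lambda>b. \<bar>\<zeta> \<bullet> b\<bar>) ` Basis))"
  have M: "1 \<le> M" "\<And>b. b \<in> Basis \<Longrightarrow> \<bar>\<zeta> \<bullet> b\<bar> \<le> M" unfolding M_def by (intro Max_ge; simp)+
  have "M \<in> insert 1 ((\<lambda>b. \<bar>\<zeta> \<bullet> b\<bar>) ` Basis)" unfolding M_def by (intro Max_in) auto
  then have Mk: "M ^ k \<le> 1 + (\<Sum>b\<in>Basis. \<bar>\<zeta> \<bullet> b\<bar> ^ k)"
  proof
    assume "M = 1" then show ?thesis by (simp add: sum_nonneg)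
  next
    assume "M \<in> (\<lambda>b. \<bar>\<zeta> \<bullet> b\<bar>) ` Basis"
    then obtain b where "b \<in> Basis" "M = \<bar>\<zeta> \<bullet> b\<bar>" by auto
    then show ?thesis using member_le_sum[of b Basis "\<lambda>b. \<bar>\<zeta> \<bullet> b\<bar> ^ k"] by simp
  qed
  have "japanese \<zeta> \<le> 1 + norm \<zeta>"
    unfolding japanese_def by (intro real_le_lsqrt) (auto simp: power2_eq_square algebra_simps)
  also have "\<dots> \<le> 1 + (\<Sum>b\<in>Basis. \<bar>\<zeta> \<bullet> b\<bar>)"
    using norm_le_l1[of \<zeta>] by simp
  also have "\<dots> \<le> M + (\<Sum>b\<in>(Basis::'a set). M)"
    using M by (intro add_mono sum_mono) auto
  also have "\<dots> = (1 + real DIM('a)) * M" by (simp add: algebra_simps)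
  finally have "japanese \<zeta> ^ k \<le> ((1 + real DIM('a)) * M) ^ k"
    using japanese_ge_1[of \<zeta>] by (intro power_mono) auto
  also have "\<dots> \<le> (1 + real DIM('a)) ^ k * (1 + (\<Sum>b\<in>Basis. \<bar>\<zeta> \<bullet> b\<bar> ^ k))"
    using Mk by (simp add: power_mult_distrib mult_left_mono)
  finally show ?thesis .
qed

text \<open>The constant is kept explicit as a sum of L1 norms, because \<open>f\<close> will depend
  on parameters and the decay must be uniform in them.\<close>

lemma fourier_decay:
  fixes f :: "'a::euclidean_space \<Rightarrow> complex"
  assumes f: "f \<in> test_functions"
  shows "japanese \<zeta> ^ k * norm (fourier f \<zeta>) \<le> (1 + real DIM('a)) ^ k *
    ((LINT y|lborel. norm (f y)) + (\<Sum>b\<in>Basis. LINT y|lborel. norm ((D_dir b ^^ k) f y)))"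
proof -
  have "japanese \<zeta> ^ k * norm (fourier f \<zeta>) \<le>
      ((1 + real DIM('a)) ^ k * (1 + (\<Sum>b\<in>Basis. \<bar>\<zeta> \<bullet> b\<bar> ^ k))) * norm (fourier f \<zeta>)"
    by (intro mult_right_mono japanese_power_le) auto
  also have "\<dots> = (1 + real DIM('a)) ^ k * (norm (fourier f \<zeta>) + (\<Sum>b\<in>Basis. norm (fourier ((D_dir b ^^ k) f) \<zeta>)))"
    using f by (simp add: fourier_funpow_D_dir norm_mult norm_power sum_distrib_left algebra_simps)
  also have "\<dots> \<le> (1 + real DIM('a)) ^ k *
      ((LINT y|lborel. norm (f y)) + (\<Sum>b\<in>Basis. LINT y|lborel. norm ((D_dir b ^^ k) f y)))"
    by (intro mult_left_mono add_mono sum_mono norm_fourier_le) auto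
  finally show ?thesis .
qed

lemma fourier_decayE:
  fixes f :: "'a::euclidean_space \<Rightarrow> complex"
  assumes "f \<in> test_functions"
  obtains C where "C \<ge> 0" "\<And>\<zeta>. norm (fourier f \<zeta>) \<le> C * japanese \<zeta> powr (- real k)"
proof -
  define C where "C = (1 + real DIM('a)) ^ k *
    ((LINT y|lborel. norm (f y)) + (\<Sum>b\<in>Basis. LINT y|lborel. norm ((D_dir b ^^ k) f y)))"
  have "norm (fourier f \<zeta>) \<le> C * japanese \<zeta> powr (- real k)" for \<zeta>
    using fourier_decay[OF assms, of \<zeta> k]
    by (simp add: C_def[symmetric] powr_minus powr_realpow divide_inverse[symmetric] pos_le_divide_eq mult.commute)
  moreover have "C \<ge> 0"
    unfolding C_def by (intro mult_nonneg_nonneg add_nonneg_nonneg sum_nonneg integral_nonneg) auto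
  ultimately show ?thesis using that by blast
qed

lemma fourier_measurable:
  assumes "f \<in> borel_measurable borel"
  shows "fourier f \<in> borel_measurable borel"
proof -
  have "(\<lambda>(\<zeta>, y). cis (- (y \<bullet> \<zeta>)) * f y) \<in> borel_measurable (borel \<Otimes>\<^sub>M lborel)"
    using assms by measurable
  then have "(\<lambda>\<zeta>. LINT y|lborel. cis (- (y \<bullet> \<zeta>)) * f y) \<in> borel_measurable borel"
    by (rule lborel.borel_measurable_lebesgue_integral)
  then show ?thesis by (simp add: fourier_def[abs_def])
qed

lemma integrable_fourier:
  fixes f :: "'a::euclidean_space \<Rightarrow> complex"
  assumes "f \<in> test_functions"
  shows "integrable lborel (fourier f)"
proof -
  obtain C where C: "C \<ge> 0" "\<And>\<zeta>. norm (fourier f \<zeta>) \<le> C * japanese \<zeta> powr (- real (2 * DIM('a)))"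
    using fourier_decayE[OF assms] by metis
  have "integrable lborel (\<lambda>\<zeta>::'a. C * japanese \<zeta> powr (- real (2 * DIM('a))))"
    by (intro integrable_mult_right integrable_japanese) auto
  then show ?thesis
    using C fourier_measurable[OF smooth_measurable[OF test_functions_smooth[OF assms]]]
    by (elim Bochner_Integration.integrable_bound) (auto simp: abs_mult)
qed

lemma integrable_tensor:
  fixes f :: "'a::euclidean_space \<Rightarrow> 'c::{real_normed_field,banach,second_countable_topology}"
    and g :: "'b::euclidean_space \<Rightarrow> 'c"
  assumes "integrable lborel f" "integrable lborel g"
  shows "integrable (lborel \<Otimes>\<^sub>M lborel) (\<lambda>(x, y). f x * g y)"
proof (rule lborel_pair.Fubini_integrable)
  note [measurable] = borel_measurable_integrable[OF assms(1)] borel_measurable_integrable[OF assms(2)]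
  show "(\<lambda>(x, y). f x * g y) \<in> borel_measurable (lborel \<Otimes>\<^sub>M lborel)" by measurable
  show "integrable lborel (\<lambda>x. LINT y|lborel. norm (case (x, y) of (x, y) \<Rightarrow> f x * g y))"
    using assms by (simp add: norm_mult)
  show "AE x in lborel. integrable lborel (\<lambda>y. case (x, y) of (x, y) \<Rightarrow> f x * g y)"
    using assms by (intro AE_I2) simp
qed

section \<open>Gaussians and Fourier inversion\<close>

definition gauss :: "'a::euclidean_space \<Rightarrow> complex" where
  "gauss \<zeta> = complex_of_real (exp (- (norm \<zeta>)\<^sup>2 / 2))"

lemma gauss_prod: "gauss (\<zeta>::'a::euclidean_space) = (\<Prod>b\<in>Basis. complex_of_real (exp (- (\<zeta> \<bullet> b)\<^sup>2 / 2)))"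
proof -
  have "(norm \<zeta>)\<^sup>2 = (\<Sum>b\<in>Basis. (\<zeta> \<bullet> b)\<^sup>2)"
    unfolding power2_norm_eq_inner by (subst euclidean_inner) (simp add: power2_eq_square)
  then have "exp (- (norm \<zeta>)\<^sup>2 / 2) = (\<Prod>b\<in>Basis. exp (- (\<zeta> \<bullet> b)\<^sup>2 / 2))"
    by (simp add: exp_sum[symmetric] sum_negf sum_divide_distrib)
  then show ?thesis by (simp add: gauss_def)
qed

text \<open>The integral is the characteristic function of the standard normal distribution with its
  normalising constant removed.\<close>

lemma gauss_1D:
  shows "integrable lborel (\<lambda>x::real. complex_of_real (exp (- x\<^sup>2 / 2)))"
    and "(LINT x|lborel. cis (s * x) * complex_of_real (exp (- x\<^sup>2 / 2))) = sqrt (2 * pi) * exp (- s\<^sup>2 / 2)"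
proof -
  have d: "std_normal_density x = exp (- x\<^sup>2 / 2) / sqrt (2 * pi)" for x
    by (simp add: std_normal_density_def)
  have "integrable lborel std_normal_density" by (rule integrable_normal_density) simp
  then have "integrable lborel (\<lambda>x. sqrt (2 * pi) * std_normal_density x)" by simp
  then have "integrable lborel (\<lambda>x::real. exp (- x\<^sup>2 / 2))" by (simp add: d)
  then show "integrable lborel (\<lambda>x::real. complex_of_real (exp (- x\<^sup>2 / 2)))"
    by (rule integrable_of_real)
  have "complex_of_real (exp (- s\<^sup>2 / 2)) = char std_normal_distribution s"
    by (simp add: char_std_normal_distribution)
  also have "\<dots> = (LINT x|density lborel std_normal_density. iexp (s * x))"
    by (simp add: char_def)
  also have "\<dots> = (LINT x|lborel. std_normal_density x *\<^sub>R iexp (s * x))"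
    by (subst integral_density) auto
  also have "\<dots> = (LINT x|lborel. complex_of_real (1 / sqrt (2 * pi)) * (cis (s * x) * complex_of_real (exp (- x\<^sup>2 / 2))))"
    by (intro Bochner_Integration.integral_cong refl) (simp add: d scaleR_conv_of_real cis_conv_exp)
  also have "\<dots> = complex_of_real (1 / sqrt (2 * pi)) * (LINT x|lborel. cis (s * x) * complex_of_real (exp (- x\<^sup>2 / 2)))"
    by (rule integral_mult_right_zero)
  finally show "(LINT x|lborel. cis (s * x) * complex_of_real (exp (- x\<^sup>2 / 2))) = sqrt (2 * pi) * exp (- s\<^sup>2 / 2)"
    by (simp add: field_simps)
qed

lemma integrable_gauss: "integrable lborel (gauss :: 'a::euclidean_space \<Rightarrow> complex)"
  using prod_Basis_integral(1)[where f = "\<lambda>_ x. complex_of_real (exp (- x\<^sup>2 / 2))" and 'a = 'a, OF gauss_1D(1)]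
  unfolding gauss_prod[symmetric] .

lemma gauss_measurable [measurable]: "gauss \<in> borel_measurable borel"
  using borel_measurable_integrable[OF integrable_gauss] by simp

lemma fourier_gauss: "fourier gauss (\<zeta>::'a::euclidean_space) = sqrt (2 * pi) ^ DIM('a) * gauss \<zeta>"
proof -
  have "fourier gauss \<zeta> = (LINT y|lborel. (\<Prod>b\<in>Basis. cis (- (\<zeta> \<bullet> b) * (y \<bullet> b)) * complex_of_real (exp (- (y \<bullet> b)\<^sup>2 / 2))))"
    unfolding fourier_def
    by (intro Bochner_Integration.integral_cong refl)
      (simp add: gauss_prod prod.distrib cis_sum[symmetric] euclidean_inner[of _ \<zeta>] sum_negf mult.commute)
  also have "\<dots> = (\<Prod>b\<in>Basis. (LINT t|lborel. cis (- (\<zeta> \<bullet> b) * t) * complex_of_real (exp (- t\<^sup>2 / 2))))"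
    by (intro prod_Basis_integral(2)[where f = "\<lambda>b t. cis (- (\<zeta> \<bullet> b) * t) * complex_of_real (exp (- t\<^sup>2 / 2))"]
        integrable_cis_mult gauss_1D(1)) auto
  also have "\<dots> = (\<Prod>b\<in>(Basis::'a set). complex_of_real (sqrt (2 * pi)) * complex_of_real (exp (- (\<zeta> \<bullet> b)\<^sup>2 / 2)))"
    by (simp only: gauss_1D(2)) simp
  finally show ?thesis by (simp add: prod.distrib gauss_prod)
qed

text \<open>Inversion at the origin is enough, since other points are reached by translating the
  test function. A Gaussian regulariser \<open>gauss (c n *\<^sub>R \<zeta>)\<close> makes Fubini
  available. One factor sqrt(2 pi) per dimension comes from the transform of the Gaussian and
  another from its integral.\<close>

theorem fourier_inversion_0:
  fixes g :: "'a::euclidean_space \<Rightarrow> complex"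
  assumes g: "g \<in> test_functions"
  shows "(LINT \<zeta>|lborel. fourier g \<zeta>) = complex_of_real (2 * pi) ^ DIM('a) * g 0"
proof -
  note sm = test_functions_smooth[OF g]
  have gm [measurable]: "g \<in> borel_measurable borel" using smooth_measurable[OF sm] .
  have fm [measurable]: "fourier g \<in> borel_measurable borel" by (rule fourier_measurable) simp
  obtain M where M: "\<And>x. norm (g x) \<le> M" using test_functions_bounded[OF g] by metis
  define c where "c n = 1 / real (Suc n)" for n
  have c: "c n > 0" for n by (simp add: c_def)
  have c0: "c \<longlonglongrightarrow> 0"
    using LIMSEQ_inverse_real_of_nat by (simp add: c_def[abs_def] inverse_eq_divide)
  have g0: "(\<lambda>n. h (c n *\<^sub>R x)) \<longlonglongrightarrow> h 0" if "continuous_on UNIV h" for h :: "'a \<Rightarrow> complex" and x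
  proof -
    have "(\<lambda>n. c n *\<^sub>R x) \<longlonglongrightarrow> 0 *\<^sub>R x" by (intro tendsto_intros c0)
    then show ?thesis using that by (auto simp: continuous_on_eq_continuous_at intro: isCont_tendsto_compose)
  qed
  have gle: "norm (gauss x) \<le> 1" for x :: 'a by (simp add: gauss_def)
  have gc: "continuous_on UNIV (gauss :: 'a \<Rightarrow> complex)"
    unfolding gauss_def by (intro continuous_intros) auto
  let ?A = "\<lambda>n. LINT \<zeta>|lborel. fourier g \<zeta> * gauss (c n *\<^sub>R \<zeta>)"
  \<comment> \<open>The regulariser tends to 1 pointwise and is bounded by 1, so the integrable
    transform of \<open>g\<close> dominates.\<close>
  have A1: "?A \<longlonglongrightarrow> (LINT \<zeta>|lborel. fourier g \<zeta> * 1)"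
  proof (rule integral_dominated_convergence[where w = "\<lambda>\<zeta>. norm (fourier g \<zeta>)"])
    have "gauss (0::'a) = 1" by (simp add: gauss_def)
    then show "AE \<zeta> in lborel. (\<lambda>n. fourier g \<zeta> * gauss (c n *\<^sub>R \<zeta>)) \<longlonglongrightarrow> fourier g \<zeta> * 1"
      using tendsto_mult[OF tendsto_const g0[OF gc]] by (intro AE_I2) simp
    show "AE \<zeta> in lborel. norm (fourier g \<zeta> * gauss (c n *\<^sub>R \<zeta>)) \<le> norm (fourier g \<zeta>)" for n
      using gle by (auto simp: norm_mult mult_left_le)
  qed (use integrable_fourier[OF g] in auto)
  \<comment> \<open>Fubini moves the transform from \<open>g\<close> to the scaled Gaussian. The
    substitution y = c w then removes the scale from that transform and leaves it in the argument of
    \<open>g\<close> only.\<close>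
  have A2: "?A n = complex_of_real (sqrt (2 * pi)) ^ DIM('a) * (LINT w|lborel. g (c n *\<^sub>R w) * gauss w)" for n
  proof -
    have "integrable lborel (\<lambda>\<zeta>::'a. gauss (c n *\<^sub>R \<zeta>))"
    proof -
      have "integrable (density (distr lborel borel (\<lambda>x::'a. 0 + c n *\<^sub>R x)) (\<lambda>_. ennreal (\<bar>c n\<bar> ^ DIM('a)))) gauss"
        using lborel_affine[of "c n" "0::'a"] c[of n] integrable_gauss[where 'a = 'a] by simp
      then have sc: "integrable lborel (\<lambda>x::'a. (c n ^ DIM('a)) *\<^sub>R gauss (c n *\<^sub>R x))"
        using c[of n] by (simp add: integrable_density integrable_distr_eq)
      have "integrable lborel (\<lambda>x::'a. inverse (c n ^ DIM('a)) *\<^sub>R ((c n ^ DIM('a)) *\<^sub>R gauss (c n *\<^sub>R x)))"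
        by (rule integrable_scaleR_right) (rule sc)
      then show ?thesis using c[of n] by simp
    qed
    note gi = this
    have "?A n = (LINT \<zeta>|lborel. (LINT y|lborel. cis (- (y \<bullet> \<zeta>)) * g y * gauss (c n *\<^sub>R \<zeta>)))"
      by (simp add: fourier_def)
    also have "\<dots> = (LINT y|lborel. (LINT \<zeta>|lborel. cis (- (y \<bullet> \<zeta>)) * g y * gauss (c n *\<^sub>R \<zeta>)))"
    proof (rule lborel_pair.Fubini_integral[where f = "\<lambda>y \<zeta>. cis (- (y \<bullet> \<zeta>)) * g y * gauss (c n *\<^sub>R \<zeta>)"])
      have "integrable (lborel \<Otimes>\<^sub>M lborel) (\<lambda>(y, \<zeta>::'a). g y * gauss (c n *\<^sub>R \<zeta>))"
        using test_functions_integrable[OF g] gi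
        by (rule integrable_tensor)
      then show "integrable (lborel \<Otimes>\<^sub>M lborel) (\<lambda>(y, \<zeta>). cis (- (y \<bullet> \<zeta>)) * g y * gauss (c n *\<^sub>R \<zeta>))"
        by (rule Bochner_Integration.integrable_bound) (auto simp: norm_mult)
    qed
    also have "\<dots> = (LINT y|lborel. g y * fourier (\<lambda>\<zeta>. gauss (c n *\<^sub>R \<zeta>)) y)"
      by (intro Bochner_Integration.integral_cong refl)
        (simp add: fourier_def integral_mult_right_zero[symmetric] inner_commute mult_ac del: integral_mult_right_zero)
    also have "\<dots> = complex_of_real (c n) ^ DIM('a) * (LINT w|lborel. g (c n *\<^sub>R w) * fourier (\<lambda>\<zeta>. gauss (c n *\<^sub>R \<zeta>)) (c n *\<^sub>R w))"
      using c[of n] by (intro integral_scale borel_measurable_times gm fourier_measurable) auto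
    also have "\<dots> = (LINT w|lborel. g (c n *\<^sub>R w) * (complex_of_real (c n) ^ DIM('a) * fourier (\<lambda>\<zeta>. gauss (c n *\<^sub>R \<zeta>)) (c n *\<^sub>R w)))"
      by (simp add: integral_mult_right_zero[symmetric] mult_ac del: integral_mult_right_zero)
    also have "\<dots> = (LINT w|lborel. g (c n *\<^sub>R w) * fourier gauss w)"
    proof (intro Bochner_Integration.integral_cong refl arg_cong2[where f = "(*)"])
      fix w :: 'a
      have "fourier gauss w = complex_of_real (c n) ^ DIM('a) * (LINT \<zeta>|lborel. cis (- ((c n *\<^sub>R \<zeta>) \<bullet> w)) * gauss (c n *\<^sub>R \<zeta>))"
        unfolding fourier_def using c[of n] by (intro integral_scale) auto
      then show "complex_of_real (c n) ^ DIM('a) * fourier (\<lambda>\<zeta>. gauss (c n *\<^sub>R \<zeta>)) (c n *\<^sub>R w) = fourier gauss w"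
        by (simp add: fourier_def)
    qed
    finally show ?thesis
      by (simp add: fourier_gauss integral_mult_right_zero[symmetric] mult_ac del: integral_mult_right_zero)
  qed
  have A3: "(\<lambda>n. complex_of_real (sqrt (2 * pi)) ^ DIM('a) * (LINT w|lborel. g (c n *\<^sub>R w) * gauss w)) \<longlonglongrightarrow>
      complex_of_real (sqrt (2 * pi)) ^ DIM('a) * (LINT w|lborel. g 0 * gauss (w::'a))"
  proof (rule tendsto_mult[OF tendsto_const], rule integral_dominated_convergence[where w = "\<lambda>w. M * norm (gauss w)"])
    show "AE w in lborel. (\<lambda>n. g (c n *\<^sub>R w) * gauss w) \<longlonglongrightarrow> g 0 * gauss w"
      using tendsto_mult[OF g0[OF smooth_continuous_on[OF sm]] tendsto_const] by (intro AE_I2) simp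
    show "AE w in lborel. norm (g (c n *\<^sub>R w) * gauss w) \<le> M * norm (gauss w)" for n
      using M by (auto simp: norm_mult intro!: mult_right_mono)
  qed (use integrable_gauss in auto)
  have "(LINT \<zeta>|lborel. fourier g \<zeta> * 1) = complex_of_real (sqrt (2 * pi)) ^ DIM('a) * (LINT w|lborel. g 0 * gauss (w::'a))"
    by (rule LIMSEQ_unique[OF A1[unfolded A2] A3])
  also have "(LINT w|lborel. g 0 * gauss (w::'a)) = g 0 * fourier gauss (0::'a)"
    by (simp add: fourier_def)
  also have "fourier gauss (0::'a) = complex_of_real (sqrt (2 * pi)) ^ DIM('a)"
    by (simp add: fourier_gauss) (simp add: gauss_def)
  also have "complex_of_real (sqrt (2 * pi)) ^ DIM('a) * (g 0 * complex_of_real (sqrt (2 * pi)) ^ DIM('a))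
      = (complex_of_real (sqrt (2 * pi)) * complex_of_real (sqrt (2 * pi))) ^ DIM('a) * g 0"
    by (simp only: power_mult_distrib mult_ac)
  also have "complex_of_real (sqrt (2 * pi)) * complex_of_real (sqrt (2 * pi)) = complex_of_real (2 * pi)"
    by (simp only: of_real_mult[symmetric] real_sqrt_mult_self) simp
  finally show ?thesis by simp
qed

section \<open>Compactly supported symbols\<close>

lemma continuous_on_smooth_compose:
  assumes "smooth f" "continuous_on S g"
  shows "continuous_on S (\<lambda>x. f (g x))"
  using continuous_on_compose2[OF smooth_continuous_on[OF assms(1), of UNIV] assms(2)] by simp

lemma compact_bound_Basis:
  fixes v :: "'w::euclidean_space \<Rightarrow> 'z::topological_space \<Rightarrow> complex"
  assumes "\<And>c. c \<in> Basis \<Longrightarrow> continuous_on K (v c)" "compact K"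
  obtains M where "M \<ge> 0" "\<And>c z. c \<in> Basis \<Longrightarrow> z \<in> K \<Longrightarrow> norm (v c z) \<le> M"
proof -
  have "\<exists>M. \<forall>z\<in>K. norm (v c z) \<le> M" if "c \<in> Basis" for c
    using compact_imp_bounded[OF compact_continuous_image[OF assms(1)[OF that] assms(2)]]
    by (auto simp: bounded_iff)
  then obtain M where M: "\<And>c z. c \<in> Basis \<Longrightarrow> z \<in> K \<Longrightarrow> norm (v c z) \<le> M c" by metis
  have "norm (v c z) \<le> (\<Sum>c\<in>Basis. \<bar>M c\<bar>)" if "c \<in> Basis" "z \<in> K" for c z
    using M[OF that] member_le_sum[of c Basis "\<lambda>c. \<bar>M c\<bar>"] that by force
  then show ?thesis using that[of "\<Sum>c\<in>Basis. \<bar>M c\<bar>"] by (simp add: sum_nonneg)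
qed

text \<open>If the support in z stays in a fixed ball while w varies in a unit ball, joint
  continuity bounds the derivatives on a compact set. A constant times the indicator of that ball
  then dominates.\<close>

lemma D_dir_integral_compact:
  fixes F :: "'w::euclidean_space \<Rightarrow> 'a::euclidean_space \<Rightarrow> complex"
  assumes diff: "\<And>z. (\<lambda>w. F w z) differentiable_on UNIV"
    and cont: "\<And>w. continuous_on UNIV (F w)"
    and contD: "\<And>c. c \<in> Basis \<Longrightarrow> continuous_on UNIV (\<lambda>wz. D_dir c (\<lambda>w. F w (snd wz)) (fst wz))"
    and sup: "\<And>w0. \<exists>\<rho>. \<forall>w\<in>ball w0 1. \<forall>z. z \<notin> cball 0 \<rho> \<longrightarrow> F w z = 0"
  shows "(\<lambda>w. LINT z|lborel. F w z) differentiable (at w0)"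
    and "c \<in> Basis \<Longrightarrow> D_dir c (\<lambda>w. LINT z|lborel. F w z) w0 = (LINT z|lborel. D_dir c (\<lambda>w. F w z) w0)"
proof -
  obtain \<rho> where \<rho>: "\<And>w z. w \<in> ball w0 1 \<Longrightarrow> z \<notin> cball 0 \<rho> \<Longrightarrow> F w z = 0"
    using sup[of w0] by blast
  have int: "integrable lborel (F w)" for w
  proof -
    obtain \<rho> where "\<And>z. z \<notin> cball 0 \<rho> \<Longrightarrow> F w z = 0"
      using sup[of w] by (metis centre_in_ball zero_less_one)
    then show ?thesis by (rule integrable_compact_support[OF cont compact_cball])
  qed
  have c1: "continuous_on (cball w0 1 \<times> cball 0 \<rho>) (\<lambda>wz. D_dir c (\<lambda>w. F w (snd wz)) (fst wz))" if "c \<in> Basis" for c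
    using continuous_on_subset[OF contD[OF that]] by blast
  have cpt: "compact (cball w0 1 \<times> cball (0::'a) \<rho>)" by (intro compact_Times compact_cball)
  obtain M where M: "M \<ge> 0" "\<And>c wz. c \<in> Basis \<Longrightarrow> wz \<in> cball w0 1 \<times> cball 0 \<rho> \<Longrightarrow>
      norm (D_dir c (\<lambda>w. F w (snd wz)) (fst wz)) \<le> M"
    by (rule compact_bound_Basis[where v = "\<lambda>c wz. D_dir c (\<lambda>w. F w (snd wz)) (fst wz)", OF c1 cpt], assumption, rule that, assumption, blast)
  have bd: "norm (D_dir c (\<lambda>w. F w z) w) \<le> indicat_real (cball 0 \<rho>) z *\<^sub>R M"
    if "c \<in> Basis" "w \<in> ball w0 1" for c w z
  proof (cases "z \<in> cball 0 \<rho>")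
    case True
    then show ?thesis using M(2)[OF that(1), of "(w, z)"] that(2) by (simp add: less_imp_le)
  next
    case False
    have "\<forall>\<^sub>F w in nhds w. F w z = (\<lambda>_. 0) w"
      unfolding eventually_nhds using \<rho> False that(2) by (intro exI[of _ "ball w0 1"]) auto
    then have "D_dir c (\<lambda>w. F w z) w = 0"
      using D_dir_cong_ev[of "\<lambda>w. F w z" "\<lambda>_. 0" w c] by simp
    then show ?thesis using False by simp
  qed
  have g: "integrable lborel (\<lambda>z::'a. indicat_real (cball 0 \<rho>) z *\<^sub>R M)"
    by (intro borel_integrable_compact) auto
  show "(\<lambda>w. LINT z|lborel. F w z) differentiable (at w0)"
    by (rule D_dir_integral(1)[OF zero_less_one int diff bd g])
  show "D_dir c (\<lambda>w. LINT z|lborel. F w z) w0 = (LINT z|lborel. D_dir c (\<lambda>w. F w z) w0)" if "c \<in> Basis"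
    by (rule D_dir_integral(2)[OF zero_less_one int diff bd g that])
qed

text \<open>The radius does not depend on \<xi>. Slices in x are therefore test functions whose L1
  norms grow in \<xi> no faster than the symbol itself.\<close>

definition csymbol :: "real \<Rightarrow> ('a::euclidean_space \<times> 'b::euclidean_space \<Rightarrow> complex) \<Rightarrow> bool" where
  "csymbol m u \<longleftrightarrow> u \<in> symbols m \<and> (\<exists>R. \<forall>x \<xi>. x \<notin> cball 0 R \<longrightarrow> u (x, \<xi>) = 0)"

lemma csymbol_symbols: "csymbol m u \<Longrightarrow> u \<in> symbols m"
  by (simp add: csymbol_def)

lemma csymbolE:
  assumes "csymbol m u"
  obtains R where "R > 0" "\<And>x \<xi>. x \<notin> cball 0 R \<Longrightarrow> u (x, \<xi>) = 0"
proof -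
  obtain R where "\<And>x \<xi>. x \<notin> cball 0 R \<Longrightarrow> u (x, \<xi>) = 0"
    using assms by (auto simp: csymbol_def)
  then show ?thesis by (intro that[of "\<bar>R\<bar> + 1"]) auto
qed

lemma csymbol_D_dir:
  assumes "csymbol m u" "b \<in> Basis"
  shows "csymbol (m - snd_weight b) (D_dir b u)"
proof -
  obtain R where R: "R > 0" "\<And>x \<xi>. x \<notin> cball 0 R \<Longrightarrow> u (x, \<xi>) = 0"
    using csymbolE[OF assms(1)] by metis
  have "D_dir b u (x, \<xi>) = 0" if "x \<notin> cball 0 R" for x \<xi>
  proof (rule D_dir_vanish[where B = "cball 0 R \<times> UNIV"])
    show "u z = 0" if "z \<notin> cball 0 R \<times> UNIV" for z
      using R(2)[of "fst z" "snd z"] that by (auto simp: mem_Times_iff)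
  qed (use that in \<open>auto intro: closed_Times\<close>)
  then show ?thesis
    using symbols_D_dir[OF csymbol_symbols[OF assms(1)] assms(2)] unfolding csymbol_def by blast
qed

lemma csymbol_foldr_D_fst:
  assumes "csymbol m u" "set bs \<subseteq> Basis"
  shows "csymbol m (foldr D_dir (map (\<lambda>b. (b, 0)) bs) u)"
  using assms(2)
proof (induction bs)
  case (Cons b bs)
  then have "(b, 0) \<in> Basis" by (simp add: Basis_prod_def)
  from csymbol_D_dir[OF Cons.IH this] Cons.prems show ?case by (simp add: snd_weight_def)
qed (use assms in simp)

lemma smooth_slice: "smooth u \<Longrightarrow> smooth (\<lambda>x. u (x, \<xi>))"
  using smooth_affine[of u "\<lambda>x. (x, 0)" "(0, \<xi>)"] by (simp add: bounded_linear_Pair bounded_linear_ident bounded_linear_zero)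

lemma csymbol_slice:
  fixes u :: "'a::euclidean_space \<times> 'b::euclidean_space \<Rightarrow> complex"
  assumes "csymbol m u"
  shows "(\<lambda>z. u (x + z, \<xi>)) \<in> test_functions"
proof -
  obtain R where R: "R > 0" "\<And>x \<xi>. x \<notin> cball 0 R \<Longrightarrow> u (x, \<xi>) = 0"
    using csymbolE[OF assms] by metis
  have "smooth (\<lambda>z. u (z + x, \<xi>))"
    by (rule smooth_affine[OF smooth_slice[OF symbols_smooth[OF csymbol_symbols[OF assms]]] bounded_linear_ident])
  then have "smooth (\<lambda>z. u (x + z, \<xi>))" by (simp add: add.commute)
  moreover have "u (x + z, \<xi>) = 0" if "z \<notin> cball (- x) R" for z
    using that R(2)[of "x + z" \<xi>] by (simp add: dist_norm norm_minus_commute[of "- x"] add.commute)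
  ultimately show ?thesis by (intro test_functionsI[of _ "cball (- x) R"]) auto
qed

lemma foldr_D_dir_translate: "foldr D_dir bs (\<lambda>z. f (x + z)) = (\<lambda>z. foldr D_dir bs f (x + z))"
proof (induction bs)
  case (Cons b bs)
  then show ?case using D_dir_translate[of b "foldr D_dir bs f" x] by (simp add: add.commute)
qed simp

text \<open>This is the transform of \<open>u\<close> in its base variable, centred at the base
  point of \<open>w\<close>, hence multiplied by exp(i<x,\<zeta>>). In this form \<open>w\<close>
  enters only through \<open>u\<close>, so derivatives in \<open>w\<close> fall on \<open>u\<close>
  and create no powers of \<zeta>.\<close>

definition ufour :: "('a::euclidean_space \<times> 'b \<Rightarrow> complex) \<Rightarrow> 'a \<times> 'b \<Rightarrow> 'a \<Rightarrow> complex" where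
  "ufour u w \<zeta> = fourier (\<lambda>z. u (fst w + z, snd w)) \<zeta>"

lemma fourier_translate:
  fixes f :: "'a::euclidean_space \<Rightarrow> complex"
  assumes [measurable]: "f \<in> borel_measurable borel"
  shows "fourier (\<lambda>z. f (x + z)) \<zeta> = cis (x \<bullet> \<zeta>) * fourier f \<zeta>"
proof -
  have "fourier (\<lambda>z. f (x + z)) \<zeta> = (LINT z|lborel. (\<lambda>y. cis (- ((y - x) \<bullet> \<zeta>)) * f y) (x + z))"
    by (simp add: fourier_def)
  also have "\<dots> = (LINT y|lborel. cis (- ((y - x) \<bullet> \<zeta>)) * f y)"
    by (intro integral_translate) simp
  also have "\<dots> = (LINT y|lborel. cis (x \<bullet> \<zeta>) * (cis (- (y \<bullet> \<zeta>)) * f y))"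
    by (intro Bochner_Integration.integral_cong refl) (simp add: cis_mult inner_diff_left mult.assoc[symmetric])
  finally show ?thesis by (simp add: fourier_def)
qed

lemma ufour_eq:
  assumes "smooth u"
  shows "ufour u (x, \<xi>) \<zeta> = cis (x \<bullet> \<zeta>) * fourier (\<lambda>y. u (y, \<xi>)) \<zeta>"
  unfolding ufour_def fst_conv snd_conv
  by (rule fourier_translate) (rule smooth_measurable[OF smooth_slice[OF assms]])

lemma ufour_D_dir:
  fixes u :: "'a::euclidean_space \<times> 'b::euclidean_space \<Rightarrow> complex"
  assumes u: "csymbol m u"
  shows "(\<lambda>w. ufour u w \<zeta>) differentiable_on UNIV"
    and "c \<in> Basis \<Longrightarrow> D_dir c (\<lambda>w. ufour u w \<zeta>) = (\<lambda>w. ufour (D_dir c u) w \<zeta>)"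
proof -
  note sm = symbols_smooth[OF csymbol_symbols[OF u]]
  obtain R where R: "R > 0" "\<And>x \<xi>. x \<notin> cball 0 R \<Longrightarrow> u (x, \<xi>) = 0"
    using csymbolE[OF u] by metis
  define F where "F w z = cis (- (z \<bullet> \<zeta>)) * u (w + (z, 0))" for w :: "'a \<times> 'b" and z
  have U: "ufour u w \<zeta> = (LINT z|lborel. F w z)"
    if "\<And>w z. F w z = cis (- (z \<bullet> \<zeta>)) * u (w + (z, 0))" for F :: "'a \<times> 'b \<Rightarrow> 'a \<Rightarrow> complex" and w and u :: "'a \<times> 'b \<Rightarrow> complex"
    using that by (cases w) (simp add: ufour_def fourier_def)
  have tr: "smooth (\<lambda>w. u (w + (z, 0)))" for z by (rule smooth_affine[OF sm bounded_linear_ident])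
  have DF: "D_dir c (\<lambda>w. F w z) w = cis (- (z \<bullet> \<zeta>)) * D_dir c u (w + (z, 0))" for c w z
    unfolding F_def using D_dir_cmult[OF smooth_differentiable_on[OF tr[of z]], of c "cis (- (z \<bullet> \<zeta>))"]
    by (simp add: D_dir_translate)
  have diff: "(\<lambda>w. F w z) differentiable_on UNIV" for z
    unfolding F_def by (rule smooth_differentiable_on[OF smooth_cmult[OF tr]])
  have cont: "continuous_on UNIV (F w)" for w
    unfolding F_def[abs_def] by (intro continuous_intros continuous_on_smooth_compose[OF sm])
  have contD: "continuous_on UNIV (\<lambda>wz. D_dir c (\<lambda>w. F w (snd wz)) (fst wz))" if "c \<in> Basis" for c
    unfolding DF by (intro continuous_intros continuous_on_smooth_compose[OF smooth_D_dir[OF sm that]])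
  have sup: "\<exists>\<rho>. \<forall>w\<in>ball w0 1. \<forall>z. z \<notin> cball 0 \<rho> \<longrightarrow> F w z = 0" for w0
  proof (intro exI[of _ "R + norm (fst w0) + 1"] ballI allI impI)
    fix w :: "'a \<times> 'b" and z :: 'a assume w: "w \<in> ball w0 1" and z: "z \<notin> cball 0 (R + norm (fst w0) + 1)"
    have "norm (fst w - fst w0) \<le> 1" using w dist_fst_le[of w w0] by (simp add: dist_norm norm_minus_commute)
    then have "norm (fst w) \<le> norm (fst w0) + 1" by norm
    then have "norm (fst w + z) > R" using z norm_triangle_ineq4[of "fst w + z" "fst w"] by simp
    then show "F w z = 0" using R(2)[of "fst w + z" "snd w"] by (cases w) (simp add: F_def)
  qed
  have Ud: "(\<lambda>w. ufour u w \<zeta>) = (\<lambda>w. LINT z|lborel. F w z)" using U[of F u] by (simp add: F_def fun_eq_iff)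
  show "(\<lambda>w. ufour u w \<zeta>) differentiable_on UNIV"
    unfolding differentiable_on_UNIV Ud using D_dir_integral_compact(1)[OF diff cont contD sup] by blast
  show "D_dir c (\<lambda>w. ufour u w \<zeta>) = (\<lambda>w. ufour (D_dir c u) w \<zeta>)" if "c \<in> Basis"
    unfolding Ud
  proof
    fix w
    have "D_dir c (\<lambda>w. LINT z|lborel. F w z) w = (LINT z|lborel. D_dir c (\<lambda>w. F w z) w)"
      by (rule D_dir_integral_compact(2)[OF diff cont contD sup that])
    also have "\<dots> = ufour (D_dir c u) w \<zeta>"
      by (subst U[of "\<lambda>w z. cis (- (z \<bullet> \<zeta>)) * D_dir c u (w + (z, 0))" "D_dir c u"]) (auto simp: DF)
    finally show "D_dir c (\<lambda>w. LINT z|lborel. F w z) w = ufour (D_dir c u) w \<zeta>" .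
  qed
qed

text \<open>Integrating the symbol estimate over a bounded set costs only its measure. The map
  \<open>h\<close> covers both uses: slices of a symbol over x, and slices in z of a symbol over
  pairs (x, z).\<close>

lemma csymbol_L1_bound:
  fixes v :: "'p::euclidean_space \<times> 'b::euclidean_space \<Rightarrow> complex" and h :: "'c \<Rightarrow> 'a::euclidean_space \<Rightarrow> 'p"
  assumes v: "v \<in> symbols m" and K: "compact K" and "A \<in> sets borel" "bounded A"
    and sup: "\<And>x y \<xi>. x \<in> X \<Longrightarrow> y \<notin> A \<Longrightarrow> v (h x y, \<xi>) = 0"
    and h: "\<And>x y. x \<in> X \<Longrightarrow> y \<in> A \<Longrightarrow> h x y \<in> K"
    and hc: "\<And>x. continuous_on UNIV (h x)"
  shows "\<exists>C\<ge>0. \<forall>x\<in>X. \<forall>\<xi>. (LINT y|lborel. norm (v (h x y, \<xi>))) \<le> C * japanese \<xi> powr m"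
proof -
  obtain C where C: "C \<ge> 0" "\<And>x \<theta>. x \<in> K \<Longrightarrow> norm (v (x, \<theta>)) \<le> C * japanese \<theta> powr m"
    using symbol_boundE[OF symbols_bound[OF v] K] by metis
  have fin: "emeasure lborel A < \<infinity>" by (rule emeasure_bounded_finite[OF assms(4)])
  have "(LINT y|lborel. norm (v (h x y, \<xi>))) \<le> measure lborel A * C * japanese \<xi> powr m" if x: "x \<in> X" for x \<xi>
  proof -
    have "(LINT y|lborel. norm (v (h x y, \<xi>))) \<le> (LINT y|lborel. indicator A y * (C * japanese \<xi> powr m))"
    proof (rule integral_mono')
      show "integrable lborel (\<lambda>y. indicator A y * (C * japanese \<xi> powr m))"
        using assms(3) fin by (intro integrable_mult_left integrable_real_indicator) auto
      show "norm (v (h x y, \<xi>)) \<le> indicator A y * (C * japanese \<xi> powr m)" for y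
        using C(2)[OF h[OF x]] sup[OF x] by (cases "y \<in> A") auto
    qed (use C(1) in auto)
    also have "\<dots> = measure lborel A * C * japanese \<xi> powr m"
      using assms(3) by simp
    finally show ?thesis .
  qed
  then show ?thesis using C(1) by (intro exI[of _ "measure lborel A * C"]) auto
qed

lemma funpow_D_dir_fst: "(D_dir b ^^ k) (\<lambda>x. a (x, \<theta>)) = (\<lambda>x. (D_dir (b, 0) ^^ k) a (x, \<theta>))"
  by (induction k) (auto simp: D_dir_Pair_fst)

lemma symbols_funpow_D_dir:
  fixes a :: "'a::euclidean_space \<times> 'b::euclidean_space \<Rightarrow> complex"
  assumes "a \<in> symbols m" "(b, 0::'b) \<in> Basis"
  shows "(D_dir (b, 0) ^^ k) a \<in> symbols m"
proof (induction k)
  case (Suc k)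
  from symbols_D_dir[OF this assms(2)] show ?case by (simp add: snd_weight_def)
qed (use assms in simp)

text \<open>Decay in \<zeta> costs derivatives in the base variable, and these do not raise the
  order in \<xi>. The bound is uniform in all x because centring at x only multiplies the transform
  by a phase.\<close>

lemma ufour_bound:
  fixes u :: "'a::euclidean_space \<times> 'b::euclidean_space \<Rightarrow> complex"
  assumes u: "csymbol m u"
  shows "\<exists>C\<ge>0. \<forall>x \<xi> \<zeta>. norm (ufour u (x, \<xi>) \<zeta>) \<le> C * japanese \<xi> powr m * japanese \<zeta> powr (- real k)"
proof -
  obtain R where R: "R > 0" "\<And>x \<xi>. x \<notin> cball 0 R \<Longrightarrow> u (x, \<xi>) = 0"
    using csymbolE[OF u] by metis
  have L: "\<exists>C\<ge>0. \<forall>\<xi>. (LINT y|lborel. norm (v (y, \<xi>))) \<le> C * japanese \<xi> powr m"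
    if v: "v \<in> symbols m" "\<And>x \<xi>. x \<notin> cball 0 R \<Longrightarrow> v (x, \<xi>) = 0" for v :: "'a \<times> 'b \<Rightarrow> complex"
    using csymbol_L1_bound[OF v(1), of "cball 0 R" "cball 0 R" UNIV "\<lambda>_ y. y"] v(2)
    by (auto simp: continuous_on_id)
  have van: "(D_dir (b, 0) ^^ k) u (x, \<xi>) = 0" if "x \<notin> cball 0 R" for b x \<xi>
    using that
  proof (induction k arbitrary: x \<xi>)
    case (Suc k)
    have "D_dir (b, 0) ((D_dir (b, 0) ^^ k) u) (x, \<xi>) = 0"
    proof (rule D_dir_vanish[where B = "cball 0 R \<times> UNIV"])
      show "(D_dir (b, 0) ^^ k) u z = 0" if "z \<notin> cball 0 R \<times> UNIV" for z
        using Suc.IH[of "fst z" "snd z"] that by (auto simp: mem_Times_iff)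
    qed (use Suc.prems in \<open>auto intro: closed_Times\<close>)
    then show ?case by simp
  qed (use R in simp)
  have "\<exists>C\<ge>0. \<forall>\<xi>. (LINT y|lborel. norm ((D_dir (b, 0) ^^ k) u (y, \<xi>))) \<le> C * japanese \<xi> powr m" if "b \<in> Basis" for b
    using that van by (intro L symbols_funpow_D_dir csymbol_symbols[OF u]) (auto simp: Basis_prod_def)
  then obtain C where C: "\<And>b. b \<in> Basis \<Longrightarrow> C b \<ge> 0"
      "\<And>b \<xi>. b \<in> Basis \<Longrightarrow> (LINT y|lborel. norm ((D_dir (b, 0) ^^ k) u (y, \<xi>))) \<le> C b * japanese \<xi> powr m"
    by metis
  obtain C0 where C0: "C0 \<ge> 0" "\<And>\<xi>. (LINT y|lborel. norm (u (y, \<xi>))) \<le> C0 * japanese \<xi> powr m"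
    using L[OF csymbol_symbols[OF u] R(2)] by metis
  have "norm (ufour u (x, \<xi>) \<zeta>) \<le> ((1 + real DIM('a)) ^ k * (C0 + (\<Sum>b\<in>Basis. C b))) * japanese \<xi> powr m * japanese \<zeta> powr (- real k)"
    for x \<xi> \<zeta>
  proof -
    have t: "(\<lambda>y. u (y, \<xi>)) \<in> test_functions" using csymbol_slice[OF u, of 0 \<xi>] by simp
    have "japanese \<zeta> ^ k * norm (ufour u (x, \<xi>) \<zeta>) = japanese \<zeta> ^ k * norm (fourier (\<lambda>y. u (y, \<xi>)) \<zeta>)"
      by (simp add: ufour_eq[OF symbols_smooth[OF csymbol_symbols[OF u]]] norm_mult)
    also have "\<dots> \<le> (1 + real DIM('a)) ^ k *
      ((LINT y|lborel. norm (u (y, \<xi>))) + (\<Sum>b\<in>Basis. LINT y|lborel. norm ((D_dir b ^^ k) (\<lambda>y. u (y, \<xi>)) y)))"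
      by (rule fourier_decay[OF t])
    also have "\<dots> \<le> (1 + real DIM('a)) ^ k * (C0 * japanese \<xi> powr m + (\<Sum>b\<in>Basis. C b * japanese \<xi> powr m))"
      unfolding funpow_D_dir_fst by (intro mult_left_mono add_mono sum_mono C0 C) auto
    also have "\<dots> = ((1 + real DIM('a)) ^ k * (C0 + (\<Sum>b\<in>Basis. C b))) * japanese \<xi> powr m"
      by (simp add: sum_distrib_right sum_distrib_left algebra_simps)
    finally have "norm (ufour u (x, \<xi>) \<zeta>) \<le> ((1 + real DIM('a)) ^ k * (C0 + (\<Sum>b\<in>Basis. C b))) * japanese \<xi> powr m / japanese \<zeta> ^ k"
      by (subst pos_le_divide_eq) (simp_all add: mult_ac)
    then show ?thesis by (simp add: powr_minus powr_realpow divide_inverse)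
  qed
  moreover have "0 \<le> (1 + real DIM('a)) ^ k * (C0 + (\<Sum>b\<in>Basis. C b))"
    using C C0 by (intro mult_nonneg_nonneg add_nonneg_nonneg sum_nonneg) auto
  ultimately show ?thesis by blast
qed

section \<open>Peetre's inequality\<close>

lemma japanese_add: "japanese (\<xi> + \<zeta>) \<le> 2 * japanese \<xi> * japanese \<zeta>"
proof -
  have "(norm (\<xi> + \<zeta>))\<^sup>2 \<le> (norm \<xi> + norm \<zeta>)\<^sup>2"
    by (intro power_mono norm_triangle_ineq) auto
  also have "\<dots> \<le> 2 * (norm \<xi>)\<^sup>2 + 2 * (norm \<zeta>)\<^sup>2"
    using sum_squares_ge_zero[of "norm \<xi> - norm \<zeta>" 0] by (simp add: power2_eq_square algebra_simps)
  finally have "(norm (\<xi> + \<zeta>))\<^sup>2 \<le> 2 * (norm \<xi>)\<^sup>2 + 2 * (norm \<zeta>)\<^sup>2" .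
  moreover have "4 * ((1 + (norm \<xi>)\<^sup>2) * (1 + (norm \<zeta>)\<^sup>2)) = 4 + 4 * (norm \<xi>)\<^sup>2 + 4 * (norm \<zeta>)\<^sup>2 + 4 * ((norm \<xi>)\<^sup>2 * (norm \<zeta>)\<^sup>2)"
    by (simp add: algebra_simps)
  moreover have "0 \<le> (norm \<xi>)\<^sup>2" "0 \<le> (norm \<zeta>)\<^sup>2" "0 \<le> (norm \<xi>)\<^sup>2 * (norm \<zeta>)\<^sup>2" by simp_all
  ultimately have "1 + (norm (\<xi> + \<zeta>))\<^sup>2 \<le> 4 * ((1 + (norm \<xi>)\<^sup>2) * (1 + (norm \<zeta>)\<^sup>2))"
    by linarith
  then have "japanese (\<xi> + \<zeta>) \<le> sqrt (4 * ((1 + (norm \<xi>)\<^sup>2) * (1 + (norm \<zeta>)\<^sup>2)))"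
    unfolding japanese_def by (rule real_sqrt_le_mono)
  also have "\<dots> = 2 * japanese \<xi> * japanese \<zeta>"
    unfolding japanese_def by (simp add: real_sqrt_mult)
  finally show ?thesis .
qed

lemma japanese_minus [simp]: "japanese (- \<zeta>) = japanese \<zeta>"
  by (simp add: japanese_def)

text \<open>For negative \<open>m\<close> the bound for sums is applied to \<xi> = (\<xi> + \<zeta>)
  + (- \<zeta>), which gives the needed lower bound for
  \<open>japanese (\<xi> + \<zeta>)\<close>.\<close>

lemma peetre: "japanese (\<xi> + \<zeta>) powr m \<le> 2 powr \<bar>m\<bar> * japanese \<xi> powr m * japanese \<zeta> powr \<bar>m\<bar>"
proof (cases "m \<ge> 0")
  case True
  then have "japanese (\<xi> + \<zeta>) powr m \<le> (2 * japanese \<xi> * japanese \<zeta>) powr m"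
    using japanese_add[of \<xi> \<zeta>] by (intro powr_mono2) (auto intro: less_imp_le)
  then show ?thesis using True by (simp add: powr_mult less_imp_le)
next
  case False
  have "japanese \<xi> \<le> 2 * japanese (\<xi> + \<zeta>) * japanese \<zeta>"
    using japanese_add[of "\<xi> + \<zeta>" "- \<zeta>"] by simp
  then have "japanese \<xi> powr (- m) \<le> (2 * japanese (\<xi> + \<zeta>) * japanese \<zeta>) powr (- m)"
    using False by (intro powr_mono2) (auto intro: less_imp_le)
  also have "\<dots> = 2 powr (- m) * japanese (\<xi> + \<zeta>) powr (- m) * japanese \<zeta> powr (- m)"
    by (simp add: powr_mult less_imp_le)
  finally show ?thesis
    using False by (simp add: powr_minus field_simps)
qed

lemma japanese_scale_le:
  assumes "\<bar>t\<bar> \<le> 1" shows "japanese (t *\<^sub>R \<zeta>) \<le> japanese \<zeta>"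
proof -
  have "(\<bar>t\<bar> * norm \<zeta>)\<^sup>2 \<le> (norm \<zeta>)\<^sup>2"
    using assms by (intro power_mono mult_left_le_one_le) auto
  then show ?thesis by (simp add: japanese_def)
qed

lemma norm_le_japanese: "norm \<zeta> \<le> japanese \<zeta>"
  unfolding japanese_def by (rule real_le_rsqrt) simp

section \<open>Taylor expansion of symbols\<close>

text \<open>The monomial \<zeta>^\<alpha>, formed over the same list that defines
  \<open>D_mi\<close>, so that the Fourier transform of an iterated derivative matches it factor by
  factor.\<close>

definition mi_power :: "'a::euclidean_space \<Rightarrow> ('a \<Rightarrow> nat) \<Rightarrow> real" where
  "mi_power \<zeta> \<alpha> = prod_list (map (\<lambda>b. \<zeta> \<bullet> b) (mi_list \<alpha>))"

abbreviation mi_incr :: "('a \<Rightarrow> nat) \<Rightarrow> 'a \<Rightarrow> 'a \<Rightarrow> nat" where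
  "mi_incr \<alpha> b \<equiv> \<alpha>(b := Suc (\<alpha> b))"

lemma finite_multi_indices_le: "finite {\<alpha>::'a::euclidean_space \<Rightarrow> nat. \<alpha> \<in> multi_indices \<and> mi_order \<alpha> \<le> N}"
proof -
  have "finite {\<alpha>::'a \<Rightarrow> nat. \<forall>b. (b \<in> Basis \<longrightarrow> \<alpha> b \<in> {..N}) \<and> (b \<notin> Basis \<longrightarrow> \<alpha> b = 0)}"
    by (rule finite_set_of_finite_funs) auto
  moreover have "\<alpha> b \<le> mi_order \<alpha>" if "b \<in> Basis" for \<alpha> :: "'a \<Rightarrow> nat" and b
    unfolding mi_order_def using that by (intro member_le_sum) auto
  ultimately show ?thesis
    by (elim rev_finite_subset) (auto simp: multi_indices_def intro: order.trans)
qed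

lemma finite_multi_indices_less: "finite {\<alpha>::'a::euclidean_space \<Rightarrow> nat. \<alpha> \<in> multi_indices \<and> mi_order \<alpha> < N}"
  by (rule finite_subset[OF _ finite_multi_indices_le[of N]]) auto

lemma finite_multi_indices_eq: "finite {\<alpha>::'a::euclidean_space \<Rightarrow> nat. \<alpha> \<in> multi_indices \<and> mi_order \<alpha> = N}"
  by (rule finite_subset[OF _ finite_multi_indices_le[of N]]) auto

lemma mi_incr:
  fixes \<alpha> :: "'a::euclidean_space \<Rightarrow> nat"
  assumes b: "b \<in> Basis"
  shows "mi_order (mi_incr \<alpha> b) = Suc (mi_order \<alpha>)" "mi_fact (mi_incr \<alpha> b) = Suc (\<alpha> b) * mi_fact \<alpha>"
    "mset (mi_list (mi_incr \<alpha> b)) = mset (b # mi_list \<alpha>)"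
proof -
  have "mi_order (mi_incr \<alpha> b) = Suc (\<alpha> b) + (\<Sum>c\<in>Basis - {b}. \<alpha> c)"
    unfolding mi_order_def using b by (subst sum.remove[of _ b]) (auto intro!: sum.cong)
  moreover have "mi_order \<alpha> = \<alpha> b + (\<Sum>c\<in>Basis - {b}. \<alpha> c)"
    unfolding mi_order_def using b by (subst sum.remove[of _ b]) auto
  ultimately show "mi_order (mi_incr \<alpha> b) = Suc (mi_order \<alpha>)" by simp
  have "mi_fact (mi_incr \<alpha> b) = fact (Suc (\<alpha> b)) * (\<Prod>c\<in>Basis - {b}. fact (\<alpha> c))"
    unfolding mi_fact_def using b by (subst prod.remove[of _ b]) (auto intro!: prod.cong)
  moreover have "mi_fact \<alpha> = fact (\<alpha> b) * (\<Prod>c\<in>Basis - {b}. fact (\<alpha> c))"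
    unfolding mi_fact_def using b by (subst prod.remove[of _ b]) auto
  ultimately show "mi_fact (mi_incr \<alpha> b) = Suc (\<alpha> b) * mi_fact \<alpha>" by (simp add: algebra_simps)
  show "mset (mi_list (mi_incr \<alpha> b)) = mset (b # mi_list \<alpha>)"
  proof (rule multiset_eqI)
    fix x show "count (mset (mi_list (mi_incr \<alpha> b))) x = count (mset (b # mi_list \<alpha>)) x"
      using b count_mi_list[of "mi_incr \<alpha> b" x] count_mi_list[of \<alpha> x] by auto
  qed
qed

lemma mi_power_incr:
  assumes "b \<in> Basis" shows "mi_power \<zeta> (mi_incr \<alpha> b) = (\<zeta> \<bullet> b) * mi_power \<zeta> \<alpha>"
proof -
  have "mi_power \<zeta> \<beta> = prod_mset (image_mset (\<lambda>b. \<zeta> \<bullet> b) (mset (mi_list \<beta>)))" for \<beta>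
    unfolding mi_power_def by (metis mset_map prod_mset_prod_list)
  then show ?thesis using mi_incr(3)[OF assms, of \<alpha>] by simp
qed

lemma mi_order_0_iff: "\<alpha> \<in> multi_indices \<Longrightarrow> mi_order \<alpha> = 0 \<longleftrightarrow> \<alpha> = (\<lambda>_. 0)"
  by (auto simp: multi_indices_def mi_order_def fun_eq_iff)

text \<open>A multi-index \<beta> of order k + 1 arises from \<beta> - e_b for each b with \<beta> b
  > 0. Since \<beta>! is \<beta> b times the factorial of \<beta> - e_b, that origin contributes the
  weight \<beta> b / \<beta>!. The weights add up to (k + 1) / \<beta>!.\<close>

lemma sum_multi_indices_step:
  fixes F :: "('a::euclidean_space \<Rightarrow> nat) \<Rightarrow> complex"
  shows "(\<Sum>\<alpha> | \<alpha> \<in> multi_indices \<and> mi_order \<alpha> = k. (\<Sum>b\<in>Basis. F (mi_incr \<alpha> b)) / of_nat (mi_fact \<alpha>))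
    = of_nat (Suc k) * (\<Sum>\<beta> | \<beta> \<in> multi_indices \<and> mi_order \<beta> = Suc k. F \<beta> / of_nat (mi_fact \<beta>))"
    (is "?L = ?R")
proof -
  have fnz: "mi_fact \<alpha> \<noteq> 0" for \<alpha> :: "'a \<Rightarrow> nat" by (simp add: mi_fact_def)
  have *: "(\<Sum>\<alpha> | \<alpha> \<in> multi_indices \<and> mi_order \<alpha> = k. F (mi_incr \<alpha> b) / of_nat (mi_fact \<alpha>))
      = (\<Sum>\<beta> | \<beta> \<in> multi_indices \<and> mi_order \<beta> = Suc k. of_nat (\<beta> b) * F \<beta> / of_nat (mi_fact \<beta>))"
    (is "sum ?f ?A = sum ?g ?B") if b: "b \<in> Basis" for b
  proof -
    have "sum ?g ?B = sum ?g {\<beta> \<in> ?B. \<beta> b \<noteq> 0}"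
      by (intro sum.mono_neutral_right finite_multi_indices_eq) auto
    also have "\<dots> = sum ?f ?A"
    proof (rule sum.reindex_bij_witness[of _ "\<lambda>\<alpha>. mi_incr \<alpha> b" "\<lambda>\<beta>. \<beta>(b := \<beta> b - 1)"])
      fix \<beta> assume \<beta>: "\<beta> \<in> {\<beta> \<in> ?B. \<beta> b \<noteq> 0}"
      then have eq: "\<beta> = mi_incr (\<beta>(b := \<beta> b - 1)) b" by (auto simp: fun_eq_iff)
      show "mi_incr (\<beta>(b := \<beta> b - 1)) b = \<beta>" using eq by simp
      have "mi_order \<beta> = Suc (mi_order (\<beta>(b := \<beta> b - 1)))"
        using mi_incr(1)[OF b, of "\<beta>(b := \<beta> b - 1)"] eq by simp
      then show "\<beta>(b := \<beta> b - 1) \<in> ?A" using \<beta> by (auto simp: multi_indices_def)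
      have "mi_fact \<beta> = \<beta> b * mi_fact (\<beta>(b := \<beta> b - 1))"
      proof -
        have "Suc ((\<beta>(b := \<beta> b - 1)) b) = \<beta> b" using \<beta> by auto
        then show ?thesis using mi_incr(2)[OF b, of "\<beta>(b := \<beta> b - 1)"] eq by metis
      qed
      then show "F (mi_incr (\<beta>(b := \<beta> b - 1)) b) / of_nat (mi_fact (\<beta>(b := \<beta> b - 1))) = of_nat (\<beta> b) * F \<beta> / of_nat (mi_fact \<beta>)"
        using \<beta> eq by (simp add: fnz)
    next
      fix \<alpha> assume \<alpha>: "\<alpha> \<in> ?A"
      show "(mi_incr \<alpha> b)(b := mi_incr \<alpha> b b - 1) = \<alpha>" by simp
      show "mi_incr \<alpha> b \<in> {\<beta> \<in> ?B. \<beta> b \<noteq> 0}"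
        using \<alpha> b mi_incr(1)[OF b, of \<alpha>] by (auto simp: multi_indices_def)
    qed
    finally show ?thesis by simp
  qed
  have "?L = (\<Sum>b\<in>Basis. \<Sum>\<alpha> | \<alpha> \<in> multi_indices \<and> mi_order \<alpha> = k. F (mi_incr \<alpha> b) / of_nat (mi_fact \<alpha>))"
    by (subst sum.swap) (simp add: sum_divide_distrib)
  also have "\<dots> = (\<Sum>\<beta> | \<beta> \<in> multi_indices \<and> mi_order \<beta> = Suc k. \<Sum>b\<in>Basis. of_nat (\<beta> b) * F \<beta> / of_nat (mi_fact \<beta>))"
    by (subst sum.swap) (simp add: *)
  also have "\<dots> = ?R"
    unfolding sum_distrib_left
  proof (rule sum.cong[OF refl])
    fix \<beta> :: "'a \<Rightarrow> nat" assume "\<beta> \<in> {\<beta> \<in> multi_indices. mi_order \<beta> = Suc k}"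
    then have "(\<Sum>b\<in>Basis. of_nat (\<beta> b)) = (of_nat (Suc k) :: complex)"
      by (simp add: mi_order_def flip: of_nat_sum)
    then show "(\<Sum>b\<in>Basis. of_nat (\<beta> b) * F \<beta> / of_nat (mi_fact \<beta>)) = of_nat (Suc k) * (F \<beta> / of_nat (mi_fact \<beta>))"
      by (simp add: sum_divide_distrib[symmetric] sum_distrib_right[symmetric])
  qed
  finally show ?thesis .
qed

lemma D_dir_D_snd:
  fixes p :: "'a::euclidean_space \<times> 'b::euclidean_space \<Rightarrow> complex"
  assumes "smooth p" "b \<in> Basis"
  shows "D_dir (0, b) (D_snd \<alpha> p) = D_snd (mi_incr \<alpha> b) p"
proof -
  have "D_snd (mi_incr \<alpha> b) p = foldr D_dir (map (\<lambda>b. (0, b)) (b # mi_list \<alpha>)) p"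
    unfolding D_snd_eq
  proof (rule foldr_D_dir_mset[OF assms(1) snd_list_subset_Basis[OF set_mi_list]])
    show "mset (map (Pair (0::'a)) (mi_list (mi_incr \<alpha> b))) = mset (map (Pair 0) (b # mi_list \<alpha>))"
      using mi_incr(3)[OF assms(2), of \<alpha>] by (metis mset_map)
  qed
  then show ?thesis unfolding D_snd_eq by simp
qed

lemma has_vector_derivative_snd:
  fixes q :: "'a::euclidean_space \<times> 'b::euclidean_space \<Rightarrow> complex"
  assumes "smooth q"
  shows "((\<lambda>t. q (x, \<xi> + t *\<^sub>R \<zeta>)) has_vector_derivative
    (\<Sum>b\<in>Basis. (\<zeta> \<bullet> b) *\<^sub>R (\<i> * D_dir (0, b) q (x, \<xi> + t *\<^sub>R \<zeta>)))) (at t within S)"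
proof -
  have "((\<lambda>t::real. (x, \<xi> + t *\<^sub>R \<zeta>)) has_derivative (\<lambda>t. (0, t *\<^sub>R \<zeta>))) (at t)"
    by (auto intro!: derivative_eq_intros)
  from diff_chain_at[OF this has_derivative_D_dir[OF smooth_differentiable[OF assms]]]
  have "((\<lambda>t. q (x, \<xi> + t *\<^sub>R \<zeta>)) has_derivative
     (\<lambda>s. \<Sum>c\<in>Basis. ((0, s *\<^sub>R \<zeta>) \<bullet> c) *\<^sub>R (\<i> * D_dir c q (x, \<xi> + t *\<^sub>R \<zeta>)))) (at t)"
    by (simp add: o_def)
  moreover have "(\<Sum>c\<in>Basis. ((0, s *\<^sub>R \<zeta>) \<bullet> c) *\<^sub>R (\<i> * D_dir c q (x, \<xi> + t *\<^sub>R \<zeta>)))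
      = s *\<^sub>R (\<Sum>b\<in>Basis. (\<zeta> \<bullet> b) *\<^sub>R (\<i> * D_dir (0, b) q (x, \<xi> + t *\<^sub>R \<zeta>)))" for s
  proof -
    have "(\<Sum>c\<in>Basis. ((0, s *\<^sub>R \<zeta>) \<bullet> c) *\<^sub>R (\<i> * D_dir c q (x, \<xi> + t *\<^sub>R \<zeta>)))
      = (\<Sum>c\<in>(\<lambda>b::'b. (0::'a, b)) ` Basis. ((0, s *\<^sub>R \<zeta>) \<bullet> c) *\<^sub>R (\<i> * D_dir c q (x, \<xi> + t *\<^sub>R \<zeta>)))"
      by (intro sum.mono_neutral_right) (auto simp: Basis_prod_def)
    also have "\<dots> = (\<Sum>b\<in>Basis. ((0, s *\<^sub>R \<zeta>) \<bullet> (0, b)) *\<^sub>R (\<i> * D_dir (0, b) q (x, \<xi> + t *\<^sub>R \<zeta>)))"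
      by (subst sum.reindex) (auto simp: inj_on_def)
    finally show ?thesis by (simp add: scaleR_sum_right)
  qed
  ultimately have "((\<lambda>t. q (x, \<xi> + t *\<^sub>R \<zeta>)) has_vector_derivative
    (\<Sum>b\<in>Basis. (\<zeta> \<bullet> b) *\<^sub>R (\<i> * D_dir (0, b) q (x, \<xi> + t *\<^sub>R \<zeta>)))) (at t)"
    by (simp add: has_vector_derivative_def)
  then show ?thesis by (rule has_vector_derivative_at_within)
qed

lemma mi_power_le: "\<bar>mi_power \<zeta> \<alpha>\<bar> \<le> japanese \<zeta> ^ mi_order \<alpha>"
proof -
  have "\<bar>prod_list (map (\<lambda>b. \<zeta> \<bullet> b) bs)\<bar> \<le> japanese \<zeta> ^ length bs" if "set bs \<subseteq> Basis" for bs
    using that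
  proof (induction bs)
    case (Cons b bs)
    have "\<bar>\<zeta> \<bullet> b\<bar> \<le> japanese \<zeta>"
      using Cons.prems Basis_le_norm[of b \<zeta>] norm_le_japanese[of \<zeta>] by simp
    then show ?case using Cons japanese_ge_1[of \<zeta>]
      by (simp add: abs_mult) (intro mult_mono, auto)
  qed simp
  from this[OF set_mi_list] show ?thesis by (simp add: mi_power_def length_mi_list)
qed

text \<open>The factor \<open>fact k\<close> makes \<open>taylor_term (Suc k)\<close> the derivative of \<open>taylor_term k\<close>.\<close>

definition taylor_term :: "('a::euclidean_space \<times> 'b::euclidean_space \<Rightarrow> complex) \<Rightarrow> 'a \<Rightarrow> 'b \<Rightarrow> 'b \<Rightarrow> nat \<Rightarrow> real \<Rightarrow> complex" where
  "taylor_term p x \<xi> \<zeta> k t = fact k * (\<Sum>\<alpha> | \<alpha> \<in> multi_indices \<and> mi_order \<alpha> = k.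
     \<i> ^ k * complex_of_real (mi_power \<zeta> \<alpha>) * D_snd \<alpha> p (x, \<xi> + t *\<^sub>R \<zeta>) / of_nat (mi_fact \<alpha>))"

text \<open>Differentiation along \<zeta> replaces each \<alpha> by all its successors \<alpha> +
  e_b. Regrouping by the new multi-index produces the factor k + 1 that completes the next
  factorial.\<close>

lemma taylor_term_derivative:
  fixes p :: "'a::euclidean_space \<times> 'b::euclidean_space \<Rightarrow> complex"
  assumes p: "smooth p"
  shows "(taylor_term p x \<xi> \<zeta> k has_vector_derivative taylor_term p x \<xi> \<zeta> (Suc k) t) (at t within S)"
proof -
  let ?A = "{\<alpha>::'b \<Rightarrow> nat. \<alpha> \<in> multi_indices \<and> mi_order \<alpha> = k}"
  define F where "F \<beta> = \<i> ^ Suc k * complex_of_real (mi_power \<zeta> \<beta>) * D_snd \<beta> p (x, \<xi> + t *\<^sub>R \<zeta>)" for \<beta>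
  have sm: "smooth (D_snd \<alpha> p)" for \<alpha>
    unfolding D_snd_eq by (intro smooth_foldr_D_dir p snd_list_subset_Basis set_mi_list)
  have "((\<lambda>t. fact k * (\<Sum>\<alpha>\<in>?A. (\<i> ^ k * complex_of_real (mi_power \<zeta> \<alpha>) / of_nat (mi_fact \<alpha>)) * D_snd \<alpha> p (x, \<xi> + t *\<^sub>R \<zeta>)))
     has_vector_derivative fact k * (\<Sum>\<alpha>\<in>?A. (\<i> ^ k * complex_of_real (mi_power \<zeta> \<alpha>) / of_nat (mi_fact \<alpha>)) *
       (\<Sum>b\<in>Basis. (\<zeta> \<bullet> b) *\<^sub>R (\<i> * D_dir (0, b) (D_snd \<alpha> p) (x, \<xi> + t *\<^sub>R \<zeta>))))) (at t within S)"
    by (intro has_vector_derivative_mult_right has_vector_derivative_sum has_vector_derivative_snd sm)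
  moreover have "(\<lambda>t. fact k * (\<Sum>\<alpha>\<in>?A. (\<i> ^ k * complex_of_real (mi_power \<zeta> \<alpha>) / of_nat (mi_fact \<alpha>)) * D_snd \<alpha> p (x, \<xi> + t *\<^sub>R \<zeta>)))
      = taylor_term p x \<xi> \<zeta> k"
    unfolding taylor_term_def by (intro ext arg_cong2[where f = "(*)"] refl sum.cong) (simp add: field_simps)
  moreover have "fact k * (\<Sum>\<alpha>\<in>?A. (\<i> ^ k * complex_of_real (mi_power \<zeta> \<alpha>) / of_nat (mi_fact \<alpha>)) *
       (\<Sum>b\<in>Basis. (\<zeta> \<bullet> b) *\<^sub>R (\<i> * D_dir (0, b) (D_snd \<alpha> p) (x, \<xi> + t *\<^sub>R \<zeta>)))) = taylor_term p x \<xi> \<zeta> (Suc k) t"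
  proof -
    have "(\<Sum>\<alpha>\<in>?A. (\<i> ^ k * complex_of_real (mi_power \<zeta> \<alpha>) / of_nat (mi_fact \<alpha>)) *
       (\<Sum>b\<in>Basis. (\<zeta> \<bullet> b) *\<^sub>R (\<i> * D_dir (0, b) (D_snd \<alpha> p) (x, \<xi> + t *\<^sub>R \<zeta>))))
       = (\<Sum>\<alpha>\<in>?A. (\<Sum>b\<in>Basis. F (mi_incr \<alpha> b)) / of_nat (mi_fact \<alpha>))"
    proof (rule sum.cong[OF refl])
      fix \<alpha> :: "'b \<Rightarrow> nat"
      have "(\<i> ^ k * complex_of_real (mi_power \<zeta> \<alpha>)) * ((\<zeta> \<bullet> b) *\<^sub>R (\<i> * D_dir (0, b) (D_snd \<alpha> p) (x, \<xi> + t *\<^sub>R \<zeta>))) = F (mi_incr \<alpha> b)"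
        if "b \<in> Basis" for b
        unfolding F_def D_dir_D_snd[OF p that] mi_power_incr[OF that] by (simp add: scaleR_conv_of_real mult_ac)
      then have "(\<Sum>b\<in>Basis. F (mi_incr \<alpha> b)) = (\<i> ^ k * complex_of_real (mi_power \<zeta> \<alpha>)) * (\<Sum>b\<in>Basis. (\<zeta> \<bullet> b) *\<^sub>R (\<i> * D_dir (0, b) (D_snd \<alpha> p) (x, \<xi> + t *\<^sub>R \<zeta>)))"
        by (simp add: sum_distrib_left)
      then show "(\<i> ^ k * complex_of_real (mi_power \<zeta> \<alpha>) / of_nat (mi_fact \<alpha>)) *
       (\<Sum>b\<in>Basis. (\<zeta> \<bullet> b) *\<^sub>R (\<i> * D_dir (0, b) (D_snd \<alpha> p) (x, \<xi> + t *\<^sub>R \<zeta>))) = (\<Sum>b\<in>Basis. F (mi_incr \<alpha> b)) / of_nat (mi_fact \<alpha>)"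
        by simp
    qed
    also have "\<dots> = of_nat (Suc k) * (\<Sum>\<beta> | \<beta> \<in> multi_indices \<and> mi_order \<beta> = Suc k. F \<beta> / of_nat (mi_fact \<beta>))"
      by (rule sum_multi_indices_step)
    finally show ?thesis
      unfolding taylor_term_def F_def fact_Suc by (simp only: mult_ac)
  qed
  ultimately show ?thesis by simp
qed

text \<open>The exponent of \<open>japanese \<zeta>\<close> has two sources: N from the monomial,
  and the absolute value of m - N from Peetre's inequality at the intermediate frequency \<xi> + t
  \<zeta>. The same inequality supplies the power of 2 in the constant.\<close>

lemma taylor_term_bound:
  fixes p :: "'a::euclidean_space \<times> 'b::euclidean_space \<Rightarrow> complex"
  assumes p: "p \<in> symbols m" and K: "compact K"
  shows "\<exists>C\<ge>0. \<forall>x\<in>K. \<forall>\<xi> \<zeta>. \<forall>t\<in>{0..1}. norm (taylor_term p x \<xi> \<zeta> N t) \<le>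
    C * japanese \<xi> powr (m - real N) * japanese \<zeta> powr (real N + \<bar>m - real N\<bar>)"
proof -
  let ?A = "{\<alpha>::'b \<Rightarrow> nat. \<alpha> \<in> multi_indices \<and> mi_order \<alpha> = N}"
  have "\<exists>C\<ge>0. \<forall>x\<in>K. \<forall>\<theta>. norm (D_snd \<alpha> p (x, \<theta>)) \<le> C * japanese \<theta> powr (m - real (mi_order \<alpha>))" for \<alpha>
    using symbol_boundE[OF symbols_bound[OF symbols_D_snd[OF p, of \<alpha>]] K] by metis
  then obtain C where C: "\<And>\<alpha>. C \<alpha> \<ge> 0" "\<And>\<alpha> x \<theta>. x \<in> K \<Longrightarrow> norm (D_snd \<alpha> p (x, \<theta>)) \<le> C \<alpha> * japanese \<theta> powr (m - real (mi_order \<alpha>))"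
    by metis
  define B where "B = 2 powr \<bar>m - real N\<bar>"
  have "norm (taylor_term p x \<xi> \<zeta> N t) \<le> (fact N * (\<Sum>\<alpha>\<in>?A. B * C \<alpha>)) * japanese \<xi> powr (m - real N) * japanese \<zeta> powr (real N + \<bar>m - real N\<bar>)"
    if x: "x \<in> K" and t: "t \<in> {0..1}" for x \<xi> \<zeta> t
  proof -
    let ?J = "japanese \<xi> powr (m - real N) * japanese \<zeta> powr (real N + \<bar>m - real N\<bar>)"
    have "norm (\<i> ^ N * complex_of_real (mi_power \<zeta> \<alpha>) * D_snd \<alpha> p (x, \<xi> + t *\<^sub>R \<zeta>) / of_nat (mi_fact \<alpha>)) \<le> B * C \<alpha> * ?J"
      if \<alpha>: "\<alpha> \<in> ?A" for \<alpha>
    proof -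
      have "norm (\<i> ^ N * complex_of_real (mi_power \<zeta> \<alpha>) * D_snd \<alpha> p (x, \<xi> + t *\<^sub>R \<zeta>) / of_nat (mi_fact \<alpha>))
          = \<bar>mi_power \<zeta> \<alpha>\<bar> * norm (D_snd \<alpha> p (x, \<xi> + t *\<^sub>R \<zeta>)) / real (mi_fact \<alpha>)"
        by (simp add: norm_mult norm_divide norm_power)
      also have "\<dots> \<le> \<bar>mi_power \<zeta> \<alpha>\<bar> * norm (D_snd \<alpha> p (x, \<xi> + t *\<^sub>R \<zeta>)) / 1"
      proof (rule divide_left_mono)
        have "mi_fact \<alpha> \<ge> 1" unfolding mi_fact_def by (intro prod_ge_1) auto
        then show "1 \<le> real (mi_fact \<alpha>)" "0 < real (mi_fact \<alpha>) * 1" by auto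
      qed auto
      also have "\<dots> \<le> japanese \<zeta> ^ N * (C \<alpha> * (B * japanese \<xi> powr (m - real N) * japanese \<zeta> powr \<bar>m - real N\<bar>))"
        unfolding div_by_1
      proof (intro mult_mono)
        show "\<bar>mi_power \<zeta> \<alpha>\<bar> \<le> japanese \<zeta> ^ N" using mi_power_le[of \<zeta> \<alpha>] \<alpha> by simp
        have "norm (D_snd \<alpha> p (x, \<xi> + t *\<^sub>R \<zeta>)) \<le> C \<alpha> * japanese (\<xi> + t *\<^sub>R \<zeta>) powr (m - real N)"
          using C(2)[OF x, of \<alpha> "\<xi> + t *\<^sub>R \<zeta>"] \<alpha> by simp
        also have "\<dots> \<le> C \<alpha> * (B * japanese \<xi> powr (m - real N) * japanese (t *\<^sub>R \<zeta>) powr \<bar>m - real N\<bar>)"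
          unfolding B_def by (intro mult_left_mono peetre C)
        also have "\<dots> \<le> C \<alpha> * (B * japanese \<xi> powr (m - real N) * japanese \<zeta> powr \<bar>m - real N\<bar>)"
          using t by (intro mult_left_mono powr_mono2 japanese_scale_le C mult_nonneg_nonneg) (auto simp: B_def less_imp_le)
        finally show "norm (D_snd \<alpha> p (x, \<xi> + t *\<^sub>R \<zeta>)) \<le> C \<alpha> * (B * japanese \<xi> powr (m - real N) * japanese \<zeta> powr \<bar>m - real N\<bar>)" .
      qed (auto simp: less_imp_le)
      also have "\<dots> = B * C \<alpha> * ?J"
        by (simp add: powr_add powr_realpow mult_ac)
      finally show ?thesis .
    qed
    then have "norm (\<Sum>\<alpha>\<in>?A. \<i> ^ N * complex_of_real (mi_power \<zeta> \<alpha>) * D_snd \<alpha> p (x, \<xi> + t *\<^sub>R \<zeta>) / of_nat (mi_fact \<alpha>)) \<le> (\<Sum>\<alpha>\<in>?A. B * C \<alpha> * ?J)"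
      by (rule sum_norm_le)
    then have "norm (taylor_term p x \<xi> \<zeta> N t) \<le> fact N * (\<Sum>\<alpha>\<in>?A. B * C \<alpha> * ?J)"
      unfolding taylor_term_def norm_mult by (simp add: mult_left_mono)
    then show ?thesis unfolding sum_distrib_right[symmetric] by (simp only: mult.assoc)
  qed
  moreover have "0 \<le> fact N * (\<Sum>\<alpha>\<in>?A. B * C \<alpha>)"
    using C(1) by (intro mult_nonneg_nonneg sum_nonneg) (auto simp: B_def)
  ultimately show ?thesis by blast
qed

lemma taylor_0: "taylor_term p x \<xi> \<zeta> 0 t = p (x, \<xi> + t *\<^sub>R \<zeta>)"
proof -
  have "{\<alpha>::'b::euclidean_space \<Rightarrow> nat. \<alpha> \<in> multi_indices \<and> mi_order \<alpha> = 0} = {\<lambda>_. 0}"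
    by (auto simp: mi_order_0_iff) (auto simp: multi_indices_def mi_order_def)
  moreover have "mi_list (\<lambda>_. 0) = ([] :: 'b list)"
    using length_mi_list[of "\<lambda>_::'b. 0"] by (simp add: mi_order_def)
  ultimately show ?thesis
    unfolding taylor_term_def D_snd_eq by (simp add: mi_power_def mi_fact_def)
qed

lemma symbol_taylor:
  fixes p :: "'a::euclidean_space \<times> 'b::euclidean_space \<Rightarrow> complex"
  assumes p: "p \<in> symbols m" and K: "compact K"
  shows "\<exists>C\<ge>0. \<forall>x\<in>K. \<forall>\<xi> \<zeta>.
    norm (p (x, \<xi> + \<zeta>) - (\<Sum>\<alpha> | \<alpha> \<in> multi_indices \<and> mi_order \<alpha> < N.
        \<i> ^ mi_order \<alpha> / of_nat (mi_fact \<alpha>) * complex_of_real (mi_power \<zeta> \<alpha>) * D_snd \<alpha> p (x, \<xi>)))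
    \<le> C * japanese \<xi> powr (m - real N) * japanese \<zeta> powr (real N + \<bar>m - real N\<bar>)"
proof -
  obtain C where C: "C \<ge> 0" "\<And>x \<xi> \<zeta> t. x \<in> K \<Longrightarrow> t \<in> {0..1} \<Longrightarrow> norm (taylor_term p x \<xi> \<zeta> N t) \<le>
    C * japanese \<xi> powr (m - real N) * japanese \<zeta> powr (real N + \<bar>m - real N\<bar>)"
    using taylor_term_bound[OF p K, of N] by metis
  have sums: "(\<Sum>i<N. (1 / fact i) * taylor_term p x \<xi> \<zeta> i 0) = (\<Sum>\<alpha> | \<alpha> \<in> multi_indices \<and> mi_order \<alpha> < N.
        \<i> ^ mi_order \<alpha> / of_nat (mi_fact \<alpha>) * complex_of_real (mi_power \<zeta> \<alpha>) * D_snd \<alpha> p (x, \<xi>))" for x \<xi> \<zeta>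
  proof -
    let ?h = "\<lambda>\<alpha>. \<i> ^ mi_order \<alpha> / of_nat (mi_fact \<alpha>) * complex_of_real (mi_power \<zeta> \<alpha>) * D_snd \<alpha> p (x, \<xi>)"
    have "(\<Sum>\<alpha> | \<alpha> \<in> multi_indices \<and> mi_order \<alpha> < N. ?h \<alpha>)
        = (\<Sum>i<N. \<Sum>\<alpha>\<in>{\<alpha>\<in>{\<alpha>. \<alpha> \<in> multi_indices \<and> mi_order \<alpha> < N}. mi_order \<alpha> = i}. ?h \<alpha>)"
      by (rule sum.group[symmetric]) (auto simp: finite_multi_indices_less)
    also have "\<dots> = (\<Sum>i<N. (1 / fact i) * taylor_term p x \<xi> \<zeta> i 0)"
    proof (rule sum.cong[OF refl])
      fix i assume "i \<in> {..<N}"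
      then have "{\<alpha>\<in>{\<alpha>. \<alpha> \<in> multi_indices \<and> mi_order \<alpha> < N}. mi_order \<alpha> = i} = {\<alpha>::'b \<Rightarrow> nat. \<alpha> \<in> multi_indices \<and> mi_order \<alpha> = i}"
        by auto
      then show "(\<Sum>\<alpha>\<in>{\<alpha>\<in>{\<alpha>. \<alpha> \<in> multi_indices \<and> mi_order \<alpha> < N}. mi_order \<alpha> = i}. ?h \<alpha>) = (1 / fact i) * taylor_term p x \<xi> \<zeta> i 0"
        by (simp add: taylor_term_def)
    qed
    finally show ?thesis by simp
  qed
  have "norm (p (x, \<xi> + \<zeta>) - (\<Sum>i<N. (1 / fact i) * taylor_term p x \<xi> \<zeta> i 0)) \<le>
      C * japanese \<xi> powr (m - real N) * japanese \<zeta> powr (real N + \<bar>m - real N\<bar>)" if x: "x \<in> K" for x \<xi> \<zeta>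
  \<comment> \<open>The integral remainder contains (1 - t)^(N - 1), so N = 0 is treated apart;
    there the estimate is the term bound itself, at t = 1.\<close>
  proof (cases "N = 0")
    case True
    then show ?thesis using C(2)[OF x, of 1 \<xi> \<zeta>] by (simp add: taylor_0)
  next
    case False
    let ?B = "C * japanese \<xi> powr (m - real N) * japanese \<zeta> powr (real N + \<bar>m - real N\<bar>)"
    have "((\<lambda>t. ((1 - t) ^ (N - 1) / fact (N - 1)) *\<^sub>R taylor_term p x \<xi> \<zeta> N t) has_integral
        taylor_term p x \<xi> \<zeta> 0 1 - (\<Sum>i<N. ((1 - 0) ^ i / fact i) *\<^sub>R taylor_term p x \<xi> \<zeta> i 0)) {0..1}"
      using False by (intro Taylor_has_integral taylor_term_derivative symbols_smooth[OF p]) auto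
    then have "norm (taylor_term p x \<xi> \<zeta> 0 1 - (\<Sum>i<N. ((1 - 0) ^ i / fact i) *\<^sub>R taylor_term p x \<xi> \<zeta> i 0)) \<le> ?B * measure lborel (cbox (0::real) 1)"
      unfolding cbox_interval[symmetric]
    proof (rule has_integral_bound[rotated])
      show "0 \<le> ?B" using C(1) by simp
      fix t :: real assume t: "t \<in> cbox 0 1"
      have "(1 - t) ^ (N - 1) / fact (N - 1) \<le> 1 / 1"
        using t by (intro frac_le power_le_one) auto
      then have "\<bar>(1 - t) ^ (N - 1) / fact (N - 1)\<bar> \<le> 1" using t by simp
      then have "norm (((1 - t) ^ (N - 1) / fact (N - 1)) *\<^sub>R taylor_term p x \<xi> \<zeta> N t) \<le> 1 * norm (taylor_term p x \<xi> \<zeta> N t)"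
        unfolding norm_scaleR by (intro mult_right_mono) auto
      also have "\<dots> \<le> ?B" using C(2)[OF x, of t \<xi> \<zeta>] t by simp
      finally show "norm (((1 - t) ^ (N - 1) / fact (N - 1)) *\<^sub>R taylor_term p x \<xi> \<zeta> N t) \<le> ?B" .
    qed
    then show ?thesis by (simp add: taylor_0 scaleR_conv_of_real)
  qed
  then show ?thesis using C(1) unfolding sums by blast
qed

section \<open>Asymptotic expansion of the symbol of a conjugated operator\<close>

lemma uniform_bound_Basis:
  fixes h :: "'c::euclidean_space \<Rightarrow> 'y \<Rightarrow> real"
  assumes "\<And>c. c \<in> Basis \<Longrightarrow> \<exists>C\<ge>0. \<forall>y\<in>Y. h c y \<le> C * g y" "\<And>y. 0 \<le> g y"
  shows "\<exists>C\<ge>0. \<forall>c\<in>Basis. \<forall>y\<in>Y. h c y \<le> C * g y"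
proof -
  obtain C where C: "\<And>c. c \<in> Basis \<Longrightarrow> C c \<ge> 0" "\<And>c y. c \<in> Basis \<Longrightarrow> y \<in> Y \<Longrightarrow> h c y \<le> C c * g y"
    using assms(1) by metis
  have "h c y \<le> (\<Sum>c\<in>Basis. C c) * g y" if "c \<in> Basis" "y \<in> Y" for c y
  proof -
    have "C c \<le> (\<Sum>c\<in>Basis. C c)" using C(1) that by (intro member_le_sum) auto
    then have "C c * g y \<le> (\<Sum>c\<in>Basis. C c) * g y" using assms(2) by (rule mult_right_mono)
    then show ?thesis using C(2)[OF that] by simp
  qed
  moreover have "0 \<le> (\<Sum>c\<in>Basis. C c)" using C(1) by (intro sum_nonneg) auto
  ultimately show ?thesis by blast
qed

lemma japanese_powr_bounded:
  fixes K :: "'a::euclidean_space set"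
  assumes "compact K"
  obtains B where "B \<ge> 0" "\<And>\<xi>. \<xi> \<in> K \<Longrightarrow> japanese \<xi> powr s \<le> B"
proof -
  have "compact ((\<lambda>\<xi>. japanese \<xi> powr s) ` K)"
    using assms by (intro compact_continuous_image continuous_intros) auto
  then obtain B where "\<And>\<xi>. \<xi> \<in> K \<Longrightarrow> norm (japanese \<xi> powr s) \<le> B"
    using compact_imp_bounded bounded_iff by (metis image_eqI)
  then show ?thesis by (intro that[of "\<bar>B\<bar>"]) fastforce+
qed

section \<open>The conjugated operator, its product rule and its expansion\<close>

definition sym_sum :: "nat \<Rightarrow> ('a::euclidean_space \<times> 'a \<Rightarrow> complex) \<Rightarrow> ('a \<times> 'a \<Rightarrow> complex) \<Rightarrow> 'a \<times> 'a \<Rightarrow> complex" where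
  "sym_sum N p u z = (\<Sum>\<alpha> | \<alpha> \<in> multi_indices \<and> mi_order \<alpha> < N.
     \<i> ^ mi_order \<alpha> / of_nat (mi_fact \<alpha>) * D_snd \<alpha> p z * D_fst \<alpha> u z)"

text \<open>The symbol of p(x, D) conjugated by exp(i<.,\<xi>>) and applied to \<open>u\<close>. The
  phase exp(i<x,\<zeta>>) of the usual formula sits inside \<open>ufour\<close>.\<close>

definition twist :: "('a::euclidean_space \<times> 'a \<Rightarrow> complex) \<Rightarrow> ('a \<times> 'a \<Rightarrow> complex) \<Rightarrow> 'a \<times> 'a \<Rightarrow> complex" where
  "twist p u w = (LINT \<zeta>|lborel. p (fst w, snd w + \<zeta>) * ufour u w \<zeta>) / complex_of_real (2 * pi) ^ DIM('a)"

text \<open>The kernel \<open>r\<close> takes the base point and the offset z = y - x. After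
  conjugation the phase is exp(i<z,\<xi>>) and involves the offset only.\<close>

definition smoothing :: "('a::euclidean_space \<times> 'a \<Rightarrow> complex) \<Rightarrow> ('a \<times> 'a \<Rightarrow> complex) \<Rightarrow> 'a \<times> 'a \<Rightarrow> complex" where
  "smoothing r u w = (LINT z|lborel. cis (z \<bullet> snd w) * r (fst w, z) * u (fst w + z, snd w))"

lemma ufour_measurable:
  fixes u :: "'a::euclidean_space \<times> 'b::euclidean_space \<Rightarrow> complex"
  assumes "csymbol m u"
  shows "ufour u w \<in> borel_measurable borel"
proof -
  have "(\<lambda>z. u (fst w + z, snd w)) \<in> borel_measurable borel"
    by (rule smooth_measurable[OF test_functions_smooth[OF csymbol_slice[OF assms]]])
  from fourier_measurable[OF this] show ?thesis by (simp add: ufour_def[abs_def])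
qed

lemma smooth_shift_snd: "smooth p \<Longrightarrow> smooth (\<lambda>w. p (fst w, snd w + \<zeta>))"
  using smooth_affine[OF _ bounded_linear_ident, of p "(0, \<zeta>)"] by (simp add: plus_prod_def)

lemma smooth_pair_snd: "smooth p \<Longrightarrow> smooth (\<lambda>\<zeta>. p (x, \<xi> + \<zeta>))"
  using smooth_affine[of p "\<lambda>\<zeta>. (0, \<zeta>)" "(x, \<xi>)"]
  by (simp add: bounded_linear_Pair bounded_linear_ident bounded_linear_zero add.commute)

lemma twist_integrand_measurable:
  fixes u p :: "'a::euclidean_space \<times> 'a \<Rightarrow> complex"
  assumes "p \<in> symbols m" "csymbol m' u"
  shows "(\<lambda>\<zeta>. p (fst w, snd w + \<zeta>) * ufour u w \<zeta>) \<in> borel_measurable borel"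
  by (intro borel_measurable_times ufour_measurable[OF assms(2)]
      smooth_measurable[OF smooth_pair_snd[OF symbols_smooth[OF assms(1)]]])

text \<open>Peetre's inequality moves the growth of \<open>p\<close> to \<xi> at the cost of
  \<open>japanese \<zeta>\<close> to the absolute value of m. The decay order \<open>k\<close> of
  \<open>ufour\<close> is chosen to absorb this and to leave the integrable weight of order -2
  DIM.\<close>

lemma twist_integrand_bound:
  fixes u p :: "'a::euclidean_space \<times> 'a \<Rightarrow> complex"
  assumes p: "p \<in> symbols m" and u: "csymbol m' u" and K: "compact K"
  shows "\<exists>C\<ge>0. \<forall>x\<in>K. \<forall>\<xi> \<zeta>. norm (p (x, \<xi> + \<zeta>) * ufour u (x, \<xi>) \<zeta>) \<le>
    C * japanese \<xi> powr (m + m') * japanese \<zeta> powr (- (2 * real DIM('a)))"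
proof -
  obtain C where C: "C \<ge> 0" "\<And>x \<theta>. x \<in> K \<Longrightarrow> norm (p (x, \<theta>)) \<le> C * japanese \<theta> powr m"
    using symbol_boundE[OF symbols_bound[OF p] K] by metis
  define k where "k = nat \<lceil>2 * real DIM('a) + \<bar>m\<bar>\<rceil>"
  have k: "2 * real DIM('a) + \<bar>m\<bar> \<le> real k" unfolding k_def by linarith
  obtain D where D: "D \<ge> 0" "\<And>x \<xi> \<zeta>. norm (ufour u (x, \<xi>) \<zeta>) \<le> D * japanese \<xi> powr m' * japanese \<zeta> powr (- real k)"
    using ufour_bound[OF u, of k] by metis
  have "norm (p (x, \<xi> + \<zeta>) * ufour u (x, \<xi>) \<zeta>) \<le>
    (C * 2 powr \<bar>m\<bar> * D) * japanese \<xi> powr (m + m') * japanese \<zeta> powr (- (2 * real DIM('a)))" if x: "x \<in> K" for x \<xi> \<zeta>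
  proof -
    have "norm (p (x, \<xi> + \<zeta>)) \<le> C * (2 powr \<bar>m\<bar> * japanese \<xi> powr m * japanese \<zeta> powr \<bar>m\<bar>)"
      using C(2)[OF x, of "\<xi> + \<zeta>"] mult_left_mono[OF peetre[of \<xi> \<zeta> m] C(1)] by linarith
    then have "norm (p (x, \<xi> + \<zeta>) * ufour u (x, \<xi>) \<zeta>) \<le>
       (C * (2 powr \<bar>m\<bar> * japanese \<xi> powr m * japanese \<zeta> powr \<bar>m\<bar>)) * (D * japanese \<xi> powr m' * japanese \<zeta> powr (- real k))"
      unfolding norm_mult using D C(1) by (intro mult_mono) auto
    also have "\<dots> = (C * 2 powr \<bar>m\<bar> * D) * japanese \<xi> powr (m + m') * japanese \<zeta> powr (\<bar>m\<bar> + - real k)"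
      unfolding powr_add by (simp only: mult_ac)
    also have "\<dots> \<le> (C * 2 powr \<bar>m\<bar> * D) * japanese \<xi> powr (m + m') * japanese \<zeta> powr (- (2 * real DIM('a)))"
      using C(1) D(1) k japanese_ge_1[of \<zeta>] by (intro mult_left_mono powr_mono mult_nonneg_nonneg) auto
    finally show ?thesis .
  qed
  then show ?thesis using C(1) D(1) by (intro exI[of _ "C * 2 powr \<bar>m\<bar> * D"]) auto
qed

lemma twist_integrable:
  fixes u p :: "'a::euclidean_space \<times> 'a \<Rightarrow> complex"
  assumes p: "p \<in> symbols m" and u: "csymbol m' u"
  shows "integrable lborel (\<lambda>\<zeta>. p (fst w, snd w + \<zeta>) * ufour u w \<zeta>)"
proof -
  obtain C where C: "C \<ge> 0" "\<And>\<xi> \<zeta>. norm (p (fst w, \<xi> + \<zeta>) * ufour u (fst w, \<xi>) \<zeta>) \<le>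
    C * japanese \<xi> powr (m + m') * japanese \<zeta> powr (- (2 * real DIM('a)))"
    using twist_integrand_bound[OF p u, of "{fst w}"] by (metis compact_sing singletonI)
  have "integrable lborel (\<lambda>\<zeta>::'a. C * japanese (snd w) powr (m + m') * japanese \<zeta> powr (- (2 * real DIM('a))))"
    by (intro integrable_mult_right integrable_japanese) auto
  then show ?thesis
  proof (rule Bochner_Integration.integrable_bound)
    show "AE \<zeta> in lborel. norm (p (fst w, snd w + \<zeta>) * ufour u w \<zeta>)
      \<le> norm (C * japanese (snd w) powr (m + m') * japanese \<zeta> powr (- (2 * real DIM('a))))"
      using C(2)[of "snd w"] C(1) by (intro AE_I2) (simp add: abs_mult)
  qed (use twist_integrand_measurable[OF p u] in simp)
qed

text \<open>A derivative falls either on \<open>p\<close> or on \<open>u\<close>, and in both cases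
  the sum of the two orders drops by \<open>snd_weight c\<close>. This makes the class of such
  integrals stable under differentiation.\<close>

lemma twist_D_dir:
  fixes u p :: "'a::euclidean_space \<times> 'a \<Rightarrow> complex"
  assumes p: "p \<in> symbols m" and u: "csymbol m' u"
  shows "twist p u differentiable_on UNIV"
    and "c \<in> Basis \<Longrightarrow> D_dir c (twist p u) = (\<lambda>w. twist (D_dir c p) u w + twist p (D_dir c u) w)"
proof -
  define F where "F w \<zeta> = p (fst w, snd w + \<zeta>) * ufour u w \<zeta>" for w and \<zeta> :: 'a
  let ?k = "complex_of_real (2 * pi) ^ DIM('a)"
  have pd: "(\<lambda>w. p (fst w, snd w + \<zeta>)) differentiable_on UNIV" for \<zeta>
    by (intro smooth_differentiable_on smooth_shift_snd symbols_smooth[OF p])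
  have diff: "(\<lambda>w. F w \<zeta>) differentiable_on UNIV" for \<zeta>
    unfolding F_def by (intro differentiable_on_mult pd ufour_D_dir(1)[OF u])
  have pD: "D_dir c (\<lambda>w. p (fst w, snd w + \<zeta>)) = (\<lambda>w. D_dir c p (fst w, snd w + \<zeta>))" for c \<zeta>
  proof
    fix w
    show "D_dir c (\<lambda>w. p (fst w, snd w + \<zeta>)) w = D_dir c p (fst w, snd w + \<zeta>)"
      using D_dir_translate[of c p "(0, \<zeta>)" w] by (simp add: plus_prod_def)
  qed
  have DF: "D_dir c (\<lambda>w. F w \<zeta>) w = D_dir c p (fst w, snd w + \<zeta>) * ufour u w \<zeta> + p (fst w, snd w + \<zeta>) * ufour (D_dir c u) w \<zeta>"
    if "c \<in> Basis" for c w \<zeta>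
    unfolding F_def D_dir_mult[OF pd ufour_D_dir(1)[OF u]] pD ufour_D_dir(2)[OF u that] ..
  have int: "integrable lborel (F w)" for w
    unfolding F_def[abs_def] by (rule twist_integrable[OF p u])
  have bd: "\<exists>C\<ge>0. \<forall>y\<in>ball w0 1 \<times> UNIV. norm (D_dir c (\<lambda>w. F w (snd y)) (fst y)) \<le> C * japanese (snd y) powr (- (2 * real DIM('a)))"
    if c: "c \<in> Basis" for c w0
  proof -
    let ?s = "m + m' - snd_weight c"
    have Kc: "compact (cball (fst w0) 1)" by simp
    obtain C1 where C1: "C1 \<ge> 0" "\<And>x \<xi> \<zeta>. x \<in> cball (fst w0) 1 \<Longrightarrow> norm (D_dir c p (x, \<xi> + \<zeta>) * ufour u (x, \<xi>) \<zeta>) \<le>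
      C1 * japanese \<xi> powr (m - snd_weight c + m') * japanese \<zeta> powr (- (2 * real DIM('a)))"
      using twist_integrand_bound[OF symbols_D_dir[OF p c] u Kc] by metis
    obtain C2 where C2: "C2 \<ge> 0" "\<And>x \<xi> \<zeta>. x \<in> cball (fst w0) 1 \<Longrightarrow> norm (p (x, \<xi> + \<zeta>) * ufour (D_dir c u) (x, \<xi>) \<zeta>) \<le>
      C2 * japanese \<xi> powr (m + (m' - snd_weight c)) * japanese \<zeta> powr (- (2 * real DIM('a)))"
      using twist_integrand_bound[OF p csymbol_D_dir[OF u c] Kc] by metis
    obtain B where B: "B \<ge> 0" "\<And>\<xi>. \<xi> \<in> cball (snd w0) 1 \<Longrightarrow> japanese \<xi> powr ?s \<le> B"
      using japanese_powr_bounded[OF compact_cball, of "snd w0" 1 ?s] by metis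
    have e1: "m - snd_weight c + m' = ?s" and e2: "m + (m' - snd_weight c) = ?s" by simp_all
    have "norm (D_dir c (\<lambda>w. F w \<zeta>) w) \<le> ((C1 + C2) * B) * japanese \<zeta> powr (- (2 * real DIM('a)))" if w: "w \<in> ball w0 1" for w \<zeta>
    proof -
      have "fst w \<in> cball (fst w0) 1" "snd w \<in> cball (snd w0) 1"
        using w dist_fst_le[of w0 w] dist_snd_le[of w0 w] by auto
      then have "norm (D_dir c (\<lambda>w. F w \<zeta>) w) \<le> C1 * japanese (snd w) powr ?s * japanese \<zeta> powr (- (2 * real DIM('a))) +
          C2 * japanese (snd w) powr ?s * japanese \<zeta> powr (- (2 * real DIM('a)))"
        using C1(2)[of "fst w" "snd w" \<zeta>] C2(2)[of "fst w" "snd w" \<zeta>] unfolding DF[OF c] e1 e2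
        by (intro order.trans[OF norm_triangle_ineq] add_mono) simp_all
      also have "\<dots> = (C1 + C2) * japanese (snd w) powr ?s * japanese \<zeta> powr (- (2 * real DIM('a)))"
        by (simp add: algebra_simps)
      also have "\<dots> \<le> (C1 + C2) * B * japanese \<zeta> powr (- (2 * real DIM('a)))"
        using B(2)[OF \<open>snd w \<in> cball (snd w0) 1\<close>] C1(1) C2(1) by (intro mult_right_mono mult_left_mono) auto
      finally show ?thesis .
    qed
    then show ?thesis using B(1) C1(1) C2(1) by (intro exI[of _ "(C1 + C2) * B"]) auto
  qed
  have main: "(\<lambda>w. LINT \<zeta>|lborel. F w \<zeta>) differentiable (at w0)"
    "c \<in> Basis \<Longrightarrow> D_dir c (\<lambda>w. LINT \<zeta>|lborel. F w \<zeta>) w0 = (LINT \<zeta>|lborel. D_dir c (\<lambda>w. F w \<zeta>) w0)" for c w0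
  proof -
    have "\<exists>C\<ge>0. \<forall>c\<in>Basis. \<forall>y\<in>ball w0 1 \<times> (UNIV::'a set).
        norm (D_dir c (\<lambda>w. F w (snd y)) (fst y)) \<le> C * japanese (snd y) powr (- (2 * real DIM('a)))"
      by (rule uniform_bound_Basis[OF bd]) auto
    then obtain C where C: "C \<ge> 0" "\<forall>c\<in>Basis. \<forall>y\<in>ball w0 1 \<times> (UNIV::'a set).
        norm (D_dir c (\<lambda>w. F w (snd y)) (fst y)) \<le> C * japanese (snd y) powr (- (2 * real DIM('a)))"
      by (elim exE conjE)
    have C': "norm (D_dir c (\<lambda>w. F w \<zeta>) w) \<le> C * japanese \<zeta> powr (- (2 * real DIM('a)))" if "c \<in> Basis" "w \<in> ball w0 1" for c w \<zeta>
      using bspec[OF bspec[OF C(2) that(1)], of "(w, \<zeta>)"] that(2) by simp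
    have g: "integrable lborel (\<lambda>\<zeta>::'a. C * japanese \<zeta> powr (- (2 * real DIM('a))))"
      by (intro integrable_mult_right integrable_japanese) auto
    show "(\<lambda>w. LINT \<zeta>|lborel. F w \<zeta>) differentiable (at w0)"
      by (rule D_dir_integral(1)[OF zero_less_one int diff C' g])
    show "D_dir c (\<lambda>w. LINT \<zeta>|lborel. F w \<zeta>) w0 = (LINT \<zeta>|lborel. D_dir c (\<lambda>w. F w \<zeta>) w0)" if "c \<in> Basis"
      by (rule D_dir_integral(2)[OF zero_less_one int diff C' g that])
  qed
  have tw: "twist p u = (\<lambda>w. inverse ?k * (LINT \<zeta>|lborel. F w \<zeta>))"
    by (simp add: fun_eq_iff twist_def F_def divide_inverse)
  have Fd: "(\<lambda>w. LINT \<zeta>|lborel. F w \<zeta>) differentiable_on UNIV"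
    using main(1) by (simp add: differentiable_on_UNIV)
  show "twist p u differentiable_on UNIV"
    unfolding tw by (intro differentiable_on_mult Fd differentiable_on_const)
  show "D_dir c (twist p u) = (\<lambda>w. twist (D_dir c p) u w + twist p (D_dir c u) w)" if c: "c \<in> Basis"
  proof
    fix w
    have "D_dir c (twist p u) w = inverse ?k * (LINT \<zeta>|lborel. D_dir c (\<lambda>w. F w \<zeta>) w)"
      unfolding tw D_dir_cmult[OF Fd] main(2)[OF c] ..
    also have "(LINT \<zeta>|lborel. D_dir c (\<lambda>w. F w \<zeta>) w) = (LINT \<zeta>|lborel. D_dir c p (fst w, snd w + \<zeta>) * ufour u w \<zeta>)
       + (LINT \<zeta>|lborel. p (fst w, snd w + \<zeta>) * ufour (D_dir c u) w \<zeta>)"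
      unfolding DF[OF c]
      by (intro Bochner_Integration.integral_add twist_integrable[OF symbols_D_dir[OF p c] u] twist_integrable[OF p csymbol_D_dir[OF u c]])
    finally show "D_dir c (twist p u) w = twist (D_dir c p) u w + twist p (D_dir c u) w"
      unfolding twist_def[of "D_dir c p"] twist_def[of p "D_dir c u"]
      by (simp only: divide_inverse distrib_left mult_ac)
  qed
qed

lemma sym_sum_symbols:
  fixes u p :: "'a::euclidean_space \<times> 'a \<Rightarrow> complex"
  assumes p: "p \<in> symbols m" and u: "u \<in> symbols m'"
  shows "sym_sum N p u \<in> symbols (m + m')"
proof -
  have "(\<lambda>z. (\<i> ^ mi_order \<alpha> / of_nat (mi_fact \<alpha>) * D_snd \<alpha> p z) * D_fst \<alpha> u z) \<in> symbols (m + m')" for \<alpha>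
  proof (rule symbols_mono)
    show "(\<lambda>z. (\<i> ^ mi_order \<alpha> / of_nat (mi_fact \<alpha>) * D_snd \<alpha> p z) * D_fst \<alpha> u z) \<in> symbols ((m - real (mi_order \<alpha>)) + m')"
      by (intro symbols_mult symbols_cmult symbols_D_snd symbols_D_fst p u)
  qed simp
  then show ?thesis
    unfolding sym_sum_def[abs_def] by (intro symbols_sum)
qed

lemma D_dir_sum:
  assumes "\<And>i. i \<in> I \<Longrightarrow> f i differentiable_on UNIV"
  shows "D_dir b (\<lambda>x. \<Sum>i\<in>I. f i x) = (\<lambda>x. \<Sum>i\<in>I. D_dir b (f i) x)"
    and "(\<lambda>x. \<Sum>i\<in>I. f i x) differentiable_on UNIV"
  using assms
proof (induction I rule: infinite_finite_induct)
  case (insert i I)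
  {
    case 1 then show ?case using insert by (simp add: D_dir_add)
  next
    case 2 then show ?case using insert by (simp add: differentiable_on_add)
  }
qed auto

text \<open>Derivatives commute with the fixed ones in each term, so the Leibniz rule returns two
  sums of the same shape. The resulting rule is exactly the one that \<open>twist\<close>
  satisfies.\<close>

lemma sym_sum_D_dir:
  fixes u p :: "'a::euclidean_space \<times> 'a \<Rightarrow> complex"
  assumes p: "p \<in> symbols m" and u: "u \<in> symbols m'" and c: "c \<in> Basis"
  shows "D_dir c (sym_sum N p u) = (\<lambda>w. sym_sum N (D_dir c p) u w + sym_sum N p (D_dir c u) w)"
proof -
  let ?c = "\<lambda>\<alpha>::'a \<Rightarrow> nat. \<i> ^ mi_order \<alpha> / of_nat (mi_fact \<alpha>)"
  have dp: "D_snd \<alpha> p differentiable_on UNIV" and du: "D_fst \<alpha> u differentiable_on UNIV" for \<alpha>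
    using symbols_D_snd[OF p, of \<alpha>] symbols_D_fst[OF u, of \<alpha>] by (auto intro: smooth_differentiable_on dest: symbols_smooth)
  have cp: "D_dir c (D_snd \<alpha> p) = D_snd \<alpha> (D_dir c p)" for \<alpha>
    unfolding D_snd_eq by (intro D_dir_foldr_commute symbols_smooth[OF p] c snd_list_subset_Basis set_mi_list)
  have cu: "D_dir c (D_fst \<alpha> u) = D_fst \<alpha> (D_dir c u)" for \<alpha>
    unfolding D_fst_eq by (intro D_dir_foldr_commute symbols_smooth[OF u] c fst_list_subset_Basis set_mi_list)
  have d1: "(\<lambda>z. ?c \<alpha> * D_snd \<alpha> p z) differentiable_on UNIV" for \<alpha>
    by (intro differentiable_on_mult dp differentiable_on_const)
  have d2: "(\<lambda>z. (?c \<alpha> * D_snd \<alpha> p z) * D_fst \<alpha> u z) differentiable_on UNIV" for \<alpha>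
    by (rule differentiable_on_mult[OF d1 du])
  have D: "D_dir c (\<lambda>z. (?c \<alpha> * D_snd \<alpha> p z) * D_fst \<alpha> u z) =
     (\<lambda>z. ?c \<alpha> * D_snd \<alpha> (D_dir c p) z * D_fst \<alpha> u z + ?c \<alpha> * D_snd \<alpha> p z * D_fst \<alpha> (D_dir c u) z)" for \<alpha>
    unfolding D_dir_mult[OF d1 du] D_dir_cmult[OF dp] cp cu ..
  show ?thesis
    unfolding sym_sum_def[abs_def] D_dir_sum(1)[OF d2] D sum.distrib ..
qed

lemma fourier_foldr_D_dir:
  fixes f :: "'a::euclidean_space \<Rightarrow> complex"
  assumes "f \<in> test_functions" "set bs \<subseteq> Basis"
  shows "foldr D_dir bs f \<in> test_functions \<and>
    fourier (foldr D_dir bs f) \<zeta> = complex_of_real (prod_list (map (\<lambda>b. \<zeta> \<bullet> b) bs)) * fourier f \<zeta>"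
  using assms(2)
  by (induction bs) (auto simp: assms(1) fourier_D_dir test_functions_D_dir)

lemma ufour_D_fst:
  fixes u :: "'a::euclidean_space \<times> 'b::euclidean_space \<Rightarrow> complex"
  assumes u: "csymbol m u"
  shows "ufour (D_fst \<alpha> u) w \<zeta> = complex_of_real (mi_power \<zeta> \<alpha>) * ufour u w \<zeta>"
proof -
  have "(\<lambda>z. D_fst \<alpha> u (fst w + z, snd w)) = foldr D_dir (mi_list \<alpha>) (\<lambda>z. u (fst w + z, snd w))"
    using foldr_D_dir_translate[of "mi_list \<alpha>" "\<lambda>y. u (y, snd w)" "fst w"] by (simp add: D_mi_foldr)
  then show ?thesis
    using fourier_foldr_D_dir[OF csymbol_slice[OF u, of "fst w" "snd w"] set_mi_list[of \<alpha>], of \<zeta>]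
    by (simp add: ufour_def mi_power_def)
qed

lemma csymbol_D_fst:
  fixes u :: "'a::euclidean_space \<times> 'b::euclidean_space \<Rightarrow> complex"
  assumes "csymbol m u" shows "csymbol m (D_fst \<alpha> u)"
  unfolding D_fst_eq by (rule csymbol_foldr_D_fst[OF assms set_mi_list])

text \<open>Because the transform is centred at the base point, Fourier inversion at 0 already
  evaluates \<open>u\<close> at \<open>w\<close>.\<close>

lemma ufour_integral:
  fixes u :: "'a::euclidean_space \<times> 'b::euclidean_space \<Rightarrow> complex"
  assumes u: "csymbol m u"
  shows "integrable lborel (ufour u w)" "(LINT \<zeta>|lborel. ufour u w \<zeta>) = complex_of_real (2 * pi) ^ DIM('a) * u w"
proof -
  have t: "(\<lambda>z. u (fst w + z, snd w)) \<in> test_functions" by (rule csymbol_slice[OF u])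
  show "integrable lborel (ufour u w)"
    using integrable_fourier[OF t] by (simp add: ufour_def[abs_def])
  show "(LINT \<zeta>|lborel. ufour u w \<zeta>) = complex_of_real (2 * pi) ^ DIM('a) * u w"
    using fourier_inversion_0[OF t] by (simp add: ufour_def[abs_def])
qed

text \<open>Multiplication of \<open>ufour u\<close> by \<zeta>^\<alpha> is the derivative
  D^\<alpha> of \<open>u\<close> in the base variable, and integrating it gives back that derivative
  at \<open>w\<close>. Thus \<open>sym_sum\<close> is what the integral yields for the Taylor
  polynomial of \<open>p\<close>, and the difference is the integral of the Taylor
  remainder.\<close>

lemma twist_sym_sum_eq:
  fixes u p :: "'a::euclidean_space \<times> 'a \<Rightarrow> complex"
  assumes p: "p \<in> symbols m" and u: "csymbol m' u"
  shows "twist p u w - sym_sum N p u w = (LINT \<zeta>|lborel. (p (fst w, snd w + \<zeta>) -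
      (\<Sum>\<alpha> | \<alpha> \<in> multi_indices \<and> mi_order \<alpha> < N. \<i> ^ mi_order \<alpha> / of_nat (mi_fact \<alpha>) * complex_of_real (mi_power \<zeta> \<alpha>) * D_snd \<alpha> p w))
      * ufour u w \<zeta>) / complex_of_real (2 * pi) ^ DIM('a)"
proof -
  let ?A = "{\<alpha>::'a \<Rightarrow> nat. \<alpha> \<in> multi_indices \<and> mi_order \<alpha> < N}"
  let ?k = "complex_of_real (2 * pi) ^ DIM('a)"
  define g where "g \<alpha> = \<i> ^ mi_order \<alpha> / of_nat (mi_fact \<alpha>) * D_snd \<alpha> p w" for \<alpha> :: "'a \<Rightarrow> nat"
  have k0: "?k \<noteq> 0" by simp
  have "(\<Sum>\<alpha>\<in>?A. \<i> ^ mi_order \<alpha> / of_nat (mi_fact \<alpha>) * complex_of_real (mi_power \<zeta> \<alpha>) * D_snd \<alpha> p w) * ufour u w \<zeta>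
      = (\<Sum>\<alpha>\<in>?A. g \<alpha> * ufour (D_fst \<alpha> u) w \<zeta>)" for \<zeta>
    unfolding ufour_D_fst[OF u] sum_distrib_right g_def by (intro sum.cong refl) (simp only: mult_ac)
  then have "(LINT \<zeta>|lborel. (p (fst w, snd w + \<zeta>) -
      (\<Sum>\<alpha>\<in>?A. \<i> ^ mi_order \<alpha> / of_nat (mi_fact \<alpha>) * complex_of_real (mi_power \<zeta> \<alpha>) * D_snd \<alpha> p w)) * ufour u w \<zeta>)
      = (LINT \<zeta>|lborel. p (fst w, snd w + \<zeta>) * ufour u w \<zeta> - (\<Sum>\<alpha>\<in>?A. g \<alpha> * ufour (D_fst \<alpha> u) w \<zeta>))"
    by (simp only: left_diff_distrib)
  also have "\<dots> = (LINT \<zeta>|lborel. p (fst w, snd w + \<zeta>) * ufour u w \<zeta>) - (LINT \<zeta>|lborel. (\<Sum>\<alpha>\<in>?A. g \<alpha> * ufour (D_fst \<alpha> u) w \<zeta>))"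
    by (intro Bochner_Integration.integral_diff twist_integrable[OF p u] Bochner_Integration.integrable_sum
        integrable_mult_right ufour_integral(1)[OF csymbol_D_fst[OF u]])
  also have "(LINT \<zeta>|lborel. (\<Sum>\<alpha>\<in>?A. g \<alpha> * ufour (D_fst \<alpha> u) w \<zeta>)) = (\<Sum>\<alpha>\<in>?A. (LINT \<zeta>|lborel. g \<alpha> * ufour (D_fst \<alpha> u) w \<zeta>))"
    by (intro Bochner_Integration.integral_sum integrable_mult_right ufour_integral(1)[OF csymbol_D_fst[OF u]])
  also have "\<dots> = (\<Sum>\<alpha>\<in>?A. g \<alpha> * (?k * D_fst \<alpha> u w))"
    by (simp only: integral_mult_right_zero ufour_integral(2)[OF csymbol_D_fst[OF u]])
  also have "\<dots> = ?k * sym_sum N p u w"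
    unfolding sym_sum_def sum_distrib_left g_def by (intro sum.cong refl) (simp only: mult_ac)
  finally show ?thesis
    using k0 by (simp add: twist_def diff_divide_distrib)
qed

text \<open>The Taylor remainder carries the gain of N orders in \<xi> and a polynomial loss in
  \<zeta>; the decay order \<open>k\<close> of \<open>ufour\<close> is taken large enough to pay for
  that loss and for integrability.\<close>

lemma twist_remainder_bound:
  fixes u p :: "'a::euclidean_space \<times> 'a \<Rightarrow> complex"
  assumes p: "p \<in> symbols m" and u: "csymbol m' u"
  shows "symbol_bound (m + m' - real N) (\<lambda>w. twist p u w - sym_sum N p u w)"
proof (rule symbol_boundI)
  fix K :: "'a set" assume K: "compact K"
  let ?s = "real N + \<bar>m - real N\<bar>"
  let ?r = "\<lambda>x \<xi> \<zeta>. p (x, \<xi> + \<zeta>) - (\<Sum>\<alpha> | \<alpha> \<in> multi_indices \<and> mi_order \<alpha> < N.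
      \<i> ^ mi_order \<alpha> / of_nat (mi_fact \<alpha>) * complex_of_real (mi_power \<zeta> \<alpha>) * D_snd \<alpha> p (x, \<xi>))"
  obtain C where C: "C \<ge> 0" "\<forall>x\<in>K. \<forall>\<xi> \<zeta>. norm (?r x \<xi> \<zeta>) \<le> C * japanese \<xi> powr (m - real N) * japanese \<zeta> powr ?s"
    using symbol_taylor[OF p K, of N] by (elim exE conjE)
  define k where "k = nat \<lceil>2 * real DIM('a) + ?s\<rceil>"
  have k: "2 * real DIM('a) + ?s \<le> real k" unfolding k_def by linarith
  obtain D where D: "D \<ge> 0" "\<And>x \<xi> \<zeta>. norm (ufour u (x, \<xi>) \<zeta>) \<le> D * japanese \<xi> powr m' * japanese \<zeta> powr (- real k)"
    using ufour_bound[OF u, of k] by metis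
  let ?k = "complex_of_real (2 * pi) ^ DIM('a)"
  define J where "J = (LINT \<zeta>::'a|lborel. japanese \<zeta> powr (- (2 * real DIM('a))))"
  have bd: "norm (?r x \<xi> \<zeta> * ufour u (x, \<xi>) \<zeta>) \<le> C * D * japanese \<xi> powr (m + m' - real N) * japanese \<zeta> powr (- (2 * real DIM('a)))"
    if x: "x \<in> K" for x \<xi> \<zeta>
  proof -
    have "norm (?r x \<xi> \<zeta> * ufour u (x, \<xi>) \<zeta>) \<le>
       (C * japanese \<xi> powr (m - real N) * japanese \<zeta> powr ?s) * (D * japanese \<xi> powr m' * japanese \<zeta> powr (- real k))"
      unfolding norm_mult using D C(1) by (intro mult_mono C(2)[rule_format, OF x]) auto
    also have "\<dots> = C * D * japanese \<xi> powr ((m - real N) + m') * japanese \<zeta> powr (?s + - real k)"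
      unfolding powr_add by (simp only: mult_ac)
    also have "\<dots> = C * D * japanese \<xi> powr (m + m' - real N) * japanese \<zeta> powr (?s + - real k)"
      by (simp add: algebra_simps)
    also have "\<dots> \<le> C * D * japanese \<xi> powr (m + m' - real N) * japanese \<zeta> powr (- (2 * real DIM('a)))"
      using C(1) D(1) k japanese_ge_1[of \<zeta>] by (intro mult_left_mono powr_mono mult_nonneg_nonneg) auto
    finally show ?thesis .
  qed
  have "norm (twist p u (x, \<xi>) - sym_sum N p u (x, \<xi>)) \<le> (C * D * J / norm ?k) * japanese \<xi> powr (m + m' - real N)" if x: "x \<in> K" for x \<xi>
  proof -
    have "norm (LINT \<zeta>|lborel. ?r x \<xi> \<zeta> * ufour u (x, \<xi>) \<zeta>) \<le> (LINT \<zeta>|lborel. norm (?r x \<xi> \<zeta> * ufour u (x, \<xi>) \<zeta>))"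
      by (rule integral_norm_bound)
    also have "\<dots> \<le> (LINT \<zeta>::'a|lborel. C * D * japanese \<xi> powr (m + m' - real N) * japanese \<zeta> powr (- (2 * real DIM('a))))"
      using C(1) D(1) by (intro integral_mono' bd[OF x] integrable_mult_right integrable_japanese) auto
    also have "\<dots> = C * D * J * japanese \<xi> powr (m + m' - real N)"
      unfolding J_def integral_mult_right_zero by (simp only: mult_ac)
    finally have "norm (LINT \<zeta>|lborel. ?r x \<xi> \<zeta> * ufour u (x, \<xi>) \<zeta>) / norm ?k \<le> C * D * J * japanese \<xi> powr (m + m' - real N) / norm ?k"
      by (intro divide_right_mono) auto
    then show ?thesis
      unfolding twist_sym_sum_eq[OF p u] fst_conv snd_conv norm_divide by (simp only: times_divide_eq_left)
  qed
  then show "\<exists>C. \<forall>x\<in>K. \<forall>\<theta>. norm (twist p u (x, \<theta>) - sym_sum N p u (x, \<theta>)) \<le> C * japanese \<theta> powr (m + m' - real N)"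
    by blast
qed

text \<open>By the two product rules a derivative of the remainder for (p, u) is the sum of the
  remainders for (D_c p, u) and (p, D_c u), with the same N. The total order has dropped by
  \<open>snd_weight c\<close>, so the undifferentiated bound at the new orders is all that the
  induction needs.\<close>

theorem twist_remainder_symbols:
  fixes u p :: "'a::euclidean_space \<times> 'a \<Rightarrow> complex"
  assumes "p \<in> symbols m" "csymbol m' u"
  shows "(\<lambda>w. twist p u w - sym_sum N p u w) \<in> symbols (m + m' - real N)"
proof -
  have "p \<in> symbols m \<Longrightarrow> csymbol m' u \<Longrightarrow>
      graded_diff symbol_bound snd_weight k (m + m' - real N) (\<lambda>w. twist p u w - sym_sum N p u w)" for k
  proof (induction k arbitrary: p u m m')
    case 0
    then show ?case using twist_remainder_bound by simp
  next
    case (Suc k)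
    note p = Suc.prems(1) and u = Suc.prems(2)
    note sS = sym_sum_symbols[OF p csymbol_symbols[OF u]]
    have dS: "sym_sum N p u differentiable_on UNIV" by (rule smooth_differentiable_on[OF symbols_smooth[OF sS]])
    have dneg: "(\<lambda>w. - 1 * sym_sum N p u w) differentiable_on UNIV"
      by (intro differentiable_on_mult dS differentiable_on_const)
    have eq: "(\<lambda>w. twist p u w - sym_sum N p u w) = (\<lambda>w. twist p u w + - 1 * sym_sum N p u w)" by simp
    have "graded_diff symbol_bound snd_weight k (m + m' - real N - snd_weight c) (D_dir c (\<lambda>w. twist p u w - sym_sum N p u w))"
      if c: "c \<in> Basis" for c
    proof -
      have "D_dir c (\<lambda>w. twist p u w - sym_sum N p u w) =
        (\<lambda>w. (twist (D_dir c p) u w - sym_sum N (D_dir c p) u w) + (twist p (D_dir c u) w - sym_sum N p (D_dir c u) w))"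
        unfolding eq D_dir_add[OF twist_D_dir(1)[OF p u] dneg] D_dir_cmult[OF dS] twist_D_dir(2)[OF p u c]
          sym_sum_D_dir[OF p csymbol_symbols[OF u] c] by (simp add: algebra_simps)
      moreover have "graded_diff symbol_bound snd_weight k (m - snd_weight c + m' - real N) (\<lambda>w. twist (D_dir c p) u w - sym_sum N (D_dir c p) u w)"
        by (rule Suc.IH[OF symbols_D_dir[OF p c] u])
      moreover have "graded_diff symbol_bound snd_weight k (m + (m' - snd_weight c) - real N) (\<lambda>w. twist p (D_dir c u) w - sym_sum N p (D_dir c u) w)"
        by (rule Suc.IH[OF p csymbol_D_dir[OF u c]])
      moreover have "m - snd_weight c + m' - real N = m + m' - real N - snd_weight c"
        "m + (m' - snd_weight c) - real N = m + m' - real N - snd_weight c" by simp_all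
      ultimately show ?thesis
        by (simp only:) (rule graded_diff_add[of symbol_bound], rule symbol_bound_add, assumption+)
    qed
    moreover have "(\<lambda>w. twist p u w - sym_sum N p u w) differentiable_on UNIV"
      unfolding eq by (intro differentiable_on_add twist_D_dir(1)[OF p u] dneg)
    ultimately show ?case using twist_remainder_bound[OF p u] by simp
  qed
  with assms show ?thesis by (simp add: symbols_iff)
qed

section \<open>Smoothing operators\<close>

lemma funpow_D_dir_vanish:
  assumes "closed A" "\<And>x. x \<notin> A \<Longrightarrow> f x = 0" "x \<notin> A"
  shows "(D_dir b ^^ k) f x = 0"
  using assms(3)
proof (induction k arbitrary: x)
  case (Suc k)
  then show ?case using D_dir_vanish[OF assms(1), of "(D_dir b ^^ k) f" x b] by simp
qed (use assms in simp)

lemma funpow_D_dir_snd_slice: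
  "(D_dir b ^^ k) (\<lambda>z. v ((x, z), \<xi>)) = (\<lambda>z. (D_dir ((0, b), 0) ^^ k) v ((x, z), \<xi>))"
proof (induction k)
  case (Suc k)
  have "D_dir b (\<lambda>z. w ((x, z), \<xi>)) z = D_dir ((0, b), 0) w ((x, z), \<xi>)" for w :: "('b \<times> 'a) \<times> 'c \<Rightarrow> complex" and z
    by (simp add: D_dir_def)
  with Suc show ?case by auto
qed simp

text \<open>For fixed x and \<xi> this is the Fourier transform at - \<xi> of r(x, z) u(x + z,
  \<xi>) in z. Decay of order k costs k derivatives in z, which leave the order m of the product
  unchanged.\<close>

lemma smoothing_bound:
  fixes r u :: "'a::euclidean_space \<times> 'a \<Rightarrow> complex"
  assumes r: "smooth r" and u: "csymbol m u"
  shows "symbol_bound (m - real k) (smoothing r u)"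
proof (rule symbol_boundI)
  fix K :: "'a set" assume K: "compact K"
  obtain R where R: "R > 0" "\<And>x \<xi>. x \<notin> cball 0 R \<Longrightarrow> u (x, \<xi>) = 0"
    using csymbolE[OF u] by metis
  obtain \<rho> where \<rho>: "\<And>x. x \<in> K \<Longrightarrow> norm x \<le> \<rho>"
    using compact_imp_bounded[OF K] by (auto simp: bounded_iff)
  \<comment> \<open>For x in K the support condition on u(x + z, \<xi>) confines z to this
    ball.\<close>
  define A where "A = cball (0::'a) (R + \<rho>)"
  define v where "v = (\<lambda>z::('a \<times> 'a) \<times> 'a. (case z of (y, \<xi>) \<Rightarrow> r y) * (case z of (y, \<xi>) \<Rightarrow> u (fst y + snd y, \<xi>)))"
  have bl: "bounded_linear (\<lambda>y::'a \<times> 'a. fst y + snd y)"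
    by (intro bounded_linear_add bounded_linear_fst bounded_linear_snd)
  \<comment> \<open>Regarded over the pairs (x, z), the kernel is a symbol of order 0. The other
    factor is the pullback of \<open>u\<close> under the sum map, which sends basis vectors to basis
    vectors.\<close>
  have "v \<in> symbols (0 + m)"
    unfolding v_def
    by (intro symbols_mult symbols_const_snd[OF r] symbols_lift[OF bl _ csymbol_symbols[OF u]])
      (auto simp: Basis_prod_def)
  then have v: "v \<in> symbols m" by simp
  have sl: "(\<lambda>z. v ((x, z), \<xi>)) \<in> test_functions" for x \<xi>
  proof -
    have "smooth (\<lambda>z. r (x, z))"
      using smooth_affine[OF r, of "\<lambda>z. (0, z)" "(x, 0)"]
      by (simp add: bounded_linear_Pair bounded_linear_ident bounded_linear_zero)
    from test_functions_mult[OF csymbol_slice[OF u, of x \<xi>] this] show ?thesis by (simp add: v_def)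
  qed
  have v0: "v ((x, z), \<xi>) = 0" if "x \<in> K" "z \<notin> A" for x z \<xi>
  proof -
    have "norm (x + z) > R"
      using that \<rho>[of x] norm_triangle_ineq4[of "x + z" x] by (simp add: A_def)
    then show ?thesis using R(2)[of "x + z" \<xi>] by (simp add: v_def)
  qed
  have L: "\<exists>C\<ge>0. \<forall>x\<in>K. \<forall>\<xi>. (LINT z|lborel. norm (w ((x, z), \<xi>))) \<le> C * japanese \<xi> powr m"
    if "w \<in> symbols m" "\<And>x z \<xi>. x \<in> K \<Longrightarrow> z \<notin> A \<Longrightarrow> w ((x, z), \<xi>) = 0" for w :: "('a \<times> 'a) \<times> 'a \<Rightarrow> complex"
    using K that
    by (intro csymbol_L1_bound[of w m "K \<times> A" A K "\<lambda>x z. (x, z)"] compact_Times)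
      (auto simp: A_def intro!: continuous_intros)
  have Dk: "(D_dir ((0, b), 0) ^^ k) v \<in> symbols m" if "b \<in> Basis" for b
    using that by (intro symbols_funpow_D_dir v) (auto simp: Basis_prod_def)
  have Dv0: "(D_dir ((0, b), 0) ^^ k) v ((x, z), \<xi>) = 0" if "x \<in> K" "z \<notin> A" for b x z \<xi>
  proof -
    have "closed A" by (simp add: A_def)
    from funpow_D_dir_vanish[where f = "\<lambda>z. v ((x, z), \<xi>)" and x = z and b = b and k = k, OF this] v0[OF that(1)] that(2)
    show ?thesis unfolding funpow_D_dir_snd_slice by simp
  qed
  have "\<exists>C\<ge>0. \<forall>x\<in>K. \<forall>\<xi>. (LINT z|lborel. norm ((D_dir ((0, b), 0) ^^ k) v ((x, z), \<xi>))) \<le> C * japanese \<xi> powr m"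
    if "b \<in> Basis" for b
    using Dv0 by (intro L Dk that) auto
  then obtain C where C: "\<And>b. b \<in> Basis \<Longrightarrow> C b \<ge> 0"
    "\<And>b x \<xi>. b \<in> Basis \<Longrightarrow> x \<in> K \<Longrightarrow> (LINT z|lborel. norm ((D_dir ((0, b), 0) ^^ k) v ((x, z), \<xi>))) \<le> C b * japanese \<xi> powr m"
    by metis
  obtain C0 where C0: "C0 \<ge> 0" "\<And>x \<xi>. x \<in> K \<Longrightarrow> (LINT z|lborel. norm (v ((x, z), \<xi>))) \<le> C0 * japanese \<xi> powr m"
    using L[OF v v0] by metis
  have "norm (smoothing r u (x, \<xi>)) \<le> ((1 + real DIM('a)) ^ k * (C0 + (\<Sum>b\<in>Basis. C b))) * japanese \<xi> powr (m - real k)"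
    if x: "x \<in> K" for x \<xi>
  proof -
    have "smoothing r u (x, \<xi>) = fourier (\<lambda>z. v ((x, z), \<xi>)) (- \<xi>)"
      by (simp add: smoothing_def fourier_def v_def mult.assoc)
    then have "japanese \<xi> ^ k * norm (smoothing r u (x, \<xi>)) = japanese (- \<xi>) ^ k * norm (fourier (\<lambda>z. v ((x, z), \<xi>)) (- \<xi>))"
      by simp
    also have "\<dots> \<le> (1 + real DIM('a)) ^ k *
      ((LINT z|lborel. norm (v ((x, z), \<xi>))) + (\<Sum>b\<in>Basis. LINT z|lborel. norm ((D_dir b ^^ k) (\<lambda>z. v ((x, z), \<xi>)) z)))"
      by (rule fourier_decay[OF sl])
    also have "\<dots> \<le> (1 + real DIM('a)) ^ k * (C0 * japanese \<xi> powr m + (\<Sum>b\<in>Basis. C b * japanese \<xi> powr m))"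
      unfolding funpow_D_dir_snd_slice by (intro mult_left_mono add_mono sum_mono C0 C x) auto
    also have "\<dots> = ((1 + real DIM('a)) ^ k * (C0 + (\<Sum>b\<in>Basis. C b))) * japanese \<xi> powr m"
      by (simp add: sum_distrib_right sum_distrib_left algebra_simps)
    finally have "norm (smoothing r u (x, \<xi>)) \<le> ((1 + real DIM('a)) ^ k * (C0 + (\<Sum>b\<in>Basis. C b))) * japanese \<xi> powr m / japanese \<xi> ^ k"
      by (subst pos_le_divide_eq) (simp_all add: mult_ac)
    then show ?thesis by (simp add: powr_diff powr_realpow)
  qed
  then show "\<exists>C. \<forall>x\<in>K. \<forall>\<theta>. norm (smoothing r u (x, \<theta>)) \<le> C * japanese \<theta> powr (m - real k)"
    by blast
qed

text \<open>The effect of D_c on exp(i<z,\<xi>>) r(x, z), with the phase removed again. For a basis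
  vector only one summand survives: the derivative of \<open>r\<close> in its first argument, or
  multiplication by a coordinate of the offset.\<close>

definition smoothing_diff :: "'a \<times> 'a \<Rightarrow> ('a::euclidean_space \<times> 'a \<Rightarrow> complex) \<Rightarrow> 'a \<times> 'a \<Rightarrow> complex" where
  "smoothing_diff c r y = D_dir (fst c, 0) r y + complex_of_real (snd y \<bullet> snd c) * r y"

lemma smooth_smoothing_diff:
  fixes r :: "'a::euclidean_space \<times> 'a \<Rightarrow> complex"
  assumes "smooth r" "c \<in> Basis"
  shows "smooth (smoothing_diff c r)"
proof -
  have "smooth (D_dir (fst c, 0) r)"
  proof (cases "fst c = 0")
    case True
    then have "D_dir (fst c, 0) r = (\<lambda>x. 0)" using D_dir_zero_dir[of r] by (simp add: zero_prod_def)
    then show ?thesis by simp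
  next
    case False
    then have "(fst c, 0) \<in> Basis" using assms(2) by (auto simp: Basis_prod_def)
    then show ?thesis using assms(1) by (rule smooth_D_dir[rotated])
  qed
  moreover have "smooth (\<lambda>y. complex_of_real (snd y \<bullet> snd c))"
    by (intro smooth_of_real_linear bounded_linear_compose[OF bounded_linear_inner_left bounded_linear_snd])
  ultimately show ?thesis
    unfolding smoothing_diff_def[abs_def] by (intro smooth_add smooth_mult assms)
qed

lemma smoothing_D_dir:
  fixes r u :: "'a::euclidean_space \<times> 'a \<Rightarrow> complex"
  assumes r: "smooth r" and u: "csymbol m u"
  shows "smoothing r u differentiable_on UNIV"
    and "c \<in> Basis \<Longrightarrow> D_dir c (smoothing r u) = (\<lambda>w. smoothing (smoothing_diff c r) u w + smoothing r (D_dir c u) w)"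
proof -
  note sm = symbols_smooth[OF csymbol_symbols[OF u]]
  obtain R where R: "R > 0" "\<And>x \<xi>. x \<notin> cball 0 R \<Longrightarrow> u (x, \<xi>) = 0"
    using csymbolE[OF u] by metis
  define F where "F w z = cis (z \<bullet> snd w) * r (fst w, z) * u (fst w + z, snd w)" for w :: "'a \<times> 'a" and z
  have s1: "smooth (\<lambda>w::'a \<times> 'a. cis (z \<bullet> snd w))" for z
    using smooth_linear[OF smooth_cis[of z] bounded_linear_snd] by (simp add: inner_commute)
  have s2: "smooth (\<lambda>w::'a \<times> 'a. r (fst w, z))" for z
    using smooth_affine[OF r, of "\<lambda>w::'a \<times> 'a. (fst w, 0)" "(0, z)"]
    by (simp add: bounded_linear_Pair bounded_linear_fst bounded_linear_zero)
  have s3: "smooth (\<lambda>w. u (fst w + z, snd w))" for z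
    using smooth_affine[OF sm bounded_linear_ident, of "(z, 0)"] by (simp add: plus_prod_def)
  have D1: "D_dir c (\<lambda>w::'a \<times> 'a. cis (z \<bullet> snd w)) = (\<lambda>w. complex_of_real (z \<bullet> snd c) * cis (z \<bullet> snd w))" for c z
  proof
    fix w
    show "D_dir c (\<lambda>w::'a \<times> 'a. cis (z \<bullet> snd w)) w = complex_of_real (z \<bullet> snd c) * cis (z \<bullet> snd w)"
      using D_dir_linear[OF bounded_linear_snd, of c "\<lambda>\<xi>. cis (\<xi> \<bullet> z)" w] by (simp add: D_dir_cis inner_commute)
  qed
  have D2: "D_dir c (\<lambda>w::'a \<times> 'a. r (fst w, z)) = (\<lambda>w. D_dir (fst c, 0) r (fst w, z))" for c z
    by (simp add: D_dir_def fun_eq_iff)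
  have D3: "D_dir c (\<lambda>w. u (fst w + z, snd w)) = (\<lambda>w. D_dir c u (fst w + z, snd w))" for c z
  proof
    fix w
    show "D_dir c (\<lambda>w. u (fst w + z, snd w)) w = D_dir c u (fst w + z, snd w)"
      using D_dir_translate[of c u "(z, 0)" w] by (simp add: plus_prod_def)
  qed
  have DF: "D_dir c (\<lambda>w. F w z) w = cis (z \<bullet> snd w) * smoothing_diff c r (fst w, z) * u (fst w + z, snd w)
      + cis (z \<bullet> snd w) * r (fst w, z) * D_dir c u (fst w + z, snd w)" for c w z
    unfolding F_def D_dir_mult[OF smooth_differentiable_on[OF smooth_mult[OF s1 s2]] smooth_differentiable_on[OF s3]]
      D_dir_mult[OF smooth_differentiable_on[OF s1] smooth_differentiable_on[OF s2]] D1 D2 D3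
    by (simp add: smoothing_diff_def algebra_simps)
  have diff: "(\<lambda>w. F w z) differentiable_on UNIV" for z
    unfolding F_def by (intro smooth_differentiable_on smooth_mult s1 s2 s3)
  have cont: "continuous_on UNIV (F w)" for w
    unfolding F_def[abs_def]
    by (intro continuous_intros continuous_on_smooth_compose[OF sm] continuous_on_smooth_compose[OF r])
  have contD: "continuous_on UNIV (\<lambda>wz. D_dir c (\<lambda>w. F w (snd wz)) (fst wz))" if "c \<in> Basis" for c
    unfolding DF by (intro continuous_intros continuous_on_smooth_compose[OF smooth_D_dir[OF sm that]]
       continuous_on_smooth_compose[OF sm] continuous_on_smooth_compose[OF r]
       continuous_on_smooth_compose[OF smooth_smoothing_diff[OF r that]])
  have sup: "\<exists>\<rho>. \<forall>w\<in>ball w0 1. \<forall>z. z \<notin> cball 0 \<rho> \<longrightarrow> F w z = 0" for w0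
  proof (intro exI[of _ "R + norm (fst w0) + 1"] ballI allI impI)
    fix w :: "'a \<times> 'a" and z :: 'a assume w: "w \<in> ball w0 1" and z: "z \<notin> cball 0 (R + norm (fst w0) + 1)"
    have "norm (fst w - fst w0) \<le> 1" using w dist_fst_le[of w w0] by (simp add: dist_norm norm_minus_commute)
    then have "norm (fst w) \<le> norm (fst w0) + 1" by norm
    then have "norm (fst w + z) > R" using z norm_triangle_ineq4[of "fst w + z" "fst w"] by simp
    then show "F w z = 0" using R(2)[of "fst w + z" "snd w"] by (simp add: F_def)
  qed
  have Ud: "smoothing r u = (\<lambda>w. LINT z|lborel. F w z)" by (simp add: smoothing_def F_def fun_eq_iff)
  show "smoothing r u differentiable_on UNIV"
    unfolding differentiable_on_UNIV Ud using D_dir_integral_compact(1)[OF diff cont contD sup] by blast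
  show "D_dir c (smoothing r u) = (\<lambda>w. smoothing (smoothing_diff c r) u w + smoothing r (D_dir c u) w)" if c: "c \<in> Basis"
  proof
    fix w
    have I: "integrable lborel (\<lambda>z. cis (z \<bullet> snd w) * q (fst w, z) * v (fst w + z, snd w))"
      if "smooth q" "csymbol n v" for q v :: "'a \<times> 'a \<Rightarrow> complex" and n
    proof (rule test_functions_integrable)
      have "smooth (\<lambda>z. q (fst w, z))"
        using smooth_affine[OF that(1), of "\<lambda>z. (0, z)" "(fst w, 0)"]
        by (simp add: bounded_linear_Pair bounded_linear_ident bounded_linear_zero)
      then show "(\<lambda>z. cis (z \<bullet> snd w) * q (fst w, z) * v (fst w + z, snd w)) \<in> test_functions"
        by (intro test_functions_mult csymbol_slice[OF that(2)] smooth_mult smooth_cis)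
    qed
    have "D_dir c (smoothing r u) w = (LINT z|lborel. D_dir c (\<lambda>w. F w z) w)"
      unfolding Ud by (rule D_dir_integral_compact(2)[OF diff cont contD sup c])
    also have "\<dots> = smoothing (smoothing_diff c r) u w + smoothing r (D_dir c u) w"
      unfolding DF smoothing_def
      by (intro Bochner_Integration.integral_add I[OF smooth_smoothing_diff[OF r c] u] I[OF r csymbol_D_dir[OF u c]])
    finally show "D_dir c (smoothing r u) w = smoothing (smoothing_diff c r) u w + smoothing r (D_dir c u) w" .
  qed
qed

text \<open>The kernel stays smooth and \<open>u\<close> stays compactly supported under the product
  rule, so each derivative is again an integral of the same kind and has every order. The target
  order \<open>s\<close> is therefore generalised in the induction.\<close>

theorem smoothing_symbols:
  fixes r u :: "'a::euclidean_space \<times> 'a \<Rightarrow> complex"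
  assumes "smooth r" "csymbol m u"
  shows "smoothing r u \<in> symbols s"
proof -
  have sb: "symbol_bound s (smoothing r u)" if "smooth r" "csymbol m u" for r u :: "'a \<times> 'a \<Rightarrow> complex" and m s
  proof -
    \<comment> \<open>The number of integrations by parts is chosen so that order m is brought down
      to at most s.\<close>
    have "m - real (nat \<lceil>m - s\<rceil>) \<le> s" by linarith
    from symbol_bound_mono[OF smoothing_bound[OF that] this] show ?thesis .
  qed
  have "smooth r \<Longrightarrow> csymbol m u \<Longrightarrow> graded_diff symbol_bound snd_weight k s (smoothing r u)" for k
  proof (induction k arbitrary: r u m s)
    case 0
    then show ?case using sb by simp
  next
    case (Suc k)
    have "graded_diff symbol_bound snd_weight k (s - snd_weight c) (D_dir c (smoothing r u))" if c: "c \<in> Basis" for c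
    proof -
      have a: "graded_diff symbol_bound snd_weight k (s - snd_weight c) (smoothing (smoothing_diff c r) u)"
        by (rule Suc.IH[OF smooth_smoothing_diff[OF Suc.prems(1) c] Suc.prems(2)])
      have b: "graded_diff symbol_bound snd_weight k (s - snd_weight c) (smoothing r (D_dir c u))"
        by (rule Suc.IH[OF Suc.prems(1) csymbol_D_dir[OF Suc.prems(2) c]])
      show ?thesis
        unfolding smoothing_D_dir(2)[OF Suc.prems c]
        by (rule graded_diff_add[of symbol_bound, OF _ a b]) (rule symbol_bound_add)
    qed
    then show ?case using sb[OF Suc.prems] smoothing_D_dir(1)[OF Suc.prems] by simp
  qed
  with assms show ?thesis by (simp add: symbols_iff)
qed

text \<open>What the operator with left symbol \<open>p\<close> and smooth kernel \<open>r\<close>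
  makes of exp(i<y,\<xi>>) u(y, \<xi>), after the phase exp(i<x,\<xi>>) has been divided
  out.\<close>

definition left_comp :: "('a::euclidean_space \<times> 'a \<Rightarrow> complex) \<Rightarrow> ('a \<times> 'a \<Rightarrow> complex) \<Rightarrow> ('a \<times> 'a \<Rightarrow> complex) \<Rightarrow> 'a \<times> 'a \<Rightarrow> complex" where
  "left_comp p r u w = twist p u w + smoothing r u w"

theorem left_comp_remainder_symbols:
  fixes p r u :: "'a::euclidean_space \<times> 'a \<Rightarrow> complex"
  assumes "p \<in> symbols m" "smooth r" "csymbol m' u"
  shows "(\<lambda>w. left_comp p r u w - sym_sum N p u w) \<in> symbols (m + m' - real N)"
proof -
  have "(\<lambda>w. (twist p u w - sym_sum N p u w) + smoothing r u w) \<in> symbols (m + m' - real N)"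
    by (intro symbols_add twist_remainder_symbols[OF assms(1,3)] smoothing_symbols[OF assms(2,3)])
  then show ?thesis by (simp add: left_comp_def algebra_simps)
qed

corollary left_comp_symbols:
  fixes p r u :: "'a::euclidean_space \<times> 'a \<Rightarrow> complex"
  assumes "p \<in> symbols m" "smooth r" "csymbol m' u"
  shows "left_comp p r u \<in> symbols (m + m')"
  using left_comp_remainder_symbols[OF assms, of 0] by (simp add: sym_sum_def)

section \<open>Pseudodifferential operators on test functions\<close>

definition psido_op :: "('a::euclidean_space \<times> 'a \<Rightarrow> complex) \<Rightarrow> ('a \<Rightarrow> complex) \<Rightarrow> 'a \<Rightarrow> complex" where
  "psido_op c \<phi> x = (LINT \<xi>|lborel. cis (x \<bullet> \<xi>) * c (x, \<xi>) * fourier \<phi> \<xi>) / complex_of_real (2 * pi) ^ DIM('a)"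

text \<open>At frequency 0 there is no phase to remove, so \<open>left_comp\<close> applied to a
  function independent of \<xi> is the operator itself.\<close>

definition left_op :: "('a::euclidean_space \<times> 'a \<Rightarrow> complex) \<Rightarrow> ('a \<times> 'a \<Rightarrow> complex) \<Rightarrow> ('a \<Rightarrow> complex) \<Rightarrow> 'a \<Rightarrow> complex" where
  "left_op p r \<phi> x = left_comp p r (\<lambda>(y, \<xi>). \<phi> y) (x, 0)"

lemma csymbol_test_function:
  fixes \<phi> :: "'a::euclidean_space \<Rightarrow> complex"
  assumes "\<phi> \<in> test_functions"
  shows "csymbol 0 (\<lambda>(y, \<xi>::'b::euclidean_space). \<phi> y)"
proof -
  obtain R where "R > 0" "smooth \<phi>" "\<And>x. x \<notin> cball 0 R \<Longrightarrow> \<phi> x = 0"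
    using test_functionsE[OF assms] by metis
  then show ?thesis unfolding csymbol_def using symbols_const_snd[of \<phi>] by auto
qed

lemma left_op_unfold:
  "left_op p r \<phi> x = (LINT \<eta>|lborel. p (x, \<eta>) * fourier (\<lambda>z. \<phi> (x + z)) \<eta>) / complex_of_real (2 * pi) ^ DIM('a)
     + (LINT z|lborel. r (x, z) * \<phi> (x + z))" for x :: "'a::euclidean_space"
  by (simp add: left_op_def left_comp_def twist_def smoothing_def ufour_def)

lemma left_op_eq:
  fixes \<phi> :: "'a::euclidean_space \<Rightarrow> complex"
  assumes "\<phi> \<in> borel_measurable borel"
  shows "left_op p r \<phi> x = psido_op p \<phi> x + (LINT z|lborel. r (x, z) * \<phi> (x + z))"
  unfolding left_op_unfold psido_op_def fourier_translate[OF assms] by (simp add: mult_ac)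

lemma fourier_modulate:
  "fourier (\<lambda>z. cis ((x + z) \<bullet> \<xi>) * f z) \<eta> = cis (x \<bullet> \<xi>) * fourier f (- \<xi> + \<eta>)"
proof -
  have "cis (- (z \<bullet> \<eta>)) * (cis ((x + z) \<bullet> \<xi>) * f z) = cis (x \<bullet> \<xi>) * (cis (- (z \<bullet> (- \<xi> + \<eta>))) * f z)" for z
  proof -
    have "- (z \<bullet> \<eta>) + (x + z) \<bullet> \<xi> = x \<bullet> \<xi> + - (z \<bullet> (- \<xi> + \<eta>))"
      by (simp add: inner_add_left inner_add_right inner_diff_right)
    then show ?thesis by (simp only: mult.assoc[symmetric] cis_mult)
  qed
  then show ?thesis by (simp only: fourier_def integral_mult_right_zero)
qed

text \<open>Modulation by exp(i<y,\<xi>>) shifts the Fourier transform by \<xi>; the substitution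
  \<eta> = \<xi> + \<zeta> moves the shift into the argument of \<open>p\<close>. Through this
  identity, locality of the operator becomes locality of its action on symbols.\<close>

lemma left_op_conjugate:
  fixes u :: "'a::euclidean_space \<times> 'a \<Rightarrow> complex"
  assumes p: "p \<in> symbols m" and u: "csymbol m' u"
  shows "left_op p r (\<lambda>y. cis (y \<bullet> \<xi>) * u (y, \<xi>)) x = cis (x \<bullet> \<xi>) * left_comp p r u (x, \<xi>)"
proof -
  have meas: "(\<lambda>\<eta>. p (x, \<eta>) * ufour u (x, \<xi>) (- \<xi> + \<eta>)) \<in> borel_measurable borel"
    using measurable_compose[OF _ ufour_measurable[OF u], of "\<lambda>\<eta>. - \<xi> + \<eta>" borel "(x, \<xi>)"]
      smooth_measurable[OF smooth_pair_snd[OF symbols_smooth[OF p], of x 0]]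
    by (intro borel_measurable_times) auto
  have "(LINT \<eta>|lborel. p (x, \<eta>) * fourier (\<lambda>z. cis ((x + z) \<bullet> \<xi>) * u (x + z, \<xi>)) \<eta>)
      = cis (x \<bullet> \<xi>) * (LINT \<eta>|lborel. p (x, \<eta>) * ufour u (x, \<xi>) (- \<xi> + \<eta>))"
    unfolding fourier_modulate integral_mult_right_zero[symmetric] ufour_def fst_conv snd_conv by (simp only: mult_ac)
  also have "(LINT \<eta>|lborel. p (x, \<eta>) * ufour u (x, \<xi>) (- \<xi> + \<eta>)) = (LINT \<zeta>|lborel. p (x, \<xi> + \<zeta>) * ufour u (x, \<xi>) \<zeta>)"
    using integral_translate[OF meas, of \<xi>] by simp
  finally have 1: "(LINT \<eta>|lborel. p (x, \<eta>) * fourier (\<lambda>z. cis ((x + z) \<bullet> \<xi>) * u (x + z, \<xi>)) \<eta>)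
      = cis (x \<bullet> \<xi>) * (LINT \<zeta>|lborel. p (x, \<xi> + \<zeta>) * ufour u (x, \<xi>) \<zeta>)" .
  have "r (x, z) * (cis ((x + z) \<bullet> \<xi>) * u (x + z, \<xi>)) = cis (x \<bullet> \<xi>) * (cis (z \<bullet> \<xi>) * r (x, z) * u (x + z, \<xi>))" for z
    by (simp add: inner_add_left cis_mult[symmetric])
  then have 2: "(LINT z|lborel. r (x, z) * (cis ((x + z) \<bullet> \<xi>) * u (x + z, \<xi>))) = cis (x \<bullet> \<xi>) * smoothing r u (x, \<xi>)"
    by (simp only: smoothing_def fst_conv snd_conv integral_mult_right_zero)
  show ?thesis
    unfolding left_op_unfold 1 2 left_comp_def twist_def by (simp add: distrib_left)
qed

text \<open>Rapid decay in the form needed to absorb a symbol of real order \<open>s\<close> and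
  still leave an integrable weight.\<close>

lemma fourier_decay_real:
  fixes \<phi> :: "'a::euclidean_space \<Rightarrow> complex"
  assumes "\<phi> \<in> test_functions"
  obtains C where "C \<ge> 0" "\<And>\<xi>. japanese \<xi> powr s * norm (fourier \<phi> \<xi>) \<le> C * japanese \<xi> powr (- (2 * real DIM('a)))"
proof -
  define k where "k = nat \<lceil>2 * real DIM('a) + s\<rceil>"
  have k: "s + - real k \<le> - (2 * real DIM('a))" unfolding k_def by linarith
  obtain C where C: "C \<ge> 0" "\<And>\<zeta>. norm (fourier \<phi> \<zeta>) \<le> C * japanese \<zeta> powr (- real k)"
    using fourier_decayE[OF assms, of k] by metis
  have "japanese \<xi> powr s * norm (fourier \<phi> \<xi>) \<le> C * japanese \<xi> powr (- (2 * real DIM('a)))" for \<xi>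
  proof -
    have "japanese \<xi> powr s * norm (fourier \<phi> \<xi>) \<le> japanese \<xi> powr s * (C * japanese \<xi> powr (- real k))"
      by (intro mult_left_mono C) auto
    also have "\<dots> = C * japanese \<xi> powr (s + - real k)" unfolding powr_add by (simp only: mult_ac)
    also have "\<dots> \<le> C * japanese \<xi> powr (- (2 * real DIM('a)))"
      using k japanese_ge_1[of \<xi>] by (intro mult_left_mono powr_mono C) auto
    finally show ?thesis .
  qed
  with C(1) show ?thesis using that by blast
qed

lemma integrable_japanese_bound:
  fixes f :: "'a::euclidean_space \<Rightarrow> complex"
  assumes "f \<in> borel_measurable borel" "\<And>\<xi>. norm (f \<xi>) \<le> C * japanese \<xi> powr (- (2 * real DIM('a)))"
  shows "integrable lborel f"
proof -
  have "integrable lborel (\<lambda>\<xi>::'a. C * japanese \<xi> powr (- (2 * real DIM('a))))"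
    by (intro integrable_mult_right integrable_japanese) auto
  then show ?thesis
    using assms by (elim Bochner_Integration.integrable_bound) (auto intro!: AE_I2 order.trans[OF assms(2) abs_ge_self])
qed

lemma fourier_test_measurable:
  "\<phi> \<in> test_functions \<Longrightarrow> fourier \<phi> \<in> borel_measurable borel"
  by (intro fourier_measurable smooth_measurable test_functions_smooth)

lemma psido_integrable:
  fixes c :: "'a::euclidean_space \<times> 'a \<Rightarrow> complex"
  assumes c: "c \<in> symbols s" and \<phi>: "\<phi> \<in> test_functions"
  shows "integrable lborel (\<lambda>\<xi>. cis (x \<bullet> \<xi>) * c (x, \<xi>) * fourier \<phi> \<xi>)"
proof -
  obtain C where C: "C \<ge> 0" "\<And>\<xi>. norm (c (x, \<xi>)) \<le> C * japanese \<xi> powr s"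
    using symbol_boundE[OF symbols_bound[OF c] compact_sing[of x]] by (metis singletonI)
  obtain D where D: "D \<ge> 0" "\<And>\<xi>. japanese \<xi> powr s * norm (fourier \<phi> \<xi>) \<le> D * japanese \<xi> powr (- (2 * real DIM('a)))"
    using fourier_decay_real[OF \<phi>, of s] by metis
  show ?thesis
  proof (rule integrable_japanese_bound)
    have [measurable]: "(\<lambda>\<xi>. c (x, \<xi>)) \<in> borel_measurable borel"
      using smooth_measurable[OF smooth_pair_snd[OF symbols_smooth[OF c], of x 0]] by simp
    have [measurable]: "fourier \<phi> \<in> borel_measurable borel" by (rule fourier_test_measurable[OF \<phi>])
    show "(\<lambda>\<xi>. cis (x \<bullet> \<xi>) * c (x, \<xi>) * fourier \<phi> \<xi>) \<in> borel_measurable borel" by measurable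
    fix \<xi>
    have "norm (cis (x \<bullet> \<xi>) * c (x, \<xi>) * fourier \<phi> \<xi>) \<le> (C * japanese \<xi> powr s) * norm (fourier \<phi> \<xi>)"
      using C by (simp add: norm_mult mult_right_mono)
    also have "\<dots> = C * (japanese \<xi> powr s * norm (fourier \<phi> \<xi>))" by (simp only: mult_ac)
    also have "\<dots> \<le> C * (D * japanese \<xi> powr (- (2 * real DIM('a))))"
      by (intro mult_left_mono D C)
    finally show "norm (cis (x \<bullet> \<xi>) * c (x, \<xi>) * fourier \<phi> \<xi>) \<le> C * D * japanese \<xi> powr (- (2 * real DIM('a)))"
      by (simp only: mult.assoc)
  qed
qed

text \<open>Compact support of \<open>u\<close> in the base variable and rapid decay of the
  transform of \<open>\<phi>\<close> make the double integral absolutely convergent. The weight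
  \<open>g\<close> is either a phase, which gives the Fourier transform of the output, or a smooth
  kernel at fixed x.\<close>

lemma weighted_psido:
  fixes u :: "'a::euclidean_space \<times> 'a \<Rightarrow> complex"
  assumes g: "continuous_on UNIV g" and u: "csymbol m u" and \<phi>: "\<phi> \<in> test_functions"
  shows "(LINT z|lborel. g z * psido_op u \<phi> (x + z)) =
    (LINT \<xi>|lborel. fourier \<phi> \<xi> * (LINT z|lborel. g z * (cis ((x + z) \<bullet> \<xi>) * u (x + z, \<xi>)))) / complex_of_real (2 * pi) ^ DIM('a)"
proof -
  let ?k = "complex_of_real (2 * pi) ^ DIM('a)"
  obtain R where R: "R > 0" "\<And>x \<xi>. x \<notin> cball 0 R \<Longrightarrow> u (x, \<xi>) = 0"
    using csymbolE[OF u] by metis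
  obtain C where C: "C \<ge> 0" "\<And>y \<xi>. y \<in> cball 0 R \<Longrightarrow> norm (u (y, \<xi>)) \<le> C * japanese \<xi> powr m"
    using symbol_boundE[OF symbols_bound[OF csymbol_symbols[OF u]] compact_cball] by metis
  obtain D where D: "D \<ge> 0" "\<And>\<xi>. japanese \<xi> powr m * norm (fourier \<phi> \<xi>) \<le> D * japanese \<xi> powr (- (2 * real DIM('a)))"
    using fourier_decay_real[OF \<phi>, of m] by metis
  have "compact (g ` cball (- x) R)"
    using continuous_on_subset[OF g] by (intro compact_continuous_image) auto
  then obtain M where M: "\<And>z. z \<in> cball (- x) R \<Longrightarrow> norm (g z) \<le> M"
    using compact_imp_bounded bounded_iff by (metis image_eqI)
  define G where "G z \<xi> = g z * (cis ((x + z) \<bullet> \<xi>) * u (x + z, \<xi>)) * fourier \<phi> \<xi>" for z \<xi>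
  have [measurable]: "g \<in> borel_measurable borel" using g by (rule borel_measurable_continuous_onI)
  have [measurable]: "u \<in> borel_measurable borel" by (rule smooth_measurable[OF symbols_smooth[OF csymbol_symbols[OF u]]])
  have [measurable]: "fourier \<phi> \<in> borel_measurable borel" by (rule fourier_test_measurable[OF \<phi>])
  have int: "integrable (lborel \<Otimes>\<^sub>M lborel) (\<lambda>(z, \<xi>). G z \<xi>)"
  proof (rule Bochner_Integration.integrable_bound)
    show "integrable (lborel \<Otimes>\<^sub>M lborel) (\<lambda>(z::'a, \<xi>::'a). (indicat_real (cball (- x) R) z * (\<bar>M\<bar> * C * D)) * japanese \<xi> powr (- (2 * real DIM('a))))"
      using emeasure_bounded_finite[OF bounded_cball, of "- x" R]
      by (intro integrable_tensor integrable_japanese integrable_mult_left integrable_real_indicator) auto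
    show "(\<lambda>(z, \<xi>). G z \<xi>) \<in> borel_measurable (lborel \<Otimes>\<^sub>M lborel)"
      unfolding G_def by measurable
    have "norm (G z \<xi>) \<le> (indicat_real (cball (- x) R) z * (\<bar>M\<bar> * C * D)) * japanese \<xi> powr (- (2 * real DIM('a)))" for z \<xi>
    proof (cases "z \<in> cball (- x) R")
      case False
      then have "x + z \<notin> cball 0 R" by (simp add: dist_norm norm_minus_commute[of "- x"] add.commute)
      then have "u (x + z, \<xi>) = 0" by (rule R(2))
      then show ?thesis using False by (simp add: G_def)
    next
      case True
      then have y: "x + z \<in> cball 0 R" by (simp add: dist_norm norm_minus_commute[of "- x"] add.commute)
      have "norm (G z \<xi>) = norm (g z) * norm (u (x + z, \<xi>)) * norm (fourier \<phi> \<xi>)"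
        by (simp add: G_def norm_mult)
      also have "\<dots> \<le> \<bar>M\<bar> * (C * japanese \<xi> powr m) * norm (fourier \<phi> \<xi>)"
        using M[OF True] C(2)[OF y] by (intro mult_right_mono mult_mono) auto
      also have "\<dots> = \<bar>M\<bar> * C * (japanese \<xi> powr m * norm (fourier \<phi> \<xi>))" by (simp only: mult_ac)
      also have "\<dots> \<le> \<bar>M\<bar> * C * (D * japanese \<xi> powr (- (2 * real DIM('a))))"
        by (intro mult_left_mono D mult_nonneg_nonneg C) auto
      finally show ?thesis using True by (simp add: mult.assoc)
    qed
    then show "AE q in lborel \<Otimes>\<^sub>M lborel. norm (case q of (z, \<xi>) \<Rightarrow> G z \<xi>) \<le>
      norm (case q of (z::'a, \<xi>::'a) \<Rightarrow> (indicat_real (cball (- x) R) z * (\<bar>M\<bar> * C * D)) * japanese \<xi> powr (- (2 * real DIM('a))))"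
      by (intro AE_I2) (auto intro: order.trans[OF _ abs_ge_self])
  qed
  have "(LINT z|lborel. g z * psido_op u \<phi> (x + z)) = (LINT z|lborel. (LINT \<xi>|lborel. G z \<xi>) / ?k)"
  proof (rule Bochner_Integration.integral_cong[OF refl])
    fix z
    have "g z * psido_op u \<phi> (x + z) = (g z * (LINT \<xi>|lborel. cis ((x + z) \<bullet> \<xi>) * u (x + z, \<xi>) * fourier \<phi> \<xi>)) / ?k"
      by (simp add: psido_op_def)
    also have "g z * (LINT \<xi>|lborel. cis ((x + z) \<bullet> \<xi>) * u (x + z, \<xi>) * fourier \<phi> \<xi>) = (LINT \<xi>|lborel. G z \<xi>)"
      unfolding integral_mult_right_zero[symmetric] G_def by (simp only: mult.assoc)
    finally show "g z * psido_op u \<phi> (x + z) = (LINT \<xi>|lborel. G z \<xi>) / ?k" .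
  qed
  also have "\<dots> = (LINT z|lborel. (LINT \<xi>|lborel. G z \<xi>)) / ?k"
    by (rule integral_divide_zero)
  also have "(LINT z|lborel. (LINT \<xi>|lborel. G z \<xi>)) = (LINT \<xi>|lborel. (LINT z|lborel. G z \<xi>))"
    by (rule lborel_pair.Fubini_integral[OF int, symmetric])
  also have "(LINT \<xi>|lborel. (LINT z|lborel. G z \<xi>)) = (LINT \<xi>|lborel. fourier \<phi> \<xi> * (LINT z|lborel. g z * (cis ((x + z) \<bullet> \<xi>) * u (x + z, \<xi>))))"
    unfolding G_def integral_mult_left_zero by (simp only: mult.commute)
  finally show ?thesis .
qed

text \<open>The output of \<open>psido_op u\<close> is a superposition over \<xi> of the functions
  exp(i<y,\<xi>>) u(y, \<xi>), weighted by the transform of \<open>\<phi>\<close>. Fubini allows the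
  outer operator to act under this integral, where conjugation produces
  \<open>left_comp p r u\<close>.\<close>

theorem left_op_psido_op:
  fixes u :: "'a::euclidean_space \<times> 'a \<Rightarrow> complex"
  assumes p: "p \<in> symbols m" and r: "smooth r" and u: "csymbol m' u" and \<phi>: "\<phi> \<in> test_functions"
  shows "left_op p r (psido_op u \<phi>) x = psido_op (left_comp p r u) \<phi> x"
proof -
  let ?k = "complex_of_real (2 * pi) ^ DIM('a)"
  define H where "H \<xi> \<eta> = fourier \<phi> \<xi> * cis (x \<bullet> \<xi>) * (p (x, \<eta>) * ufour u (x, \<xi>) (- \<xi> + \<eta>))" for \<xi> \<eta>
  have [measurable]: "u \<in> borel_measurable borel" by (rule smooth_measurable[OF symbols_smooth[OF csymbol_symbols[OF u]]])
  have [measurable]: "fourier \<phi> \<in> borel_measurable borel" by (rule fourier_test_measurable[OF \<phi>])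
  have [measurable]: "(\<lambda>\<eta>. p (x, \<eta>)) \<in> borel_measurable borel"
    using smooth_measurable[OF smooth_pair_snd[OF symbols_smooth[OF p], of x 0]] by simp
  have Um [measurable]: "(\<lambda>q. ufour u (x, fst q) (- fst q + snd q)) \<in> borel_measurable (lborel \<Otimes>\<^sub>M lborel)"
  proof -
    have "(\<lambda>(q, z). cis (- (z \<bullet> (- fst q + snd q))) * u (x + z, fst q)) \<in> borel_measurable ((lborel \<Otimes>\<^sub>M lborel) \<Otimes>\<^sub>M lborel)"
      by measurable
    then have "(\<lambda>q. LINT z|lborel. cis (- (z \<bullet> (- fst q + snd q))) * u (x + z, fst q)) \<in> borel_measurable (lborel \<Otimes>\<^sub>M lborel)"
      by (rule lborel.borel_measurable_lebesgue_integral)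
    then show ?thesis by (simp add: ufour_def fourier_def)
  qed
  have Hm: "(\<lambda>q. H (fst q) (snd q)) \<in> borel_measurable (lborel \<Otimes>\<^sub>M lborel)"
    unfolding H_def by measurable
  have tr: "(LINT \<eta>|lborel. f (- \<xi> + \<eta>)) = (LINT \<zeta>|lborel. f \<zeta>)" if "f \<in> borel_measurable borel" for f :: "'a \<Rightarrow> complex" and \<xi>
    using that by (rule integral_translate)
  have ti: "integrable lborel (\<lambda>\<zeta>. p (x, \<xi> + \<zeta>) * ufour u (x, \<xi>) \<zeta>)" for \<xi>
    using twist_integrable[OF p u, of "(x, \<xi>)"] by simp
  have Hi: "integrable lborel (\<lambda>\<eta>. H \<xi> \<eta>)" for \<xi>
  proof -
    have "integrable lborel (\<lambda>\<eta>. p (x, \<xi> + (- \<xi> + \<eta>)) * ufour u (x, \<xi>) (- \<xi> + \<eta>))"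
      by (rule integrable_translate[OF ti])
    then show ?thesis unfolding H_def by simp
  qed
  obtain C where C: "C \<ge> 0" "\<And>\<xi> \<zeta>. norm (p (x, \<xi> + \<zeta>) * ufour u (x, \<xi>) \<zeta>) \<le>
      C * japanese \<xi> powr (m + m') * japanese \<zeta> powr (- (2 * real DIM('a)))"
    using twist_integrand_bound[OF p u compact_sing[of x]] by (metis singletonI)
  obtain D where D: "D \<ge> 0" "\<And>\<xi>. japanese \<xi> powr (m + m') * norm (fourier \<phi> \<xi>) \<le> D * japanese \<xi> powr (- (2 * real DIM('a)))"
    using fourier_decay_real[OF \<phi>, of "m + m'"] by metis
  define J where "J = (LINT \<zeta>::'a|lborel. japanese \<zeta> powr (- (2 * real DIM('a))))"
  have J: "J \<ge> 0" unfolding J_def by (intro Bochner_Integration.integral_nonneg) auto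
  \<comment> \<open>After the shift \<eta> = \<xi> + \<zeta> the inner L1 norm grows like
    \<open>japanese \<xi>\<close> to the power m + m', and the decay of the transform of
    \<open>\<phi>\<close> outweighs this growth.\<close>
  have bd: "(LINT \<eta>|lborel. norm (H \<xi> \<eta>)) \<le> C * J * D * japanese \<xi> powr (- (2 * real DIM('a)))" for \<xi>
  proof -
    have "(LINT \<eta>|lborel. norm (H \<xi> \<eta>)) = norm (fourier \<phi> \<xi>) * (LINT \<eta>|lborel. norm (p (x, \<eta>) * ufour u (x, \<xi>) (- \<xi> + \<eta>)))"
      by (simp add: H_def norm_mult)
    also have "(LINT \<eta>|lborel. norm (p (x, \<eta>) * ufour u (x, \<xi>) (- \<xi> + \<eta>))) = (LINT \<zeta>|lborel. norm (p (x, \<xi> + \<zeta>) * ufour u (x, \<xi>) \<zeta>))"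
    proof -
      have "(\<lambda>\<zeta>. norm (p (x, \<xi> + \<zeta>) * ufour u (x, \<xi>) \<zeta>)) \<in> borel_measurable borel"
        using borel_measurable_integrable[OF ti[of \<xi>]] by simp
      from integral_translate[OF this, of "- \<xi>"] show ?thesis by simp
    qed
    also have "\<dots> \<le> (LINT \<zeta>::'a|lborel. C * japanese \<xi> powr (m + m') * japanese \<zeta> powr (- (2 * real DIM('a))))"
      using C by (intro integral_mono' integrable_mult_right integrable_japanese) auto
    also have "\<dots> = C * japanese \<xi> powr (m + m') * J" unfolding J_def by (rule integral_mult_right_zero)
    finally have "(LINT \<eta>|lborel. norm (H \<xi> \<eta>)) \<le> norm (fourier \<phi> \<xi>) * (C * japanese \<xi> powr (m + m') * J)"
      by (simp add: mult_left_mono)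
    also have "\<dots> = C * J * (japanese \<xi> powr (m + m') * norm (fourier \<phi> \<xi>))" by (simp only: mult_ac)
    also have "\<dots> \<le> C * J * (D * japanese \<xi> powr (- (2 * real DIM('a))))"
      by (intro mult_left_mono D mult_nonneg_nonneg C J)
    finally show ?thesis by (simp only: mult.assoc)
  qed
  have int: "integrable (lborel \<Otimes>\<^sub>M lborel) (\<lambda>(\<xi>, \<eta>). H \<xi> \<eta>)"
  proof (rule lborel_pair.Fubini_integrable)
    show "(\<lambda>(\<xi>, \<eta>). H \<xi> \<eta>) \<in> borel_measurable (lborel \<Otimes>\<^sub>M lborel)"
      using Hm by (simp add: case_prod_unfold)
    have "(\<lambda>q. norm (H (fst q) (snd q))) \<in> borel_measurable (lborel \<Otimes>\<^sub>M lborel)"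
      using Hm by measurable
    then have nm: "(\<lambda>\<xi>. LINT \<eta>|lborel. norm (H \<xi> \<eta>)) \<in> borel_measurable lborel"
      by (intro lborel.borel_measurable_lebesgue_integral) (simp add: case_prod_unfold)
    have "integrable lborel (\<lambda>\<xi>. LINT \<eta>|lborel. norm (H \<xi> \<eta>))"
    proof (rule Bochner_Integration.integrable_bound)
      show "integrable lborel (\<lambda>\<xi>::'a. C * J * D * japanese \<xi> powr (- (2 * real DIM('a))))"
        by (intro integrable_mult_right integrable_japanese) auto
      show "AE \<xi> in lborel. norm (LINT \<eta>|lborel. norm (H \<xi> \<eta>)) \<le> norm (C * J * D * japanese \<xi> powr (- (2 * real DIM('a))))"
        using bd by (intro AE_I2) (auto simp: Bochner_Integration.integral_nonneg intro: order.trans[OF _ abs_ge_self])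
    qed (rule nm)
    then show "integrable lborel (\<lambda>\<xi>. LINT \<eta>|lborel. norm (case (\<xi>, \<eta>) of (\<xi>, \<eta>) \<Rightarrow> H \<xi> \<eta>))" by simp
    show "AE \<xi> in lborel. integrable lborel (\<lambda>\<eta>. case (\<xi>, \<eta>) of (\<xi>, \<eta>) \<Rightarrow> H \<xi> \<eta>)"
      using Hi by simp
  qed
  have fw: "fourier (\<lambda>z. psido_op u \<phi> (x + z)) \<eta> = (LINT \<xi>|lborel. fourier \<phi> \<xi> * (cis (x \<bullet> \<xi>) * ufour u (x, \<xi>) (- \<xi> + \<eta>))) / ?k" for \<eta>
  proof -
    have "fourier (\<lambda>z. psido_op u \<phi> (x + z)) \<eta> = (LINT z|lborel. cis (- (z \<bullet> \<eta>)) * psido_op u \<phi> (x + z))"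
      by (simp add: fourier_def)
    also have "\<dots> = (LINT \<xi>|lborel. fourier \<phi> \<xi> * (LINT z|lborel. cis (- (z \<bullet> \<eta>)) * (cis ((x + z) \<bullet> \<xi>) * u (x + z, \<xi>)))) / ?k"
      by (rule weighted_psido[OF _ u \<phi>]) (intro continuous_intros)
    finally have e1: "fourier (\<lambda>z. psido_op u \<phi> (x + z)) \<eta> = \<dots>" .
    have e2: "(LINT z|lborel. cis (- (z \<bullet> \<eta>)) * (cis ((x + z) \<bullet> \<xi>) * u (x + z, \<xi>))) = cis (x \<bullet> \<xi>) * ufour u (x, \<xi>) (- \<xi> + \<eta>)" for \<xi>
      using fourier_modulate[of x \<xi> "\<lambda>z. u (x + z, \<xi>)" \<eta>] by (simp add: ufour_def fourier_def)
    show ?thesis unfolding e1 e2 ..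
  qed
  have "(LINT \<eta>|lborel. p (x, \<eta>) * fourier (\<lambda>z. psido_op u \<phi> (x + z)) \<eta>) = (LINT \<eta>|lborel. (LINT \<xi>|lborel. H \<xi> \<eta>) / ?k)"
  proof (rule Bochner_Integration.integral_cong[OF refl])
    fix \<eta>
    have "p (x, \<eta>) * (LINT \<xi>|lborel. fourier \<phi> \<xi> * (cis (x \<bullet> \<xi>) * ufour u (x, \<xi>) (- \<xi> + \<eta>))) = (LINT \<xi>|lborel. H \<xi> \<eta>)"
      unfolding integral_mult_right_zero[symmetric] H_def by (simp only: mult_ac)
    then show "p (x, \<eta>) * fourier (\<lambda>z. psido_op u \<phi> (x + z)) \<eta> = (LINT \<xi>|lborel. H \<xi> \<eta>) / ?k"
      unfolding fw by (simp only: times_divide_eq_right)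
  qed
  also have "\<dots> = (LINT \<eta>|lborel. (LINT \<xi>|lborel. H \<xi> \<eta>)) / ?k" by (rule integral_divide_zero)
  also have "(LINT \<eta>|lborel. (LINT \<xi>|lborel. H \<xi> \<eta>)) = (LINT \<xi>|lborel. (LINT \<eta>|lborel. H \<xi> \<eta>))"
    by (rule lborel_pair.Fubini_integral[OF int])
  also have "\<dots> = (LINT \<xi>|lborel. ?k * (cis (x \<bullet> \<xi>) * twist p u (x, \<xi>) * fourier \<phi> \<xi>))"
  proof (rule Bochner_Integration.integral_cong[OF refl])
    fix \<xi>
    have "(\<lambda>\<zeta>. p (x, \<xi> + \<zeta>) * ufour u (x, \<xi>) \<zeta>) \<in> borel_measurable borel"
      using borel_measurable_integrable[OF ti[of \<xi>]] by simp
    from tr[OF this, of \<xi>]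
    have "(LINT \<eta>|lborel. p (x, \<eta>) * ufour u (x, \<xi>) (- \<xi> + \<eta>)) = ?k * twist p u (x, \<xi>)"
      by (simp add: twist_def)
    then show "(LINT \<eta>|lborel. H \<xi> \<eta>) = ?k * (cis (x \<bullet> \<xi>) * twist p u (x, \<xi>) * fourier \<phi> \<xi>)"
      unfolding H_def integral_mult_right_zero by (simp only: mult_ac)
  qed
  also have "\<dots> = ?k * (LINT \<xi>|lborel. cis (x \<bullet> \<xi>) * twist p u (x, \<xi>) * fourier \<phi> \<xi>)"
    by (rule integral_mult_right_zero)
  finally have T: "(LINT \<eta>|lborel. p (x, \<eta>) * fourier (\<lambda>z. psido_op u \<phi> (x + z)) \<eta>)
      = (LINT \<xi>|lborel. cis (x \<bullet> \<xi>) * twist p u (x, \<xi>) * fourier \<phi> \<xi>)"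
    by simp
  have e1: "(LINT z|lborel. r (x, z) * psido_op u \<phi> (x + z)) =
      (LINT \<xi>|lborel. fourier \<phi> \<xi> * (LINT z|lborel. r (x, z) * (cis ((x + z) \<bullet> \<xi>) * u (x + z, \<xi>)))) / ?k"
    by (intro weighted_psido[OF _ u \<phi>] continuous_on_smooth_compose[OF r] continuous_intros)
  have e2: "(LINT z|lborel. r (x, z) * (cis ((x + z) \<bullet> \<xi>) * u (x + z, \<xi>))) = cis (x \<bullet> \<xi>) * smoothing r u (x, \<xi>)" for \<xi>
  proof -
    have "r (x, z) * (cis ((x + z) \<bullet> \<xi>) * u (x + z, \<xi>)) = cis (x \<bullet> \<xi>) * (cis (z \<bullet> \<xi>) * r (x, z) * u (x + z, \<xi>))" for z
      by (simp add: inner_add_left cis_mult[symmetric])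
    then show ?thesis by (simp only: smoothing_def fst_conv snd_conv integral_mult_right_zero)
  qed
  have S: "(LINT z|lborel. r (x, z) * psido_op u \<phi> (x + z)) =
      (LINT \<xi>|lborel. cis (x \<bullet> \<xi>) * smoothing r u (x, \<xi>) * fourier \<phi> \<xi>) / ?k"
    unfolding e1 e2 by (simp only: mult_ac)
  have ts: "twist p u \<in> symbols (m + m')"
    using twist_remainder_symbols[OF p u, of 0] by (simp add: sym_sum_def)
  have "(LINT \<xi>|lborel. cis (x \<bullet> \<xi>) * left_comp p r u (x, \<xi>) * fourier \<phi> \<xi>)
    = (LINT \<xi>|lborel. cis (x \<bullet> \<xi>) * twist p u (x, \<xi>) * fourier \<phi> \<xi> + cis (x \<bullet> \<xi>) * smoothing r u (x, \<xi>) * fourier \<phi> \<xi>)"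
    by (simp only: left_comp_def distrib_left distrib_right)
  also have "\<dots> = (LINT \<xi>|lborel. cis (x \<bullet> \<xi>) * twist p u (x, \<xi>) * fourier \<phi> \<xi>) + (LINT \<xi>|lborel. cis (x \<bullet> \<xi>) * smoothing r u (x, \<xi>) * fourier \<phi> \<xi>)"
    by (intro Bochner_Integration.integral_add psido_integrable[OF ts \<phi>] psido_integrable[OF smoothing_symbols[OF r u, of 0] \<phi>])
  finally show ?thesis
    unfolding left_op_unfold T S unfolding psido_op_def by (simp only: add_divide_distrib)
qed

section \<open>Cutoff functions\<close>

text \<open>The derivatives of \<open>exp (- 1/t)\<close> are linear combinations of these functions.\<close>

definition flat_fun :: "nat \<Rightarrow> real \<Rightarrow> real" where
  "flat_fun k t = (if t > 0 then inverse t ^ k * exp (- inverse t) else 0)"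

lemma flat_fun_tendsto_0: "(flat_fun k \<longlongrightarrow> 0) (at 0)"
proof -
  have "((\<lambda>t::real. inverse t ^ k / exp (inverse t)) \<longlongrightarrow> 0) (at_right 0)"
    by (rule filterlim_compose[OF tendsto_power_div_exp_0 filterlim_inverse_at_top_right])
  moreover have "\<forall>\<^sub>F t in at_right 0. inverse t ^ k / exp (inverse t) = flat_fun k t"
    by (auto simp: flat_fun_def eventually_at_right_field exp_minus divide_inverse intro!: exI[of _ 1])
  ultimately have "(flat_fun k \<longlongrightarrow> 0) (at_right 0)" by (rule Lim_transform_eventually)
  moreover have "(flat_fun k \<longlongrightarrow> 0) (at_left 0)"
    by (rule tendsto_eventually) (auto simp: flat_fun_def eventually_at_left_field intro!: exI[of _ "-1"])
  ultimately show ?thesis by (simp add: filterlim_split_at)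
qed

lemma flat_fun_deriv: "(flat_fun k has_real_derivative flat_fun (k + 2) t - real k * flat_fun (k + 1) t) (at t)"
proof -
  consider "t > 0" | "t < 0" | "t = 0" by linarith
  then show ?thesis
  proof cases
    case 1
    have "((\<lambda>t. inverse t ^ k * exp (- inverse t)) has_real_derivative flat_fun (k + 2) t - real k * flat_fun (k + 1) t) (at t)"
    proof -
      have 2: "(inverse has_real_derivative - (inverse t ^ 2)) (at t)"
        using DERIV_inverse[of t UNIV] 1 by (simp add: numeral_2_eq_2)
      have 3: "((\<lambda>t. exp (- inverse t)) has_real_derivative exp (- inverse t) * - (- (inverse t ^ 2))) (at t)"
        by (intro DERIV_fun_exp DERIV_minus 2)
      have "((\<lambda>t. inverse t ^ k * exp (- inverse t)) has_real_derivative
         real k * (- (inverse t ^ 2) * inverse t ^ (k - Suc 0)) * exp (- inverse t) + exp (- inverse t) * - (- (inverse t ^ 2)) * inverse t ^ k) (at t)"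
        by (rule DERIV_mult[OF DERIV_power[OF 2] 3])
      then show ?thesis
        using 1 by (cases k) (simp_all add: flat_fun_def power2_eq_square algebra_simps)
    qed
    then show ?thesis
      by (rule has_field_derivative_transform_within_open[of _ _ _ "{0<..}"]) (use 1 in \<open>auto simp: flat_fun_def\<close>)
  next
    case 2
    have "((\<lambda>t. 0) has_real_derivative 0) (at t)" by simp
    then have "(flat_fun k has_real_derivative 0) (at t)"
      by (rule has_field_derivative_transform_within_open[of _ _ _ "{..<0}"]) (use 2 in \<open>auto simp: flat_fun_def\<close>)
    then show ?thesis using 2 by (simp add: flat_fun_def)
  next
    case 3
    \<comment> \<open>At the origin the difference quotient is the next function of the family,
      which tends to 0.\<close>
    have "(flat_fun k y - flat_fun k 0) / (y - 0) = flat_fun (k + 1) y" for y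
      by (auto simp: flat_fun_def divide_inverse)
    then have "(flat_fun k has_real_derivative 0) (at 0)"
      unfolding has_field_derivative_iff using flat_fun_tendsto_0[of "k + 1"] by simp
    then show ?thesis using 3 by (simp add: flat_fun_def)
  qed
qed

lemma D_dir_real:
  assumes "\<And>t. (f has_real_derivative f' t) (at t)"
  shows "(\<lambda>t. complex_of_real (f t)) differentiable_on UNIV"
    "D_dir (1::real) (\<lambda>t. complex_of_real (f t)) = (\<lambda>t. - \<i> * complex_of_real (f' t))"
proof -
  have d: "((\<lambda>t. complex_of_real (f t)) has_derivative (\<lambda>h. complex_of_real (f' t * h))) (at t)" for t
    using has_derivative_of_real[OF has_field_derivative_imp_has_derivative[OF assms]] .
  show "(\<lambda>t. complex_of_real (f t)) differentiable_on UNIV"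
    using d by (auto simp: differentiable_on_UNIV differentiable_def)
  show "D_dir (1::real) (\<lambda>t. complex_of_real (f t)) = (\<lambda>t. - \<i> * complex_of_real (f' t))"
    by (simp add: fun_eq_iff D_dir_eqI[OF d])
qed

lemma smooth_real_antiderivative:
  assumes "\<And>t. (f has_real_derivative f' t) (at t)" "smooth (\<lambda>t. complex_of_real (f' t))"
  shows "smooth (\<lambda>t. complex_of_real (f t))"
  unfolding smooth_iff
proof
  fix k
  have "smooth (\<lambda>t. - \<i> * complex_of_real (f' t))" using assms(2) by (rule smooth_cmult)
  then show "graded_diff (\<lambda>_ _. True) (\<lambda>_. 0) k 0 (\<lambda>t. complex_of_real (f t))"
    by (cases k) (auto simp: D_dir_real[OF assms(1)] smooth_iff simp del: mult_minus_left)
qed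

lemma smooth_flat_fun: "smooth (\<lambda>t. complex_of_real (flat_fun k t))"
proof -
  have "graded_diff (\<lambda>_ _. True) (\<lambda>_. 0) n 0 (\<lambda>t. complex_of_real (flat_fun k t))" for n
  proof (induction n arbitrary: k)
    case (Suc n)
    have D: "D_dir (1::real) (\<lambda>t. complex_of_real (flat_fun k t)) =
        (\<lambda>t. (- \<i>) * complex_of_real (flat_fun (k + 2) t) + (\<i> * real k) * complex_of_real (flat_fun (k + 1) t))"
      unfolding D_dir_real(2)[OF flat_fun_deriv] by (simp add: algebra_simps)
    have cm: "graded_diff (\<lambda>_ _. True) (\<lambda>_. 0) n 0 (\<lambda>t. c * complex_of_real (flat_fun j t))" for c j
      using graded_diff_mult[of "\<lambda>_ _. True" "\<lambda>_. 0" n 0 "\<lambda>_. c" 0 "\<lambda>t. complex_of_real (flat_fun j t)"] Suc.IH by simp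
    have "graded_diff (\<lambda>_ _. True) (\<lambda>_. 0) n 0 (D_dir (1::real) (\<lambda>t. complex_of_real (flat_fun k t)))"
      unfolding D by (rule graded_diff_add[of "\<lambda>_ _. True", OF _ cm cm]) simp
    then show ?case using D_dir_real(1)[OF flat_fun_deriv, of k] by simp
  qed simp
  then show ?thesis by (simp add: smooth_iff)
qed

text \<open>The step is the antiderivative of the bump exp(-1/t) exp(-1/(1 - t)) on (0, 1), divided
  by its total integral.\<close>

lemma smooth_step_exists:
  obtains s :: "real \<Rightarrow> real" where "smooth (\<lambda>t. complex_of_real (s t))" "\<And>t. t \<le> 0 \<Longrightarrow> s t = 0"
    "\<And>t. t \<ge> 1 \<Longrightarrow> s t = 1" "\<And>t. 0 \<le> s t" "\<And>t. s t \<le> 1"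
proof -
  define \<kappa> where "\<kappa> t = flat_fun 0 t * flat_fun 0 (1 - t)" for t
  have \<kappa>0: "\<kappa> t = 0" if "t \<le> 0 \<or> t \<ge> 1" for t using that by (auto simp: \<kappa>_def flat_fun_def)
  have \<kappa>p: "0 \<le> \<kappa> t" for t by (simp add: \<kappa>_def flat_fun_def)
  have fc: "continuous_on UNIV (flat_fun 0)"
    using DERIV_isCont[OF flat_fun_deriv] by (simp add: continuous_on_eq_continuous_at)
  have cont: "continuous_on S \<kappa>" for S
  proof -
    have "continuous_on S (\<lambda>t. flat_fun 0 (1 - t))"
      by (rule continuous_on_compose2[OF fc]) (auto intro!: continuous_intros)
    with continuous_on_subset[OF fc] show ?thesis
      unfolding \<kappa>_def[abs_def] by (intro continuous_on_mult) auto
  qed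
  have int: "\<kappa> integrable_on {a..b}" for a b by (intro integrable_continuous_interval cont)
  have "smooth (\<lambda>t. complex_of_real (flat_fun 0 ((- t) + 1)))"
    by (rule smooth_affine[OF smooth_flat_fun bounded_linear_minus[OF bounded_linear_ident]])
  then have "smooth (\<lambda>t. complex_of_real (flat_fun 0 t) * complex_of_real (flat_fun 0 ((- t) + 1)))"
    by (intro smooth_mult smooth_flat_fun)
  then have sm\<kappa>: "smooth (\<lambda>t. complex_of_real (\<kappa> t))" by (simp add: \<kappa>_def)
  \<comment> \<open>The base point -1 lies strictly to the left of the bump, so every t \<ge> 0 is
    interior to [-1, t + 1] and the one-sided fundamental theorem yields a two-sided
    derivative.\<close>
  define S where "S t = integral {-1..t} \<kappa>" for t
  have S0: "S t = 0" if "t \<le> 0" for t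
  proof -
    have "integral {-1..t} \<kappa> = integral {-1..t} (\<lambda>_. 0)"
      using \<kappa>0 that by (intro Henstock_Kurzweil_Integration.integral_cong) auto
    then show ?thesis by (simp add: S_def)
  qed
  have dS: "(S has_real_derivative \<kappa> t) (at t)" for t
  proof (cases "t < 0")
    case True
    have "((\<lambda>t. 0) has_real_derivative 0) (at t)" by simp
    then have "(S has_real_derivative 0) (at t)"
      by (rule has_field_derivative_transform_within_open[of _ _ _ "{..<0}"]) (use True S0 in auto)
    then show ?thesis using True \<kappa>0 by simp
  next
    case False
    have "(S has_real_derivative \<kappa> t) (at t within {-1..t + 1})"
      unfolding S_def[abs_def] using False by (intro integral_has_real_derivative cont) auto
    moreover have "at t within {-1..t + 1} = at t" using False by (intro at_within_interior) (auto simp: interior_atLeastAtMost_real)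
    ultimately show ?thesis by simp
  qed
  have mono: "S a \<le> S b" if "a \<le> b" for a b
    by (rule DERIV_nonneg_imp_nondecreasing[OF that]) (use dS \<kappa>p in blast)
  have S1: "S t = S 1" if "t \<ge> 1" for t
  proof -
    have "integral {-1..t} \<kappa> = integral {-1..1} \<kappa> + integral {1..t} \<kappa>"
      using that by (intro Henstock_Kurzweil_Integration.integral_combine[symmetric] int) auto
    moreover have "integral {1..t} \<kappa> = integral {1..t} (\<lambda>_. 0)"
      using \<kappa>0 by (intro Henstock_Kurzweil_Integration.integral_cong) auto
    ultimately show ?thesis by (simp add: S_def)
  qed
  have "S 1 \<noteq> 0"
  proof
    assume "S 1 = 0"
    then have "\<forall>t\<in>{-1..1}. \<kappa> t = 0"
      using integral_eq_0_iff[of "-1" 1 \<kappa>] cont \<kappa>p by (auto simp: S_def)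
    then have "\<kappa> (1/2) = 0" by auto
    then show False by (simp add: \<kappa>_def flat_fun_def)
  qed
  then have pos: "S 1 > 0" using mono[of 0 1] S0[of 0] by simp
  have "smooth (\<lambda>t. complex_of_real (S t))"
    by (rule smooth_real_antiderivative[OF dS sm\<kappa>])
  from smooth_cmult[OF this, of "inverse (complex_of_real (S 1))"]
  have 1: "smooth (\<lambda>t. complex_of_real (S t / S 1))" by (simp add: divide_inverse mult.commute)
  have 2: "0 \<le> S t / S 1" for t
    using mono[of 0 t] S0[of 0] S0[of t] pos by (cases "t \<le> 0") auto
  have 3: "S t / S 1 \<le> 1" for t
    using mono[of t 1] S1[of t] pos by (cases "t \<le> 1") auto
  show ?thesis
  proof (rule that[of "\<lambda>t. S t / S 1"])
    show "S t / S 1 = 1" if "t \<ge> 1" for t using S1[OF that] pos by simp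
  qed (use 1 2 3 S0 in auto)
qed

text \<open>The step is composed with an affine function of the squared distance, a polynomial and
  hence smooth at the centre as well. It is at least 1 on the inner ball and at most 0 off the outer
  one.\<close>

lemma cutoff_exists:
  fixes x0 :: "'a::euclidean_space"
  assumes "0 < r" "r < R"
  obtains cutf :: "'a \<Rightarrow> real" where "smooth (\<lambda>x. complex_of_real (cutf x))" "\<And>x. 0 \<le> cutf x" "\<And>x. cutf x \<le> 1"
    "\<And>x. x \<in> cball x0 r \<Longrightarrow> cutf x = 1" "\<And>x. x \<notin> ball x0 R \<Longrightarrow> cutf x = 0"
proof -
  obtain s :: "real \<Rightarrow> real" where s: "smooth (\<lambda>t. complex_of_real (s t))" "\<And>t. t \<le> 0 \<Longrightarrow> s t = 0"
    "\<And>t. t \<ge> 1 \<Longrightarrow> s t = 1" "\<And>t. 0 \<le> s t" "\<And>t. s t \<le> 1" using smooth_step_exists by metis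
  define g where "g x = (R\<^sup>2 - (norm (x - x0))\<^sup>2) / (R\<^sup>2 - r\<^sup>2)" for x :: 'a
  have d: "R\<^sup>2 - r\<^sup>2 > 0" using assms by (simp add: power_strict_mono)
  have lin: "smooth (\<lambda>x. complex_of_real (x \<bullet> b) - complex_of_real (x0 \<bullet> b))" for b
    by (intro smooth_diff smooth_of_real_linear bounded_linear_inner_left smooth_const)
  have "smooth (\<lambda>x. inverse (complex_of_real (R\<^sup>2 - r\<^sup>2)) * (complex_of_real (R\<^sup>2) -
      (\<Sum>b\<in>Basis. (complex_of_real (x \<bullet> b) - complex_of_real (x0 \<bullet> b)) * (complex_of_real (x \<bullet> b) - complex_of_real (x0 \<bullet> b)))))"
    by (intro lin smooth_cmult smooth_diff smooth_sum smooth_mult smooth_const)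
  moreover have "inverse (complex_of_real (R\<^sup>2 - r\<^sup>2)) * (complex_of_real (R\<^sup>2) -
      (\<Sum>b\<in>Basis. (complex_of_real (x \<bullet> b) - complex_of_real (x0 \<bullet> b)) * (complex_of_real (x \<bullet> b) - complex_of_real (x0 \<bullet> b))))
      = complex_of_real (g x)" for x
  proof -
    have "(norm (x - x0))\<^sup>2 = (\<Sum>b\<in>Basis. (x \<bullet> b - x0 \<bullet> b) * (x \<bullet> b - x0 \<bullet> b))"
      unfolding power2_norm_eq_inner by (subst euclidean_inner) (simp add: inner_diff_left)
    then show ?thesis by (simp add: g_def divide_inverse mult.commute)
  qed
  ultimately have "smooth (\<lambda>x. complex_of_real (g x))" by simp
  then have sm: "smooth (\<lambda>x. complex_of_real (s (g x)))"
    by (intro smooth_compose[OF s(1)]) auto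
  have "s (g x) = 1" if "x \<in> cball x0 r" for x
  proof (rule s(3))
    have "(norm (x - x0))\<^sup>2 \<le> r\<^sup>2" using that by (intro power_mono) (auto simp: dist_norm norm_minus_commute)
    then show "1 \<le> g x" using d by (simp add: g_def)
  qed
  moreover have "s (g x) = 0" if "x \<notin> ball x0 R" for x
  proof (rule s(2))
    have "R\<^sup>2 \<le> (norm (x - x0))\<^sup>2" using that assms by (intro power_mono) (auto simp: dist_norm norm_minus_commute)
    then show "g x \<le> 0" using d by (simp add: g_def divide_le_0_iff)
  qed
  ultimately show ?thesis using that[of "\<lambda>x. s (g x)"] sm s(4,5) by auto
qed

lemma cutoff_test_function:
  fixes x0 :: "'a::euclidean_space"
  assumes "smooth (\<lambda>x. complex_of_real (cutf x))" "\<And>x. x \<notin> ball x0 R \<Longrightarrow> cutf x = 0"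
  shows "(\<lambda>x. complex_of_real (cutf x)) \<in> test_functions" "supp (\<lambda>x. complex_of_real (cutf x)) \<subseteq> cball x0 R"
  using test_functionsI[OF assms(1) compact_cball[of x0 R]] assms(2) by auto

text \<open>If g(x0) were nonzero, the real part of conj(g(x0)) g would exceed half its value at x0
  near that point, and a small bump would give a positive integral. The test functions are confined
  to a ball around x0 because kernel information will be available only locally.\<close>

lemma fundamental_lemma:
  fixes g :: "'a::euclidean_space \<Rightarrow> complex"
  assumes g: "continuous_on UNIV g" and "\<delta> > 0"
    and int: "\<And>\<psi>. \<psi> \<in> test_functions \<Longrightarrow> supp \<psi> \<subseteq> ball x0 \<delta> \<Longrightarrow> dist_of_fun g \<psi> = 0"
  shows "g x0 = 0"
proof (rule ccontr)
  assume g0: "g x0 \<noteq> 0"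
  define q where "q x = Re (cnj (g x0) * g x)" for x
  have q0: "q x0 > 0"
    using g0 by (simp add: q_def complex_neq_0 power2_eq_square)
  have "continuous_on UNIV q" unfolding q_def by (intro continuous_intros g)
  then have "isCont q x0" by (simp add: continuous_on_eq_continuous_at)
  then obtain e where e: "e > 0" "\<And>x. dist x x0 < e \<Longrightarrow> dist (q x) (q x0) < q x0 / 2"
    using q0 unfolding continuous_at_eps_delta by (metis half_gt_zero)
  define \<epsilon> where "\<epsilon> = min e \<delta>"
  have \<epsilon>: "\<epsilon> > 0" "\<epsilon> \<le> e" "\<epsilon> \<le> \<delta>" using e(1) assms(2) by (auto simp: \<epsilon>_def)
  obtain cutf :: "'a \<Rightarrow> real" where cutf: "smooth (\<lambda>x. complex_of_real (cutf x))" "\<And>x. 0 \<le> cutf x" "\<And>x. cutf x \<le> 1"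
    "\<And>x. x \<in> cball x0 (\<epsilon> / 4) \<Longrightarrow> cutf x = 1" "\<And>x. x \<notin> ball x0 (\<epsilon> / 2) \<Longrightarrow> cutf x = 0"
    using cutoff_exists[of "\<epsilon> / 4" "\<epsilon> / 2" x0] \<epsilon>(1) by (metis divide_pos_pos divide_strict_left_mono mult_pos_pos numeral_less_iff semiring_norm(76,78) zero_less_numeral)
  let ?\<psi> = "\<lambda>x. complex_of_real (cutf x)"
  have t: "?\<psi> \<in> test_functions" "supp ?\<psi> \<subseteq> cball x0 (\<epsilon> / 2)"
    using cutoff_test_function[of cutf x0 "\<epsilon> / 2", OF cutf(1)] cutf(5) by blast+
  have "supp ?\<psi> \<subseteq> ball x0 \<delta>" using t(2) \<epsilon> by (auto simp: subset_iff)
  from int[OF t(1) this] have 0: "(LINT x|lborel. g x * ?\<psi> x) = 0" by (simp add: dist_of_fun_def)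
  have ig: "integrable lborel (\<lambda>x. g x * ?\<psi> x)"
    using cutf(5) by (intro integrable_compact_support[of _ "cball x0 (\<epsilon> / 2)"] continuous_intros g smooth_continuous_on cutf(1)) auto
  then have ic: "integrable lborel (\<lambda>x. cnj (g x0) * (g x * ?\<psi> x))" by (intro integrable_mult_right)
  have "0 = Re (cnj (g x0) * (LINT x|lborel. g x * ?\<psi> x))" using 0 by simp
  also have "\<dots> = Re (LINT x|lborel. cnj (g x0) * (g x * ?\<psi> x))" by (simp only: integral_mult_right_zero)
  also have "\<dots> = (LINT x|lborel. Re (cnj (g x0) * (g x * ?\<psi> x)))" by (rule integral_Re[OF ic, symmetric])
  also have "\<dots> = (LINT x|lborel. q x * cutf x)"
    by (intro Bochner_Integration.integral_cong refl) (simp add: q_def algebra_simps)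
  finally have z: "(LINT x|lborel. q x * cutf x) = 0" by simp
  have iq: "integrable lborel (\<lambda>x. q x * cutf x)"
  proof -
    have "integrable lborel (\<lambda>x. Re (cnj (g x0) * (g x * ?\<psi> x)))" using ic by (rule integrable_Re)
    then show ?thesis by (simp add: q_def algebra_simps)
  qed
  have "(LINT x|lborel. indicat_real (ball x0 (\<epsilon> / 4)) x * (q x0 / 2)) \<le> (LINT x|lborel. q x * cutf x)"
  proof (rule integral_mono)
    show "integrable lborel (\<lambda>x. indicat_real (ball x0 (\<epsilon> / 4)) x * (q x0 / 2))"
      using emeasure_bounded_finite[OF bounded_ball, of x0 "\<epsilon> / 4"]
      by (intro integrable_mult_left integrable_real_indicator) auto
    fix x
    have qx: "q x \<ge> q x0 / 2" if "x \<in> ball x0 (\<epsilon> / 2)"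
    proof -
      have "dist x x0 < e" using that \<epsilon> by (simp add: dist_commute)
      from e(2)[OF this] show ?thesis unfolding dist_real_def by linarith
    qed
    show "indicat_real (ball x0 (\<epsilon> / 4)) x * (q x0 / 2) \<le> q x * cutf x"
    proof (cases "x \<in> ball x0 (\<epsilon> / 2)")
      case False
      then show ?thesis using cutf(5) \<epsilon>(1) by (auto simp: indicator_def)
    next
      case True
      show ?thesis
      proof (cases "x \<in> ball x0 (\<epsilon> / 4)")
        case t: True
        then have "cutf x = 1" using cutf(4)[of x] by simp
        then show ?thesis using qx[OF True] t by simp
      next
        case False
        have "0 \<le> q x * cutf x" using qx[OF True] q0 cutf(2)[of x] by (intro mult_nonneg_nonneg) auto
        then show ?thesis using False by simp
      qed
    qed
  qed (rule iq)
  moreover have "(LINT x|lborel. indicat_real (ball x0 (\<epsilon> / 4)) x * (q x0 / 2)) = measure lborel (ball x0 (\<epsilon> / 4)) * (q x0 / 2)"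
    by simp
  moreover have "measure lborel (ball x0 (\<epsilon> / 4)) > 0"
    using \<epsilon>(1) content_ball_pos[of "\<epsilon> / 4" x0] by simp
  ultimately show False using z q0 by (simp add: mult_le_0_iff)
qed

section \<open>Schwartz kernels of pseudodifferential operators\<close>

text \<open>Integrating over (x, y) before \<xi> turns the oscillatory integral into an absolutely
  convergent one: the y-integration is a Fourier transform and supplies the decay in \<xi>.\<close>

definition kern_slice :: "('a::euclidean_space \<times> 'a \<Rightarrow> complex) \<Rightarrow> ('a \<times> 'a \<Rightarrow> complex) \<Rightarrow> 'a \<Rightarrow> complex" where
  "kern_slice c \<Phi> \<xi> = (LINT z|lborel. cis ((fst z - snd z) \<bullet> \<xi>) * c (fst z, \<xi>) * \<Phi> z)"

definition kern :: "('a::euclidean_space \<times> 'a \<Rightarrow> complex) \<Rightarrow> ('a \<times> 'a) functional" where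
  "kern c \<Phi> = (LINT \<xi>|lborel. kern_slice c \<Phi> \<xi>) / complex_of_real (2 * pi) ^ DIM('a)"

definition seminorm_le :: "nat \<Rightarrow> ('a::euclidean_space \<Rightarrow> complex) \<Rightarrow> real" where
  "seminorm_le N \<Phi> = (\<Sum>\<alpha> | \<alpha> \<in> multi_indices \<and> mi_order \<alpha> \<le> N. SUP x. norm (D_mi \<alpha> \<Phi> x))"

lemma seminorm_le_bound:
  fixes \<Phi> :: "'a::euclidean_space \<Rightarrow> complex"
  assumes \<Phi>: "\<Phi> \<in> test_functions" and b: "b \<in> Basis" and j: "j \<le> N"
  shows "norm ((D_dir b ^^ j) \<Phi> z) \<le> seminorm_le N \<Phi>"
proof -
  define \<alpha> where "\<alpha> c = (if c = b then j else 0)" for c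
  have \<alpha>: "\<alpha> \<in> multi_indices" "mi_order \<alpha> = j"
    using b by (auto simp: multi_indices_def mi_order_def \<alpha>_def)
  have "mset (mi_list \<alpha>) = mset (replicate j b)"
    by (rule multiset_eqI) (use b in \<open>auto simp: count_mi_list \<alpha>_def\<close>)
  then have "foldr D_dir (mi_list \<alpha>) \<Phi> = foldr D_dir (replicate j b) \<Phi>"
    by (rule foldr_D_dir_mset[OF test_functions_smooth[OF \<Phi>] set_mi_list])
  also have "foldr D_dir (replicate j b) \<Phi> = (D_dir b ^^ j) \<Phi>" by (induction j) auto
  finally have D: "D_mi \<alpha> \<Phi> = (D_dir b ^^ j) \<Phi>" by (simp add: D_mi_foldr)
  have bdd: "bdd_above (range (\<lambda>x. norm (D_mi \<beta> \<Phi> x)))" for \<beta>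
  proof -
    have "D_mi \<beta> \<Phi> \<in> test_functions"
      unfolding D_mi_foldr using fourier_foldr_D_dir[OF \<Phi> set_mi_list] by blast
    then obtain M where "\<And>x. norm (D_mi \<beta> \<Phi> x) \<le> M" using test_functions_bounded by metis
    then show ?thesis by (intro bdd_aboveI[of _ M]) auto
  qed
  have "norm (D_mi \<alpha> \<Phi> z) \<le> (SUP x. norm (D_mi \<alpha> \<Phi> x))"
    by (intro cSUP_upper bdd) auto
  also have "\<dots> \<le> seminorm_le N \<Phi>"
    unfolding seminorm_le_def
  proof (rule member_le_sum)
    show "0 \<le> (SUP x. norm (D_mi \<beta> \<Phi> x))" for \<beta>
      by (rule cSUP_upper2[OF bdd, where x = 0]) simp_all
  qed (use \<alpha> j in \<open>auto simp: finite_multi_indices_le\<close>)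
  finally show ?thesis by (simp add: D)
qed

lemma test_function_pair_slice:
  fixes \<Phi> :: "'a::euclidean_space \<times> 'b::euclidean_space \<Rightarrow> complex"
  assumes "smooth \<Phi>" "\<forall>z. z \<notin> cball 0 R \<longrightarrow> \<Phi> z = 0"
  shows "(\<lambda>y. \<Phi> (x, y)) \<in> test_functions" "\<And>y. y \<notin> cball 0 R \<Longrightarrow> \<Phi> (x, y) = 0" "\<And>y. x \<notin> cball 0 R \<Longrightarrow> \<Phi> (x, y) = 0"
proof -
  show *: "\<Phi> (x, y) = 0" if "y \<notin> cball 0 R" for y
    using that norm_snd_le[of y x] by (intro assms(2)[rule_format]) auto
  show "\<Phi> (x, y) = 0" if "x \<notin> cball 0 R" for y
    using that norm_fst_le[of x y] by (intro assms(2)[rule_format]) auto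
  have "smooth (\<lambda>y. \<Phi> (x, y))" using smooth_pair_snd[OF assms(1), of x 0] by simp
  then show "(\<lambda>y. \<Phi> (x, y)) \<in> test_functions"
    using * by (intro test_functionsI[of _ "cball 0 R"]) auto
qed

lemma kern_integrand:
  fixes c :: "'a::euclidean_space \<times> 'a \<Rightarrow> complex"
  assumes c: "c \<in> symbols m" and \<Phi>: "\<Phi> \<in> test_functions"
  shows "integrable lborel (\<lambda>z. cis ((fst z - snd z) \<bullet> \<xi>) * c (fst z, \<xi>) * \<Phi> z)"
proof -
  obtain R where R: "R > 0" "smooth \<Phi>" "\<And>z. z \<notin> cball 0 R \<Longrightarrow> \<Phi> z = 0"
    using test_functionsE[OF \<Phi>] by metis
  have "continuous_on UNIV (\<lambda>z. cis ((fst z - snd z) \<bullet> \<xi>) * c (fst z, \<xi>) * \<Phi> z)"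
    by (intro continuous_intros continuous_on_smooth_compose[OF symbols_smooth[OF c]] smooth_continuous_on R)
  then show ?thesis by (rule integrable_compact_support[OF _ compact_cball[of 0 R]]) (simp add: R(3))
qed

lemma kern_slice_eq:
  fixes c :: "'a::euclidean_space \<times> 'a \<Rightarrow> complex"
  assumes c: "c \<in> symbols m" and \<Phi>: "\<Phi> \<in> test_functions"
  shows "kern_slice c \<Phi> \<xi> = (LINT x|lborel. cis (x \<bullet> \<xi>) * c (x, \<xi>) * fourier (\<lambda>y. \<Phi> (x, y)) \<xi>)"
proof -
  let ?G = "\<lambda>z. cis ((fst z - snd z) \<bullet> \<xi>) * c (fst z, \<xi>) * \<Phi> z"
  have "integrable (lborel \<Otimes>\<^sub>M lborel) ?G"
    unfolding lborel_prod by (rule kern_integrand[OF c \<Phi>])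
  then have "(LINT x|lborel. (LINT y|lborel. ?G (x, y))) = integral\<^sup>L (lborel \<Otimes>\<^sub>M lborel) ?G"
    by (rule lborel_pair.integral_fst')
  then have "kern_slice c \<Phi> \<xi> = (LINT x|lborel. (LINT y|lborel. ?G (x, y)))"
    unfolding lborel_prod kern_slice_def by simp
  also have "\<dots> = (LINT x|lborel. cis (x \<bullet> \<xi>) * c (x, \<xi>) * fourier (\<lambda>y. \<Phi> (x, y)) \<xi>)"
  proof (rule Bochner_Integration.integral_cong[OF refl])
    fix x
    have "?G (x, y) = (cis (x \<bullet> \<xi>) * c (x, \<xi>)) * (cis (- (y \<bullet> \<xi>)) * \<Phi> (x, y))" for y
    proof -
      have "cis ((x - y) \<bullet> \<xi>) = cis (x \<bullet> \<xi>) * cis (- (y \<bullet> \<xi>))" by (simp add: cis_mult inner_diff_left)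
      then show ?thesis by (simp only: fst_conv snd_conv mult_ac)
    qed
    then show "(LINT y|lborel. ?G (x, y)) = cis (x \<bullet> \<xi>) * c (x, \<xi>) * fourier (\<lambda>y. \<Phi> (x, y)) \<xi>"
      by (simp only: fourier_def integral_mult_right_zero)
  qed
  finally show ?thesis .
qed

lemma integral_norm_cball_le:
  fixes f :: "'a::euclidean_space \<Rightarrow> complex"
  assumes "\<And>y. norm (f y) \<le> S" "\<And>y. y \<notin> cball 0 R \<Longrightarrow> f y = 0"
  shows "(LINT y|lborel. norm (f y)) \<le> measure lborel (cball (0::'a) R) * S"
proof -
  have S: "0 \<le> S" using assms(1)[of undefined] norm_ge_zero order.trans by blast
  have "(LINT y|lborel. norm (f y)) \<le> (LINT y|lborel. indicator (cball (0::'a) R) y * S)"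
  proof (rule integral_mono')
    show "integrable lborel (\<lambda>y. indicator (cball (0::'a) R) y * S)"
      using emeasure_bounded_finite[OF bounded_cball, of "0::'a" R]
      by (intro integrable_mult_left integrable_real_indicator) auto
    show "norm (f y) \<le> indicator (cball 0 R) y * S" for y
      using assms(1)[of y] assms(2)[of y] by (cases "y \<in> cball 0 R") (auto simp: indicator_def)
  qed (use S in auto)
  also have "\<dots> = measure lborel (cball (0::'a) R) * S" by simp
  finally show ?thesis .
qed

text \<open>The transform of \<Phi>(x, .) decays to an order \<open>k\<close> chosen against m + 2
  DIM, at the cost of derivatives of \<Phi> of order at most \<open>k\<close>. Finitely many
  seminorms and the volume of the fixed ball thus control the slice, which is the continuity
  estimate of a distribution.\<close>

lemma kern_slice_bound:
  fixes c :: "'a::euclidean_space \<times> 'a \<Rightarrow> complex"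
  assumes c: "c \<in> symbols m"
  shows "\<exists>C N. C \<ge> 0 \<and> (\<forall>\<Phi>\<in>test_functions. (\<forall>z. z \<notin> cball 0 R \<longrightarrow> \<Phi> z = 0) \<longrightarrow>
     (\<forall>\<xi>. norm (kern_slice c \<Phi> \<xi>) \<le> C * seminorm_le N \<Phi> * japanese \<xi> powr (- (2 * real DIM('a)))))"
proof -
  define k where "k = nat \<lceil>2 * real DIM('a) + m\<rceil>"
  have k: "m + - real k \<le> - (2 * real DIM('a))" unfolding k_def by linarith
  obtain C where C: "C \<ge> 0" "\<And>x \<xi>. x \<in> cball 0 R \<Longrightarrow> norm (c (x, \<xi>)) \<le> C * japanese \<xi> powr m"
    using symbol_boundE[OF symbols_bound[OF c] compact_cball] by metis
  define V where "V = measure lborel (cball (0::'a) R)"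
  have V: "V \<ge> 0" by (simp add: V_def)
  define D where "D = (1 + real DIM('a)) ^ k * (1 + real DIM('a)) * V"
  have D: "D \<ge> 0" using V by (simp add: D_def)
  have "norm (kern_slice c \<Phi> \<xi>) \<le> (V * C * D) * seminorm_le k \<Phi> * japanese \<xi> powr (- (2 * real DIM('a)))"
    if \<Phi>: "\<Phi> \<in> test_functions" and \<Phi>R: "\<forall>z. z \<notin> cball 0 R \<longrightarrow> \<Phi> z = 0" for \<Phi> :: "'a \<times> 'a \<Rightarrow> complex" and \<xi>
  proof -
    let ?S = "seminorm_le k \<Phi>"
    obtain b0 :: 'a where b0: "b0 \<in> Basis" using nonempty_Basis by blast
    have S: "norm ((D_dir (0, b) ^^ j) \<Phi> z) \<le> ?S" if "b \<in> Basis" "j \<le> k" for b :: 'a and j z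
      using that by (intro seminorm_le_bound \<Phi>) (auto simp: Basis_prod_def)
    have S0: "0 \<le> ?S" using S[OF b0, of 0 undefined] norm_ge_zero order.trans by blast
    note sl = test_function_pair_slice[OF test_functions_smooth[OF \<Phi>] \<Phi>R]
    have Dsl: "(D_dir b ^^ j) (\<lambda>y. \<Phi> (x, y)) = (\<lambda>y. (D_dir (0, b) ^^ j) \<Phi> (x, y))" for b :: 'a and j x
      by (induction j) (auto simp: D_dir_Pair_snd)
    have F: "norm (fourier (\<lambda>y. \<Phi> (x, y)) \<xi>) \<le> D * ?S * japanese \<xi> powr (- real k)" for x
    proof -
      have "japanese \<xi> ^ k * norm (fourier (\<lambda>y. \<Phi> (x, y)) \<xi>) \<le> (1 + real DIM('a)) ^ k *
        ((LINT y|lborel. norm (\<Phi> (x, y))) + (\<Sum>b\<in>Basis. LINT y|lborel. norm ((D_dir b ^^ k) (\<lambda>y. \<Phi> (x, y)) y)))"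
        by (rule fourier_decay[OF sl(1)])
      also have "\<dots> \<le> (1 + real DIM('a)) ^ k * (V * ?S + (\<Sum>b\<in>(Basis::'a set). V * ?S))"
      proof (intro mult_left_mono add_mono sum_mono)
        show "(LINT y|lborel. norm (\<Phi> (x, y))) \<le> V * ?S"
          unfolding V_def using S[OF b0, of 0] sl(2) by (intro integral_norm_cball_le) auto
        show "(LINT y|lborel. norm ((D_dir b ^^ k) (\<lambda>y. \<Phi> (x, y)) y)) \<le> V * ?S" if "b \<in> Basis" for b :: 'a
          unfolding V_def
        proof (rule integral_norm_cball_le)
          show "norm ((D_dir b ^^ k) (\<lambda>y. \<Phi> (x, y)) y) \<le> ?S" for y
            unfolding Dsl by (rule S[OF that]) simp
          show "(D_dir b ^^ k) (\<lambda>y. \<Phi> (x, y)) y = 0" if "y \<notin> cball 0 R" for y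
            by (rule funpow_D_dir_vanish[OF closed_cball sl(2) that])
        qed
      qed simp
      also have "\<dots> = D * ?S" by (simp add: D_def algebra_simps)
      finally have "norm (fourier (\<lambda>y. \<Phi> (x, y)) \<xi>) \<le> D * ?S / japanese \<xi> ^ k"
        by (subst pos_le_divide_eq) (simp_all add: mult_ac)
      then show ?thesis by (simp add: powr_minus powr_realpow divide_inverse)
    qed
    have "norm (kern_slice c \<Phi> \<xi>) \<le> (LINT x|lborel. norm (cis (x \<bullet> \<xi>) * c (x, \<xi>) * fourier (\<lambda>y. \<Phi> (x, y)) \<xi>))"
      unfolding kern_slice_eq[OF c \<Phi>] by (rule integral_norm_bound)
    also have "\<dots> \<le> V * (C * japanese \<xi> powr m * (D * ?S * japanese \<xi> powr (- real k)))"
      unfolding V_def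
    proof (rule integral_norm_cball_le)
      fix x
      show z: "cis (x \<bullet> \<xi>) * c (x, \<xi>) * fourier (\<lambda>y. \<Phi> (x, y)) \<xi> = 0" if "x \<notin> cball 0 R"
        using sl(3)[OF that] by (simp add: fourier_def)
      show "norm (cis (x \<bullet> \<xi>) * c (x, \<xi>) * fourier (\<lambda>y. \<Phi> (x, y)) \<xi>) \<le> C * japanese \<xi> powr m * (D * ?S * japanese \<xi> powr (- real k))"
      proof (cases "x \<in> cball 0 R")
        case True
        then show ?thesis using C F by (auto simp: norm_mult intro!: mult_mono)
      next
        case False
        then have "cis (x \<bullet> \<xi>) * c (x, \<xi>) * fourier (\<lambda>y. \<Phi> (x, y)) \<xi> = 0" by (rule z)
        then show ?thesis using C(1) D S0 by (simp only: norm_zero) simp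
      qed
    qed
    also have "\<dots> = (V * C * D) * ?S * japanese \<xi> powr (m + - real k)"
      unfolding powr_add by (simp only: mult_ac)
    also have "\<dots> \<le> (V * C * D) * ?S * japanese \<xi> powr (- (2 * real DIM('a)))"
      using k japanese_ge_1[of \<xi>] V C(1) D S0 by (intro mult_left_mono powr_mono mult_nonneg_nonneg) auto
    finally show ?thesis .
  qed
  moreover have "V * C * D \<ge> 0" using V C(1) D by simp
  ultimately show ?thesis by blast
qed

lemma kern_slice_integrable:
  fixes c :: "'a::euclidean_space \<times> 'a \<Rightarrow> complex"
  assumes c: "c \<in> symbols m" and \<Phi>: "\<Phi> \<in> test_functions"
  shows "integrable lborel (kern_slice c \<Phi>)"
proof -
  obtain R where R: "R > 0" "smooth \<Phi>" "\<And>z. z \<notin> cball 0 R \<Longrightarrow> \<Phi> z = 0"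
    using test_functionsE[OF \<Phi>] by metis
  obtain C N where C: "C \<ge> 0" "\<forall>\<Phi>\<in>test_functions. (\<forall>z. z \<notin> cball 0 R \<longrightarrow> \<Phi> z = 0) \<longrightarrow>
     (\<forall>\<xi>. norm (kern_slice c \<Phi> \<xi>) \<le> C * seminorm_le N \<Phi> * japanese \<xi> powr (- (2 * real DIM('a))))"
    using kern_slice_bound[OF c, of R] by (elim exE conjE)
  have [measurable]: "c \<in> borel_measurable borel" by (rule smooth_measurable[OF symbols_smooth[OF c]])
  have [measurable]: "\<Phi> \<in> borel_measurable borel" by (rule smooth_measurable[OF R(2)])
  have "(\<lambda>(\<xi>, z). cis ((fst z - snd z) \<bullet> \<xi>) * c (fst z, \<xi>) * \<Phi> z) \<in> borel_measurable (borel \<Otimes>\<^sub>M lborel)"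
  proof -
    have "(\<lambda>q. cis ((fst (snd q) - snd (snd q)) \<bullet> fst q) * c (fst (snd q), fst q) * \<Phi> (snd q)) \<in> borel_measurable (borel \<Otimes>\<^sub>M borel :: ('a \<times> 'a \<times> 'a) measure)"
      unfolding borel_prod
      by (intro borel_measurable_continuous_onI continuous_intros continuous_on_smooth_compose[OF symbols_smooth[OF c]]
          continuous_on_smooth_compose[OF R(2)])
    then show ?thesis by (simp add: case_prod_unfold cong: measurable_cong_sets)
  qed
  then have "(\<lambda>\<xi>. LINT z|lborel. cis ((fst z - snd z) \<bullet> \<xi>) * c (fst z, \<xi>) * \<Phi> z) \<in> borel_measurable borel"
    by (rule lborel.borel_measurable_lebesgue_integral)
  then have "kern_slice c \<Phi> \<in> borel_measurable borel" by (simp add: kern_slice_def[abs_def])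
  then show ?thesis
    by (rule integrable_japanese_bound) (use C(2) \<Phi> R(3) in blast)
qed

lemma test_functions_add:
  fixes f g :: "'a::euclidean_space \<Rightarrow> complex"
  assumes "f \<in> test_functions" "g \<in> test_functions"
  shows "(\<lambda>x. f x + g x) \<in> test_functions"
proof -
  obtain R where R: "R > 0" "smooth f" "\<And>z. z \<notin> cball 0 R \<Longrightarrow> f z = 0"
    using test_functionsE[OF assms(1)] by metis
  obtain S where S: "S > 0" "smooth g" "\<And>z. z \<notin> cball 0 S \<Longrightarrow> g z = 0"
    using test_functionsE[OF assms(2)] by metis
  show ?thesis
    using R(3) S(3) by (intro test_functionsI[of _ "cball 0 (max R S)"] smooth_add R S) auto
qed

lemma test_functions_cmult: "f \<in> test_functions \<Longrightarrow> (\<lambda>x. c * f x) \<in> test_functions"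
  by (rule test_functions_mult[OF _ smooth_const])

theorem kern_distribution:
  fixes c :: "'a::euclidean_space \<times> 'a \<Rightarrow> complex"
  assumes c: "c \<in> symbols m"
  shows "distribution (kern c)"
  unfolding distribution_def
proof (intro conjI ballI allI impI)
  fix \<phi> \<psi> :: "'a \<times> 'a \<Rightarrow> complex" assume t: "\<phi> \<in> test_functions" "\<psi> \<in> test_functions"
  have "kern_slice c (\<lambda>x. \<phi> x + \<psi> x) \<xi> = kern_slice c \<phi> \<xi> + kern_slice c \<psi> \<xi>" for \<xi>
    unfolding kern_slice_def distrib_left by (intro Bochner_Integration.integral_add kern_integrand[OF c] t)
  then show "kern c (\<lambda>x. \<phi> x + \<psi> x) = kern c \<phi> + kern c \<psi>"
    using kern_slice_integrable[OF c t(1)] kern_slice_integrable[OF c t(2)] by (simp add: kern_def add_divide_distrib)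
next
  fix k and \<phi> :: "'a \<times> 'a \<Rightarrow> complex" assume t: "\<phi> \<in> test_functions"
  have "cis ((fst z - snd z) \<bullet> \<xi>) * c (fst z, \<xi>) * (k * \<phi> z) = k * (cis ((fst z - snd z) \<bullet> \<xi>) * c (fst z, \<xi>) * \<phi> z)" for z \<xi>
    by (simp only: mult_ac)
  then have "kern_slice c (\<lambda>x. k * \<phi> x) \<xi> = k * kern_slice c \<phi> \<xi>" for \<xi>
    unfolding kern_slice_def by (simp only: integral_mult_right_zero)
  then show "kern c (\<lambda>x. k * \<phi> x) = k * kern c \<phi>" by (simp add: kern_def)
next
  fix K :: "('a \<times> 'a) set" assume cK: "compact K"
  obtain R where R: "\<And>z. z \<in> K \<Longrightarrow> norm z \<le> R"
    using compact_imp_bounded[OF cK] unfolding bounded_iff by blast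
  obtain C N where C: "C \<ge> 0" "\<forall>\<Phi>\<in>test_functions. (\<forall>z. z \<notin> cball 0 R \<longrightarrow> \<Phi> z = 0) \<longrightarrow>
     (\<forall>\<xi>. norm (kern_slice c \<Phi> \<xi>) \<le> C * seminorm_le N \<Phi> * japanese \<xi> powr (- (2 * real DIM('a))))"
    using kern_slice_bound[OF c, of R] by (elim exE conjE)
  define J where "J = (LINT \<zeta>::'a|lborel. japanese \<zeta> powr (- (2 * real DIM('a))))"
  let ?k = "complex_of_real (2 * pi) ^ DIM('a)"
  have "norm (kern c \<phi>) \<le> (C * J / norm ?k) * seminorm_le N \<phi>" if t: "\<phi> \<in> test_functions" "supp \<phi> \<subseteq> K" for \<phi>
  proof -
    have z: "\<forall>z. z \<notin> cball 0 R \<longrightarrow> \<phi> z = 0"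
    proof (intro allI impI)
      fix z :: "'a \<times> 'a" assume z: "z \<notin> cball 0 R"
      have "z \<notin> supp \<phi>"
      proof
        assume "z \<in> supp \<phi>"
        with t(2) have "norm z \<le> R" by (intro R) (rule subsetD)
        with z show False by simp
      qed
      then show "\<phi> z = 0" using closure_subset[of "{x. \<phi> x \<noteq> 0}"] by (auto simp: supp_def)
    qed
    have "norm (LINT \<xi>|lborel. kern_slice c \<phi> \<xi>) \<le> (LINT \<xi>|lborel. norm (kern_slice c \<phi> \<xi>))"
      by (rule integral_norm_bound)
    also have "\<dots> \<le> (LINT \<xi>::'a|lborel. C * seminorm_le N \<phi> * japanese \<xi> powr (- (2 * real DIM('a))))"
      using C(2) t(1) z
      by (intro integral_mono integrable_norm kern_slice_integrable[OF c] integrable_mult_right integrable_japanese) auto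
    also have "\<dots> = C * seminorm_le N \<phi> * J" unfolding J_def by (rule integral_mult_right_zero)
    finally show ?thesis
      by (simp add: kern_def norm_divide divide_right_mono mult_ac)
  qed
  then show "\<exists>C N. \<forall>\<phi>\<in>test_functions. supp \<phi> \<subseteq> K \<longrightarrow>
      norm (kern c \<phi>) \<le> C * (\<Sum>\<alpha> | \<alpha> \<in> multi_indices \<and> mi_order \<alpha> \<le> N. SUP x. norm (D_mi \<alpha> \<phi> x))"
    unfolding seminorm_le_def by blast
qed

text \<open>A cutoff in \<xi> merely multiplies each slice by \<kappa>(\<epsilon> \<xi>). This tends
  to 1 and is bounded, so dominated convergence gives a limit that is the same for all admissible
  cutoffs.\<close>

theorem kern_oscillatory:
  fixes c :: "'a::euclidean_space \<times> 'a \<Rightarrow> complex"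
  assumes c: "c \<in> symbols m"
  shows "is_oscillatory_integral (\<lambda>((x, y), \<xi>). (x - y) \<bullet> \<xi>) (\<lambda>((x, y), \<xi>). c (x, \<xi>))
    (\<lambda>\<Phi>. LINT \<xi>|lborel. kern_slice c \<Phi> \<xi>)"
  unfolding is_oscillatory_integral_def
proof (intro ballI impI)
  fix \<kappa> :: "'a \<Rightarrow> complex" and \<Phi> :: "'a \<times> 'a \<Rightarrow> complex"
  assume \<kappa>: "\<kappa> \<in> test_functions" "\<forall>\<^sub>F \<theta> in nhds 0. \<kappa> \<theta> = 1" and \<Phi>: "\<Phi> \<in> test_functions"
  have \<kappa>1: "\<kappa> 0 = 1" using \<kappa>(2) by (rule eventually_nhds_x_imp_x)
  obtain R where R: "R > 0" "smooth \<Phi>" "\<And>z. z \<notin> cball 0 R \<Longrightarrow> \<Phi> z = 0"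
    using test_functionsE[OF \<Phi>] by metis
  obtain \<rho> where \<rho>: "\<rho> > 0" "smooth \<kappa>" "\<And>z. z \<notin> cball 0 \<rho> \<Longrightarrow> \<kappa> z = 0"
    using test_functionsE[OF \<kappa>(1)] by metis
  obtain M where M: "M \<ge> 0" "\<And>x. norm (\<kappa> x) \<le> M" using test_functions_bounded[OF \<kappa>(1)] by metis
  let ?F = "\<lambda>\<epsilon>::real. LINT z|lborel. exp (\<i> * complex_of_real (case z of (q, \<xi>) \<Rightarrow> (case q of (x, y) \<Rightarrow> \<lambda>\<xi>. (x - y) \<bullet> \<xi>) \<xi>)) *
      \<kappa> (\<epsilon> *\<^sub>R snd z) * (case z of (q, \<xi>) \<Rightarrow> (case q of (x, y) \<Rightarrow> \<lambda>\<xi>. c (x, \<xi>)) \<xi>) * \<Phi> (fst z)"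
  \<comment> \<open>For \<epsilon> > 0 the integrand has compact support in all variables jointly,
    so the order of integration can be changed.\<close>
  have eq: "?F \<epsilon> = (LINT \<xi>|lborel. \<kappa> (\<epsilon> *\<^sub>R \<xi>) * kern_slice c \<Phi> \<xi>)" if \<epsilon>: "\<epsilon> > 0" for \<epsilon>
  proof -
    define G where "G q \<xi> = \<kappa> (\<epsilon> *\<^sub>R \<xi>) * (cis ((fst q - snd q) \<bullet> \<xi>) * c (fst q, \<xi>) * \<Phi> q)" for q \<xi>
    have "continuous_on UNIV (\<lambda>z. G (fst z) (snd z))"
      unfolding G_def by (intro continuous_intros continuous_on_smooth_compose[OF symbols_smooth[OF c]]
          continuous_on_smooth_compose[OF R(2)] continuous_on_smooth_compose[OF \<rho>(2)])
    moreover have "G (fst z) (snd z) = 0" if "z \<notin> cball 0 R \<times> cball 0 (\<rho> / \<epsilon>)" for z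
    proof -
      have "fst z \<notin> cball 0 R \<or> \<epsilon> *\<^sub>R snd z \<notin> cball 0 \<rho>"
        using that \<epsilon> by (auto simp: mem_Times_iff field_simps)
      then show ?thesis using R(3)[of "fst z"] \<rho>(3)[of "\<epsilon> *\<^sub>R snd z"] by (auto simp: G_def)
    qed
    ultimately have "integrable lborel (\<lambda>z. G (fst z) (snd z))"
      by (intro integrable_compact_support[of _ "cball 0 R \<times> cball 0 (\<rho> / \<epsilon>)"] compact_Times) auto
    then have int: "integrable (lborel \<Otimes>\<^sub>M lborel) (\<lambda>(q, \<xi>). G q \<xi>)"
      unfolding lborel_prod by (simp add: case_prod_unfold)
    have "?F \<epsilon> = (LINT z|lborel. (case z of (q, \<xi>) \<Rightarrow> G q \<xi>))"
      by (intro Bochner_Integration.integral_cong refl) (auto simp: G_def cis_conv_exp mult_ac)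
    also have "\<dots> = (LINT \<xi>|lborel. (LINT q|lborel. G q \<xi>))"
      using lborel_pair.integral_snd[OF int] unfolding lborel_prod by simp
    also have "\<dots> = (LINT \<xi>|lborel. \<kappa> (\<epsilon> *\<^sub>R \<xi>) * kern_slice c \<Phi> \<xi>)"
      by (simp only: G_def integral_mult_right_zero kern_slice_def)
    finally show ?thesis .
  qed
  show "(?F \<longlongrightarrow> (LINT \<xi>|lborel. kern_slice c \<Phi> \<xi>)) (at_right 0)"
  proof (rule tendsto_at_right_sequentially[of 0 1])
    fix S :: "nat \<Rightarrow> real" assume S: "\<And>n. 0 < S n" "S \<longlonglongrightarrow> 0"
    have "(\<lambda>n. LINT \<xi>|lborel. \<kappa> (S n *\<^sub>R \<xi>) * kern_slice c \<Phi> \<xi>) \<longlonglongrightarrow> (LINT \<xi>|lborel. 1 * kern_slice c \<Phi> \<xi>)"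
    proof (rule integral_dominated_convergence[where w = "\<lambda>\<xi>. M * norm (kern_slice c \<Phi> \<xi>)"])
      note [measurable] = borel_measurable_integrable[OF kern_slice_integrable[OF c \<Phi>]] smooth_measurable[OF \<rho>(2)]
      show "(\<lambda>\<xi>. 1 * kern_slice c \<Phi> \<xi>) \<in> borel_measurable lborel" by measurable
      show "(\<lambda>\<xi>. \<kappa> (S n *\<^sub>R \<xi>) * kern_slice c \<Phi> \<xi>) \<in> borel_measurable lborel" for n by measurable
      show "integrable lborel (\<lambda>\<xi>. M * norm (kern_slice c \<Phi> \<xi>))"
        by (intro integrable_mult_right integrable_norm kern_slice_integrable[OF c \<Phi>])
      show "AE \<xi> in lborel. norm (\<kappa> (S n *\<^sub>R \<xi>) * kern_slice c \<Phi> \<xi>) \<le> M * norm (kern_slice c \<Phi> \<xi>)" for n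
        using M by (intro AE_I2) (simp add: norm_mult mult_right_mono)
      show "AE \<xi> in lborel. (\<lambda>n. \<kappa> (S n *\<^sub>R \<xi>) * kern_slice c \<Phi> \<xi>) \<longlonglongrightarrow> 1 * kern_slice c \<Phi> \<xi>"
      proof (rule AE_I2)
        fix \<xi> :: 'a
        have "(\<lambda>n. S n *\<^sub>R \<xi>) \<longlonglongrightarrow> 0 *\<^sub>R \<xi>" by (rule tendsto_scaleR[OF S(2) tendsto_const])
        moreover have "isCont \<kappa> 0" using smooth_continuous_on[OF \<rho>(2), of UNIV] by (simp add: continuous_on_eq_continuous_at)
        ultimately have "(\<lambda>n. \<kappa> (S n *\<^sub>R \<xi>)) \<longlonglongrightarrow> \<kappa> 0" by (intro isCont_tendsto_compose[of 0 \<kappa>]) auto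
        then show "(\<lambda>n. \<kappa> (S n *\<^sub>R \<xi>) * kern_slice c \<Phi> \<xi>) \<longlonglongrightarrow> 1 * kern_slice c \<Phi> \<xi>"
          unfolding \<kappa>1 by (intro tendsto_mult tendsto_const)
      qed
    qed
    then show "(\<lambda>n. ?F (S n)) \<longlonglongrightarrow> (LINT \<xi>|lborel. kern_slice c \<Phi> \<xi>)"
      unfolding eq[OF S(1)] by simp
  qed simp
qed

section \<open>Properly supported operators\<close>

lemma supp_subset: "f x \<noteq> 0 \<Longrightarrow> x \<in> supp f"
  using closure_subset[of "{x. f x \<noteq> 0}"] by (auto simp: supp_def)

lemma supp_minimal:
  assumes "closed B" "\<And>x. f x \<noteq> 0 \<Longrightarrow> x \<in> B"
  shows "supp f \<subseteq> B"
  unfolding supp_def using assms by (intro closure_minimal) auto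

lemma closed_supp: "closed (supp f)"
  by (simp add: supp_def)

lemma tensor_test_functions:
  fixes \<psi> :: "'a::euclidean_space \<Rightarrow> complex" and \<phi> :: "'b::euclidean_space \<Rightarrow> complex"
  assumes "\<psi> \<in> test_functions" "\<phi> \<in> test_functions"
  shows "(\<lambda>(x, y). \<psi> x * \<phi> y) \<in> test_functions" "supp (\<lambda>(x, y). \<psi> x * \<phi> y) \<subseteq> supp \<psi> \<times> supp \<phi>"
proof -
  have "smooth (\<lambda>z::'a \<times> 'b. \<psi> (fst z) * \<phi> (snd z))"
    by (intro smooth_mult smooth_linear[OF test_functions_smooth[OF assms(1)] bounded_linear_fst]
        smooth_linear[OF test_functions_smooth[OF assms(2)] bounded_linear_snd])
  then have sm: "smooth (\<lambda>(x, y). \<psi> x * \<phi> y)" by (simp add: case_prod_unfold)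
  have z: "(case z of (x, y) \<Rightarrow> \<psi> x * \<phi> y) = 0" if "z \<notin> supp \<psi> \<times> supp \<phi>" for z
    using that supp_subset[of \<psi> "fst z"] supp_subset[of \<phi> "snd z"] by (auto simp: mem_Times_iff case_prod_unfold)
  have "compact (supp \<psi> \<times> supp \<phi>)"
    using assms by (intro compact_Times) (auto simp: test_functions_def)
  from test_functionsI[OF sm this z]
  show "(\<lambda>(x, y). \<psi> x * \<phi> y) \<in> test_functions" "supp (\<lambda>(x, y). \<psi> x * \<phi> y) \<subseteq> supp \<psi> \<times> supp \<phi>"
    by auto
qed

lemma fourier_cmult: "fourier (\<lambda>y. k * f y) \<xi> = k * fourier f \<xi>"
proof -
  have "cis (- (y \<bullet> \<xi>)) * (k * f y) = k * (cis (- (y \<bullet> \<xi>)) * f y)" for y by (simp only: mult_ac)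
  then show ?thesis by (simp only: fourier_def integral_mult_right_zero)
qed

lemma kern_tensor:
  fixes c :: "'a::euclidean_space \<times> 'a \<Rightarrow> complex"
  assumes c: "c \<in> symbols m" and \<psi>: "\<psi> \<in> test_functions" and \<phi>: "\<phi> \<in> test_functions"
  shows "kern c (\<lambda>(x, y). \<psi> x * \<phi> y) = dist_of_fun (psido_op c \<phi>) \<psi>"
proof -
  let ?k = "complex_of_real (2 * pi) ^ DIM('a)"
  obtain R where R: "R > 0" "smooth \<psi>" "\<And>x. x \<notin> cball 0 R \<Longrightarrow> \<psi> x = 0"
    using test_functionsE[OF \<psi>] by metis
  obtain M where M: "M \<ge> 0" "\<And>x. norm (\<psi> x) \<le> M" using test_functions_bounded[OF \<psi>] by metis
  obtain C where C: "C \<ge> 0" "\<And>y \<xi>. y \<in> cball 0 R \<Longrightarrow> norm (c (y, \<xi>)) \<le> C * japanese \<xi> powr m"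
    using symbol_boundE[OF symbols_bound[OF c] compact_cball] by metis
  obtain D where D: "D \<ge> 0" "\<And>\<xi>. japanese \<xi> powr m * norm (fourier \<phi> \<xi>) \<le> D * japanese \<xi> powr (- (2 * real DIM('a)))"
    using fourier_decay_real[OF \<phi>, of m] by metis
  have [measurable]: "c \<in> borel_measurable borel" by (rule smooth_measurable[OF symbols_smooth[OF c]])
  have [measurable]: "\<psi> \<in> borel_measurable borel" by (rule smooth_measurable[OF R(2)])
  have [measurable]: "fourier \<phi> \<in> borel_measurable borel" by (rule fourier_test_measurable[OF \<phi>])
  define f where "f x \<xi> = cis (x \<bullet> \<xi>) * c (x, \<xi>) * (\<psi> x * fourier \<phi> \<xi>)" for x \<xi>
  have int: "integrable (lborel \<Otimes>\<^sub>M lborel) (\<lambda>(x, \<xi>). f x \<xi>)"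
  proof (rule Bochner_Integration.integrable_bound)
    show "integrable (lborel \<Otimes>\<^sub>M lborel) (\<lambda>(x::'a, \<xi>::'a). (indicat_real (cball 0 R) x * (M * C * D)) * japanese \<xi> powr (- (2 * real DIM('a))))"
      using emeasure_bounded_finite[OF bounded_cball, of "0::'a" R]
      by (intro integrable_tensor integrable_japanese integrable_mult_left integrable_real_indicator) auto
    show "(\<lambda>(x, \<xi>). f x \<xi>) \<in> borel_measurable (lborel \<Otimes>\<^sub>M lborel)"
      unfolding f_def by measurable
    have "norm (f x \<xi>) \<le> (indicat_real (cball 0 R) x * (M * C * D)) * japanese \<xi> powr (- (2 * real DIM('a)))" for x \<xi>
    proof (cases "x \<in> cball 0 R")
      case False
      then have "\<psi> x = 0" by (rule R(3))
      then show ?thesis using False by (simp add: f_def)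
    next
      case True
      have "norm (f x \<xi>) = norm (\<psi> x) * norm (c (x, \<xi>)) * norm (fourier \<phi> \<xi>)"
        by (simp add: f_def norm_mult)
      also have "\<dots> \<le> M * (C * japanese \<xi> powr m) * norm (fourier \<phi> \<xi>)"
        using M C(2)[OF True] by (intro mult_right_mono mult_mono) auto
      also have "\<dots> = M * C * (japanese \<xi> powr m * norm (fourier \<phi> \<xi>))" by (simp only: mult_ac)
      also have "\<dots> \<le> M * C * (D * japanese \<xi> powr (- (2 * real DIM('a))))"
        by (intro mult_left_mono D mult_nonneg_nonneg C M)
      finally show ?thesis using True by (simp add: mult.assoc)
    qed
    then show "AE q in lborel \<Otimes>\<^sub>M lborel. norm (case q of (z, \<xi>) \<Rightarrow> f z \<xi>) \<le>
      norm (case q of (z::'a, \<xi>::'a) \<Rightarrow> (indicat_real (cball 0 R) z * (M * C * D)) * japanese \<xi> powr (- (2 * real DIM('a))))"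
      by (intro AE_I2) (auto intro: order.trans[OF _ abs_ge_self])
  qed
  have "kern_slice c (\<lambda>(x, y). \<psi> x * \<phi> y) \<xi> = (LINT x|lborel. f x \<xi>)" for \<xi>
    unfolding kern_slice_eq[OF c tensor_test_functions(1)[OF \<psi> \<phi>]] prod.case fourier_cmult f_def ..
  then have "kern c (\<lambda>(x, y). \<psi> x * \<phi> y) = (LINT \<xi>|lborel. (LINT x|lborel. f x \<xi>)) / ?k"
    by (simp only: kern_def)
  also have "\<dots> = (LINT x|lborel. (LINT \<xi>|lborel. f x \<xi>)) / ?k"
    by (simp only: lborel_pair.Fubini_integral[OF int])
  also have "\<dots> = (LINT x|lborel. (LINT \<xi>|lborel. f x \<xi>) / ?k)"
    by (rule integral_divide_zero[symmetric])
  also have "\<dots> = dist_of_fun (psido_op c \<phi>) \<psi>"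
    unfolding dist_of_fun_def
  proof (rule Bochner_Integration.integral_cong[OF refl])
    fix x
    have "(LINT \<xi>|lborel. f x \<xi>) = (LINT \<xi>|lborel. \<psi> x * (cis (x \<bullet> \<xi>) * c (x, \<xi>) * fourier \<phi> \<xi>))"
      unfolding f_def by (simp only: mult_ac)
    then show "(LINT \<xi>|lborel. f x \<xi>) / ?k = psido_op c \<phi> x * \<psi> x"
      unfolding integral_mult_right_zero by (simp add: psido_op_def)
  qed
  finally show ?thesis .
qed

text \<open>Two functionals satisfying the limit condition agree by uniqueness of limits as soon as
  one admissible cutoff exists. Hence the arbitrary functional in a total left symbol may be
  replaced by the explicit \<open>kern p\<close>.\<close>

lemma has_amplitude_kern:
  fixes p :: "'a::euclidean_space \<times> 'a \<Rightarrow> complex"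
  assumes L: "has_amplitude L (\<lambda>((x, y), \<xi>). p (x, \<xi>))" and p: "p \<in> symbols m" and \<Phi>: "\<Phi> \<in> test_functions"
  shows "L \<Phi> = kern p \<Phi>"
proof -
  obtain I where I: "is_oscillatory_integral (\<lambda>((x, y), \<xi>). (x - y) \<bullet> \<xi>) (\<lambda>((x, y), \<xi>). p (x, \<xi>)) I"
    "\<And>\<Phi>. \<Phi> \<in> test_functions \<Longrightarrow> L \<Phi> = I \<Phi> / (2 * pi) ^ DIM('a)"
    using L unfolding has_amplitude_def by blast
  obtain h :: "'a \<Rightarrow> real" where h: "smooth (\<lambda>x. complex_of_real (h x))"
    "\<And>x. x \<in> cball 0 1 \<Longrightarrow> h x = 1" "\<And>x. x \<notin> ball 0 2 \<Longrightarrow> h x = 0"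
    using cutoff_exists[of 1 2 "0::'a"] by (metis one_less_numeral_iff semiring_norm(76) zero_less_one)
  let ?\<kappa> = "\<lambda>x. complex_of_real (h x)"
  have \<kappa>: "?\<kappa> \<in> test_functions" by (rule cutoff_test_function(1)[OF h(1)]) (erule h(3))
  have \<kappa>1: "\<forall>\<^sub>F x in nhds 0. ?\<kappa> x = 1"
    unfolding eventually_nhds using h(2) by (intro exI[of _ "ball 0 1"]) auto
  have "I \<Phi> = (LINT \<xi>|lborel. kern_slice p \<Phi> \<xi>)"
    using I(1)[unfolded is_oscillatory_integral_def, rule_format, OF \<kappa> \<kappa>1 \<Phi>]
      kern_oscillatory[OF p, unfolded is_oscillatory_integral_def, rule_format, OF \<kappa> \<kappa>1 \<Phi>]
    by (rule tendsto_unique[rotated 1]) simp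
  then show ?thesis using I(2)[OF \<Phi>] by (simp add: kern_def)
qed

lemma psido_op_twist:
  fixes \<phi> :: "'a::euclidean_space \<Rightarrow> complex"
  assumes "\<phi> \<in> test_functions"
  shows "psido_op p \<phi> = (\<lambda>x. twist p (\<lambda>(y, \<xi>). \<phi> y) (x, 0))"
  unfolding fun_eq_iff psido_op_def twist_def ufour_def prod.case fst_conv snd_conv
    fourier_translate[OF smooth_measurable[OF test_functions_smooth[OF assms]]] by (simp add: mult_ac)

text \<open>The function is the slice at frequency 0 of a \<open>twist\<close>, whose smoothness is
  the remainder theorem with an empty sum.\<close>

lemma smooth_psido_op:
  fixes \<phi> :: "'a::euclidean_space \<Rightarrow> complex"
  assumes "p \<in> symbols m" "\<phi> \<in> test_functions"
  shows "smooth (psido_op p \<phi>)"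
proof -
  have "twist p (\<lambda>(y, \<xi>). \<phi> y) \<in> symbols (m + 0)"
    using twist_remainder_symbols[OF assms(1) csymbol_test_function[OF assms(2)], of 0] by (simp add: sym_sum_def)
  from smooth_slice[OF symbols_smooth[OF this], of 0] show ?thesis
    by (simp add: psido_op_twist[OF assms(2)])
qed

lemma smooth_smoothing_part:
  fixes \<phi> :: "'a::euclidean_space \<Rightarrow> complex"
  assumes "smooth r" "\<phi> \<in> test_functions"
  shows "smooth (\<lambda>x. LINT z|lborel. r (x, z) * \<phi> (x + z))"
proof -
  have "smoothing r (\<lambda>(y, \<xi>). \<phi> y) \<in> symbols 0"
    by (rule smoothing_symbols[OF assms(1) csymbol_test_function[OF assms(2)]])
  from smooth_slice[OF symbols_smooth[OF this], of 0] show ?thesis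
    by (simp add: smoothing_def)
qed

lemma smooth_left_op:
  fixes \<phi> :: "'a::euclidean_space \<Rightarrow> complex"
  assumes "p \<in> symbols m" "smooth r" "\<phi> \<in> test_functions"
  shows "smooth (left_op p r \<phi>)"
proof -
  have "left_op p r \<phi> = (\<lambda>x. psido_op p \<phi> x + (LINT z|lborel. r (x, z) * \<phi> (x + z)))"
    using left_op_eq[OF smooth_measurable[OF test_functions_smooth[OF assms(3)]]] by blast
  then show ?thesis
    using smooth_add[OF smooth_psido_op[OF assms(1,3)] smooth_smoothing_part[OF assms(2,3)]] by simp
qed

text \<open>The abstract operator becomes a concrete one with function values; every later statement
  about composition and locality is about these functions.\<close>

theorem total_left_symbol_left_op:
  fixes P :: "'a::euclidean_space operator"
  assumes "total_left_symbol m P p"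
  obtains r where "smooth r" "\<And>\<phi> \<psi>. \<phi> \<in> test_functions \<Longrightarrow> \<psi> \<in> test_functions \<Longrightarrow> P \<phi> \<psi> = dist_of_fun (left_op p r \<phi>) \<psi>"
proof -
  obtain K L r where p: "p \<in> symbols m" and K: "is_schwartz_kernel P K" and L: "has_amplitude L (\<lambda>((x, y), \<xi>). p (x, \<xi>))"
    and r: "smooth r" and KL: "\<And>\<Phi>. \<Phi> \<in> test_functions \<Longrightarrow> K \<Phi> = L \<Phi> + dist_of_fun r \<Phi>"
    using assms unfolding total_left_symbol_def by blast
  \<comment> \<open>The kernel is rewritten in base point and offset, the variables in which
    \<open>smoothing\<close> expects it.\<close>
  define r' where "r' = (\<lambda>w::'a \<times> 'a. r (fst w, fst w + snd w))"
  have r': "smooth r'"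
    unfolding r'_def by (intro smooth_linear[OF r] bounded_linear_Pair bounded_linear_add bounded_linear_fst bounded_linear_snd)
  have "P \<phi> \<psi> = dist_of_fun (left_op p r' \<phi>) \<psi>" if \<phi>: "\<phi> \<in> test_functions" and \<psi>: "\<psi> \<in> test_functions" for \<phi> \<psi>
  proof -
    note t = tensor_test_functions(1)[OF \<psi> \<phi>]
    note rm = smooth_measurable[OF test_functions_smooth[OF \<phi>]]
    have "P \<phi> \<psi> = kern p (\<lambda>(x, y). \<psi> x * \<phi> y) + dist_of_fun r (\<lambda>(x, y). \<psi> x * \<phi> y)"
      using K \<phi> \<psi> KL[OF t] has_amplitude_kern[OF L p t] by (simp add: is_schwartz_kernel_def)
    also have "kern p (\<lambda>(x, y). \<psi> x * \<phi> y) = (LINT x|lborel. psido_op p \<phi> x * \<psi> x)"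
      by (simp add: kern_tensor[OF p \<psi> \<phi>] dist_of_fun_def)
    also have "dist_of_fun r (\<lambda>(x, y). \<psi> x * \<phi> y) = (LINT x|lborel. (LINT z|lborel. r' (x, z) * \<phi> (x + z)) * \<psi> x)"
    proof -
      let ?G = "\<lambda>z. r z * (case z of (x, y) \<Rightarrow> \<psi> x * \<phi> y)"
      have "integrable (lborel \<Otimes>\<^sub>M lborel) ?G"
        unfolding lborel_prod by (rule test_functions_integrable[OF test_functions_mult[OF t r]])
      then have "(LINT x|lborel. (LINT y|lborel. ?G (x, y))) = integral\<^sup>L (lborel \<Otimes>\<^sub>M lborel) ?G"
        by (rule lborel_pair.integral_fst')
      then have "dist_of_fun r (\<lambda>(x, y). \<psi> x * \<phi> y) = (LINT x|lborel. (LINT y|lborel. ?G (x, y)))"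
        unfolding lborel_prod dist_of_fun_def by simp
      also have "\<dots> = (LINT x|lborel. (LINT z|lborel. r' (x, z) * \<phi> (x + z)) * \<psi> x)"
      proof (rule Bochner_Integration.integral_cong[OF refl])
        fix x
        have "(LINT y|lborel. ?G (x, y)) = (LINT y|lborel. (r (x, y) * \<phi> y) * \<psi> x)"
          by (simp only: prod.case mult_ac)
        also have "\<dots> = (LINT y|lborel. r (x, y) * \<phi> y) * \<psi> x" by (rule integral_mult_left_zero)
        also have "(LINT y|lborel. r (x, y) * \<phi> y) = (LINT z|lborel. r (x, x + z) * \<phi> (x + z))"
        proof (rule integral_translate[symmetric])
          show "(\<lambda>y. r (x, y) * \<phi> y) \<in> borel_measurable borel"
            using smooth_measurable[OF smooth_pair_snd[OF r, of x 0]] by (intro borel_measurable_times rm) simp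
        qed
        finally show "(LINT y|lborel. ?G (x, y)) = (LINT z|lborel. r' (x, z) * \<phi> (x + z)) * \<psi> x"
          by (simp add: r'_def)
      qed
      finally show ?thesis .
    qed
    also have "(LINT x|lborel. psido_op p \<phi> x * \<psi> x) + (LINT x|lborel. (LINT z|lborel. r' (x, z) * \<phi> (x + z)) * \<psi> x)
       = (LINT x|lborel. psido_op p \<phi> x * \<psi> x + (LINT z|lborel. r' (x, z) * \<phi> (x + z)) * \<psi> x)"
      by (intro Bochner_Integration.integral_add[symmetric] test_functions_integrable test_functions_mult \<psi>
          smooth_psido_op[OF p \<phi>] smooth_smoothing_part[OF r' \<phi>])
    also have "\<dots> = dist_of_fun (left_op p r' \<phi>) \<psi>"
      by (simp add: dist_of_fun_def left_op_eq[OF rm] distrib_right)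
    finally show ?thesis .
  qed
  with r' that show ?thesis by blast
qed

text \<open>Each point (x0, y) with y in the support of \<open>\<phi>\<close> has a product
  neighbourhood on which the kernel vanishes. Compactness leaves finitely many; cutoffs split
  \<open>\<phi>\<close> accordingly, the pairing with every bump near x0 is zero, and the localised
  fundamental lemma gives the value at x0.\<close>

lemma kernel_vanish:
  fixes P :: "'a::euclidean_space operator"
  assumes K: "is_schwartz_kernel P K"
    and A: "\<And>\<phi> \<psi>. \<phi> \<in> test_functions \<Longrightarrow> \<psi> \<in> test_functions \<Longrightarrow> P \<phi> \<psi> = dist_of_fun (A \<phi>) \<psi>"
    and Ac: "\<And>\<phi>. \<phi> \<in> test_functions \<Longrightarrow> smooth (A \<phi>)"
    and \<phi>: "\<phi> \<in> test_functions" and sup: "\<And>y. y \<in> supp \<phi> \<Longrightarrow> (x0, y) \<notin> dist_support K"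
  shows "A \<phi> x0 = 0"
proof -
  have "\<exists>d>0. \<forall>\<Phi>\<in>test_functions. supp \<Phi> \<subseteq> ball x0 d \<times> ball y d \<longrightarrow> K \<Phi> = 0" if y: "y \<in> supp \<phi>" for y
  proof -
    obtain U where U: "open U" "(x0, y) \<in> U" "\<And>\<Phi>. \<Phi> \<in> test_functions \<Longrightarrow> supp \<Phi> \<subseteq> U \<Longrightarrow> K \<Phi> = 0"
      using sup[OF y] unfolding dist_support_def by auto
    obtain S T where ST: "open S" "open T" "x0 \<in> S" "y \<in> T" "S \<times> T \<subseteq> U"
      using open_prod_elim[OF U(1,2)] by (metis mem_Sigma_iff)
    obtain d1 where d1: "d1 > 0" "ball x0 d1 \<subseteq> S" using ST(1,3) open_contains_ball by blast
    obtain d2 where d2: "d2 > 0" "ball y d2 \<subseteq> T" using ST(2,4) open_contains_ball by blast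
    have "ball x0 (min d1 d2) \<times> ball y (min d1 d2) \<subseteq> U"
      using d1 d2 ST(5) by (auto simp: subset_iff)
    then show ?thesis using U(3) d1(1) d2(1) by (intro exI[of _ "min d1 d2"]) (meson min_less_iff_conj order.trans)
  qed
  then obtain d where d: "\<And>y. y \<in> supp \<phi> \<Longrightarrow> d y > 0"
    "\<And>y \<Phi>. y \<in> supp \<phi> \<Longrightarrow> \<Phi> \<in> test_functions \<Longrightarrow> supp \<Phi> \<subseteq> ball x0 (d y) \<times> ball y (d y) \<Longrightarrow> K \<Phi> = 0"
    by metis
  have "compact (supp \<phi>)" using \<phi> by (simp add: test_functions_def)
  moreover have "supp \<phi> \<subseteq> (\<Union>y\<in>supp \<phi>. ball y (d y / 2))"
  proof
    fix y assume "y \<in> supp \<phi>"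
    with d(1)[OF this] show "y \<in> (\<Union>y\<in>supp \<phi>. ball y (d y / 2))" by (intro UN_I[of y]) auto
  qed
  ultimately obtain Y where Y: "Y \<subseteq> supp \<phi>" "finite Y" "supp \<phi> \<subseteq> (\<Union>y\<in>Y. ball y (d y / 2))"
    by (rule compactE_image[where f = "\<lambda>y. ball y (d y / 2)", OF _ open_ball])
  have Kadd: "K (\<lambda>z. \<Phi> z + \<Psi> z) = K \<Phi> + K \<Psi>" if "\<Phi> \<in> test_functions" "\<Psi> \<in> test_functions" for \<Phi> \<Psi>
    using K that by (simp add: is_schwartz_kernel_def distribution_def)
  have Kcmult: "K (\<lambda>z. k * \<Phi> z) = k * K \<Phi>" if "\<Phi> \<in> test_functions" for \<Phi> k
    using K that by (simp add: is_schwartz_kernel_def distribution_def)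
  have K0: "K (\<lambda>z. 0) = 0"
  proof -
    have "(\<lambda>z::'a \<times> 'a. 0) \<in> test_functions" by (rule test_functionsI(1)[OF smooth_const compact_empty]) simp
    from Kcmult[OF this, of 0] show ?thesis by simp
  qed
  \<comment> \<open>One radius around x0 has to serve all the chosen neighbourhoods; inserting 1
    keeps the minimum defined and positive when the cover is empty.\<close>
  obtain \<delta> where \<delta>: "\<delta> > 0" "\<And>y. y \<in> Y \<Longrightarrow> \<delta> \<le> d y"
  proof
    show "Min (insert 1 (d ` Y)) > 0" using Y d(1) by auto
    show "Min (insert 1 (d ` Y)) \<le> d y" if "y \<in> Y" for y using Y(2) that by (intro Min_le) auto
  qed
  have main: "K (\<lambda>(x, y). \<psi> x * f y) = 0"
    if "finite Z" "Z \<subseteq> Y" "f \<in> test_functions" "supp f \<subseteq> (\<Union>y\<in>Z. ball y (d y / 2))" "\<psi> \<in> test_functions" "supp \<psi> \<subseteq> ball x0 \<delta>" for Z f \<psi>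
    using that
  proof (induction Z arbitrary: f rule: finite_induct)
    case empty
    then have "f y = 0" for y using supp_subset[of f y] by auto
    then show ?case using K0 by (simp add: case_prod_unfold)
  next
    case (insert y Z)
    have yY: "y \<in> Y" "y \<in> supp \<phi>" using insert.prems(1) Y(1) by auto
    have dy: "d y > 0" using d(1) yY by blast
    \<comment> \<open>The cutoff is 1 on the half-radius ball and its support stays inside the full
      ball. Thus h f is covered by this neighbourhood alone, while (1 - h) f has support off the
      half-radius ball and is left to the remaining centres.\<close>
    have pos: "0 < d y / 2" "d y / 2 < 3 * d y / 4" using dy by auto
    obtain h :: "'a \<Rightarrow> real" where h: "smooth (\<lambda>x. complex_of_real (h x))"
      "\<And>x. x \<in> cball y (d y / 2) \<Longrightarrow> h x = 1" "\<And>x. x \<notin> ball y (3 * d y / 4) \<Longrightarrow> h x = 0"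
      using cutoff_exists[OF pos, of y] by metis
    let ?f1 = "\<lambda>x. complex_of_real (h x) * f x" and ?f2 = "\<lambda>x. (1 - complex_of_real (h x)) * f x"
    have t1: "?f1 \<in> test_functions" by (rule test_functions_mult[OF insert.prems(2) h(1)])
    have t2: "?f2 \<in> test_functions"
      by (rule test_functions_mult[OF insert.prems(2)]) (intro smooth_diff smooth_const h(1))
    have s1: "supp ?f1 \<subseteq> cball y (3 * d y / 4)"
    proof (rule supp_minimal)
      fix x assume "?f1 x \<noteq> 0"
      then show "x \<in> cball y (3 * d y / 4)" using h(3)[of x] by (cases "x \<in> ball y (3 * d y / 4)") auto
    qed simp
    have s2: "supp ?f2 \<subseteq> supp f - ball y (d y / 2)"
    proof (rule supp_minimal)
      show "closed (supp f - ball y (d y / 2))" by (intro closed_Diff closed_supp open_ball)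
      fix x assume "?f2 x \<noteq> 0"
      then show "x \<in> supp f - ball y (d y / 2)" using h(2)[of x] supp_subset[of f x] by auto
    qed
    have "K (\<lambda>(x, y). \<psi> x * ?f1 y) = 0"
    proof (rule d(2)[OF yY(2) tensor_test_functions(1)[OF insert.prems(4) t1]])
      have "supp \<psi> \<times> supp ?f1 \<subseteq> ball x0 (d y) \<times> ball y (d y)"
      proof (rule Sigma_mono)
        show "supp \<psi> \<subseteq> ball x0 (d y)" using insert.prems(5) \<delta>(2)[OF yY(1)] by (auto simp: subset_iff)
        show "supp ?f1 \<subseteq> ball y (d y)" using s1 dy by (auto simp: subset_iff)
      qed
      then show "supp (\<lambda>(x, y). \<psi> x * ?f1 y) \<subseteq> ball x0 (d y) \<times> ball y (d y)"
        using tensor_test_functions(2)[OF insert.prems(4) t1] by (rule order.trans[rotated])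
    qed
    moreover have "K (\<lambda>(x, y). \<psi> x * ?f2 y) = 0"
      using s2 insert.prems by (intro insert.IH t2) auto
    moreover have "(\<lambda>(x, y). \<psi> x * f y) = (\<lambda>z. (case z of (x, y) \<Rightarrow> \<psi> x * ?f1 y) + (case z of (x, y) \<Rightarrow> \<psi> x * ?f2 y))"
      by (auto simp: fun_eq_iff algebra_simps)
    ultimately show ?case
      using Kadd[OF tensor_test_functions(1)[OF insert.prems(4) t1] tensor_test_functions(1)[OF insert.prems(4) t2]] by simp
  qed
  show ?thesis
  proof (rule fundamental_lemma[OF smooth_continuous_on[OF Ac[OF \<phi>]] \<delta>(1)])
    fix \<psi> :: "'a \<Rightarrow> complex" assume \<psi>: "\<psi> \<in> test_functions" "supp \<psi> \<subseteq> ball x0 \<delta>"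
    have "dist_of_fun (A \<phi>) \<psi> = K (\<lambda>(x, y). \<psi> x * \<phi> y)"
      using A[OF \<phi> \<psi>(1)] K \<phi> \<psi>(1) by (simp add: is_schwartz_kernel_def)
    also have "\<dots> = 0" by (rule main[OF Y(2) order.refl \<phi> Y(3) \<psi>])
    finally show "dist_of_fun (A \<phi>) \<psi> = 0" .
  qed
qed

text \<open>The operator form of proper support. The first clause reflects properness of the
  projection to y and bounds the support of the output; the second reflects properness of the
  projection to x and bounds the dependence on the input. In both, the radius is uniform over all
  test functions.\<close>

definition support_preserving :: "(('a::euclidean_space \<Rightarrow> complex) \<Rightarrow> 'a \<Rightarrow> complex) \<Rightarrow> bool" where
  "support_preserving A \<longleftrightarrow>
     (\<forall>R. \<exists>S. \<forall>\<phi>\<in>test_functions. (\<forall>y. y \<notin> cball 0 R \<longrightarrow> \<phi> y = 0) \<longrightarrow> (\<forall>x. x \<notin> cball 0 S \<longrightarrow> A \<phi> x = 0)) \<and>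
     (\<forall>R. \<exists>S. \<forall>\<phi>\<in>test_functions. (\<forall>y\<in>ball 0 S. \<phi> y = 0) \<longrightarrow> (\<forall>x\<in>cball 0 R. A \<phi> x = 0))"

theorem properly_supported_local:
  fixes P :: "'a::euclidean_space operator" and A :: "('a \<Rightarrow> complex) \<Rightarrow> 'a \<Rightarrow> complex"
  assumes P: "properly_supported P"
    and A: "\<And>\<phi> \<psi>. \<phi> \<in> test_functions \<Longrightarrow> \<psi> \<in> test_functions \<Longrightarrow> P \<phi> \<psi> = dist_of_fun (A \<phi>) \<psi>"
    and Ac: "\<And>\<phi>. \<phi> \<in> test_functions \<Longrightarrow> smooth (A \<phi>)"
  shows "support_preserving A"
  unfolding support_preserving_def
proof (rule conjI; rule allI)
  fix R
  obtain K where K: "is_schwartz_kernel P K" "proper_map (top_of_set (dist_support K)) euclidean fst"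
    "proper_map (top_of_set (dist_support K)) euclidean snd"
    using P unfolding properly_supported_def by blast
  have c1: "compact {z \<in> dist_support K. fst z \<in> cball 0 R}"
    using compactin_proper_map_preimage[OF K(2), of "cball 0 R"] by (simp add: compactin_subtopology)
  have c2: "compact {z \<in> dist_support K. snd z \<in> cball 0 R}"
    using compactin_proper_map_preimage[OF K(3), of "cball 0 R"] by (simp add: compactin_subtopology)
  have van: "A \<phi> x0 = 0" if "\<phi> \<in> test_functions" "\<And>y. y \<in> supp \<phi> \<Longrightarrow> (x0, y) \<notin> dist_support K" for \<phi> x0
    by (rule kernel_vanish[where A = A, OF K(1)]) (fact A, fact Ac, fact that(1), fact that(2))
  have b2: "bounded (fst ` {z \<in> dist_support K. snd z \<in> cball 0 R})"
    by (intro compact_imp_bounded compact_continuous_image c2 continuous_intros)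
  then obtain S where S: "\<And>z. z \<in> dist_support K \<Longrightarrow> snd z \<in> cball 0 R \<Longrightarrow> norm (fst z) \<le> S"
    unfolding bounded_iff by blast
  show "\<exists>S. \<forall>\<phi>\<in>test_functions. (\<forall>y. y \<notin> cball 0 R \<longrightarrow> \<phi> y = 0) \<longrightarrow> (\<forall>x. x \<notin> cball 0 S \<longrightarrow> A \<phi> x = 0)"
  proof (intro exI[of _ S] ballI impI allI)
    fix \<phi> :: "'a \<Rightarrow> complex" and x :: 'a assume \<phi>: "\<phi> \<in> test_functions" "\<forall>y. y \<notin> cball 0 R \<longrightarrow> \<phi> y = 0" and x: "x \<notin> cball 0 S"
    show "A \<phi> x = 0"
    proof (rule van[OF \<phi>(1)])
      fix y :: 'a assume "y \<in> supp \<phi>"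
      moreover have "supp \<phi> \<subseteq> cball 0 R" using \<phi>(2) by (intro supp_minimal closed_cball) blast
      ultimately have "y \<in> cball 0 R" by blast
      then show "(x, y) \<notin> dist_support K" using S[of "(x, y)"] x by auto
    qed
  qed
  have b1: "bounded (snd ` {z \<in> dist_support K. fst z \<in> cball 0 R})"
    by (intro compact_imp_bounded compact_continuous_image c1 continuous_intros)
  then obtain T where T: "\<And>z. z \<in> dist_support K \<Longrightarrow> fst z \<in> cball 0 R \<Longrightarrow> norm (snd z) \<le> T"
    unfolding bounded_iff by blast
  show "\<exists>S. \<forall>\<phi>\<in>test_functions. (\<forall>y\<in>ball 0 S. \<phi> y = 0) \<longrightarrow> (\<forall>x\<in>cball 0 R. A \<phi> x = 0)"
  \<comment> \<open>The added 1 separates strictly: a function vanishing on this ball has its closed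
    support at distance at least T + 1, whereas kernel points over the given ball have second
    component of norm at most T.\<close>
  proof (intro exI[of _ "T + 1"] ballI impI)
    fix \<phi> :: "'a \<Rightarrow> complex" and x :: 'a assume \<phi>: "\<phi> \<in> test_functions" "\<forall>y\<in>ball 0 (T + 1). \<phi> y = 0" and x: "x \<in> cball 0 R"
    show "A \<phi> x = 0"
    proof (rule van[OF \<phi>(1)])
      fix y :: 'a assume y: "y \<in> supp \<phi>"
      have "supp \<phi> \<subseteq> - ball 0 (T + 1)"
        using \<phi>(2) by (intro supp_minimal) (auto simp: closed_Compl)
      with y have "norm y \<ge> T + 1" by auto
      then show "(x, y) \<notin> dist_support K" using T[of "(x, y)"] x by auto
    qed
  qed
qed

section \<open>Composition\<close>

text \<open>The explicit kernel \<open>kern c\<close> is at once the Schwartz kernel and the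
  oscillatory integral, so the smooth remainder in the total left symbol can be taken to be
  0.\<close>

lemma psido_of_symbol:
  fixes c :: "'a::euclidean_space \<times> 'a \<Rightarrow> complex"
  assumes c: "c \<in> symbols m"
    and Q: "\<And>\<phi> \<psi>. \<phi> \<in> test_functions \<Longrightarrow> \<psi> \<in> test_functions \<Longrightarrow> Q \<phi> \<psi> = dist_of_fun (psido_op c \<phi>) \<psi>"
  shows "Q \<in> PsiDO m" and "total_left_symbol m Q c"
proof -
  have K: "is_schwartz_kernel Q (kern c)"
    unfolding is_schwartz_kernel_def using kern_distribution[OF c] Q kern_tensor[OF c] by simp
  have L: "has_amplitude (kern c) (\<lambda>((x, y), \<xi>). c (x, \<xi>))"
    unfolding has_amplitude_def using kern_oscillatory[OF c]
    by (intro exI[of _ "\<lambda>\<Phi>. LINT \<xi>|lborel. kern_slice c \<Phi> \<xi>"]) (simp add: kern_def)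
  have "(\<lambda>(z, \<xi>). c (fst z, \<xi>)) \<in> symbols m"
    by (rule symbols_lift[OF bounded_linear_fst _ c]) (auto simp: Basis_prod_def)
  then have "(\<lambda>((x, y), \<xi>). c (x, \<xi>)) \<in> symbols m" by (simp add: case_prod_unfold)
  with K L show "Q \<in> PsiDO m" unfolding PsiDO_def by blast
  show "total_left_symbol m Q c"
    unfolding total_left_symbol_def using c K L
    by (intro conjI exI[of _ "kern c"] exI[of _ "\<lambda>_. 0"]) (simp_all add: dist_of_fun_def)
qed

text \<open>Fourier inversion says that a symbol independent of \<xi> acts by multiplication. A
  cutoff can thus be inserted as a symbol without changing a test function on which it equals
  1.\<close>

lemma psido_op_multiplication:
  fixes \<phi> :: "'a::euclidean_space \<Rightarrow> complex"
  assumes "\<phi> \<in> test_functions"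
  shows "psido_op (\<lambda>(y, \<xi>). h y) \<phi> x = h x * \<phi> x"
proof -
  have t: "(\<lambda>z. \<phi> (x + z)) \<in> test_functions"
    using csymbol_slice[OF csymbol_test_function[OF assms], of x "0::'a"] by simp
  have c: "cis (x \<bullet> \<xi>) * h x * fourier \<phi> \<xi> = h x * fourier (\<lambda>z. \<phi> (x + z)) \<xi>" for \<xi>
    by (simp add: fourier_translate[OF smooth_measurable[OF test_functions_smooth[OF assms]]] mult_ac)
  show ?thesis
    unfolding psido_op_def prod.case c integral_mult_right_zero fourier_inversion_0[OF t] by simp
qed

lemma fourier_add:
  fixes f g :: "'a::euclidean_space \<Rightarrow> complex"
  assumes "f \<in> test_functions" "g \<in> test_functions"
  shows "fourier (\<lambda>y. f y + g y) \<xi> = fourier f \<xi> + fourier g \<xi>"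
proof -
  have i: "integrable lborel (\<lambda>y. cis (- (y \<bullet> \<xi>)) * f y)" if "f \<in> test_functions" for f :: "'a \<Rightarrow> complex"
    using test_functions_integrable[OF test_functions_mult[OF that smooth_cis, of "- \<xi>"]] by simp
  show ?thesis
    unfolding fourier_def distrib_left by (rule Bochner_Integration.integral_add[OF i[OF assms(1)] i[OF assms(2)]])
qed

lemma left_op_add:
  fixes f g :: "'a::euclidean_space \<Rightarrow> complex"
  assumes p: "p \<in> symbols m" and r: "smooth r" and f: "f \<in> test_functions" and g: "g \<in> test_functions"
  shows "left_op p r (\<lambda>y. f y + g y) x = left_op p r f x + left_op p r g x"
proof -
  note tf = test_functions_add[OF f g]
  have "psido_op p (\<lambda>y. f y + g y) x = psido_op p f x + psido_op p g x"
    unfolding psido_op_def fourier_add[OF f g] distrib_left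
      Bochner_Integration.integral_add[OF psido_integrable[OF p f] psido_integrable[OF p g]] by (rule add_divide_distrib)
  moreover have i: "integrable lborel (\<lambda>z. r (x, z) * h (x + z))" if "h \<in> test_functions" for h :: "'a \<Rightarrow> complex"
  proof -
    have "(\<lambda>z. h (x + z)) \<in> test_functions"
      using csymbol_slice[OF csymbol_test_function[OF that], of x "0::'a"] by simp
    from test_functions_integrable[OF test_functions_mult[OF this, of "\<lambda>z. r (x, z)"]] show ?thesis
      using smooth_pair_snd[OF r, of x 0] by simp
  qed
  have "(LINT z|lborel. r (x, z) * (f (x + z) + g (x + z))) = (LINT z|lborel. r (x, z) * f (x + z)) + (LINT z|lborel. r (x, z) * g (x + z))"
    unfolding distrib_left by (rule Bochner_Integration.integral_add[OF i[OF f] i[OF g]])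
  ultimately show ?thesis
    by (simp add: left_op_eq[OF smooth_measurable[OF test_functions_smooth[OF tf]]]
        left_op_eq[OF smooth_measurable[OF test_functions_smooth[OF f]]]
        left_op_eq[OF smooth_measurable[OF test_functions_smooth[OF g]]])
qed

lemma test_functions_diff:
  fixes f g :: "'a::euclidean_space \<Rightarrow> complex"
  assumes "f \<in> test_functions" "g \<in> test_functions"
  shows "(\<lambda>x. f x - g x) \<in> test_functions"
  using test_functions_add[OF assms(1) test_functions_cmult[OF assms(2), of "-1"]] by simp

lemma dist_of_fun_unique:
  fixes f g :: "'a::euclidean_space \<Rightarrow> complex"
  assumes f: "f \<in> test_functions" and g: "g \<in> test_functions"
    and eq: "\<And>\<psi>. \<psi> \<in> test_functions \<Longrightarrow> dist_of_fun f \<psi> = dist_of_fun g \<psi>"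
  shows "f = g"
proof
  fix x0
  have "f x0 - g x0 = 0"
  proof (rule fundamental_lemma[where \<delta> = 1 and g = "\<lambda>x. f x - g x" and ?x0.0 = x0])
    show "continuous_on UNIV (\<lambda>x. f x - g x)"
      by (intro smooth_continuous_on test_functions_smooth test_functions_diff f g)
    fix \<psi> :: "'a \<Rightarrow> complex" assume \<psi>: "\<psi> \<in> test_functions"
    show "dist_of_fun (\<lambda>x. f x - g x) \<psi> = 0"
      using eq[OF \<psi>] Bochner_Integration.integral_diff[OF
          test_functions_integrable[OF test_functions_mult[OF \<psi> test_functions_smooth[OF f]]]
          test_functions_integrable[OF test_functions_mult[OF \<psi> test_functions_smooth[OF g]]]]
      by (simp add: dist_of_fun_def left_diff_distrib)
  qed simp
  then show "f x0 = g x0" by simp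
qed

lemma csymbol_modulate:
  fixes u :: "'a::euclidean_space \<times> 'a \<Rightarrow> complex"
  assumes "csymbol m u"
  shows "(\<lambda>y. cis (y \<bullet> \<xi>) * u (y, \<xi>)) \<in> test_functions"
  using test_functions_mult[OF csymbol_slice[OF assms, of 0 \<xi>] smooth_cis, of \<xi>] by simp

text \<open>The two modulated functions differ by a test function that vanishes on the ball, and the
  operator sends it to 0 at x. The nonzero phase in the conjugation identity is then
  cancelled.\<close>

lemma left_comp_local:
  fixes u v :: "'a::euclidean_space \<times> 'a \<Rightarrow> complex"
  assumes p: "p \<in> symbols m" and r: "smooth r" and u: "csymbol m1 u" and v: "csymbol m2 v"
    and loc: "\<And>\<phi>. \<phi> \<in> test_functions \<Longrightarrow> \<forall>y\<in>ball 0 S. \<phi> y = 0 \<Longrightarrow> left_op p r \<phi> x = 0"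
    and eq: "\<And>y. y \<in> ball 0 S \<Longrightarrow> u (y, \<xi>) = v (y, \<xi>)"
  shows "left_comp p r u (x, \<xi>) = left_comp p r v (x, \<xi>)"
proof -
  let ?f = "\<lambda>y. cis (y \<bullet> \<xi>) * u (y, \<xi>)" and ?g = "\<lambda>y. cis (y \<bullet> \<xi>) * v (y, \<xi>)"
  note tf = csymbol_modulate[OF u, of \<xi>] and tg = csymbol_modulate[OF v, of \<xi>]
  have "left_op p r ?f x = left_op p r (\<lambda>y. ?g y + (?f y - ?g y)) x" by simp
  also have "\<dots> = left_op p r ?g x + left_op p r (\<lambda>y. ?f y - ?g y) x"
    by (rule left_op_add[OF p r tg test_functions_diff[OF tf tg]])
  also have "left_op p r (\<lambda>y. ?f y - ?g y) x = 0"
    using eq by (intro loc test_functions_diff[OF tf tg]) simp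
  finally have "cis (x \<bullet> \<xi>) * left_comp p r u (x, \<xi>) = cis (x \<bullet> \<xi>) * left_comp p r v (x, \<xi>)"
    by (simp add: left_op_conjugate[OF p u] left_op_conjugate[OF p v])
  then show ?thesis by simp
qed

text \<open>Modulation does not change supports, so the radius provided by
  \<open>support_preserving\<close> is the same for all \<xi>. This uniformity allows the second
  operator to be applied to the result.\<close>

lemma left_comp_csymbol:
  fixes u :: "'a::euclidean_space \<times> 'a \<Rightarrow> complex"
  assumes p: "p \<in> symbols m" and r: "smooth r" and u: "csymbol m' u" and A: "support_preserving (left_op p r)"
  shows "csymbol (m + m') (left_comp p r u)"
proof -
  obtain R where R: "\<And>x \<xi>. x \<notin> cball 0 R \<Longrightarrow> u (x, \<xi>) = 0" using csymbolE[OF u] by metis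
  obtain S where S: "\<And>\<phi> x. \<phi> \<in> test_functions \<Longrightarrow> (\<And>y. y \<notin> cball 0 R \<Longrightarrow> \<phi> y = 0) \<Longrightarrow> x \<notin> cball 0 S \<Longrightarrow> left_op p r \<phi> x = 0"
    using A unfolding support_preserving_def by metis
  have "left_comp p r u (x, \<xi>) = 0" if "x \<notin> cball 0 S" for x \<xi>
  proof -
    have "left_op p r (\<lambda>y. cis (y \<bullet> \<xi>) * u (y, \<xi>)) x = 0"
      by (rule S[OF csymbol_modulate[OF u] _ that]) (simp add: R)
    then show ?thesis by (simp add: left_op_conjugate[OF p u])
  qed
  then show ?thesis
    using left_comp_symbols[OF p r u] unfolding csymbol_def by blast
qed

lemma foldr_D_dir_const: "foldr D_dir bs (\<lambda>x. c) = (\<lambda>x. if bs = [] then c else 0)"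
  by (induction bs) auto

lemma foldr_D_dir_diff:
  assumes "smooth f" "smooth g" "set bs \<subseteq> Basis"
  shows "foldr D_dir bs (\<lambda>x. f x - g x) = (\<lambda>x. foldr D_dir bs f x - foldr D_dir bs g x)"
  using assms(3)
proof (induction bs)
  case (Cons b bs)
  have d: "foldr D_dir bs f differentiable_on UNIV" "foldr D_dir bs g differentiable_on UNIV"
    using assms(1,2) Cons.prems by (auto simp: smooth_def)
  then have "(\<lambda>x. (-1) * foldr D_dir bs g x) differentiable_on UNIV" by (auto intro: derivative_intros)
  from D_dir_add[OF d(1) this, of b] D_dir_cmult[OF d(2), of b "-1"] show ?case using Cons by simp
qed simp

text \<open>All derivatives of 1 vanish, leaving only the zero multi-index; \<open>Suc N\<close>
  guarantees that this index lies in the range of summation.\<close>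

lemma sym_sum_one: "sym_sum (Suc N) p (\<lambda>w. 1) = (p :: 'a::euclidean_space \<times> 'a \<Rightarrow> complex)"
proof
  fix z :: "'a \<times> 'a"
  let ?t = "\<lambda>\<alpha>::'a \<Rightarrow> nat. \<i> ^ mi_order \<alpha> / of_nat (mi_fact \<alpha>) * D_snd \<alpha> p z * D_fst \<alpha> (\<lambda>w. 1) z"
  have D1: "D_fst \<alpha> (\<lambda>w. 1) z = (if mi_list \<alpha> = [] then 1 else 0)" for \<alpha> :: "'a \<Rightarrow> nat"
    using fun_cong[OF D_fst_eq[where a = "\<lambda>w. 1" and \<alpha> = \<alpha>], of z] by (simp only: foldr_D_dir_const map_is_Nil_conv)
  have t: "?t \<alpha> = (if \<alpha> = (\<lambda>_. 0) then p z else 0)" if "\<alpha> \<in> multi_indices" for \<alpha> :: "'a \<Rightarrow> nat"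
  proof (cases "\<alpha> = (\<lambda>_. 0)")
    case True
    then have "mi_list \<alpha> = []" "mi_order \<alpha> = 0" "mi_fact \<alpha> = 1"
      using length_mi_list[of \<alpha>] by (auto simp: mi_order_def mi_fact_def)
    with True show ?thesis by (simp only: D1) (simp add: D_snd_eq)
  next
    case False
    then have "mi_list \<alpha> \<noteq> []" using length_mi_list[of \<alpha>] mi_order_0_iff[OF that] by auto
    with False show ?thesis by (simp only: D1) simp
  qed
  have "sym_sum (Suc N) p (\<lambda>w. 1) z = (\<Sum>\<alpha>\<in>{\<alpha>::'a \<Rightarrow> nat. \<alpha> \<in> multi_indices \<and> mi_order \<alpha> < Suc N}. if \<alpha> = (\<lambda>_. 0) then p z else 0)"
    unfolding sym_sum_def
  proof (rule sum.cong)
    fix \<alpha> :: "'a \<Rightarrow> nat"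
    assume "\<alpha> \<in> {\<alpha>. \<alpha> \<in> multi_indices \<and> mi_order \<alpha> < Suc N}"
    then show "?t \<alpha> = (if \<alpha> = (\<lambda>_. 0) then p z else 0)" by (intro t) simp
  qed (rule refl)
  also have "\<dots> = p z"
    using finite_multi_indices_less[of "Suc N", where ?'a = 'a] by (auto simp: sum.delta multi_indices_def mi_order_def)
  finally show "sym_sum (Suc N) p (\<lambda>w. 1) z = p z" .
qed

lemma sym_sum_local:
  assumes "open U" "\<And>x \<xi>. x \<in> U \<Longrightarrow> u (x, \<xi>) = v (x, \<xi>)" "x \<in> U"
  shows "sym_sum N p u (x, \<xi>) = sym_sum N p v (x, \<xi>)"
proof -
  have "D_fst \<alpha> u (x, \<xi>) = D_fst \<alpha> v (x, \<xi>)" for \<alpha>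
    unfolding D_fst_eq by (rule foldr_D_dir_cong_open[of "U \<times> UNIV"]) (use assms in \<open>auto intro: open_Times\<close>)
  then show ?thesis unfolding sym_sum_def by (simp only:)
qed

lemma sym_sum_diff:
  assumes "smooth u" "smooth v"
  shows "sym_sum N p (\<lambda>w. u w - v w) z = sym_sum N p u z - sym_sum N p v z"
proof -
  have "D_fst \<alpha> (\<lambda>w. u w - v w) z = D_fst \<alpha> u z - D_fst \<alpha> v z" for \<alpha>
  proof -
    have "D_fst \<alpha> (\<lambda>w. u w - v w) z = foldr D_dir (map (\<lambda>b. (b, 0)) (mi_list \<alpha>)) (\<lambda>w. u w - v w) z"
      by (rule fun_cong[OF D_fst_eq[where a = "\<lambda>w. u w - v w"]])
    then show ?thesis
      by (simp only: foldr_D_dir_diff[OF assms fst_list_subset_Basis[OF set_mi_list]] D_fst_eq)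
  qed
  then show ?thesis unfolding sym_sum_def by (simp only: right_diff_distrib sum_subtractf)
qed


text \<open>For the expansion, the inner symbol \<open>u R\<close> agrees with \<open>p2\<close>
  over a given ball up to an error of low order, because there the cutoff is 1 and the expansion of
  its constant value is \<open>p2\<close> itself. Applying the outer expansion to \<open>u R\<close>
  leaves two errors, that of the outer operator and the image of the inner one, both of order m1 +
  m2 - N.\<close>

theorem symbol_composition:
  fixes p1 p2 r1 r2 :: "'a::euclidean_space \<times> 'a \<Rightarrow> complex"
  assumes p1: "p1 \<in> symbols m1" and r1: "smooth r1" and A1: "support_preserving (left_op p1 r1)"
    and p2: "p2 \<in> symbols m2" and r2: "smooth r2" and A2: "support_preserving (left_op p2 r2)"
  obtains c where "c \<in> symbols (m1 + m2)"
    "asymptotic_sum (m1 + m2) c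
       (\<lambda>\<alpha> z. \<i> ^ mi_order \<alpha> / of_nat (mi_fact \<alpha>) * D_snd \<alpha> p1 z * D_fst \<alpha> p2 z)"
    "\<And>\<phi> x. \<phi> \<in> test_functions \<Longrightarrow> left_op p1 r1 (left_op p2 r2 \<phi>) x = psido_op c \<phi> x"
proof -
  have "\<exists>\<theta>::'a \<Rightarrow> complex. \<theta> \<in> test_functions \<and> (\<forall>y\<in>cball 0 (real R + 1). \<theta> y = 1)" for R :: nat
  proof -
    have pos: "0 < real R + 1" "real R + 1 < real R + 2" by simp_all
    obtain h :: "'a \<Rightarrow> real" where h: "smooth (\<lambda>x. complex_of_real (h x))"
      "\<And>x. x \<in> cball 0 (real R + 1) \<Longrightarrow> h x = 1" "\<And>x. x \<notin> ball 0 (real R + 2) \<Longrightarrow> h x = 0"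
      using cutoff_exists[OF pos, of "0::'a"] by metis
    have "(\<lambda>x. complex_of_real (h x)) \<in> test_functions"
      by (rule cutoff_test_function(1)[OF h(1)]) (erule h(3))
    with h(2) show ?thesis by (intro exI[of _ "\<lambda>x. complex_of_real (h x)"]) simp
  qed
  then obtain \<theta> :: "nat \<Rightarrow> 'a \<Rightarrow> complex" where
    \<theta>: "\<And>R. \<theta> R \<in> test_functions" "\<And>R y. y \<in> cball 0 (real R + 1) \<Longrightarrow> \<theta> R y = 1"
    by metis
  define q where "q R = (\<lambda>(y::'a, \<xi>::'a). \<theta> R y)" for R
  define u where "u R = left_comp p2 r2 (q R)" for R
  define d where "d R = left_comp p1 r1 (u R)" for R
  have q: "csymbol 0 (q R)" for R unfolding q_def by (rule csymbol_test_function[OF \<theta>(1)])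
  have u: "csymbol m2 (u R)" for R
    using left_comp_csymbol[OF p2 r2 q A2, of R] by (simp add: u_def)
  have d: "d R \<in> symbols (m1 + m2)" for R
    unfolding d_def by (rule left_comp_symbols[OF p1 r1 u])
  \<comment> \<open>The second clause of \<open>support_preserving\<close> is used twice. Values of
    the outer operator on the ball of radius k see only the ball of radius S1, and values of the
    inner one there see only the ball of radius S2, where the cutoffs of index at least \<rho> are
    all 1.\<close>
  have "\<exists>\<rho>::nat. \<rho> \<ge> k \<and> (\<forall>R\<ge>\<rho>. \<forall>R'\<ge>\<rho>. \<forall>x\<in>cball 0 (real k). \<forall>\<xi>. d R (x, \<xi>) = d R' (x, \<xi>))" for k :: nat
  proof -
    obtain S1 where S1: "\<And>\<phi> x. \<phi> \<in> test_functions \<Longrightarrow> \<forall>y\<in>ball 0 S1. \<phi> y = 0 \<Longrightarrow> x \<in> cball 0 (real k) \<Longrightarrow> left_op p1 r1 \<phi> x = 0"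
      using A1 unfolding support_preserving_def by metis
    obtain S2 where S2: "\<And>\<phi> x. \<phi> \<in> test_functions \<Longrightarrow> \<forall>y\<in>ball 0 S2. \<phi> y = 0 \<Longrightarrow> x \<in> cball 0 S1 \<Longrightarrow> left_op p2 r2 \<phi> x = 0"
      using A2 unfolding support_preserving_def by metis
    define \<rho> where "\<rho> = max k (nat \<lceil>S2\<rceil>)"
    have S2\<rho>: "S2 \<le> real R" if "R \<ge> \<rho>" for R
      using that by (simp add: \<rho>_def ceiling_le_iff)
    have eq: "d R (x, \<xi>) = d R' (x, \<xi>)" if R: "R \<ge> \<rho>" "R' \<ge> \<rho>" and x: "x \<in> cball 0 (real k)" for R R' x \<xi>
      unfolding d_def
    proof (rule left_comp_local[OF p1 r1 u u S1])
      fix y :: 'a assume y: "y \<in> ball 0 S1"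
      show "u R (y, \<xi>) = u R' (y, \<xi>)"
        unfolding u_def
      proof (rule left_comp_local[OF p2 r2 q q S2])
        fix t :: 'a assume "t \<in> ball 0 S2"
        then have "t \<in> cball 0 (real R + 1)" "t \<in> cball 0 (real R' + 1)" using S2\<rho>[OF R(1)] S2\<rho>[OF R(2)] by auto
        then show "q R (t, \<xi>) = q R' (t, \<xi>)" by (simp only: q_def prod.case \<theta>(2))
      qed (use y in auto)
    qed (use x in auto)
    show ?thesis
    proof (intro exI[of _ \<rho>] conjI allI impI ballI)
      show "k \<le> \<rho>" by (simp add: \<rho>_def)
    qed (erule (2) eq)
  qed
  then have "\<exists>\<rho>::nat \<Rightarrow> nat. \<forall>k. \<rho> k \<ge> k \<and>
      (\<forall>R\<ge>\<rho> k. \<forall>R'\<ge>\<rho> k. \<forall>x\<in>cball 0 (real k). \<forall>\<xi>. d R (x, \<xi>) = d R' (x, \<xi>))"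
    by (intro choice allI)
  then obtain \<rho> :: "nat \<Rightarrow> nat" where \<rho>0: "\<forall>k. \<rho> k \<ge> k \<and>
      (\<forall>R\<ge>\<rho> k. \<forall>R'\<ge>\<rho> k. \<forall>x\<in>cball 0 (real k). \<forall>\<xi>. d R (x, \<xi>) = d R' (x, \<xi>))" ..
  have \<rho>: "\<rho> k \<ge> k" for k using \<rho>0 by blast
  have \<rho>_eq: "d R (x, \<xi>) = d R' (x, \<xi>)" if "R \<ge> \<rho> k" "R' \<ge> \<rho> k" "x \<in> cball 0 (real k)" for k R R' x \<xi>
    using \<rho>0 that by blast
  \<comment> \<open>At each point the stable value over the smallest ball of integer radius
    containing x is taken; by stability any larger index gives the same value.\<close>
  define c where "c z = d (\<rho> (nat \<lceil>norm (fst z)\<rceil>)) z" for z :: "'a \<times> 'a"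
  have c: "c (x, \<xi>) = d R (x, \<xi>)" if "x \<in> cball 0 (real k)" "R \<ge> \<rho> k" for x \<xi> k R
  proof -
    define j where "j = nat \<lceil>norm x\<rceil>"
    have j: "x \<in> cball 0 (real j)" by (simp add: j_def real_nat_ceiling_ge)
    have "c (x, \<xi>) = d (max R (\<rho> j)) (x, \<xi>)"
      unfolding c_def fst_conv j_def[symmetric] by (rule \<rho>_eq[OF _ _ j]) simp_all
    also have "\<dots> = d R (x, \<xi>)" using that(2) by (intro \<rho>_eq[OF _ _ that(1)]) simp_all
    finally show ?thesis .
  qed
  have cs: "c \<in> symbols (m1 + m2)"
  proof (rule symbols_local)
    fix k :: nat
    show "\<exists>b\<in>symbols (m1 + m2). \<forall>x\<in>ball 0 (real k). \<forall>\<theta>. c (x, \<theta>) = b (x, \<theta>)"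
      using d c[of _ k "\<rho> k"] by (intro bexI[of _ "d (\<rho> k)"]) auto
  qed
  have rem: "(\<lambda>z. c z - sym_sum N p1 p2 z) \<in> symbols (m1 + m2 - real N)" for N
  proof (rule symbols_local)
    fix k :: nat
    define R where "R = \<rho> k"
    \<comment> \<open>The error of the inner operator against \<open>p2\<close> near the ball.
      Truncating at \<open>Suc N\<close> keeps the zero multi-index in the sum also when N = 0, and
      the order m2 - (N + 1) is more than low enough.\<close>
    define v where "v = (\<lambda>z. u R z - sym_sum (Suc N) p2 (q R) z)"
    \<comment> \<open>Over the ball, \<open>p2\<close> equals \<open>u R - v\<close>, so this is the
      remainder of the outer expansion at \<open>u R\<close> corrected by the terms that come from
      \<open>v\<close>.\<close>
    define b where "b = (\<lambda>z. (d R z - sym_sum N p1 (u R) z) + sym_sum N p1 v z)"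
    have v: "v \<in> symbols (m2 - real (Suc N))"
      unfolding v_def u_def using left_comp_remainder_symbols[OF p2 r2 q, of R "Suc N"] by simp
    have "sym_sum N p1 v \<in> symbols (m1 + m2 - real N)"
      by (rule symbols_mono[OF sym_sum_symbols[OF p1 v]]) simp
    then have b: "b \<in> symbols (m1 + m2 - real N)"
      unfolding b_def d_def by (intro symbols_add left_comp_remainder_symbols[OF p1 r1 u])
    have "c (x, \<xi>) - sym_sum N p1 p2 (x, \<xi>) = b (x, \<xi>)" if x: "x \<in> ball 0 (real k)" for x \<xi>
    proof -
      have p2v: "p2 (y, \<xi>) = u R (y, \<xi>) - v (y, \<xi>)" if y: "y \<in> ball 0 (real k)" for y \<xi>
      proof -
        have "sym_sum (Suc N) p2 (q R) (y, \<xi>) = sym_sum (Suc N) p2 (\<lambda>w. 1) (y, \<xi>)"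
        proof (rule sym_sum_local[OF open_ball _ y])
          fix t \<xi> :: 'a assume "t \<in> ball 0 (real k)"
          then have "t \<in> cball 0 (real R + 1)" using \<rho>[of k] by (simp add: R_def)
          then show "q R (t, \<xi>) = 1" by (simp only: q_def prod.case \<theta>(2))
        qed
        then show ?thesis by (simp add: v_def sym_sum_one)
      qed
      have "sym_sum N p1 p2 (x, \<xi>) = sym_sum N p1 (\<lambda>w. u R w - v w) (x, \<xi>)"
        by (rule sym_sum_local[OF open_ball _ x]) (rule p2v)
      also have "\<dots> = sym_sum N p1 (u R) (x, \<xi>) - sym_sum N p1 v (x, \<xi>)"
        by (rule sym_sum_diff[OF symbols_smooth[OF csymbol_symbols[OF u]] symbols_smooth[OF v]])
      finally show ?thesis using c[of x k R \<xi>] x by (simp add: b_def R_def)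
    qed
    then show "\<exists>b\<in>symbols (m1 + m2 - real N). \<forall>x\<in>ball 0 (real k). \<forall>\<theta>. c (x, \<theta>) - sym_sum N p1 p2 (x, \<theta>) = b (x, \<theta>)"
      by (intro bexI[OF _ b]) blast
  qed
  have "(\<lambda>z. \<i> ^ mi_order \<alpha> / of_nat (mi_fact \<alpha>) * D_snd \<alpha> p1 z * D_fst \<alpha> p2 z) \<in> symbols (m1 + m2 - real (mi_order \<alpha>))" for \<alpha> :: "'a \<Rightarrow> nat"
    using symbols_mult[OF symbols_cmult[OF symbols_D_snd[OF p1, of \<alpha>], of "\<i> ^ mi_order \<alpha> / of_nat (mi_fact \<alpha>)"] symbols_D_fst[OF p2, of \<alpha>]]
    by (simp only: diff_add_eq)
  then have "asymptotic_sum (m1 + m2) c (\<lambda>\<alpha> z. \<i> ^ mi_order \<alpha> / of_nat (mi_fact \<alpha>) * D_snd \<alpha> p1 z * D_fst \<alpha> p2 z)"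
    unfolding asymptotic_sum_def using rem unfolding sym_sum_def by (intro conjI ballI allI)
  moreover have "left_op p1 r1 (left_op p2 r2 \<phi>) x = psido_op c \<phi> x" if \<phi>: "\<phi> \<in> test_functions" for \<phi> x
  proof -
    obtain M where M: "\<And>y. y \<notin> cball 0 M \<Longrightarrow> \<phi> y = 0" using test_functionsE[OF \<phi>] by metis
    define k where "k = nat \<lceil>norm x\<rceil>"
    \<comment> \<open>The index must serve two purposes: the cutoff is 1 on the support of
      \<open>\<phi>\<close>, and the symbol \<open>d R\<close> has already reached its stable value
      at x.\<close>
    define R where "R = max (\<rho> k) (nat \<lceil>M\<rceil>)"
    have x: "x \<in> cball 0 (real k)" by (simp add: k_def real_nat_ceiling_ge)
    have MR: "M \<le> real R" by (simp add: R_def le_max_iff_disj real_nat_ceiling_ge of_nat_max)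
    have "\<theta> R y * \<phi> y = \<phi> y" for y
    proof (cases "y \<in> cball 0 M")
      case True
      then have "y \<in> cball 0 (real R + 1)" using MR by simp
      then show ?thesis by (simp only: \<theta>(2) mult_1)
    qed (simp add: M)
    then have "psido_op (q R) \<phi> = \<phi>" by (simp add: q_def psido_op_multiplication[OF \<phi>] fun_eq_iff)
    moreover have "left_op p2 r2 (psido_op (q R) \<phi>) = psido_op (u R) \<phi>"
      using left_op_psido_op[OF p2 r2 q \<phi>] by (auto simp: u_def)
    ultimately have "left_op p2 r2 \<phi> = psido_op (u R) \<phi>" by simp
    then have "left_op p1 r1 (left_op p2 r2 \<phi>) x = psido_op (d R) \<phi> x"
      using left_op_psido_op[OF p1 r1 u \<phi>, of R x] by (simp add: d_def)
    also have "\<dots> = psido_op c \<phi> x"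
      using c[OF x, of R] by (simp add: psido_op_def R_def)
    finally show ?thesis .
  qed
  ultimately show ?thesis using that cs by blast
qed

theorem composition_of_psido:
  fixes P1 P2 :: "'a::euclidean_space operator"
  assumes "properly_supported P1" "properly_supported P2"
    and t1: "total_left_symbol m1 P1 p1" and t2: "total_left_symbol m2 P2 p2"
  shows "op_composable P1 P2" "op_comp P1 P2 \<in> PsiDO (m1 + m2)"
    "\<exists>a. total_left_symbol (m1 + m2) (op_comp P1 P2) a \<and> asymptotic_sum (m1 + m2) a
        (\<lambda>\<alpha> z. \<i> ^ mi_order \<alpha> / of_nat (mi_fact \<alpha>) * D_snd \<alpha> p1 z * D_fst \<alpha> p2 z)"
proof -
  have p: "p1 \<in> symbols m1" "p2 \<in> symbols m2" using t1 t2 by (simp_all add: total_left_symbol_def)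
  obtain r1 where r1: "smooth r1" "\<And>\<phi> \<psi>. \<phi> \<in> test_functions \<Longrightarrow> \<psi> \<in> test_functions \<Longrightarrow> P1 \<phi> \<psi> = dist_of_fun (left_op p1 r1 \<phi>) \<psi>"
    using total_left_symbol_left_op[OF t1] by metis
  obtain r2 where r2: "smooth r2" "\<And>\<phi> \<psi>. \<phi> \<in> test_functions \<Longrightarrow> \<psi> \<in> test_functions \<Longrightarrow> P2 \<phi> \<psi> = dist_of_fun (left_op p2 r2 \<phi>) \<psi>"
    using total_left_symbol_left_op[OF t2] by metis
  have A1: "support_preserving (left_op p1 r1)"
    by (rule properly_supported_local[OF assms(1)]) (auto intro: r1 smooth_left_op[OF p(1) r1(1)])
  have A2: "support_preserving (left_op p2 r2)"
    by (rule properly_supported_local[OF assms(2)]) (auto intro: r2 smooth_left_op[OF p(2) r2(1)])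
  have test: "left_op p2 r2 \<phi> \<in> test_functions" if \<phi>: "\<phi> \<in> test_functions" for \<phi>
  proof -
    obtain R where R: "\<And>y. y \<notin> cball 0 R \<Longrightarrow> \<phi> y = 0" using test_functionsE[OF \<phi>] by metis
    obtain S where S: "\<And>\<phi> x. \<phi> \<in> test_functions \<Longrightarrow> (\<And>y. y \<notin> cball 0 R \<Longrightarrow> \<phi> y = 0) \<Longrightarrow> x \<notin> cball 0 S \<Longrightarrow> left_op p2 r2 \<phi> x = 0"
      using A2 unfolding support_preserving_def by metis
    show ?thesis
      by (rule test_functionsI(1)[OF smooth_left_op[OF p(2) r2(1) \<phi>] compact_cball]) (rule S[OF \<phi> R])
  qed
  show "op_composable P1 P2"
    unfolding op_composable_def using test r2(2) by blast
  obtain c where c: "c \<in> symbols (m1 + m2)"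
    "asymptotic_sum (m1 + m2) c (\<lambda>\<alpha> z. \<i> ^ mi_order \<alpha> / of_nat (mi_fact \<alpha>) * D_snd \<alpha> p1 z * D_fst \<alpha> p2 z)"
    "\<And>\<phi> x. \<phi> \<in> test_functions \<Longrightarrow> left_op p1 r1 (left_op p2 r2 \<phi>) x = psido_op c \<phi> x"
    by (rule symbol_composition[OF p(1) r1(1) A1 p(2) r2(1) A2]) (rule that)
  have comp: "op_comp P1 P2 \<phi> \<psi> = dist_of_fun (psido_op c \<phi>) \<psi>"
    if \<phi>: "\<phi> \<in> test_functions" and \<psi>: "\<psi> \<in> test_functions" for \<phi> \<psi>
  proof -
    \<comment> \<open>The description in \<open>op_comp\<close> is resolved by uniqueness: two test
      functions with equal pairings coincide by the fundamental lemma.\<close>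
    have "(THE f. f \<in> test_functions \<and> (\<forall>\<psi>\<in>test_functions. P2 \<phi> \<psi> = dist_of_fun f \<psi>)) = left_op p2 r2 \<phi>"
    proof (rule the_equality)
      show "left_op p2 r2 \<phi> \<in> test_functions \<and> (\<forall>\<psi>\<in>test_functions. P2 \<phi> \<psi> = dist_of_fun (left_op p2 r2 \<phi>) \<psi>)"
        using test[OF \<phi>] r2(2)[OF \<phi>] by blast
      fix f assume f: "f \<in> test_functions \<and> (\<forall>\<psi>\<in>test_functions. P2 \<phi> \<psi> = dist_of_fun f \<psi>)"
      show "f = left_op p2 r2 \<phi>"
        by (rule dist_of_fun_unique) (use f test[OF \<phi>] r2(2)[OF \<phi>] in auto)
    qed
    then have "op_comp P1 P2 \<phi> \<psi> = P1 (left_op p2 r2 \<phi>) \<psi>" by (simp add: op_comp_def)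
    also have "\<dots> = dist_of_fun (left_op p1 r1 (left_op p2 r2 \<phi>)) \<psi>" by (rule r1(2)[OF test[OF \<phi>] \<psi>])
    also have "left_op p1 r1 (left_op p2 r2 \<phi>) = psido_op c \<phi>" using c(3)[OF \<phi>] by (simp add: fun_eq_iff)
    finally show ?thesis .
  qed
  show "op_comp P1 P2 \<in> PsiDO (m1 + m2)" by (rule psido_of_symbol(1)[OF c(1) comp])
  show "\<exists>a. total_left_symbol (m1 + m2) (op_comp P1 P2) a \<and> asymptotic_sum (m1 + m2) a
        (\<lambda>\<alpha> z. \<i> ^ mi_order \<alpha> / of_nat (mi_fact \<alpha>) * D_snd \<alpha> p1 z * D_fst \<alpha> p2 z)"
    using psido_of_symbol(2)[OF c(1) comp] c(2) by blast
qed

theorem theorem4p12: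
  fixes P1 P2 :: "(real ^ 'n) operator"
    and p1 p2 :: "(real ^ 'n) \<times> (real ^ 'n) \<Rightarrow> complex"
    and m1 m2 :: real
  assumes "P1 \<in> PsiDO m1" and "P2 \<in> PsiDO m2"
    and "properly_supported P1" and "properly_supported P2"
    and "total_left_symbol m1 P1 p1" and "total_left_symbol m2 P2 p2"
  shows "op_composable P1 P2 \<and> op_comp P1 P2 \<in> PsiDO (m1 + m2) \<and>
    (\<exists>a. total_left_symbol (m1 + m2) (op_comp P1 P2) a \<and>
      asymptotic_sum (m1 + m2) a
        (\<lambda>\<alpha> z. \<i> ^ mi_order \<alpha> / of_nat (mi_fact \<alpha>) * D_snd \<alpha> p1 z * D_fst \<alpha> p2 z))"
  using composition_of_psido[OF assms(3-6)] by blast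

end
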